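(* Let $n\ge 11$ and let $\Gamma$ be a connected quartic graph on $n$ vertices whose algebraic connectivity is minimum among all connected quartic graphs on $n$ vertices. Then every end block of $\Gamma$ (a block containing exactly one cut vertex of $\Gamma$) is isomorphic to one of $D_0,D_1,D_2,D_3,D_4$, with the cut vertex corresponding to the vertex $w$ of that block.
   Context: All graphs are finite and simple; quartic means 4-regular. The algebraic connectivity of $G$ is the second smallest eigenvalue of the Laplacian $L(G)=\Delta-A$. $D_0$: vertices $a,b,c,d,e,w$; edges: all edges among $a,b,c,d,e$ except $de$, plus $wd,we$. $D_1$: vertices $a,b,c,d,e,f,w$; edges: all six edges among $a,b,c,d$, plus $ea,eb,fc,fd,ef,we,wf$. $D_2$: vertices $a,b,c,d,e,f,g,w$; edges: all six edges among $a,b,c,d$, plus $ea,eb,fc,fe,gd,ge,fg,wf,wg$. $D_3$: vertices $a,b,c,d,e,f,g,h,w$; edges: all six edges among $a,b,c,d$, plus $ea,eb,fc,fd,ge,gf,he,hf,gh,wg,wh$. $D_4$: vertices $a,b,c,d,e,f,g,h,i,w$; edges: all edges among $a,b,c,d,e$ except $de$, plus $df,eg$, all six edges among $f,g,h,i$, plus $wh,wi$. *)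

theory Defs
  imports "Jordan_Normal_Form.Char_Poly" "HOL-Computational_Algebra.Polynomial"
begin

definition simple_graph :: "nat \<Rightarrow> nat set set \<Rightarrow> bool" where
  "simple_graph n E \<longleftrightarrow> (\<forall>e\<in>E. \<exists>u v. u \<noteq> v \<and> u < n \<and> v < n \<and> e = {u, v})"

definition degree :: "nat set set \<Rightarrow> nat \<Rightarrow> nat" where
  "degree E v = card {u. {u, v} \<in> E}"

definition quartic :: "nat \<Rightarrow> nat set set \<Rightarrow> bool" where
  "quartic n E \<longleftrightarrow> (\<forall>v<n. degree E v = 4)"

definition reach_in :: "nat set set \<Rightarrow> nat set \<Rightarrow> nat \<Rightarrow> nat \<Rightarrow> bool" where
  "reach_in E S = (\<lambda>x y. {x, y} \<in> E \<and> x \<in> S \<and> y \<in> S)\<^sup>*\<^sup>*"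

definition connected_on :: "nat set set \<Rightarrow> nat set \<Rightarrow> bool" where
  "connected_on E S \<longleftrightarrow> (\<forall>u\<in>S. \<forall>v\<in>S. reach_in E S u v)"

definition connected_graph :: "nat \<Rightarrow> nat set set \<Rightarrow> bool" where
  "connected_graph n E \<longleftrightarrow> connected_on E {0..<n}"

definition cut_vertex :: "nat set set \<Rightarrow> nat set \<Rightarrow> nat \<Rightarrow> bool" where
  "cut_vertex E S v \<longleftrightarrow> v \<in> S \<and>
     (\<exists>x\<in>S - {v}. \<exists>y\<in>S - {v}. reach_in E S x y \<and> \<not> reach_in E (S - {v}) x y)"

text \<open>A block of the graph on S: a maximal connected subgraph without cut vertex (of
  itself).  Blocks are automatically induced subgraphs, so they are described by
  their vertex sets.\<close>
definition nonsep :: "nat set set \<Rightarrow> nat set \<Rightarrow> bool" where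
  "nonsep E B \<longleftrightarrow> B \<noteq> {} \<and> connected_on E B \<and> (\<forall>v. \<not> cut_vertex E B v)"

definition is_block :: "nat set set \<Rightarrow> nat set \<Rightarrow> nat set \<Rightarrow> bool" where
  "is_block E S B \<longleftrightarrow> B \<subseteq> S \<and> nonsep E B \<and>
     (\<forall>B'. B \<subset> B' \<and> B' \<subseteq> S \<longrightarrow> \<not> nonsep E B')"

definition end_block :: "nat \<Rightarrow> nat set set \<Rightarrow> nat set \<Rightarrow> bool" where
  "end_block n E B \<longleftrightarrow> is_block E {0..<n} B \<and>
     card {v \<in> B. cut_vertex E {0..<n} v} = 1"

definition laplacian :: "nat \<Rightarrow> nat set set \<Rightarrow> real mat" where
  "laplacian n E = mat n n (\<lambda>(i, j).
     if i = j then real (degree E i) else if {i, j} \<in> E then -1 else 0)"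

text \<open>Second smallest Laplacian eigenvalue (eigenvalues counted with multiplicity as
  roots of the characteristic polynomial; the Laplacian is real symmetric, so all
  its n eigenvalues are real).\<close>
definition algebraic_connectivity :: "nat \<Rightarrow> nat set set \<Rightarrow> real" where
  "algebraic_connectivity n E =
     sorted_list_of_multiset (proots (char_poly (laplacian n E))) ! 1"

datatype lbl = La | Lb | Lc | Ld | Le | Lf | Lg | Lh | Li | Lw

definition clique :: "lbl set \<Rightarrow> lbl set set" where
  "clique S = {{x, y} | x y. x \<in> S \<and> y \<in> S \<and> x \<noteq> y}"

definition D0_V :: "lbl set" where "D0_V = {La, Lb, Lc, Ld, Le, Lw}"
definition D0_E :: "lbl set set" where
  "D0_E = (clique {La, Lb, Lc, Ld, Le} - {{Ld, Le}}) \<union> {{Lw, Ld}, {Lw, Le}}"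

definition D1_V :: "lbl set" where "D1_V = {La, Lb, Lc, Ld, Le, Lf, Lw}"
definition D1_E :: "lbl set set" where
  "D1_E = clique {La, Lb, Lc, Ld} \<union>
     {{Le, La}, {Le, Lb}, {Lf, Lc}, {Lf, Ld}, {Le, Lf}, {Lw, Le}, {Lw, Lf}}"

definition D2_V :: "lbl set" where "D2_V = {La, Lb, Lc, Ld, Le, Lf, Lg, Lw}"
definition D2_E :: "lbl set set" where
  "D2_E = clique {La, Lb, Lc, Ld} \<union>
     {{Le, La}, {Le, Lb}, {Lf, Lc}, {Lf, Le}, {Lg, Ld}, {Lg, Le}, {Lf, Lg}, {Lw, Lf}, {Lw, Lg}}"

definition D3_V :: "lbl set" where "D3_V = {La, Lb, Lc, Ld, Le, Lf, Lg, Lh, Lw}"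
definition D3_E :: "lbl set set" where
  "D3_E = clique {La, Lb, Lc, Ld} \<union>
     {{Le, La}, {Le, Lb}, {Lf, Lc}, {Lf, Ld}, {Lg, Le}, {Lg, Lf}, {Lh, Le}, {Lh, Lf},
      {Lg, Lh}, {Lw, Lg}, {Lw, Lh}}"

definition D4_V :: "lbl set" where "D4_V = {La, Lb, Lc, Ld, Le, Lf, Lg, Lh, Li, Lw}"
definition D4_E :: "lbl set set" where
  "D4_E = (clique {La, Lb, Lc, Ld, Le} - {{Ld, Le}}) \<union> {{Ld, Lf}, {Le, Lg}} \<union>
     clique {Lf, Lg, Lh, Li} \<union> {{Lw, Lh}, {Lw, Li}}"

definition pointed_iso :: "nat set set \<Rightarrow> nat set \<Rightarrow> nat \<Rightarrow> lbl set \<Rightarrow> lbl set set \<Rightarrow> bool" where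
  "pointed_iso E B c DV DE \<longleftrightarrow>
     (\<exists>\<phi>. bij_betw \<phi> B DV \<and> \<phi> c = Lw \<and>
        (\<forall>x\<in>B. \<forall>y\<in>B. {x, y} \<in> E \<longleftrightarrow> {\<phi> x, \<phi> y} \<in> DE))"

end

theory Submission
  imports Defs "HOL-Analysis.Function_Topology"
begin

text \<open>Let \<open>x\<close> be an eigenvector for the minimal algebraic connectivity \<open>\<mu>\<close>. For every competitor \<open>E'\<close> and
  every \<open>z\<close>, the Rayleigh principle gives \<open>q(E', z) \<ge> q(E, x) + 2 \<mu> \<langle>x, z - x\<rangle>\<close>, with equality only if \<open>z - x\<close> is
  constant. Applied to edge switches it shows that, up to sign, \<open>x\<close> is larger on an end block than at its
  cut vertex. Sort the other \<open>m\<close> vertices of the block decreasingly. Its energy is then the sum of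
  \<open>c k l * g k * g l\<close> over the gaps \<open>g k\<close> between consecutive values, where \<open>c k l\<close> counts the edges that jump over both
  gaps. Applied to the replacement of the block by another gadget on \<open>m\<close> vertices, the principle says
  that the block beats all gadgets. Chains of small gadgets, cut where the block has 2-edge cuts, do
  strictly better than the block unless it is one of the five exceptions, where equality in the
  principle determines \<open>x\<close> and hence the edge counts.\<close>

section \<open>Quadratic inequalities\<close>

text \<open>A block is known only through edge counts, while competitors are explicit graphs. Both
  are cut into stretches: at a suitable position \<open>z\<close> the quadratic form in the gaps
  decouples at the cost \<open>(f z)^2 / 2\<close>, which is also the cost of the two edges that
  join two gadgets. So stretches can be compared one by one. A stretch of length 4 ties with an
  attached \<open>K4\<close>; lengths 5, 6, 7 lose strictly to a cut vertex followed by a link on 4,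
  5, 6 vertices. The initial stretch, of length 5 to 8, ties with its own gadget, so it can only
  lose together with its successors: writing chains by their lengths, 6-4 loses to 5-5, 7-4 to 6-5,
  8-4 to 7-5 and 5-4-4 to 6-7. The last pair may have equal values, for instance for constant
  weights; hence a competitor also records one gap. The numerical slack has three sources: the
  partial sums \<open>f\<close> are concave, vanish at 0 and are nonnegative at
  \<open>m + 1\<close>; the indicator of the block bounds \<open>\<mu>\<close>; and degree four
  bounds the edge counts from below.\<close>

lemma zero_split:
  fixes f0 u g0 g1 cm c0 c1 :: real
  assumes "0 \<le> u" "0 \<le> g0" "0 \<le> g1" "4 \<le> cm" "2 \<le> c0" "4 \<le> c1"
  shows "c0 * g0\<^sup>2 - 2 * f0 * g0 + (cm + c0 - 4) * u * g0 + (c0 + c1 - 4) * g0 * g1 - f0 * u + u\<^sup>2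
         \<ge> - f0\<^sup>2 / 2 + f0 * g1 - g1\<^sup>2"
proof -
  have 1: "2 * g0\<^sup>2 \<le> c0 * g0\<^sup>2" using assms by (intro mult_right_mono) auto
  have 2: "2 * u * g0 \<le> (cm + c0 - 4) * u * g0"
    using assms by (intro mult_right_mono) auto
  have 3: "2 * g0 * g1 \<le> (c0 + c1 - 4) * g0 * g1"
    using assms by (intro mult_right_mono) auto
  \<comment> \<open>The first square is the minimisation over \<open>g0\<close>. The second is the
    price of separating \<open>u\<close> from \<open>g1\<close>, namely
    \<open>(u + g1)^2 / 2 \<le> u^2 + g1^2\<close>.\<close>
  have 4: "0 \<le> 2 * (g0 + (u + g1) / 2 - f0 / 2)\<^sup>2 + (u - g1)\<^sup>2 / 2" by simp
  have "2 * (g0 + (u + g1) / 2 - f0 / 2)\<^sup>2 + (u - g1)\<^sup>2 / 2 =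
     2 * g0\<^sup>2 - 2 * f0 * g0 + 2 * u * g0 + 2 * g0 * g1 - f0 * u + u\<^sup>2 + f0\<^sup>2 / 2 - f0 * g1 + g1\<^sup>2"
    by (simp add: power2_eq_square field_simps)
  with 1 2 3 4 show ?thesis by linarith
qed

section \<open>Stretches of length four to seven between two stopping points\<close>

lemma coeff_sq: "(a::real) \<le> c \<Longrightarrow> a * g\<^sup>2 \<le> c * g\<^sup>2"
  by (intro mult_right_mono) auto

lemma coeff_adj: "\<lbrakk>(4::real) \<le> c; 4 \<le> d; 0 \<le> g; 0 \<le> h\<rbrakk> \<Longrightarrow> 4 * (g * h) \<le> (c + d - 4) * g * h"
  unfolding mult.assoc by (intro mult_right_mono) auto

text \<open>The outer gaps carry the remainders \<open>f0 * g1 - g1^2\<close> and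
  \<open>f4 * g3 - g3^2\<close> left by splitting at both ends. Concavity of \<open>f\<close>, in
  the form of hypothesis \<open>f\<close>, cancels \<open>f0\<close> and \<open>f4\<close>, so that
  \<open>f2\<close> is the only linear coefficient left and one square suffices. The bound is the
  minimum of \<open>4 * g^2 - 2 * f2 * g\<close>, the value of a 4-edge cut.\<close>

lemma inner4:
  fixes f0 f1 f2 f3 f4 g1 g2 g3 c1 c2 c3 \<mu> :: real
  assumes g: "0 \<le> g1" "0 \<le> g2" "0 \<le> g3" and c: "4 \<le> c1" "4 \<le> c2" "4 \<le> c3"
    and f: "2 * f1 = f0 + f2 + \<mu> * g1" "2 * f3 = f2 + f4 + \<mu> * g3" and mu: "\<mu> \<le> 1"
  shows "f0 * g1 - g1\<^sup>2 + (c1 * g1\<^sup>2 - 2 * f1 * g1) + ((c1 + c2 - 4) * g1 * g2 + (c2 * g2\<^sup>2 - 2 * f2 * g2))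
     + ((c2 + c3 - 4) * g2 * g3 + (c3 * g3\<^sup>2 - 2 * f3 * g3)) + f4 * g3 - g3\<^sup>2 \<ge> - f2\<^sup>2 / 4"
proof -
  have "4 * g1\<^sup>2 \<le> c1 * g1\<^sup>2" "4 * g2\<^sup>2 \<le> c2 * g2\<^sup>2" "4 * g3\<^sup>2 \<le> c3 * g3\<^sup>2"
    using c by (auto intro!: coeff_sq)
  moreover have "4 * (g1 * g2) \<le> (c1 + c2 - 4) * g1 * g2" "4 * (g2 * g3) \<le> (c2 + c3 - 4) * g2 * g3"
    using c g by (auto intro!: coeff_adj)
  moreover have "0 \<le> 4 * (g2 + (g1 + g3) / 2 - f2 / 4)\<^sup>2 + (1 - \<mu>) * (g1\<^sup>2 + g3\<^sup>2) + (g1 - g3)\<^sup>2"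
    using mu by simp
  moreover have "4 * (g2 + (g1 + g3) / 2 - f2 / 4)\<^sup>2 + (1 - \<mu>) * (g1\<^sup>2 + g3\<^sup>2) + (g1 - g3)\<^sup>2 =
     f0 * g1 - g1\<^sup>2 + (4 * g1\<^sup>2 - (f0 + f2 + \<mu> * g1) * g1) + (4 * (g1 * g2) + (4 * g2\<^sup>2 - 2 * f2 * g2))
     + (4 * (g2 * g3) + (4 * g3\<^sup>2 - (f2 + f4 + \<mu> * g3) * g3)) + f4 * g3 - g3\<^sup>2 + f2\<^sup>2 / 4"
    by (simp add: power2_eq_square field_simps)
  ultimately show ?thesis unfolding f by linarith
qed

text \<open>With several interior gaps each linear term is halved between two neighbouring squares.
  The middle square has a single linear coefficient for two gaps, hence the maximum; the surplus
  \<open>g2 * (p - f2) + g3 * (p - f3)\<close> is nonnegative.\<close>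

lemma inner5:
  fixes f0 f1 f2 f3 f4 f5 g1 g2 g3 g4 c1 c2 c3 c4 \<mu> :: real
  assumes g: "0 \<le> g1" "0 \<le> g2" "0 \<le> g3" "0 \<le> g4" and c: "4 \<le> c1" "4 \<le> c2" "4 \<le> c3" "4 \<le> c4"
    and f: "2 * f1 = f0 + f2 + \<mu> * g1" "2 * f4 = f3 + f5 + \<mu> * g4" and mu: "\<mu> \<le> 1"
  shows "f0 * g1 - g1\<^sup>2 + (c1 * g1\<^sup>2 - 2 * f1 * g1) + ((c1 + c2 - 4) * g1 * g2 + (c2 * g2\<^sup>2 - 2 * f2 * g2))
     + ((c2 + c3 - 4) * g2 * g3 + (c3 * g3\<^sup>2 - 2 * f3 * g3)) + ((c3 + c4 - 4) * g3 * g4 + (c4 * g4\<^sup>2 - 2 * f4 * g4))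
     + f5 * g4 - g4\<^sup>2 \<ge> - (f2\<^sup>2 / 8 + (max f2 f3)\<^sup>2 / 8 + f3\<^sup>2 / 8)"
proof -
  define p where "p = max f2 f3"
  have p: "f2 \<le> p" "f3 \<le> p" by (auto simp: p_def)
  have "4 * g1\<^sup>2 \<le> c1 * g1\<^sup>2" "4 * g2\<^sup>2 \<le> c2 * g2\<^sup>2" "4 * g3\<^sup>2 \<le> c3 * g3\<^sup>2" "4 * g4\<^sup>2 \<le> c4 * g4\<^sup>2"
    using c by (auto intro!: coeff_sq)
  moreover have "4 * (g1 * g2) \<le> (c1 + c2 - 4) * g1 * g2" "4 * (g2 * g3) \<le> (c2 + c3 - 4) * g2 * g3"
     "4 * (g3 * g4) \<le> (c3 + c4 - 4) * g3 * g4"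
    using c g by (auto intro!: coeff_adj)
  moreover have "0 \<le> 2 * (g1 + g2 - f2 / 4)\<^sup>2 + 2 * (g2 + g3 - p / 4)\<^sup>2 + 2 * (g3 + g4 - f3 / 4)\<^sup>2
     + (1 - \<mu>) * (g1\<^sup>2 + g4\<^sup>2) + g2 * (p - f2) + g3 * (p - f3)"
    using mu p g by (intro add_nonneg_nonneg mult_nonneg_nonneg) auto
  moreover have "2 * (g1 + g2 - f2 / 4)\<^sup>2 + 2 * (g2 + g3 - p / 4)\<^sup>2 + 2 * (g3 + g4 - f3 / 4)\<^sup>2
     + (1 - \<mu>) * (g1\<^sup>2 + g4\<^sup>2) + g2 * (p - f2) + g3 * (p - f3) =
     f0 * g1 - g1\<^sup>2 + (4 * g1\<^sup>2 - (f0 + f2 + \<mu> * g1) * g1) + (4 * (g1 * g2) + (4 * g2\<^sup>2 - 2 * f2 * g2))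
     + (4 * (g2 * g3) + (4 * g3\<^sup>2 - 2 * f3 * g3)) + (4 * (g3 * g4) + (4 * g4\<^sup>2 - (f3 + f5 + \<mu> * g4) * g4))
     + f5 * g4 - g4\<^sup>2 + f2\<^sup>2 / 8 + p\<^sup>2 / 8 + f3\<^sup>2 / 8"
    by (simp add: power2_eq_square field_simps)
  ultimately show ?thesis unfolding f p_def[symmetric] by linarith
qed

lemma inner6:
  fixes f0 f1 f2 f3 f4 f5 f6 g1 g2 g3 g4 g5 c1 c2 c3 c4 c5 \<mu> :: real
  assumes g: "0 \<le> g1" "0 \<le> g2" "0 \<le> g3" "0 \<le> g4" "0 \<le> g5" and c: "4 \<le> c1" "4 \<le> c2" "4 \<le> c3" "4 \<le> c4" "4 \<le> c5"
    and f: "2 * f1 = f0 + f2 + \<mu> * g1" "2 * f5 = f4 + f6 + \<mu> * g5" and mu: "\<mu> \<le> 1"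
  shows "f0 * g1 - g1\<^sup>2 + (c1 * g1\<^sup>2 - 2 * f1 * g1) + ((c1 + c2 - 4) * g1 * g2 + (c2 * g2\<^sup>2 - 2 * f2 * g2))
     + ((c2 + c3 - 4) * g2 * g3 + (c3 * g3\<^sup>2 - 2 * f3 * g3)) + ((c3 + c4 - 4) * g3 * g4 + (c4 * g4\<^sup>2 - 2 * f4 * g4))
     + ((c4 + c5 - 4) * g4 * g5 + (c5 * g5\<^sup>2 - 2 * f5 * g5))
     + f6 * g5 - g5\<^sup>2 \<ge> - (f2\<^sup>2 / 8 + (max f2 f3)\<^sup>2 / 8 + (max f3 f4)\<^sup>2 / 8 + f4\<^sup>2 / 8)"
proof -
  define p where "p = max f2 f3"
  define q where "q = max f3 f4"
  have p: "f2 \<le> p" "f3 \<le> p" "f3 \<le> q" "f4 \<le> q" by (auto simp: p_def q_def)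
  have "4 * g1\<^sup>2 \<le> c1 * g1\<^sup>2" "4 * g2\<^sup>2 \<le> c2 * g2\<^sup>2" "4 * g3\<^sup>2 \<le> c3 * g3\<^sup>2" "4 * g4\<^sup>2 \<le> c4 * g4\<^sup>2" "4 * g5\<^sup>2 \<le> c5 * g5\<^sup>2"
    using c by (auto intro!: coeff_sq)
  moreover have "4 * (g1 * g2) \<le> (c1 + c2 - 4) * g1 * g2" "4 * (g2 * g3) \<le> (c2 + c3 - 4) * g2 * g3"
     "4 * (g3 * g4) \<le> (c3 + c4 - 4) * g3 * g4" "4 * (g4 * g5) \<le> (c4 + c5 - 4) * g4 * g5"
    using c g by (auto intro!: coeff_adj)
  moreover have "0 \<le> 2 * (g1 + g2 - f2 / 4)\<^sup>2 + 2 * (g2 + g3 - p / 4)\<^sup>2 + 2 * (g3 + g4 - q / 4)\<^sup>2 + 2 * (g4 + g5 - f4 / 4)\<^sup>2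
     + (1 - \<mu>) * (g1\<^sup>2 + g5\<^sup>2) + g2 * (p - f2) + g3 * ((p - f3) + (q - f3)) + g4 * (q - f4)"
    using mu p g by (intro add_nonneg_nonneg mult_nonneg_nonneg) auto
  moreover have "2 * (g1 + g2 - f2 / 4)\<^sup>2 + 2 * (g2 + g3 - p / 4)\<^sup>2 + 2 * (g3 + g4 - q / 4)\<^sup>2 + 2 * (g4 + g5 - f4 / 4)\<^sup>2
     + (1 - \<mu>) * (g1\<^sup>2 + g5\<^sup>2) + g2 * (p - f2) + g3 * ((p - f3) + (q - f3)) + g4 * (q - f4) =
     f0 * g1 - g1\<^sup>2 + (4 * g1\<^sup>2 - (f0 + f2 + \<mu> * g1) * g1) + (4 * (g1 * g2) + (4 * g2\<^sup>2 - 2 * f2 * g2))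
     + (4 * (g2 * g3) + (4 * g3\<^sup>2 - 2 * f3 * g3)) + (4 * (g3 * g4) + (4 * g4\<^sup>2 - 2 * f4 * g4))
     + (4 * (g4 * g5) + (4 * g5\<^sup>2 - (f4 + f6 + \<mu> * g5) * g5))
     + f6 * g5 - g5\<^sup>2 + f2\<^sup>2 / 8 + p\<^sup>2 / 8 + q\<^sup>2 / 8 + f4\<^sup>2 / 8"
    by (simp add: power2_eq_square field_simps)
  ultimately show ?thesis unfolding f p_def[symmetric] q_def[symmetric] by linarith
qed

lemma inner7:
  fixes f0 f1 f2 f3 f4 f5 f6 f7 g1 g2 g3 g4 g5 g6 c1 c2 c3 c4 c5 c6 \<mu> :: real
  assumes g: "0 \<le> g1" "0 \<le> g2" "0 \<le> g3" "0 \<le> g4" "0 \<le> g5" "0 \<le> g6"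
    and c: "4 \<le> c1" "4 \<le> c2" "4 \<le> c3" "4 \<le> c4" "4 \<le> c5" "4 \<le> c6"
    and f: "2 * f1 = f0 + f2 + \<mu> * g1" "2 * f6 = f5 + f7 + \<mu> * g6" and mu: "\<mu> \<le> 1"
  shows "f0 * g1 - g1\<^sup>2 + (c1 * g1\<^sup>2 - 2 * f1 * g1) + ((c1 + c2 - 4) * g1 * g2 + (c2 * g2\<^sup>2 - 2 * f2 * g2))
     + ((c2 + c3 - 4) * g2 * g3 + (c3 * g3\<^sup>2 - 2 * f3 * g3)) + ((c3 + c4 - 4) * g3 * g4 + (c4 * g4\<^sup>2 - 2 * f4 * g4))
     + ((c4 + c5 - 4) * g4 * g5 + (c5 * g5\<^sup>2 - 2 * f5 * g5)) + ((c5 + c6 - 4) * g5 * g6 + (c6 * g6\<^sup>2 - 2 * f6 * g6))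
     + f7 * g6 - g6\<^sup>2 \<ge> - (f2\<^sup>2 / 8 + (max f2 f3)\<^sup>2 / 8 + (max f3 f4)\<^sup>2 / 8 + (max f4 f5)\<^sup>2 / 8 + f5\<^sup>2 / 8)"
proof -
  define p where "p = max f2 f3"
  define q where "q = max f3 f4"
  define r where "r = max f4 f5"
  have p: "f2 \<le> p" "f3 \<le> p" "f3 \<le> q" "f4 \<le> q" "f4 \<le> r" "f5 \<le> r" by (auto simp: p_def q_def r_def)
  have "4 * g1\<^sup>2 \<le> c1 * g1\<^sup>2" "4 * g2\<^sup>2 \<le> c2 * g2\<^sup>2" "4 * g3\<^sup>2 \<le> c3 * g3\<^sup>2" "4 * g4\<^sup>2 \<le> c4 * g4\<^sup>2" "4 * g5\<^sup>2 \<le> c5 * g5\<^sup>2" "4 * g6\<^sup>2 \<le> c6 * g6\<^sup>2"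
    using c by (auto intro!: coeff_sq)
  moreover have "4 * (g1 * g2) \<le> (c1 + c2 - 4) * g1 * g2" "4 * (g2 * g3) \<le> (c2 + c3 - 4) * g2 * g3"
     "4 * (g3 * g4) \<le> (c3 + c4 - 4) * g3 * g4" "4 * (g4 * g5) \<le> (c4 + c5 - 4) * g4 * g5"
     "4 * (g5 * g6) \<le> (c5 + c6 - 4) * g5 * g6"
    using c g by (auto intro!: coeff_adj)
  moreover have "0 \<le> 2 * (g1 + g2 - f2 / 4)\<^sup>2 + 2 * (g2 + g3 - p / 4)\<^sup>2 + 2 * (g3 + g4 - q / 4)\<^sup>2 + 2 * (g4 + g5 - r / 4)\<^sup>2 + 2 * (g5 + g6 - f5 / 4)\<^sup>2
     + (1 - \<mu>) * (g1\<^sup>2 + g6\<^sup>2) + g2 * (p - f2) + g3 * ((p - f3) + (q - f3)) + g4 * ((q - f4) + (r - f4)) + g5 * (r - f5)"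
    using mu p g by (intro add_nonneg_nonneg mult_nonneg_nonneg) auto
  moreover have "2 * (g1 + g2 - f2 / 4)\<^sup>2 + 2 * (g2 + g3 - p / 4)\<^sup>2 + 2 * (g3 + g4 - q / 4)\<^sup>2 + 2 * (g4 + g5 - r / 4)\<^sup>2 + 2 * (g5 + g6 - f5 / 4)\<^sup>2
     + (1 - \<mu>) * (g1\<^sup>2 + g6\<^sup>2) + g2 * (p - f2) + g3 * ((p - f3) + (q - f3)) + g4 * ((q - f4) + (r - f4)) + g5 * (r - f5) =
     f0 * g1 - g1\<^sup>2 + (4 * g1\<^sup>2 - (f0 + f2 + \<mu> * g1) * g1) + (4 * (g1 * g2) + (4 * g2\<^sup>2 - 2 * f2 * g2))
     + (4 * (g2 * g3) + (4 * g3\<^sup>2 - 2 * f3 * g3)) + (4 * (g3 * g4) + (4 * g4\<^sup>2 - 2 * f4 * g4))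
     + (4 * (g4 * g5) + (4 * g5\<^sup>2 - 2 * f5 * g5)) + (4 * (g5 * g6) + (4 * g6\<^sup>2 - (f5 + f7 + \<mu> * g6) * g6))
     + f7 * g6 - g6\<^sup>2 + f2\<^sup>2 / 8 + p\<^sup>2 / 8 + q\<^sup>2 / 8 + r\<^sup>2 / 8 + f5\<^sup>2 / 8"
    by (simp add: power2_eq_square field_simps)
  ultimately show ?thesis unfolding f p_def[symmetric] q_def[symmetric] r_def[symmetric] by linarith
qed

section \<open>Comparison of the lower bounds with gadget values\<close>

lemma sq_bound: "\<lbrakk>0 \<le> x; x \<le> k * y\<rbrakk> \<Longrightarrow> x\<^sup>2 \<le> k\<^sup>2 * (y::real)\<^sup>2"
  by (metis power_mono power_mult_distrib)

lemma max_sq_cases: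
  "\<lbrakk>0 \<le> a; 0 \<le> b\<rbrakk> \<Longrightarrow> (max a b)\<^sup>2 = (b::real)\<^sup>2 \<and> a\<^sup>2 \<le> b\<^sup>2 \<or> (max a b)\<^sup>2 = a\<^sup>2 \<and> b\<^sup>2 \<le> a\<^sup>2"
  by (cases "a \<le> b") (simp_all add: max_def power_mono)

text \<open>The right side is the gain of a cut vertex followed by \<open>K4\<close>. A concave
  sequence starting at 0 grows from \<open>z + 1\<close> to \<open>z + 2\<close> at most by the
  factor \<open>(z + 2) / (z + 1)\<close>, which is at most 7/6 for
  \<open>z \<ge> 5\<close>.\<close>

lemma gain5:
  fixes f1 f2 f3 :: real
  assumes "0 < f1" "0 \<le> f2" "0 \<le> f3" "f2 \<le> 7/6 * f1"
  shows "f2\<^sup>2 / 8 + (max f2 f3)\<^sup>2 / 8 + f3\<^sup>2 / 8 < f1\<^sup>2 / 2 + f3\<^sup>2 / 4"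
proof -
  have "f2\<^sup>2 \<le> (7/6)\<^sup>2 * f1\<^sup>2" using assms by (intro sq_bound)
  hence "f2\<^sup>2 \<le> 49/36 * f1\<^sup>2" by (simp add: power2_eq_square)
  moreover have "0 < f1\<^sup>2" using assms by simp
  moreover have "0 \<le> f3\<^sup>2" by simp
  ultimately show ?thesis using max_sq_cases[OF assms(2,3)] by (elim disjE) linarith+
qed

text \<open>The right side belongs to a cut vertex followed by \<open>G5\<close>, whose two
  overlapping cuts produce the mixed term. The ratios are again those of concavity for
  \<open>z \<ge> 5\<close>.\<close>

lemma gain6:
  fixes f1 f2 f3 f4 :: real
  assumes "0 < f1" "0 \<le> f2" "0 \<le> f3" "0 \<le> f4" "f2 \<le> 7/6 * f1" "f3 \<le> 8/6 * f1" "f4 \<le> 9/8 * f3"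
  shows "f2\<^sup>2 / 8 + (max f2 f3)\<^sup>2 / 8 + (max f3 f4)\<^sup>2 / 8 + f4\<^sup>2 / 8 < f1\<^sup>2 / 2 + f3\<^sup>2 / 3 + f4\<^sup>2 / 3 - f3 * f4 / 3"
proof -
  have "f2\<^sup>2 \<le> (7/6)\<^sup>2 * f1\<^sup>2" using assms by (intro sq_bound)
  hence 1: "f2\<^sup>2 \<le> 49/36 * f1\<^sup>2" by (simp add: power2_eq_square)
  have "f3\<^sup>2 \<le> (8/6)\<^sup>2 * f1\<^sup>2" using assms by (intro sq_bound)
  hence 2: "f3\<^sup>2 \<le> 64/36 * f1\<^sup>2" by (simp add: power2_eq_square)
  have 3: "0 < f1\<^sup>2" using assms by simp
  have 4: "0 \<le> (f3 - f4)\<^sup>2" by simp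
  have 5: "(f3 - f4)\<^sup>2 = f3\<^sup>2 + f4\<^sup>2 - 2 * (f3 * f4)" by (simp add: power2_eq_square algebra_simps)
  have 6: "f3 * f4 \<le> 9/8 * f3\<^sup>2" using mult_left_mono[OF assms(7,3)] by (simp add: power2_eq_square)
  have 7: "0 \<le> f4\<^sup>2" "0 \<le> f3\<^sup>2" "0 \<le> f2\<^sup>2" by auto
  show ?thesis
    using max_sq_cases[OF assms(2,3)] max_sq_cases[OF assms(3,4)] 1 2 3 4 5 6 7 by (elim disjE conjE) linarith+
qed

text \<open>The right side belongs to a cut vertex followed by \<open>G6\<close>. The last
  hypothesis is concavity seen from the far end, where at least three more positions remain.\<close>

lemma gain7:
  fixes f1 f2 f3 f4 f5 :: real
  assumes "0 < f1" "0 \<le> f2" "0 \<le> f3" "0 \<le> f4" "0 \<le> f5" "f2 \<le> 7/6 * f1" "f3 \<le> 8/6 * f1" "f4 \<le> 9/6 * f1"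
     "f4 \<le> 9/8 * f3" "3/4 * f4 \<le> f5"
  shows "f2\<^sup>2 / 8 + (max f2 f3)\<^sup>2 / 8 + (max f3 f4)\<^sup>2 / 8 + (max f4 f5)\<^sup>2 / 8 + f5\<^sup>2 / 8 < f1\<^sup>2 / 2 + f3\<^sup>2 / 4 + f5\<^sup>2 / 4"
proof -
  have "f2\<^sup>2 \<le> (7/6)\<^sup>2 * f1\<^sup>2" using assms by (intro sq_bound)
  hence 1: "f2\<^sup>2 \<le> 49/36 * f1\<^sup>2" by (simp add: power2_eq_square)
  have "f3\<^sup>2 \<le> (8/6)\<^sup>2 * f1\<^sup>2" using assms by (intro sq_bound)
  hence 2: "f3\<^sup>2 \<le> 64/36 * f1\<^sup>2" by (simp add: power2_eq_square)
  have "f4\<^sup>2 \<le> (9/6)\<^sup>2 * f1\<^sup>2" using assms by (intro sq_bound)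
  hence 22: "f4\<^sup>2 \<le> 81/36 * f1\<^sup>2" by (simp add: power2_eq_square)
  have "f4\<^sup>2 \<le> (9/8)\<^sup>2 * f3\<^sup>2" using assms by (intro sq_bound)
  hence 3: "f4\<^sup>2 \<le> 81/64 * f3\<^sup>2" by (simp add: power2_eq_square)
  have "(3/4 * f4)\<^sup>2 \<le> f5\<^sup>2" using assms by (intro power_mono) auto
  hence 4: "9/16 * f4\<^sup>2 \<le> f5\<^sup>2" by (simp add: power2_eq_square)
  have 5: "0 < f1\<^sup>2" using assms by simp
  have 7: "0 \<le> f4\<^sup>2" "0 \<le> f3\<^sup>2" "0 \<le> f2\<^sup>2" "0 \<le> f5\<^sup>2" by auto
  show ?thesis
    using max_sq_cases[OF assms(2,3)] max_sq_cases[OF assms(3,4)] max_sq_cases[OF assms(4,5)] 1 2 22 3 4 5 7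
    by (elim disjE conjE) linarith+
qed

section \<open>Initial stretches of length five to eight\<close>

lemma start5:
  fixes f3 f4 f5 g1 g2 g3 g4 \<mu> :: real
  assumes f: "2 * f4 = f3 + f5 + \<mu> * g4" "f1 = f3 / 3 + \<mu> / 3 * (2 * g1 + g2)" "f2 = 2 * f3 / 3 + \<mu> / 3 * (g1 + 2 * g2)"
    and mu: "\<mu> \<le> 1" and g: "0 \<le> g1" "0 \<le> g2"
  shows "4 * g1\<^sup>2 + 6 * g2\<^sup>2 + 6 * g3\<^sup>2 + 4 * g4\<^sup>2 + 6 * g1 * g2 + 8 * g2 * g3 + 6 * g3 * g4
     + 4 * g1 * g3 + 2 * g1 * g4 + 4 * g2 * g4 - 2 * f1 * g1 - 2 * f2 * g2 - 2 * f3 * g3 - 2 * f4 * g4 + f5 * g4 - g4\<^sup>2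
     \<ge> - f3\<^sup>2 / 6"
proof -
  \<comment> \<open>The square minimises \<open>6 * g^2 - 2 * f3 * g\<close>, the value of
    \<open>S5\<close> with its first three vertices on one level. The other terms are slack,
    nonnegative for \<open>\<mu> \<le> 1\<close>.\<close>
  have "0 \<le> 6 * (g3 + 2 * g2 / 3 + g1 / 3 + g4 / 2 - f3 / 6)\<^sup>2 + (10/3 - 4 * \<mu> / 3) * (g1\<^sup>2 + g2\<^sup>2 + g1 * g2) + (3/2 - \<mu>) * g4\<^sup>2"
    using mu g by (intro add_nonneg_nonneg mult_nonneg_nonneg) auto
  moreover have "6 * (g3 + 2 * g2 / 3 + g1 / 3 + g4 / 2 - f3 / 6)\<^sup>2 + (10/3 - 4 * \<mu> / 3) * (g1\<^sup>2 + g2\<^sup>2 + g1 * g2) + (3/2 - \<mu>) * g4\<^sup>2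
    = 4 * g1\<^sup>2 + 6 * g2\<^sup>2 + 6 * g3\<^sup>2 + 4 * g4\<^sup>2 + 6 * g1 * g2 + 8 * g2 * g3 + 6 * g3 * g4
     + 4 * g1 * g3 + 2 * g1 * g4 + 4 * g2 * g4 - 2 * (f3 / 3 + \<mu> / 3 * (2 * g1 + g2)) * g1
     - 2 * (2 * f3 / 3 + \<mu> / 3 * (g1 + 2 * g2)) * g2 - 2 * f3 * g3 - (f3 + f5 + \<mu> * g4) * g4 + f5 * g4 - g4\<^sup>2 + f3\<^sup>2 / 6"
    by (simp add: power2_eq_square field_simps)
  ultimately show ?thesis unfolding f by linarith
qed

text \<open>In \<open>S6\<close> the first four vertices share one level, so only their total weight
  counts; therefore \<open>f1\<close>, \<open>f2\<close>, \<open>f3\<close> are eliminated in favour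
  of \<open>f4\<close>.\<close>

lemma start6:
  fixes f1 f2 f3 f4 f5 f6 g1 g2 g3 g4 g5 \<mu> :: real
  assumes f: "2 * f5 = f4 + f6 + \<mu> * g5" "f1 = f4 / 4 + \<mu> / 4 * (3 * g1 + 2 * g2 + g3)"
      "f2 = f4 / 2 + \<mu> / 2 * (g1 + 2 * g2 + g3)" "f3 = 3 * f4 / 4 + \<mu> / 4 * (g1 + 2 * g2 + 3 * g3)"
    and mu: "\<mu> \<le> 3/4" and g: "0 \<le> g1" "0 \<le> g2" "0 \<le> g3" "0 \<le> g4" "0 \<le> g5"
  shows "4 * g1\<^sup>2 + 6 * g2\<^sup>2 + 6 * g3\<^sup>2 + 4 * g4\<^sup>2 + 4 * g5\<^sup>2 + 6 * g1 * g2 + 8 * g2 * g3 + 6 * g3 * g4 + 4 * g4 * g5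
     + 4 * g1 * g3 + 2 * g1 * g4 + 4 * g2 * g4 + 2 * g3 * g5
     - 2 * f1 * g1 - 2 * f2 * g2 - 2 * f3 * g3 - 2 * f4 * g4 - 2 * f5 * g5 + f6 * g5 - g5\<^sup>2
     \<ge> - f4\<^sup>2 / 4"
proof -
  \<comment> \<open>Completing the square in \<open>g4\<close> leaves negative products of
    \<open>g5\<close> with \<open>g1\<close>, \<open>g2\<close>, \<open>g3\<close>; the square with
    factor 5/4 absorbs them.\<close>
  have A: "4 * (g4 + 3 * g3 / 4 + g2 / 2 + g1 / 4 + g5 / 2 - f4 / 4)\<^sup>2
       + (3/4 - \<mu>) * (3/2 * g1\<^sup>2 + 2 * g2\<^sup>2 + 3/2 * g3\<^sup>2 + g5\<^sup>2 + 2 * g1 * g2 + 2 * g2 * g3 + g1 * g3)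
       + 5/4 * (g5 - 2/5 * g1 - 4/5 * g2 - 2/5 * g3)\<^sup>2 + (15/4 - 9/8 - 1/5) * g1\<^sup>2 + (5 - 3/2 - 4/5) * g2\<^sup>2 + (15/4 - 9/8 - 1/5) * g3\<^sup>2
       + (7/2 - 4/5) * g1 * g2 + (7/2 - 4/5) * g2 * g3 + (7/4 - 2/5) * g1 * g3
    = 4 * g1\<^sup>2 + 6 * g2\<^sup>2 + 6 * g3\<^sup>2 + 4 * g4\<^sup>2 + 4 * g5\<^sup>2 + 6 * g1 * g2 + 8 * g2 * g3 + 6 * g3 * g4 + 4 * g4 * g5
     + 4 * g1 * g3 + 2 * g1 * g4 + 4 * g2 * g4 + 2 * g3 * g5
     - 2 * (f4 / 4 + \<mu> / 4 * (3 * g1 + 2 * g2 + g3)) * g1 - 2 * (f4 / 2 + \<mu> / 2 * (g1 + 2 * g2 + g3)) * g2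
     - 2 * (3 * f4 / 4 + \<mu> / 4 * (g1 + 2 * g2 + 3 * g3)) * g3 - 2 * f4 * g4 - (f4 + f6 + \<mu> * g5) * g5 + f6 * g5 - g5\<^sup>2
     + f4\<^sup>2 / 4"
    by (simp add: power2_eq_square field_simps)
  have "0 \<le> 4 * (g4 + 3 * g3 / 4 + g2 / 2 + g1 / 4 + g5 / 2 - f4 / 4)\<^sup>2
       + (3/4 - \<mu>) * (3/2 * g1\<^sup>2 + 2 * g2\<^sup>2 + 3/2 * g3\<^sup>2 + g5\<^sup>2 + 2 * g1 * g2 + 2 * g2 * g3 + g1 * g3)
       + 5/4 * (g5 - 2/5 * g1 - 4/5 * g2 - 2/5 * g3)\<^sup>2 + (15/4 - 9/8 - 1/5) * g1\<^sup>2 + (5 - 3/2 - 4/5) * g2\<^sup>2 + (15/4 - 9/8 - 1/5) * g3\<^sup>2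
       + (7/2 - 4/5) * g1 * g2 + (7/2 - 4/5) * g2 * g3 + (7/4 - 2/5) * g1 * g3"
    using mu g by (intro add_nonneg_nonneg mult_nonneg_nonneg) auto
  with A show ?thesis unfolding f by linarith
qed

lemma start7:
  fixes f1 f2 f3 f4 f5 f6 f7 g1 g2 g3 g4 g5 g6 \<mu> :: real
  assumes f: "2 * f1 = f2 + \<mu> * g1" "2 * f3 = f2 + f4 + \<mu> * g3" "2 * f6 = f5 + f7 + \<mu> * g6"
    and mu: "\<mu> \<le> 3/4" and g: "0 \<le> g1" "0 \<le> g2" "0 \<le> g3" "0 \<le> g4" "0 \<le> g5" "0 \<le> g6"
  shows "4 * g1\<^sup>2 + 6 * g2\<^sup>2 + 6 * g3\<^sup>2 + 4 * g4\<^sup>2 + 4 * g5\<^sup>2 + 4 * g6\<^sup>2 + 6 * g1 * g2 + 8 * g2 * g3 + 6 * g3 * g4 + 4 * g4 * g5 + 4 * g5 * g6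
     + 4 * g1 * g3 + 2 * g1 * g4 + 4 * g2 * g4 + 2 * g3 * g5 + 2 * g4 * g6
     - 2 * f1 * g1 - 2 * f2 * g2 - 2 * f3 * g3 - 2 * f4 * g4 - 2 * f5 * g5 - 2 * f6 * g6 + f7 * g6 - g6\<^sup>2
     \<ge> - (3/14 * f2\<^sup>2 + 3/7 * f4\<^sup>2 + 5/14 * f5\<^sup>2 - 2/7 * f2 * f4 + 1/7 * f2 * f5 - 3/7 * f4 * f5)"
proof -
  \<comment> \<open>These are the deviations of the level gaps from the stationary point of the
    value of \<open>S7\<close>, the one used in \<open>y7o\<close>. The energy of \<open>S7\<close>
    in its three level gaps is
    \<open>2 * (a + b)^2 + 4 * a^2 + 2 * (b + c)^2 + 2 * c^2\<close>.\<close>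
  define a where "a = g2 + g1 / 2 + g3 / 2 - (9 * f2 - 6 * f4 + 3 * f5) / 42"
  define b where "b = g4 + g3 / 2 - (6 * f4 - 2 * f2 - 3 * f5) / 14"
  define c where "c = g5 + g6 / 2 - (10 * f5 - 6 * f4 + 2 * f2) / 28"
  have A: "2 * (a + b)\<^sup>2 + 4 * a\<^sup>2 + 2 * (b + c)\<^sup>2 + 2 * c\<^sup>2
       + (3/4 - \<mu>) * (g1\<^sup>2 + g3\<^sup>2 + g6\<^sup>2) + 7/4 * g1\<^sup>2 + 3/4 * g3\<^sup>2 + g6\<^sup>2 + (g6 / 2 - g3)\<^sup>2
    = (4 * g1\<^sup>2 + 6 * g2\<^sup>2 + 6 * g3\<^sup>2 + 4 * g4\<^sup>2 + 4 * g5\<^sup>2 + 4 * g6\<^sup>2 + 6 * g1 * g2 + 8 * g2 * g3 + 6 * g3 * g4 + 4 * g4 * g5 + 4 * g5 * g6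
     + 4 * g1 * g3 + 2 * g1 * g4 + 4 * g2 * g4 + 2 * g3 * g5 + 2 * g4 * g6
     - (f2 + \<mu> * g1) * g1 - 2 * f2 * g2 - (f2 + f4 + \<mu> * g3) * g3 - 2 * f4 * g4 - 2 * f5 * g5 - (f5 + f7 + \<mu> * g6) * g6 + f7 * g6 - g6\<^sup>2
     + (3/14 * f2\<^sup>2 + 3/7 * f4\<^sup>2 + 5/14 * f5\<^sup>2 - 2/7 * f2 * f4 + 1/7 * f2 * f5 - 3/7 * f4 * f5))" (is "_ = ?R")
    unfolding a_def b_def c_def by (simp add: power2_eq_square field_simps)
  have "0 \<le> 2 * (a + b)\<^sup>2 + 4 * a\<^sup>2 + 2 * (b + c)\<^sup>2 + 2 * c\<^sup>2
       + (3/4 - \<mu>) * (g1\<^sup>2 + g3\<^sup>2 + g6\<^sup>2) + 7/4 * g1\<^sup>2 + 3/4 * g3\<^sup>2 + g6\<^sup>2 + (g6 / 2 - g3)\<^sup>2"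
    using mu g by (intro add_nonneg_nonneg mult_nonneg_nonneg) auto
  hence "0 \<le> ?R" unfolding A .
  thus ?thesis unfolding f by argo
qed

text \<open>The 4-edge cuts at 4 and at 6 are optimised independently. The remaining terms need the
  sharper bound on \<open>\<mu>\<close>, available since the block then has at least eight vertices
  besides the cut vertex.\<close>

lemma start8:
  fixes f1 f2 f3 f4 f5 f6 f7 f8 g1 g2 g3 g4 g5 g6 g7 \<mu> :: real
  assumes f: "2 * f5 = f4 + f6 + \<mu> * g5" "2 * f7 = f6 + f8 + \<mu> * g7" "f1 = f4 / 4 + \<mu> / 4 * (3 * g1 + 2 * g2 + g3)"
      "f2 = f4 / 2 + \<mu> / 2 * (g1 + 2 * g2 + g3)" "f3 = 3 * f4 / 4 + \<mu> / 4 * (g1 + 2 * g2 + 3 * g3)"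
    and mu: "\<mu> \<le> 3/5" and g: "0 \<le> g1" "0 \<le> g2" "0 \<le> g3" "0 \<le> g4" "0 \<le> g5" "0 \<le> g6" "0 \<le> g7"
  shows "4 * g1\<^sup>2 + 6 * g2\<^sup>2 + 6 * g3\<^sup>2 + 4 * g4\<^sup>2 + 4 * g5\<^sup>2 + 4 * g6\<^sup>2 + 4 * g7\<^sup>2
     + 6 * g1 * g2 + 8 * g2 * g3 + 6 * g3 * g4 + 4 * g4 * g5 + 4 * g5 * g6 + 4 * g6 * g7
     + 4 * g1 * g3 + 2 * g1 * g4 + 4 * g2 * g4 + 2 * g3 * g5
     - 2 * f1 * g1 - 2 * f2 * g2 - 2 * f3 * g3 - 2 * f4 * g4 - 2 * f5 * g5 - 2 * f6 * g6 - 2 * f7 * g7 + f8 * g7 - g7\<^sup>2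
     \<ge> - f4\<^sup>2 / 4 - f6\<^sup>2 / 4"
proof -
  have A: "4 * (g4 + 3 * g3 / 4 + g2 / 2 + g1 / 4 + g5 / 2 - f4 / 4)\<^sup>2 + 4 * (g6 + g5 / 2 + g7 / 2 - f6 / 4)\<^sup>2
       + (3/5 - \<mu>) * (3/2 * g1\<^sup>2 + 2 * g2\<^sup>2 + 3/2 * g3\<^sup>2 + g5\<^sup>2 + g7\<^sup>2 + 2 * g1 * g2 + 2 * g2 * g3 + g1 * g3)
       + 7/5 * (g7 - 5/7 * g5)\<^sup>2 + 24/35 * (g5 - 35/48 * g1 - 35/24 * g2 - 35/48 * g3)\<^sup>2
       + (15/4 - 9/10 - 35/96) * g1\<^sup>2 + (5 - 6/5 - 35/24) * g2\<^sup>2 + (15/4 - 9/10 - 35/96) * g3\<^sup>2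
       + (19/5 - 35/24) * g1 * g2 + (19/5 - 35/24) * g2 * g3 + (19/10 - 35/48) * g1 * g3
    = 4 * g1\<^sup>2 + 6 * g2\<^sup>2 + 6 * g3\<^sup>2 + 4 * g4\<^sup>2 + 4 * g5\<^sup>2 + 4 * g6\<^sup>2 + 4 * g7\<^sup>2
     + 6 * g1 * g2 + 8 * g2 * g3 + 6 * g3 * g4 + 4 * g4 * g5 + 4 * g5 * g6 + 4 * g6 * g7
     + 4 * g1 * g3 + 2 * g1 * g4 + 4 * g2 * g4 + 2 * g3 * g5
     - 2 * (f4 / 4 + \<mu> / 4 * (3 * g1 + 2 * g2 + g3)) * g1 - 2 * (f4 / 2 + \<mu> / 2 * (g1 + 2 * g2 + g3)) * g2
     - 2 * (3 * f4 / 4 + \<mu> / 4 * (g1 + 2 * g2 + 3 * g3)) * g3 - 2 * f4 * g4 - (f4 + f6 + \<mu> * g5) * g5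
     - 2 * f6 * g6 - (f6 + f8 + \<mu> * g7) * g7 + f8 * g7 - g7\<^sup>2
     + f4\<^sup>2 / 4 + f6\<^sup>2 / 4"
    by (simp add: power2_eq_square field_simps)
  have "0 \<le> 4 * (g4 + 3 * g3 / 4 + g2 / 2 + g1 / 4 + g5 / 2 - f4 / 4)\<^sup>2 + 4 * (g6 + g5 / 2 + g7 / 2 - f6 / 4)\<^sup>2
       + (3/5 - \<mu>) * (3/2 * g1\<^sup>2 + 2 * g2\<^sup>2 + 3/2 * g3\<^sup>2 + g5\<^sup>2 + g7\<^sup>2 + 2 * g1 * g2 + 2 * g2 * g3 + g1 * g3)
       + 7/5 * (g7 - 5/7 * g5)\<^sup>2 + 24/35 * (g5 - 35/48 * g1 - 35/24 * g2 - 35/48 * g3)\<^sup>2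
       + (15/4 - 9/10 - 35/96) * g1\<^sup>2 + (5 - 6/5 - 35/24) * g2\<^sup>2 + (15/4 - 9/10 - 35/96) * g3\<^sup>2
       + (19/5 - 35/24) * g1 * g2 + (19/5 - 35/24) * g2 * g3 + (19/10 - 35/48) * g1 * g3"
    using mu g by (intro add_nonneg_nonneg mult_nonneg_nonneg) auto
  with A show ?thesis unfolding f by linarith
qed

text \<open>The chain 5-4-4 against 6-7, with the common terms cancelled. Here \<open>a\<close>,
  \<open>b\<close>, \<open>c\<close>, \<open>d\<close> are the mean weights of consecutive groups of
  3, 2, 2 and 2 vertices. For nine equal weights both sides agree, so strictness needs an additional
  assumption.\<close>

lemma gain544:
  fixes f3 f4 f5 f6 f7 f9 a b c d :: real
  assumes f: "f3 = 3 * a" "f5 = f3 + 2 * b" "f7 = f5 + 2 * c" "f9 = f7 + 2 * d" "f3 + b \<le> f4" "f5 + c \<le> f6"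
    and pos: "0 < f3" "0 < f5" "0 < f7" "0 < f9" and mono: "b \<le> a" "c \<le> b" "d \<le> c" and tail: "0 \<le> f5 + 9 * c"
  shows "f3\<^sup>2 / 6 + f5\<^sup>2 / 2 + f9\<^sup>2 / 4 \<le> f4\<^sup>2 / 4 + f6\<^sup>2 / 2 + f7\<^sup>2 / 4"
    and "b < a \<Longrightarrow> f3\<^sup>2 / 6 + f5\<^sup>2 / 2 + f9\<^sup>2 / 4 < f4\<^sup>2 / 4 + f6\<^sup>2 / 2 + f7\<^sup>2 / 4"
proof -
  have 1: "(f3 + b)\<^sup>2 \<le> f4\<^sup>2" using f pos by (intro power_mono) auto
  have 2: "(f5 + c)\<^sup>2 \<le> f6\<^sup>2" using f pos by (intro power_mono) auto
  have 3: "f9\<^sup>2 \<le> (f7 + 2 * c)\<^sup>2" using f pos mono by (intro power_mono) auto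
  have 4: "(f3 + b)\<^sup>2 / 4 + (f5 + c)\<^sup>2 / 2 + f7\<^sup>2 / 4 - f3\<^sup>2 / 6 - f5\<^sup>2 / 2 - (f7 + 2 * c)\<^sup>2 / 4
     = 3/4 * a\<^sup>2 + 3/2 * a * b + b\<^sup>2 / 4 - 5/2 * c\<^sup>2"
    unfolding f by (simp add: power2_eq_square field_simps)
  have a: "0 < a" using f pos by simp
  have *: "3/4 * a\<^sup>2 + 3/2 * a * b + b\<^sup>2 / 4 - 5/2 * c\<^sup>2 \<ge> 0 \<and> (b < a \<longrightarrow> 3/4 * a\<^sup>2 + 3/2 * a * b + b\<^sup>2 / 4 - 5/2 * c\<^sup>2 > 0)"
  proof (cases "0 \<le> c")
    case True
    have "c\<^sup>2 \<le> b\<^sup>2" using True mono by (intro power_mono) auto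
    \<comment> \<open>For nonnegative \<open>c\<close> the worst case is \<open>c = b\<close>, where
      the form factors; \<open>b < a\<close> makes both factors positive.\<close>
    moreover have "3/4 * a\<^sup>2 + 3/2 * a * b + b\<^sup>2 / 4 - 5/2 * b\<^sup>2 = 3/4 * ((a - b) * (a + 3 * b))"
      by (simp add: power2_eq_square field_simps)
    moreover have "0 \<le> (a - b) * (a + 3 * b)" using mono True a by (intro mult_nonneg_nonneg) auto
    moreover have "b < a \<Longrightarrow> 0 < (a - b) * (a + 3 * b)" using mono True a by (intro mult_pos_pos) auto
    ultimately show ?thesis by linarith
  next
    case False
    \<comment> \<open>A negative \<open>c\<close> is controlled by the tail condition: its size is
      at most \<open>f5 / 9\<close>.\<close>
    have "(- 9 * c)\<^sup>2 \<le> f5\<^sup>2" using False tail by (intro power_mono) auto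
    hence c: "81 * c\<^sup>2 \<le> (3 * a + 2 * b)\<^sup>2" using f by (simp add: power2_eq_square)
    have b: "0 \<le> 11 * b + 3 * a" using f tail mono by linarith
    have "0 < 3/4 * a\<^sup>2 + 3/2 * a * b + b\<^sup>2 / 4 - 5/2 * ((3 * a + 2 * b)\<^sup>2 / 81)"
    proof -
      have "3/4 * a\<^sup>2 + 3/2 * a * b + b\<^sup>2 / 4 - 5/2 * ((3 * a + 2 * b)\<^sup>2 / 81) =
         (17/36) * a\<^sup>2 + (61/54) * (a * b) + (41/324) * b\<^sup>2"
        by (simp add: power2_eq_square field_simps)
      moreover have "a * b \<ge> - 3/11 * a\<^sup>2" using mult_left_mono[OF b, of a] a by (simp add: power2_eq_square algebra_simps)
      moreover have "0 < a\<^sup>2" using a by simp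
      ultimately show ?thesis using zero_le_power2[of b] by linarith
    qed
    thus ?thesis using c by linarith
  qed
  show "f3\<^sup>2 / 6 + f5\<^sup>2 / 2 + f9\<^sup>2 / 4 \<le> f4\<^sup>2 / 4 + f6\<^sup>2 / 2 + f7\<^sup>2 / 4" using 1 2 3 4 * by linarith
  show "b < a \<Longrightarrow> f3\<^sup>2 / 6 + f5\<^sup>2 / 2 + f9\<^sup>2 / 4 < f4\<^sup>2 / 4 + f6\<^sup>2 / 2 + f7\<^sup>2 / 4" using 1 2 3 4 * by linarith
qed

section \<open>Gadgets and their values\<close>

type_synonym edges = "(nat \<times> nat) list"

definition pdeg :: "edges \<Rightarrow> nat \<Rightarrow> nat" where
  "pdeg H i = (\<Sum>(a, b)\<leftarrow>H. of_bool (a = i) + of_bool (b = i))"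

definition penergy :: "edges \<Rightarrow> (nat \<Rightarrow> real) \<Rightarrow> real" where
  "penergy H y = (\<Sum>(a, b)\<leftarrow>H. (y a - y b)\<^sup>2)"

definition padj :: "edges \<Rightarrow> nat \<Rightarrow> nat \<Rightarrow> bool" where
  "padj H a b \<longleftrightarrow> (a, b) \<in> set H \<or> (b, a) \<in> set H"

text \<open>The exits \<open>s\<close> and \<open>t\<close> are the positions joined to the cut vertex; that vertex and the two edges at it are not part of \<open>H\<close>.\<close>

definition end_gadget :: "nat \<Rightarrow> edges \<Rightarrow> nat \<Rightarrow> nat \<Rightarrow> bool" where
  "end_gadget k H s t \<longleftrightarrow> distinct H \<and> (\<forall>(a, b)\<in>set H. a < b \<and> b < k) \<and> s < k \<and> t < k \<and>
     (\<forall>i<k. pdeg H i + of_bool (i = s) + of_bool (i = t) = 4) \<and> (\<forall>i<k. (padj H)\<^sup>*\<^sup>* i s)"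

text \<open>Entries and exits may coincide, so that a single cut vertex is a link as well.\<close>

definition link_gadget :: "nat \<Rightarrow> edges \<Rightarrow> nat \<Rightarrow> nat \<Rightarrow> nat \<Rightarrow> nat \<Rightarrow> bool" where
  "link_gadget l N e e' s t \<longleftrightarrow> distinct N \<and> (\<forall>(a, b)\<in>set N. a < b \<and> b < l) \<and> e < l \<and> e' < l \<and> s < l \<and> t < l \<and>
     (\<forall>i<l. pdeg N i + of_bool (i = e) + of_bool (i = e') + of_bool (i = s) + of_bool (i = t) = 4) \<and>
     (\<forall>i<l. (padj N)\<^sup>*\<^sup>* i s)"

definition shift :: "nat \<Rightarrow> edges \<Rightarrow> edges" where
  "shift k N = map (\<lambda>(a, b). (k + a, k + b)) N"

definition attach :: "nat \<Rightarrow> edges \<Rightarrow> nat \<Rightarrow> nat \<Rightarrow> edges \<Rightarrow> nat \<Rightarrow> nat \<Rightarrow> edges" where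
  "attach k H s t N e e' = H @ [(s, k + e), (t, k + e')] @ shift k N"

lemma pdeg_Nil [simp]: "pdeg [] i = 0"
  and pdeg_Cons [simp]: "pdeg ((a, b) # H) i = of_bool (a = i) + of_bool (b = i) + pdeg H i"
  and pdeg_append [simp]: "pdeg (H @ H') i = pdeg H i + pdeg H' i"
  by (simp_all add: pdeg_def)

lemma penergy_Nil [simp]: "penergy [] y = 0"
  and penergy_Cons [simp]: "penergy ((a, b) # H) y = (y a - y b)\<^sup>2 + penergy H y"
  and penergy_append [simp]: "penergy (H @ H') y = penergy H y + penergy H' y"
  by (simp_all add: penergy_def)

lemma pdeg_shift: "pdeg (shift k N) i = (if k \<le> i then pdeg N (i - k) else 0)"
  unfolding shift_def by (induction N) auto

lemma penergy_shift: "penergy (shift k N) y = penergy N (\<lambda>i. y (k + i))"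
  unfolding shift_def by (induction N) auto

lemma penergy_cong:
  assumes "\<And>a b. (a, b) \<in> set H \<Longrightarrow> y a - y b = z a - z b"
  shows "penergy H y = penergy H z"
  using assms by (induction H) auto

lemma pdeg_out: "\<forall>(a, b)\<in>set H. a < b \<and> b < k \<Longrightarrow> k \<le> i \<Longrightarrow> pdeg H i = 0"
  by (induction H) auto

lemma padj_mono: "set H \<subseteq> set H' \<Longrightarrow> (padj H)\<^sup>*\<^sup>* a b \<Longrightarrow> (padj H')\<^sup>*\<^sup>* a b"
  by (erule rtranclp_mono[THEN predicate2D, rotated]) (auto simp: padj_def)

lemma padj_shift:
  assumes "(padj N)\<^sup>*\<^sup>* a b"
  shows "(padj (shift k N))\<^sup>*\<^sup>* (k + a) (k + b)"
  using assms
proof (induction rule: rtranclp_induct)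
  case (step y z)
  have "padj (shift k N) (k + y) (k + z)" using step(2) by (force simp: padj_def shift_def)
  with step(3) show ?case by simp
qed simp

text \<open>Chains grow by one link at a time and remain end gadgets. The hypothesis
  \<open>s \<noteq> t \<or> e \<noteq> e'\<close> keeps the two joining edges distinct.\<close>

lemma attach_end_gadget:
  assumes H: "end_gadget k H s t" and N: "link_gadget l N e e' s' t'" and d: "s \<noteq> t \<or> e \<noteq> e'"
  shows "end_gadget (k + l) (attach k H s t N e e') (k + s') (k + t')"
proof -
  let ?A = "attach k H s t N e e'"
  have H': "distinct H" "\<forall>(a, b)\<in>set H. a < b \<and> b < k" "s < k" "t < k"
     "\<And>i. i < k \<Longrightarrow> pdeg H i + of_bool (i = s) + of_bool (i = t) = 4" "\<And>i. i < k \<Longrightarrow> (padj H)\<^sup>*\<^sup>* i s"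
    using H by (auto simp: end_gadget_def)
  have N': "distinct N" "\<forall>(a, b)\<in>set N. a < b \<and> b < l" "e < l" "e' < l" "s' < l" "t' < l"
     "\<And>i. i < l \<Longrightarrow> pdeg N i + of_bool (i = e) + of_bool (i = e') + of_bool (i = s') + of_bool (i = t') = 4"
     "\<And>i. i < l \<Longrightarrow> (padj N)\<^sup>*\<^sup>* i s'"
    using N by (auto simp: link_gadget_def)
  have "distinct (shift k N)" unfolding shift_def distinct_map using N'(1)
    by (auto simp: inj_on_def)
  moreover have "set H \<inter> (set [(s, k + e), (t, k + e')] \<union> set (shift k N)) = {}"
    using H'(2) by (auto simp: shift_def)
  moreover have "set [(s, k + e), (t, k + e')] \<inter> set (shift k N) = {}"
    using H'(3,4) by (auto simp: shift_def)
  ultimately have 1: "distinct ?A" using H'(1) d by (auto simp: attach_def)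
  have 2: "\<forall>(a, b)\<in>set ?A. a < b \<and> b < k + l"
    using H' N' by (auto simp: attach_def shift_def)
  have 3: "pdeg ?A i + of_bool (i = k + s') + of_bool (i = k + t') = 4" if i: "i < k + l" for i
  proof (cases "i < k")
    case True
    thus ?thesis using H'(5)[OF True] by (simp add: attach_def pdeg_shift eq_commute[of i])
  next
    case False
    define j where "j = i - k"
    have j: "i = k + j" "j < l" using False i by (auto simp: j_def)
    have "pdeg H i = 0" using pdeg_out[OF H'(2)] False by auto
    thus ?thesis using N'(7)[OF j(2)] H'(3,4) j by (simp add: attach_def pdeg_shift eq_commute[of j])
  qed
  have new: "(padj ?A)\<^sup>*\<^sup>* (k + i) (k + s')" if "i < l" for i
    by (rule padj_mono[OF _ padj_shift[OF N'(8)[OF that]]]) (auto simp: attach_def)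
  have 4: "(padj ?A)\<^sup>*\<^sup>* i (k + s')" if i: "i < k + l" for i
  proof (cases "i < k")
    case True
    have "(padj ?A)\<^sup>*\<^sup>* i s" by (rule padj_mono[OF _ H'(6)[OF True]]) (auto simp: attach_def)
    moreover have "padj ?A s (k + e)" by (auto simp: padj_def attach_def)
    ultimately show ?thesis using new[OF N'(3)] by (meson rtranclp.rtrancl_into_rtrancl rtranclp_trans)
  next
    case False
    thus ?thesis using new[of "i - k"] i by simp
  qed
  show ?thesis unfolding end_gadget_def using 1 2 3 4 N' by auto
qed

section \<open>Concrete gadgets\<close>

lemma padj_star_step: "padj H a b \<Longrightarrow> (padj H)\<^sup>*\<^sup>* b c \<Longrightarrow> (padj H)\<^sup>*\<^sup>* a c"
  by (rule converse_rtranclp_into_rtranclp)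

text \<open>One vertex without edges: two entries and two exits at it make it a cut vertex of degree
  four.\<close>

definition cutv :: edges where "cutv = []"
definition K4 :: edges where "K4 = [(0, 1), (0, 2), (0, 3), (1, 2), (1, 3), (2, 3)]"
text \<open>\<open>G5\<close> is the complete graph on five vertices without the edges 03 and 14.
  \<open>G6\<close> consists of the pairs 01, 23, 45, consecutive pairs completely joined and the
  outer two pairs adjacent.\<close>

definition G5 :: edges where "G5 = [(0, 1), (0, 2), (0, 4), (1, 2), (1, 3), (2, 3), (2, 4), (3, 4)]"
definition G6 :: edges where "G6 = [(0, 1), (0, 2), (0, 3), (1, 2), (1, 3), (2, 4), (2, 5), (3, 4), (3, 5), (4, 5)]"
text \<open>\<open>S5\<close> to \<open>S8\<close> are the graphs D0 to D3 without the vertex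
  \<open>w\<close>, numbered so that the exits come last.\<close>

definition S5 :: edges where "S5 = [(0, 1), (0, 2), (1, 2), (0, 3), (0, 4), (1, 3), (1, 4), (2, 3), (2, 4)]"
definition S6 :: edges where "S6 = K4 @ [(0, 4), (1, 4), (2, 5), (3, 5), (4, 5)]"
definition S7 :: edges where "S7 = K4 @ [(0, 4), (1, 4), (2, 5), (3, 6), (4, 5), (4, 6), (5, 6)]"
definition S8 :: edges where "S8 = K4 @ [(0, 4), (1, 4), (2, 5), (3, 5), (4, 6), (4, 7), (5, 6), (5, 7), (6, 7)]"

lemma padj_star1: "padj H a b \<Longrightarrow> (padj H)\<^sup>*\<^sup>* a b" by simp
lemma padj_star2: "padj H a c \<Longrightarrow> padj H c b \<Longrightarrow> (padj H)\<^sup>*\<^sup>* a b" by (meson padj_star_step padj_star1)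

lemma link_cutv: "link_gadget 1 cutv 0 0 0 0"
  by (simp add: link_gadget_def cutv_def)

lemma nat_less_cases:
  "(i::nat) < 4 \<Longrightarrow> i = 0 \<or> i = 1 \<or> i = 2 \<or> i = 3"
  "(i::nat) < 5 \<Longrightarrow> i = 0 \<or> i = 1 \<or> i = 2 \<or> i = 3 \<or> i = 4"
  "(i::nat) < 6 \<Longrightarrow> i = 0 \<or> i = 1 \<or> i = 2 \<or> i = 3 \<or> i = 4 \<or> i = 5"
  "(i::nat) < 7 \<Longrightarrow> i = 0 \<or> i = 1 \<or> i = 2 \<or> i = 3 \<or> i = 4 \<or> i = 5 \<or> i = 6"
  "(i::nat) < 8 \<Longrightarrow> i = 0 \<or> i = 1 \<or> i = 2 \<or> i = 3 \<or> i = 4 \<or> i = 5 \<or> i = 6 \<or> i = 7"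
  by auto

lemma link_K4: "link_gadget 4 K4 0 1 2 3"
proof -
  have "(padj K4)\<^sup>*\<^sup>* i 2" if "i < 4" for i
    using nat_less_cases(1)[OF that] by (auto simp: K4_def padj_def)
  thus ?thesis unfolding link_gadget_def
    by (auto dest!: nat_less_cases(1) simp: K4_def)
qed

lemma link_G5: "link_gadget 5 G5 0 1 3 4"
proof -
  have "(padj G5)\<^sup>*\<^sup>* i 3" if "i < 5" for i
    using nat_less_cases(2)[OF that] padj_star2[of G5 0 1 3] by (auto simp: G5_def padj_def)
  thus ?thesis unfolding link_gadget_def
    by (auto dest!: nat_less_cases(2) simp: G5_def)
qed

lemma link_G6: "link_gadget 6 G6 0 1 4 5"
proof -
  have "(padj G6)\<^sup>*\<^sup>* i 4" if "i < 6" for i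
    using nat_less_cases(3)[OF that] padj_star2[of G6 0 2 4] padj_star2[of G6 1 2 4] by (auto simp: G6_def padj_def)
  thus ?thesis unfolding link_gadget_def
    by (auto dest!: nat_less_cases(3) simp: G6_def)
qed

lemma end_S5: "end_gadget 5 S5 3 4"
proof -
  have "(padj S5)\<^sup>*\<^sup>* i 3" if "i < 5" for i
    using nat_less_cases(2)[OF that] padj_star2[of S5 4 0 3] by (auto simp: S5_def padj_def)
  thus ?thesis unfolding end_gadget_def
    by (auto dest!: nat_less_cases(2) simp: S5_def)
qed

lemma end_S6: "end_gadget 6 S6 4 5"
proof -
  have "(padj S6)\<^sup>*\<^sup>* i 4" if "i < 6" for i
    using nat_less_cases(3)[OF that] padj_star2[of S6 2 0 4] padj_star2[of S6 3 0 4]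
    by (auto simp: S6_def K4_def padj_def)
  thus ?thesis unfolding end_gadget_def
    by (auto dest!: nat_less_cases(3) simp: S6_def K4_def)
qed

lemma end_S7: "end_gadget 7 S7 5 6"
proof -
  have "(padj S7)\<^sup>*\<^sup>* i 5" if "i < 7" for i
    using nat_less_cases(4)[OF that] padj_star2[of S7 0 4 5] padj_star2[of S7 1 4 5] padj_star2[of S7 3 2 5]
    by (auto simp: S7_def K4_def padj_def)
  thus ?thesis unfolding end_gadget_def
    by (auto dest!: nat_less_cases(4) simp: S7_def K4_def)
qed

lemma end_S8: "end_gadget 8 S8 6 7"
proof -
  have "(padj S8)\<^sup>*\<^sup>* i 6" if "i < 8" for i
    using nat_less_cases(5)[OF that] padj_star2[of S8 0 4 6] padj_star2[of S8 1 4 6] padj_star2[of S8 3 5 6] padj_star2[of S8 2 5 6]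
    by (auto simp: S8_def K4_def padj_def)
  thus ?thesis unfolding end_gadget_def
    by (auto dest!: nat_less_cases(5) simp: S8_def K4_def)
qed

text \<open>If \<open>y\<close> vanishes at both exits, adding a constant \<open>d\<close> to \<open>y\<close> and putting \<open>0\<close> at the cut vertex changes the value by
  \<open>2 * d\<^sup>2 - 2 * d * (\<Sum>i<k. w i)\<close>, which is minimised separately.\<close>

definition gval :: "(nat \<Rightarrow> real) \<Rightarrow> nat \<Rightarrow> edges \<Rightarrow> (nat \<Rightarrow> real) \<Rightarrow> real" where
  "gval w k H y = penergy H y - 2 * (\<Sum>i<k. w i * y i)"

lemma sum_lessThan_add: "(\<Sum>i<k + l. f i) = (\<Sum>i<k. f i) + (\<Sum>i<l. f (k + i) :: real)" for k l :: nat
  by (induction l) (auto simp: add.assoc)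

text \<open>Both joining edges carry the drop \<open>h\<close>. The old gadget is only translated by
  \<open>d\<close>: its energy is unchanged, and the translation is charged to its total
  weight.\<close>

lemma gval_attach:
  assumes H: "end_gadget k H s t" and N: "link_gadget l N e e' s' t'"
    and y: "y s = 0" "y t = 0" and z: "z e = \<eta>" "z e' = \<eta>" and d: "d = h + \<eta>"
  shows "gval w (k + l) (attach k H s t N e e') (\<lambda>i. if i < k then y i + d else z (i - k))
    = gval w k H y + 2 * h\<^sup>2 - 2 * d * (\<Sum>i<k. w i) + gval (\<lambda>i. w (k + i)) l N z"
proof -
  let ?y = "\<lambda>i. if i < k then y i + d else z (i - k)"
  have H': "\<forall>(a, b)\<in>set H. a < b \<and> b < k" "s < k" "t < k" using H by (auto simp: end_gadget_def)
  have 1: "penergy H ?y = penergy H y" by (rule penergy_cong) (use H' in auto)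
  have 2: "penergy (shift k N) ?y = penergy N z" by (simp add: penergy_shift)
  have 3: "(\<Sum>i<k + l. w i * ?y i) = (\<Sum>i<k. w i * (y i + d)) + (\<Sum>i<l. w (k + i) * z i)"
    by (simp add: sum_lessThan_add)
  show ?thesis unfolding gval_def attach_def penergy_append penergy_Cons penergy_Nil 1 2 3
    using H' y z unfolding d by (simp add: algebra_simps sum.distrib sum_distrib_left power2_eq_square sum_distrib_right)
qed

text \<open>The gap \<open>\<delta>\<close> is recorded because it tells two profiles apart when the values agree.\<close>

definition realises :: "(nat \<Rightarrow> real) \<Rightarrow> nat \<Rightarrow> real \<Rightarrow> real \<Rightarrow> bool" where
  "realises w k v \<delta> \<longleftrightarrow> (\<exists>H s t y. end_gadget k H s t \<and> s \<noteq> t \<and> y s = 0 \<and> y t = 0 \<and> gval w k H y = v \<and> y 3 - y 4 = \<delta>)"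

section \<open>Values of chains built link by link\<close>

definition psum :: "(nat \<Rightarrow> real) \<Rightarrow> nat \<Rightarrow> real" where "psum w k = (\<Sum>i<k. w i)"

lemma realises_K4:
  assumes R: "realises w k v \<delta>" and k: "5 \<le> k"
  shows "realises w (k + 4) (v - (psum w k)\<^sup>2 / 2 - (psum w (k + 2))\<^sup>2 / 4) \<delta>"
proof -
  obtain H s t y where H: "end_gadget k H s t" "s \<noteq> t" "y s = 0" "y t = 0" "gval w k H y = v" "y 3 - y 4 = \<delta>"
    using R by (auto simp: realises_def)
  \<comment> \<open>\<open>h\<close> minimises \<open>2 * h^2 - 2 * h * psum w k\<close> and
    \<open>g\<close> minimises \<open>4 * g^2 - 2 * g * psum w (k + 2)\<close>: the two cuts are
    crossed by two and by four edges.\<close>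
  define h where "h = psum w k / 2"
  define g where "g = psum w (k + 2) / 4"
  define z where "z = (\<lambda>i::nat. if i < 2 then g else 0)"
  have z: "z 0 = g" "z 1 = g" by (auto simp: z_def)
  define y' where "y' = (\<lambda>i. if i < k then y i + (h + g) else z (i - k))"
  have e: "end_gadget (k + 4) (attach k H s t K4 0 1) (k + 2) (k + 3)"
    by (rule attach_end_gadget[OF H(1) link_K4]) simp
  have p2: "psum w (k + 2) = psum w k + w k + w (k + 1)" by (simp add: psum_def)
  have "gval (\<lambda>i. w (k + i)) 4 K4 z = 4 * g\<^sup>2 - 2 * g * (w k + w (k + 1))"
    by (simp add: gval_def K4_def z_def numeral_eq_Suc algebra_simps)
  hence "gval w (k + 4) (attach k H s t K4 0 1) y' = v - (psum w k)\<^sup>2 / 2 - (psum w (k + 2))\<^sup>2 / 4"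
    unfolding y'_def gval_attach[OF H(1) link_K4 H(3,4) z refl] H(5) psum_def[symmetric]
    unfolding h_def g_def p2 by (simp add: power2_eq_square field_simps)
  moreover have "y' 3 - y' 4 = \<delta>" using k H(6) by (simp add: y'_def)
  moreover have "y' (k + 2) = 0" "y' (k + 3) = 0" by (auto simp: y'_def z_def)
  moreover have "k + 2 \<noteq> k + 3" by simp
  ultimately show ?thesis unfolding realises_def using e by blast
qed

lemma attach_cutv_end:
  assumes "end_gadget k H s t" "s \<noteq> t" shows "end_gadget (k + 1) (attach k H s t cutv 0 0) k k"
  using attach_end_gadget[OF assms(1) link_cutv] assms(2) by simp

lemma gval_attach_cutv:
  assumes H: "end_gadget k H s t" and y: "y s = 0" "y t = 0"
  shows "gval w (k + 1) (attach k H s t cutv 0 0) (\<lambda>i. if i < k then y i + psum w k / 2 else 0) = gval w k H y - (psum w k)\<^sup>2 / 2"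
  using gval_attach[OF H link_cutv y, of "\<lambda>_. 0" 0 "psum w k / 2" "psum w k / 2" w]
  unfolding psum_def[symmetric] by (simp add: gval_def[of _ "Suc 0"] cutv_def power2_eq_square field_simps)

text \<open>The drops before and after the new cut vertex are optimised here once and for all; only
  the values \<open>z\<close> on the link behind it remain to be chosen.\<close>

lemma realises_cutv_then:
  assumes R: "realises w k v \<delta>" and k: "5 \<le> k" and N: "link_gadget l N 0 1 s' t'" "s' \<noteq> t'"
    and z: "z 0 = \<eta>" "z (Suc 0) = \<eta>" "z s' = 0" "z t' = 0"
  shows "realises w (k + 1 + l) (v - (psum w k)\<^sup>2 / 2 - (psum w (k + 1))\<^sup>2 / 2 - 2 * \<eta> * psum w (k + 1)
    + gval (\<lambda>i. w (k + 1 + i)) l N z) \<delta>"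
proof -
  obtain H s t y where H: "end_gadget k H s t" "s \<noteq> t" "y s = 0" "y t = 0" "gval w k H y = v" "y 3 - y 4 = \<delta>"
    using R by (auto simp: realises_def)
  define H1 where "H1 = attach k H s t cutv 0 0"
  define y1 where "y1 = (\<lambda>i. if i < k then y i + psum w k / 2 else 0)"
  have e1: "end_gadget (k + 1) H1 k k" unfolding H1_def by (rule attach_cutv_end[OF H(1,2)])
  have v1: "gval w (k + 1) H1 y1 = v - (psum w k)\<^sup>2 / 2"
    unfolding H1_def y1_def gval_attach_cutv[OF H(1,3,4)] H(5) ..
  have y1: "y1 k = 0" by (simp add: y1_def)
  define h where "h = psum w (k + 1) / 2"
  define y' where "y' = (\<lambda>i. if i < k + 1 then y1 i + (h + \<eta>) else z (i - (k + 1)))"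
  have e: "end_gadget (k + 1 + l) (attach (k + 1) H1 k k N 0 1) (k + 1 + s') (k + 1 + t')"
    by (rule attach_end_gadget[OF e1 N(1)]) simp
  have "gval w (k + 1 + l) (attach (k + 1) H1 k k N 0 1) y' = v - (psum w k)\<^sup>2 / 2 - (psum w (k + 1))\<^sup>2 / 2 - 2 * \<eta> * psum w (k + 1)
    + gval (\<lambda>i. w (k + 1 + i)) l N z"
    unfolding y'_def gval_attach[where z = z and y = y1 and \<eta> = \<eta>, OF e1 N(1) y1 y1 z(1) z(2)[folded One_nat_def] refl] v1 psum_def[symmetric]
    unfolding h_def by (simp add: power2_eq_square field_simps)
  moreover have "y' 3 - y' 4 = \<delta>" using k H(6) by (simp add: y'_def y1_def)
  moreover have "y' (k + 1 + s') = 0" "y' (k + 1 + t') = 0" using z by (auto simp: y'_def)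
  moreover have "k + 1 + s' \<noteq> k + 1 + t'" using N(2) by simp
  ultimately show ?thesis unfolding realises_def using e by blast
qed

lemma realises_cutv_K4:
  assumes R: "realises w k v \<delta>" and k: "5 \<le> k"
  shows "realises w (k + 5) (v - (psum w k)\<^sup>2 / 2 - (psum w (k + 1))\<^sup>2 / 2 - (psum w (k + 3))\<^sup>2 / 4) \<delta>"
proof -
  define g where "g = psum w (k + 3) / 4"
  have p: "psum w (k + 3) = psum w (k + 1) + w (k + 1) + w (k + 2)" by (simp add: psum_def numeral_eq_Suc)
  have "gval (\<lambda>i. w (k + 1 + i)) 4 K4 (\<lambda>i. if i < 2 then g else 0) = 4 * g\<^sup>2 - 2 * g * (w (k + 1) + w (k + 2))"
    by (simp add: gval_def K4_def numeral_eq_Suc algebra_simps)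
  with realises_cutv_then[OF R k link_K4, of "\<lambda>i. if i < 2 then g else 0" g]
  have "realises w (k + 1 + 4) (v - (psum w k)\<^sup>2 / 2 - (psum w (k + 1))\<^sup>2 / 2 - 2 * g * psum w (k + 1) +
     (4 * g\<^sup>2 - 2 * g * (w (k + 1) + w (k + 2)))) \<delta>" by simp
  moreover have "v - (psum w k)\<^sup>2 / 2 - (psum w (k + 1))\<^sup>2 / 2 - 2 * g * psum w (k + 1) +
     (4 * g\<^sup>2 - 2 * g * (w (k + 1) + w (k + 2))) = v - (psum w k)\<^sup>2 / 2 - (psum w (k + 1))\<^sup>2 / 2 - (psum w (k + 3))\<^sup>2 / 4"
    unfolding g_def p by (simp add: power2_eq_square field_simps)
  moreover have "k + 1 + 4 = k + 5" by simp
  ultimately show ?thesis by metis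
qed

lemma realises_cutv_G5:
  assumes R: "realises w k v \<delta>" and k: "5 \<le> k"
  shows "realises w (k + 6) (v - (psum w k)\<^sup>2 / 2 - (psum w (k + 1))\<^sup>2 / 2 -
     ((psum w (k + 3))\<^sup>2 / 3 + (psum w (k + 4))\<^sup>2 / 3 - psum w (k + 3) * psum w (k + 4) / 3)) \<delta>"
proof -
  define a where "a = psum w (k + 3)"
  define b where "b = psum w (k + 4)"
  \<comment> \<open>\<open>g\<close> and \<open>g'\<close> form the stationary point of
    \<open>4 * g^2 + 4 * g * g' + 4 * g'^2 - 2 * g * a - 2 * g' * b\<close>.\<close>
  define g where "g = (2 * a - b) / 6"
  define g' where "g' = (2 * b - a) / 6"
  define z where "z = (\<lambda>i::nat. if i < 2 then g + g' else if i = 2 then g' else 0)"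
  have p: "a = psum w (k + 1) + w (k + 1) + w (k + 2)" "b = psum w (k + 1) + w (k + 1) + w (k + 2) + w (k + 3)"
    by (simp_all add: psum_def numeral_eq_Suc a_def b_def)
  have "gval (\<lambda>i. w (k + 1 + i)) 5 G5 z = 4 * g\<^sup>2 + 4 * g * g' + 4 * g'\<^sup>2 - 2 * (g + g') * (w (k + 1) + w (k + 2)) - 2 * g' * w (k + 3)"
    by (simp add: gval_def G5_def z_def numeral_eq_Suc algebra_simps power2_eq_square)
  with realises_cutv_then[OF R k link_G5, of z "g + g'"]
  have R': "realises w (k + 1 + 5) (v - (psum w k)\<^sup>2 / 2 - (psum w (k + 1))\<^sup>2 / 2 - 2 * (g + g') * psum w (k + 1) +
     (4 * g\<^sup>2 + 4 * g * g' + 4 * g'\<^sup>2 - 2 * (g + g') * (w (k + 1) + w (k + 2)) - 2 * g' * w (k + 3))) \<delta>" by (simp add: z_def)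
  have "- 2 * (g + g') * psum w (k + 1) - 2 * (g + g') * (w (k + 1) + w (k + 2)) - 2 * g' * w (k + 3) = - 2 * g * a - 2 * g' * b"
    unfolding p by (simp add: algebra_simps)
  moreover have "4 * g\<^sup>2 + 4 * g * g' + 4 * g'\<^sup>2 - 2 * g * a - 2 * g' * b = - (a\<^sup>2 / 3 + b\<^sup>2 / 3 - a * b / 3)"
    unfolding g_def g'_def by (simp add: power2_eq_square field_simps)
  ultimately have "v - (psum w k)\<^sup>2 / 2 - (psum w (k + 1))\<^sup>2 / 2 - 2 * (g + g') * psum w (k + 1) +
     (4 * g\<^sup>2 + 4 * g * g' + 4 * g'\<^sup>2 - 2 * (g + g') * (w (k + 1) + w (k + 2)) - 2 * g' * w (k + 3))
     = v - (psum w k)\<^sup>2 / 2 - (psum w (k + 1))\<^sup>2 / 2 - (a\<^sup>2 / 3 + b\<^sup>2 / 3 - a * b / 3)"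
    by argo
  moreover have "k + 1 + 5 = k + 6" by simp
  ultimately show ?thesis using R' unfolding a_def b_def by metis
qed

lemma realises_cutv_G6:
  assumes R: "realises w k v \<delta>" and k: "5 \<le> k"
  shows "realises w (k + 7) (v - (psum w k)\<^sup>2 / 2 - (psum w (k + 1))\<^sup>2 / 2 - (psum w (k + 3))\<^sup>2 / 4 - (psum w (k + 5))\<^sup>2 / 4) \<delta>"
proof -
  define a where "a = psum w (k + 3)"
  define b where "b = psum w (k + 5)"
  define g where "g = a / 4"
  define g' where "g' = b / 4"
  define z where "z = (\<lambda>i::nat. if i < 2 then g + g' else if i < 4 then g' else 0)"
  have p: "a = psum w (k + 1) + w (k + 1) + w (k + 2)" "b = psum w (k + 1) + w (k + 1) + w (k + 2) + w (k + 3) + w (k + 4)"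
    by (simp_all add: psum_def numeral_eq_Suc a_def b_def)
  have "gval (\<lambda>i. w (k + 1 + i)) 6 G6 z = 4 * g\<^sup>2 + 4 * g'\<^sup>2 - 2 * (g + g') * (w (k + 1) + w (k + 2)) - 2 * g' * (w (k + 3) + w (k + 4))"
    by (simp add: gval_def G6_def z_def numeral_eq_Suc algebra_simps power2_eq_square)
  with realises_cutv_then[OF R k link_G6, of z "g + g'"]
  have R': "realises w (k + 1 + 6) (v - (psum w k)\<^sup>2 / 2 - (psum w (k + 1))\<^sup>2 / 2 - 2 * (g + g') * psum w (k + 1) +
     (4 * g\<^sup>2 + 4 * g'\<^sup>2 - 2 * (g + g') * (w (k + 1) + w (k + 2)) - 2 * g' * (w (k + 3) + w (k + 4)))) \<delta>" by (simp add: z_def)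
  have "- 2 * (g + g') * psum w (k + 1) - 2 * (g + g') * (w (k + 1) + w (k + 2)) - 2 * g' * (w (k + 3) + w (k + 4)) = - 2 * g * a - 2 * g' * b"
    unfolding p by (simp add: algebra_simps)
  moreover have "4 * g\<^sup>2 + 4 * g'\<^sup>2 - 2 * g * a - 2 * g' * b = - a\<^sup>2 / 4 - b\<^sup>2 / 4"
    unfolding g_def g'_def by (simp add: power2_eq_square field_simps)
  ultimately have "v - (psum w k)\<^sup>2 / 2 - (psum w (k + 1))\<^sup>2 / 2 - 2 * (g + g') * psum w (k + 1) +
     (4 * g\<^sup>2 + 4 * g'\<^sup>2 - 2 * (g + g') * (w (k + 1) + w (k + 2)) - 2 * g' * (w (k + 3) + w (k + 4)))
     = v - (psum w k)\<^sup>2 / 2 - (psum w (k + 1))\<^sup>2 / 2 - a\<^sup>2 / 4 - b\<^sup>2 / 4"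
    by argo
  moreover have "k + 1 + 6 = k + 7" by simp
  ultimately show ?thesis using R' unfolding a_def b_def by metis
qed

section \<open>Trial functions on the initial gadgets\<close>

definition "y5 w = (\<lambda>i::nat. if i < 3 then psum w 3 / 6 else 0)"
definition "y6 w = (\<lambda>i::nat. if i < 4 then psum w 4 / 4 else 0)"
text \<open>A cruder trial function than \<open>y7o\<close>: its value involves only
  \<open>psum w 4\<close>, a term that also occurs for \<open>S8\<close>, with which it is
  compared.\<close>

definition "y7 w = (\<lambda>i::nat. if i < 4 then psum w 4 / 4 else 0)"
definition "y8 w = (\<lambda>i::nat. if i < 4 then psum w 4 / 4 + psum w 6 / 4 else if i < 6 then psum w 6 / 4 else 0)"

lemma gval_S5: "gval w 5 S5 (y5 w) = - (psum w 3)\<^sup>2 / 6"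
  by (simp add: gval_def y5_def S5_def numeral_eq_Suc psum_def power2_eq_square field_simps)
lemma gval_S6: "gval w 6 S6 (y6 w) = - (psum w 4)\<^sup>2 / 4"
  by (simp add: gval_def y6_def S6_def K4_def numeral_eq_Suc psum_def power2_eq_square field_simps)
lemma gval_S7: "gval w 7 S7 (y7 w) = - (psum w 4)\<^sup>2 / 4"
  by (simp add: gval_def y7_def S7_def K4_def numeral_eq_Suc psum_def power2_eq_square field_simps)
lemma gval_S8: "gval w 8 S8 (y8 w) = - (psum w 4)\<^sup>2 / 4 - (psum w 6)\<^sup>2 / 4"
  by (simp add: gval_def y8_def S8_def K4_def numeral_eq_Suc psum_def power2_eq_square field_simps)

definition lev7 :: "real \<Rightarrow> real \<Rightarrow> real \<Rightarrow> nat \<Rightarrow> real" where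
  "lev7 a b c i = (if i < 2 then a + b + c else if i < 4 then b + c else if i = 4 then c else 0)"

text \<open>The coefficients solve the stationarity equations \<open>6 * a + 2 * b = f 2\<close>,
  \<open>2 * a + 4 * b + 2 * c = f 4\<close>, \<open>2 * b + 4 * c = f 5\<close> of the three-level
  value of \<open>S7\<close>, with \<open>f = psum w\<close>.\<close>

definition "y7o w = lev7 ((9 * psum w 2 - 6 * psum w 4 + 3 * psum w 5) / 42) ((6 * psum w 4 - 2 * psum w 2 - 3 * psum w 5) / 14)
    ((10 * psum w 5 - 6 * psum w 4 + 2 * psum w 2) / 28)"

lemma gval_lev7: "gval w 7 S7 (lev7 a b c) = 6 * a\<^sup>2 + 4 * b\<^sup>2 + 4 * c\<^sup>2 + 4 * a * b + 4 * b * c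
    - 2 * (a * psum w 2 + b * psum w 4 + c * psum w 5)"
proof -
  have "penergy S7 (lev7 a b c) = 6 * a\<^sup>2 + 4 * b\<^sup>2 + 4 * c\<^sup>2 + 4 * a * b + 4 * b * c"
    by (simp add: S7_def K4_def lev7_def power2_eq_square algebra_simps)
  moreover have "(\<Sum>i<7. w i * lev7 a b c i) = a * psum w 2 + b * psum w 4 + c * psum w 5"
    by (simp add: lev7_def psum_def numeral_eq_Suc algebra_simps)
  ultimately show ?thesis by (simp add: gval_def)
qed

lemma gval_S7o: "gval w 7 S7 (y7o w) = - (3/14 * (psum w 2)\<^sup>2 + 3/7 * (psum w 4)\<^sup>2 + 5/14 * (psum w 5)\<^sup>2
    - 2/7 * psum w 2 * psum w 4 + 1/7 * psum w 2 * psum w 5 - 3/7 * psum w 4 * psum w 5)"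
  unfolding y7o_def gval_lev7 by (simp add: power2_eq_square field_simps)

lemma realises_start:
  "\<exists>\<delta>. realises w 5 (- (psum w 3)\<^sup>2 / 6) \<delta>"
  "realises w 6 (- (psum w 4)\<^sup>2 / 4) (psum w 4 / 4)"
  "\<exists>\<delta>. realises w 7 (- (psum w 4)\<^sup>2 / 4) \<delta>"
  "\<exists>\<delta>. realises w 7 (- (3/14 * (psum w 2)\<^sup>2 + 3/7 * (psum w 4)\<^sup>2 + 5/14 * (psum w 5)\<^sup>2
    - 2/7 * psum w 2 * psum w 4 + 1/7 * psum w 2 * psum w 5 - 3/7 * psum w 4 * psum w 5)) \<delta>"
  "\<exists>\<delta>. realises w 8 (- (psum w 4)\<^sup>2 / 4 - (psum w 6)\<^sup>2 / 4) \<delta>"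
proof -
  show "\<exists>\<delta>. realises w 5 (- (psum w 3)\<^sup>2 / 6) \<delta>" unfolding realises_def
    using end_S5 gval_S5[of w] by (intro exI[of _ "y5 w 3 - y5 w 4"] exI[of _ S5] exI[of _ 3] exI[of _ 4] exI[of _ "y5 w"]) (simp add: y5_def)
  show "realises w 6 (- (psum w 4)\<^sup>2 / 4) (psum w 4 / 4)" unfolding realises_def
    using end_S6 gval_S6[of w] by (intro exI[of _ S6] exI[of _ 4] exI[of _ 5] exI[of _ "y6 w"]) (simp add: y6_def)
  show "\<exists>\<delta>. realises w 7 (- (psum w 4)\<^sup>2 / 4) \<delta>" unfolding realises_def
    using end_S7 gval_S7[of w] by (intro exI[of _ "y7 w 3 - y7 w 4"] exI[of _ S7] exI[of _ 5] exI[of _ 6] exI[of _ "y7 w"]) (simp add: y7_def)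
  show "\<exists>\<delta>. realises w 7 (- (3/14 * (psum w 2)\<^sup>2 + 3/7 * (psum w 4)\<^sup>2 + 5/14 * (psum w 5)\<^sup>2
    - 2/7 * psum w 2 * psum w 4 + 1/7 * psum w 2 * psum w 5 - 3/7 * psum w 4 * psum w 5)) \<delta>" unfolding realises_def
    using end_S7 gval_S7o[of w] by (intro exI[of _ "y7o w 3 - y7o w 4"] exI[of _ S7] exI[of _ 5] exI[of _ 6] exI[of _ "y7o w"]) (simp add: y7o_def lev7_def)
  show "\<exists>\<delta>. realises w 8 (- (psum w 4)\<^sup>2 / 4 - (psum w 6)\<^sup>2 / 4) \<delta>" unfolding realises_def
    using end_S8 gval_S8[of w] by (intro exI[of _ "y8 w 3 - y8 w 4"] exI[of _ S8] exI[of _ 6] exI[of _ 7] exI[of _ "y8 w"]) (simp add: y8_def)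
qed

section \<open>Profiles of sorted blocks\<close>

text \<open>Position \<open>m\<close> is the cut vertex, and \<open>c k l\<close> counts the edges from positions below \<open>min k l\<close> to positions at least
  \<open>max k l\<close>. By parity \<open>c k k\<close> is even, and \<open>c k k = 2\<close> means that cut \<open>k\<close> is a 2-edge cut.\<close>

locale profile =
  fixes m :: nat and X :: "nat \<Rightarrow> real" and \<mu> :: real and c :: "nat \<Rightarrow> nat \<Rightarrow> real"
  assumes m5: "5 \<le> m" and mu0: "0 < \<mu>" and mu34: "\<mu> \<le> 3/4" and mu35: "8 \<le> m \<Longrightarrow> \<mu> \<le> 3/5"
    and anti: "\<And>i j. i \<le> j \<Longrightarrow> j \<le> m \<Longrightarrow> X j \<le> X i"
    and total: "0 < (\<Sum>i<m. X i)" and tail: "0 \<le> (\<Sum>i\<le>m. X i)"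
    and c0: "\<And>k l. 0 \<le> c k l" and c_sym: "\<And>k l. c k l = c l k"
    and c_adj: "\<And>k. 1 \<le> k \<Longrightarrow> k < m \<Longrightarrow> 2 * c k (Suc k) = c k k + c (Suc k) (Suc k) - 4"
    and c_ge: "\<And>k. 1 \<le> k \<Longrightarrow> k \<le> m \<Longrightarrow> c k k = 2 \<or> 4 \<le> c k k"
    and c_m: "c m m = 2"
    and c_space: "\<And>k l. 1 \<le> k \<Longrightarrow> k < l \<Longrightarrow> l \<le> m \<Longrightarrow> c k k = 2 \<Longrightarrow> c l l = 2 \<Longrightarrow> k + 4 \<le> l"
    and c1: "4 \<le> c 1 1" and c2: "6 \<le> c 2 2" and c3: "6 \<le> c 3 3" and c4: "4 \<le> c 4 4"
    and c13: "2 \<le> c 1 3" and c14: "1 \<le> c 1 4" and c24: "2 \<le> c 2 4"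
    and c35: "4 \<le> c 5 5 \<Longrightarrow> 1 \<le> c 3 5" and c46: "7 \<le> m \<Longrightarrow> c 7 7 = 2 \<Longrightarrow> 1 \<le> c 4 6"
begin

definition "g k = (if 1 \<le> k \<and> k \<le> m then X (k - 1) - X k else 0)"
definition "w i = \<mu> * X i"
definition "f k = psum w k"
definition "C k = c k k"
text \<open>The contribution of gap \<open>k\<close> together with its coupling to the preceding
  gap; the coefficient of the coupling is \<open>2 * c (k - 1) k\<close> by
  \<open>c_adj\<close>.\<close>

definition "T k = C k * (g k)\<^sup>2 - 2 * f k * g k + (C (k - 1) + C k - 4) * g (k - 1) * g k"
text \<open>The products of nonadjacent gaps that are kept from the double sum; degree four forces
  enough of them to be present.\<close>

definition "ex = 2 * c 1 3 * g 1 * g 3 + 2 * c 1 4 * g 1 * g 4 + 2 * c 2 4 * g 2 * g 4 + 2 * c 3 5 * g 3 * g 5 + 2 * c 4 6 * g 4 * g 6"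
text \<open>\<open>P z\<close> is a lower bound for the part of \<open>J\<close> before cut \<open>z\<close>, to be compared with the gadgets on the first \<open>z\<close> positions.\<close>

definition "P z = ex + (\<Sum>k<z. T k) + f z * g (z - 1) - (g (z - 1))\<^sup>2"
text \<open>By summation by parts the linear term is
  \<open>2 * (\<Sum>i<m. w i * (X i - X m))\<close>, so that \<open>J\<close> is the side of the
  block in the replacement inequality.\<close>

definition "J = (\<Sum>k=1..m. \<Sum>l=1..m. c k l * g k * g l) - 2 * (\<Sum>k=1..m. f k * g k)"

section \<open>Gaps and the concave partial sums \<open>f\<close>\<close>

lemma g0: "0 \<le> g k" unfolding g_def using anti[of "k - 1" k] by auto

lemma g_zero [simp]: "g 0 = 0" by (simp add: g_def)

lemma g_nz: "g k \<noteq> 0 \<Longrightarrow> k \<le> m" by (auto simp: g_def split: if_splits)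

lemma T0 [simp]: "T 0 = 0" by (simp add: T_def)

lemma C4: "1 \<le> k \<Longrightarrow> k \<le> m \<Longrightarrow> C k \<noteq> 2 \<Longrightarrow> 4 \<le> C k" unfolding C_def using c_ge by blast
lemma C2: "1 \<le> k \<Longrightarrow> k \<le> m \<Longrightarrow> 2 \<le> C k" unfolding C_def using c_ge[of k] by auto

lemma f_Suc: "f (Suc k) = f k + w k" by (simp add: f_def psum_def)
lemma f_0 [simp]: "f 0 = 0" by (simp add: f_def psum_def)

text \<open>The second difference of \<open>f\<close> at \<open>k\<close> is
  \<open>w k - w (k - 1) = - \<mu> * g k\<close>. In this form it removes the linear terms next to a
  stopping point.\<close>

lemma f_rel: "1 \<le> k \<Longrightarrow> k \<le> m \<Longrightarrow> 2 * f k = f (k - 1) + f (k + 1) + \<mu> * g k"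
  using f_Suc[of k] f_Suc[of "k - 1"] by (simp add: g_def w_def algebra_simps)

lemma w_anti: "i \<le> j \<Longrightarrow> j \<le> m \<Longrightarrow> w j \<le> w i"
  unfolding w_def using anti mu0 by (simp add: mult_left_mono)

lemma f_up: "i \<le> j \<Longrightarrow> j \<le> m \<Longrightarrow> real (j - i) * w j \<le> f j - f i"
proof (induction j)
  case (Suc j)
  show ?case
  proof (cases "i = Suc j")
    case False
    hence "i \<le> j" using Suc.prems by simp
    moreover have "w (Suc j) \<le> w j" using Suc.prems by (intro w_anti) auto
    moreover have "real (j - i) * w (Suc j) \<le> real (j - i) * w j" using calculation by (intro mult_left_mono) auto
    ultimately show ?thesis using Suc f_Suc[of j] by (simp add: Suc_diff_le algebra_simps)
  qed simp
qed simp

lemma f_down: "j \<le> k \<Longrightarrow> k \<le> m + 1 \<Longrightarrow> f k - f j \<le> real (k - j) * w j"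
proof (induction k)
  case (Suc k)
  show ?case
  proof (cases "j = Suc k")
    case False
    hence "j \<le> k" using Suc.prems by simp
    moreover have "w k \<le> w j" using Suc.prems False by (intro w_anti) auto
    ultimately show ?thesis using Suc f_Suc[of k] by (simp add: Suc_diff_le algebra_simps)
  qed simp
qed simp

text \<open>The slopes of \<open>f\<close> before \<open>j\<close> are at least \<open>w j\<close>,
  those from \<open>j\<close> on at most \<open>w j\<close>.\<close>

lemma f_conc:
  assumes "i \<le> j" "j < k" "k \<le> m + 1"
  shows "real (k - j) * f i + real (j - i) * f k \<le> real (k - i) * f j"
proof -
  have "real (k - j) * (real (j - i) * w j) \<le> real (k - j) * (f j - f i)"
    using assms by (intro mult_left_mono f_up) auto
  moreover have "real (j - i) * (f k - f j) \<le> real (j - i) * (real (k - j) * w j)"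
    using assms by (intro mult_left_mono f_down) auto
  ultimately have "real (j - i) * (f k - f j) \<le> real (k - j) * (f j - f i)" by (simp add: algebra_simps)
  moreover have "real (k - i) = real (k - j) + real (j - i)" using assms by simp
  ultimately show ?thesis by (simp add: algebra_simps)
qed

lemma f_m: "0 < f m" unfolding f_def psum_def w_def using total mu0 by (simp add: sum_distrib_left[symmetric])
lemma f_m1: "0 \<le> f (Suc m)" unfolding f_def psum_def w_def using tail mu0
  by (simp add: sum_distrib_left[symmetric] lessThan_Suc_atMost del: sum.lessThan_Suc)

text \<open>Concavity against the chord from position 0, where \<open>f\<close> vanishes.\<close>

lemma f_left: "i \<le> j \<Longrightarrow> j \<le> m + 1 \<Longrightarrow> real i * f j \<le> real j * f i"
  using f_conc[of 0 i j] by (cases "i = j") auto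

text \<open>The mirror image: the chord ends at \<open>m + 1\<close>, where \<open>f\<close> is
  nonnegative because of \<open>tail\<close>.\<close>

lemma f_right: "i \<le> j \<Longrightarrow> j \<le> m \<Longrightarrow> real (m + 1 - j) * f i \<le> real (m + 1 - i) * f j"
proof (cases "i = j")
  case False
  assume "i \<le> j" "j \<le> m"
  hence "real (m + 1 - j) * f i + real (j - i) * f (m + 1) \<le> real (m + 1 - i) * f j"
    using f_conc[of i j "m + 1"] False by simp
  moreover have "0 \<le> real (j - i) * f (m + 1)" using f_m1 by simp
  ultimately show ?thesis by simp
qed simp

lemma f_pos: "1 \<le> k \<Longrightarrow> k \<le> m \<Longrightarrow> 0 < f k"
proof -
  assume k: "1 \<le> k" "k \<le> m"
  have "0 < real k * f m" using f_m k by simp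
  also have "\<dots> \<le> real m * f k" using f_left[of k m] k by simp
  finally show ?thesis using k by (simp add: zero_less_mult_iff)
qed

text \<open>Gaps and edge counts are nonnegative, so the sum only decreases when the products
  outside the diagonal, its two neighbours and the list \<open>E\<close> are dropped.\<close>

lemma J_lower: "ex + (\<Sum>k<Suc m. T k) \<le> J"
proof -
  \<comment> \<open>The larger square contains \<open>E\<close> even for \<open>m = 5\<close>; the
    gaps beyond \<open>m\<close> are zero.\<close>
  define M where "M = m + 6"
  define h where "h = (\<lambda>(k, l). c k l * g k * g l)"
  have h0: "0 \<le> h p" for p unfolding h_def using c0 g0 by (auto split: prod.split)
  define A where "A = (\<lambda>k. (k, k)) ` {1..m}"
  define B where "B = (\<lambda>k. (k, Suc k)) ` {1..<m}"
  define B' where "B' = (\<lambda>k. (Suc k, k)) ` {1..<m}"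
  define E where "E = {(1::nat, 3::nat), (3, 1), (1, 4), (4, 1), (2, 4), (4, 2), (3, 5), (5, 3), (4, 6), (6, 4)}"
  have "(\<Sum>k=1..m. \<Sum>l=1..m. c k l * g k * g l) = (\<Sum>p\<in>{1..m} \<times> {1..m}. h p)"
    by (simp add: sum.cartesian_product h_def)
  also have "\<dots> = (\<Sum>p\<in>{1..M} \<times> {1..M}. h p)"
  proof (rule sum.mono_neutral_left)
    show "\<forall>i\<in>{1..M} \<times> {1..M} - {1..m} \<times> {1..m}. h i = 0" unfolding h_def by (auto dest: g_nz)
  qed (auto simp: M_def)
  also have "\<dots> \<ge> (\<Sum>p\<in>(A \<union> (B \<union> B')) \<union> E. h p)"
    by (rule sum_mono2) (use m5 in \<open>auto simp: h0 A_def B_def B'_def E_def M_def\<close>)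
  moreover have "(\<Sum>p\<in>(A \<union> (B \<union> B')) \<union> E. h p) = (\<Sum>p\<in>A. h p) + ((\<Sum>p\<in>B. h p) + (\<Sum>p\<in>B'. h p)) + (\<Sum>p\<in>E. h p)"
    by (subst sum.union_disjoint, simp_all add: A_def B_def B'_def E_def, force)+
  moreover have "(\<Sum>p\<in>A. h p) = (\<Sum>k=1..m. c k k * (g k)\<^sup>2)"
    unfolding A_def by (subst sum.reindex) (auto simp: inj_on_def h_def power2_eq_square mult.assoc)
  moreover have "(\<Sum>p\<in>B. h p) = (\<Sum>k=1..<m. c k (Suc k) * g k * g (Suc k))"
    unfolding B_def by (subst sum.reindex) (auto simp: inj_on_def h_def)
  moreover have "(\<Sum>p\<in>B'. h p) = (\<Sum>k=1..<m. c k (Suc k) * g k * g (Suc k))"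
    unfolding B'_def by (subst sum.reindex) (auto simp: inj_on_def h_def c_sym mult.assoc mult.commute intro!: sum.cong)
  moreover have "(\<Sum>p\<in>E. h p) = ex"
    unfolding E_def h_def ex_def by (simp add: c_sym[of 3 "Suc 0"] c_sym[of 4 "Suc 0"] c_sym[of 4 2] c_sym[of 5 3] c_sym[of 6 4])
  moreover have "(\<Sum>k=1..<m. c k (Suc k) * g k * g (Suc k)) + (\<Sum>k=1..<m. c k (Suc k) * g k * g (Suc k)) =
     (\<Sum>k=1..<m. (C k + C (Suc k) - 4) * g k * g (Suc k))"
    unfolding sum.distrib[symmetric] using c_adj by (intro sum.cong) (auto simp: C_def algebra_simps simp flip: c_adj)
  moreover have "(\<Sum>k<Suc m. T k) = (\<Sum>k=1..m. c k k * (g k)\<^sup>2) - 2 * (\<Sum>k=1..m. f k * g k) +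
     (\<Sum>k=1..<m. (C k + C (Suc k) - 4) * g k * g (Suc k))"
  proof -
    have s: "(\<Sum>k<Suc n. F k) = F 0 + (\<Sum>k=1..n. F k)" for n and F :: "nat \<Rightarrow> real"
      by (induction n) auto
    have "(\<Sum>k=1..n. (C (k - 1) + C k - 4) * g (k - 1) * g k) = (\<Sum>k=1..<n. (C k + C (Suc k) - 4) * g k * g (Suc k))" for n
      by (induction n) auto
    thus ?thesis unfolding s T_def by (simp add: sum.distrib sum_subtractf sum_distrib_left C_def mult.assoc)
  qed
  ultimately show ?thesis unfolding J_def by linarith
qed

lemma P_final:
  assumes "4 \<le> C (m - 1)"
  shows "P m - (f m)\<^sup>2 / 2 \<le> J"
proof -
  \<comment> \<open>No gap follows the last cut: \<open>g1\<close> is 0 and its count is an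
    arbitrary 4.\<close>
  have "c m m * (g m)\<^sup>2 - 2 * f m * g m + (C (m - 1) + c m m - 4) * g (m - 1) * g m + (c m m + 4 - 4) * g m * 0 - f m * g (m - 1) + (g (m - 1))\<^sup>2
         \<ge> - (f m)\<^sup>2 / 2 + f m * 0 - 0\<^sup>2"
    by (rule zero_split) (use assms c_m g0 in auto)
  thus ?thesis using J_lower unfolding P_def sum.lessThan_Suc T_def[of m] C_def[of m] by simp
qed

lemma sum4: "(\<Sum>k<z+4. T k) = (\<Sum>k<z. T k) + T z + T (z+1) + T (z+2) + T (z+3)" by (simp add: numeral_eq_Suc)
lemma sum5: "(\<Sum>k<z+5. T k) = (\<Sum>k<z. T k) + T z + T (z+1) + T (z+2) + T (z+3) + T (z+4)" by (simp add: numeral_eq_Suc)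
lemma sum6: "(\<Sum>k<z+6. T k) = (\<Sum>k<z. T k) + T z + T (z+1) + T (z+2) + T (z+3) + T (z+4) + T (z+5)" by (simp add: numeral_eq_Suc)
lemma sum7: "(\<Sum>k<z+7. T k) = (\<Sum>k<z. T k) + T z + T (z+1) + T (z+2) + T (z+3) + T (z+4) + T (z+5) + T (z+6)" by (simp add: numeral_eq_Suc)

lemma f_rels:
  "z + 1 \<le> m \<Longrightarrow> 2 * f (z + 1) = f z + f (z + 2) + \<mu> * g (z + 1)"
  "z + 3 \<le> m \<Longrightarrow> 2 * f (z + 3) = f (z + 2) + f (z + 4) + \<mu> * g (z + 3)"
  "z + 4 \<le> m \<Longrightarrow> 2 * f (z + 4) = f (z + 3) + f (z + 5) + \<mu> * g (z + 4)"
  "z + 5 \<le> m \<Longrightarrow> 2 * f (z + 5) = f (z + 4) + f (z + 6) + \<mu> * g (z + 5)"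
  "z + 6 \<le> m \<Longrightarrow> 2 * f (z + 6) = f (z + 5) + f (z + 7) + \<mu> * g (z + 6)"
  using f_rel[of "z + 1"] f_rel[of "z + 3"] f_rel[of "z + 4"] f_rel[of "z + 5"] f_rel[of "z + 6"]
  by (simp_all add: numeral_eq_Suc)

lemma mu1: "\<mu> \<le> 1" using mu34 by simp

section \<open>Advancing the lower bound to the next stopping point\<close>

context
  fixes z :: nat
  assumes z: "1 \<le> z" "4 \<le> C (z - 1)" "z \<le> m"
begin

text \<open>At \<open>z\<close> itself only \<open>2 \<le> C z\<close> enters, so that the form can
  be split at a 2-edge cut and elsewhere alike.\<close>

lemma zsplit:
  assumes "4 \<le> C (z + 1)"
  shows "T z + (C z + C (z + 1) - 4) * g z * g (z + 1) - f z * g (z - 1) + (g (z - 1))\<^sup>2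
         \<ge> - (f z)\<^sup>2 / 2 + f z * g (z + 1) - (g (z + 1))\<^sup>2"
proof -
  have "C z * (g z)\<^sup>2 - 2 * f z * g z + (C (z - 1) + C z - 4) * g (z - 1) * g z + (C z + C (z + 1) - 4) * g z * g (z + 1)
     - f z * g (z - 1) + (g (z - 1))\<^sup>2 \<ge> - (f z)\<^sup>2 / 2 + f z * g (z + 1) - (g (z + 1))\<^sup>2"
    by (rule zero_split) (use assms z g0 C2 in auto)
  thus ?thesis unfolding T_def by linarith
qed

lemma P4:
  assumes "z + 4 \<le> m" "4 \<le> C (z + 1)" "4 \<le> C (z + 2)" "4 \<le> C (z + 3)"
  shows "P (z + 4) \<ge> P z - (f z)\<^sup>2 / 2 - (f (z + 2))\<^sup>2 / 4"
proof -
  have "f z * g (z+1) - (g (z+1))\<^sup>2 + (C (z+1) * (g (z+1))\<^sup>2 - 2 * f (z+1) * g (z+1))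
     + ((C (z+1) + C (z+2) - 4) * g (z+1) * g (z+2) + (C (z+2) * (g (z+2))\<^sup>2 - 2 * f (z+2) * g (z+2)))
     + ((C (z+2) + C (z+3) - 4) * g (z+2) * g (z+3) + (C (z+3) * (g (z+3))\<^sup>2 - 2 * f (z+3) * g (z+3))) + f (z+4) * g (z+3) - (g (z+3))\<^sup>2 \<ge> - (f (z+2))\<^sup>2 / 4"
    by (rule inner4[where \<mu> = \<mu>]) (use assms f_rels g0 mu1 in auto)
  with zsplit[OF assms(2)] show ?thesis unfolding P_def sum4 T_def[of "z+1"] T_def[of "z+2"] T_def[of "z+3"] by (simp add: numeral_eq_Suc)
qed

lemma P5:
  assumes "z + 5 \<le> m" "4 \<le> C (z + 1)" "4 \<le> C (z + 2)" "4 \<le> C (z + 3)" "4 \<le> C (z + 4)"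
  shows "P (z + 5) \<ge> P z - (f z)\<^sup>2 / 2 - ((f (z + 2))\<^sup>2 / 8 + (max (f (z + 2)) (f (z + 3)))\<^sup>2 / 8 + (f (z + 3))\<^sup>2 / 8)"
proof -
  have "f z * g (z+1) - (g (z+1))\<^sup>2 + (C (z+1) * (g (z+1))\<^sup>2 - 2 * f (z+1) * g (z+1))
     + ((C (z+1) + C (z+2) - 4) * g (z+1) * g (z+2) + (C (z+2) * (g (z+2))\<^sup>2 - 2 * f (z+2) * g (z+2)))
     + ((C (z+2) + C (z+3) - 4) * g (z+2) * g (z+3) + (C (z+3) * (g (z+3))\<^sup>2 - 2 * f (z+3) * g (z+3)))
     + ((C (z+3) + C (z+4) - 4) * g (z+3) * g (z+4) + (C (z+4) * (g (z+4))\<^sup>2 - 2 * f (z+4) * g (z+4)))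
     + f (z+5) * g (z+4) - (g (z+4))\<^sup>2 \<ge> - ((f (z + 2))\<^sup>2 / 8 + (max (f (z + 2)) (f (z + 3)))\<^sup>2 / 8 + (f (z + 3))\<^sup>2 / 8)"
    by (rule inner5[where \<mu> = \<mu>]) (use assms f_rels g0 mu1 in auto)
  with zsplit[OF assms(2)] show ?thesis unfolding P_def sum5 T_def[of "z+1"] T_def[of "z+2"] T_def[of "z+3"] T_def[of "z+4"] by (simp add: numeral_eq_Suc)
qed

lemma P6:
  assumes "z + 6 \<le> m" "4 \<le> C (z + 1)" "4 \<le> C (z + 2)" "4 \<le> C (z + 3)" "4 \<le> C (z + 4)" "4 \<le> C (z + 5)"
  shows "P (z + 6) \<ge> P z - (f z)\<^sup>2 / 2 - ((f (z + 2))\<^sup>2 / 8 + (max (f (z + 2)) (f (z + 3)))\<^sup>2 / 8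
     + (max (f (z + 3)) (f (z + 4)))\<^sup>2 / 8 + (f (z + 4))\<^sup>2 / 8)"
proof -
  have "f z * g (z+1) - (g (z+1))\<^sup>2 + (C (z+1) * (g (z+1))\<^sup>2 - 2 * f (z+1) * g (z+1))
     + ((C (z+1) + C (z+2) - 4) * g (z+1) * g (z+2) + (C (z+2) * (g (z+2))\<^sup>2 - 2 * f (z+2) * g (z+2)))
     + ((C (z+2) + C (z+3) - 4) * g (z+2) * g (z+3) + (C (z+3) * (g (z+3))\<^sup>2 - 2 * f (z+3) * g (z+3)))
     + ((C (z+3) + C (z+4) - 4) * g (z+3) * g (z+4) + (C (z+4) * (g (z+4))\<^sup>2 - 2 * f (z+4) * g (z+4)))
     + ((C (z+4) + C (z+5) - 4) * g (z+4) * g (z+5) + (C (z+5) * (g (z+5))\<^sup>2 - 2 * f (z+5) * g (z+5)))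
     + f (z+6) * g (z+5) - (g (z+5))\<^sup>2 \<ge> - ((f (z + 2))\<^sup>2 / 8 + (max (f (z + 2)) (f (z + 3)))\<^sup>2 / 8
     + (max (f (z + 3)) (f (z + 4)))\<^sup>2 / 8 + (f (z + 4))\<^sup>2 / 8)"
    by (rule inner6[where \<mu> = \<mu>]) (use assms f_rels g0 mu1 in auto)
  with zsplit[OF assms(2)] show ?thesis
    unfolding P_def sum6 T_def[of "z+1"] T_def[of "z+2"] T_def[of "z+3"] T_def[of "z+4"] T_def[of "z+5"] by (simp add: numeral_eq_Suc)
qed

lemma P7:
  assumes "z + 7 \<le> m" "4 \<le> C (z + 1)" "4 \<le> C (z + 2)" "4 \<le> C (z + 3)" "4 \<le> C (z + 4)" "4 \<le> C (z + 5)" "4 \<le> C (z + 6)"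
  shows "P (z + 7) \<ge> P z - (f z)\<^sup>2 / 2 - ((f (z + 2))\<^sup>2 / 8 + (max (f (z + 2)) (f (z + 3)))\<^sup>2 / 8
     + (max (f (z + 3)) (f (z + 4)))\<^sup>2 / 8 + (max (f (z + 4)) (f (z + 5)))\<^sup>2 / 8 + (f (z + 5))\<^sup>2 / 8)"
proof -
  have "f z * g (z+1) - (g (z+1))\<^sup>2 + (C (z+1) * (g (z+1))\<^sup>2 - 2 * f (z+1) * g (z+1))
     + ((C (z+1) + C (z+2) - 4) * g (z+1) * g (z+2) + (C (z+2) * (g (z+2))\<^sup>2 - 2 * f (z+2) * g (z+2)))
     + ((C (z+2) + C (z+3) - 4) * g (z+2) * g (z+3) + (C (z+3) * (g (z+3))\<^sup>2 - 2 * f (z+3) * g (z+3)))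
     + ((C (z+3) + C (z+4) - 4) * g (z+3) * g (z+4) + (C (z+4) * (g (z+4))\<^sup>2 - 2 * f (z+4) * g (z+4)))
     + ((C (z+4) + C (z+5) - 4) * g (z+4) * g (z+5) + (C (z+5) * (g (z+5))\<^sup>2 - 2 * f (z+5) * g (z+5)))
     + ((C (z+5) + C (z+6) - 4) * g (z+5) * g (z+6) + (C (z+6) * (g (z+6))\<^sup>2 - 2 * f (z+6) * g (z+6)))
     + f (z+7) * g (z+6) - (g (z+6))\<^sup>2 \<ge> - ((f (z + 2))\<^sup>2 / 8 + (max (f (z + 2)) (f (z + 3)))\<^sup>2 / 8
     + (max (f (z + 3)) (f (z + 4)))\<^sup>2 / 8 + (max (f (z + 4)) (f (z + 5)))\<^sup>2 / 8 + (f (z + 5))\<^sup>2 / 8)"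
    by (rule inner7[where \<mu> = \<mu>]) (use assms f_rels g0 mu1 in auto)
  with zsplit[OF assms(2)] show ?thesis
    unfolding P_def sum7 T_def[of "z+1"] T_def[of "z+2"] T_def[of "z+3"] T_def[of "z+4"] T_def[of "z+5"] T_def[of "z+6"] by (simp add: numeral_eq_Suc)
qed

end

section \<open>The lower bound on the initial stretch\<close>

lemma C_first: "4 \<le> C 1" "6 \<le> C 2" "6 \<le> C 3" "4 \<le> C 4" unfolding C_def using c1 c2 c3 c4 by auto

lemma coeff3: "(a::real) \<le> b \<Longrightarrow> 0 \<le> x \<Longrightarrow> 0 \<le> y \<Longrightarrow> a * x * y \<le> b * x * y"
  unfolding mult.assoc by (intro mult_right_mono) auto

lemma ex_ge: "4 * g 1 * g 3 + 2 * g 1 * g 4 + 4 * g 2 * g 4 + 2 * c 3 5 * g 3 * g 5 + 2 * c 4 6 * g 4 * g 6 \<le> ex"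
proof -
  have "4 * g 1 * g 3 \<le> 2 * c 1 3 * g 1 * g 3" by (rule coeff3) (use c13 g0 in auto)
  moreover have "2 * g 1 * g 4 \<le> 2 * c 1 4 * g 1 * g 4" by (rule coeff3) (use c14 g0 in auto)
  moreover have "4 * g 2 * g 4 \<le> 2 * c 2 4 * g 2 * g 4" by (rule coeff3) (use c24 g0 in auto)
  ultimately show ?thesis unfolding ex_def by linarith
qed

lemma P_num: "P 5 = ex + (\<Sum>k<5. T k) + f 5 * g 4 - (g 4)\<^sup>2" "P 6 = ex + (\<Sum>k<6. T k) + f 6 * g 5 - (g 5)\<^sup>2"
  "P 7 = ex + (\<Sum>k<7. T k) + f 7 * g 6 - (g 6)\<^sup>2" "P 8 = ex + (\<Sum>k<8. T k) + f 8 * g 7 - (g 7)\<^sup>2"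
  by (simp_all add: P_def)

lemma ex35: "0 \<le> 2 * c 3 5 * g 3 * g 5" "0 \<le> 2 * c 4 6 * g 4 * g 6" using c0 g0 by auto

lemma T_first: "4 * (g 1)\<^sup>2 + 6 * (g 2)\<^sup>2 + 6 * (g 3)\<^sup>2 + 4 * (g 4)\<^sup>2 + 6 * g 1 * g 2 + 8 * g 2 * g 3 + 6 * g 3 * g 4
   - 2 * f 1 * g 1 - 2 * f 2 * g 2 - 2 * f 3 * g 3 - 2 * f 4 * g 4 \<le> (\<Sum>k<5. T k)"
proof -
  have "(\<Sum>k<5. T k) = T 1 + T 2 + T 3 + T 4" by (simp add: numeral_eq_Suc)
  moreover have "T 1 = C 1 * (g 1)\<^sup>2 - 2 * f 1 * g 1" "T 2 = C 2 * (g 2)\<^sup>2 - 2 * f 2 * g 2 + (C 1 + C 2 - 4) * g 1 * g 2"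
    "T 3 = C 3 * (g 3)\<^sup>2 - 2 * f 3 * g 3 + (C 2 + C 3 - 4) * g 2 * g 3" "T 4 = C 4 * (g 4)\<^sup>2 - 2 * f 4 * g 4 + (C 3 + C 4 - 4) * g 3 * g 4"
    by (simp_all add: T_def numeral_eq_Suc)
  moreover have "4 * (g 1)\<^sup>2 \<le> C 1 * (g 1)\<^sup>2" "6 * (g 2)\<^sup>2 \<le> C 2 * (g 2)\<^sup>2" "6 * (g 3)\<^sup>2 \<le> C 3 * (g 3)\<^sup>2" "4 * (g 4)\<^sup>2 \<le> C 4 * (g 4)\<^sup>2"
    using C_first by (auto intro: coeff_sq)
  moreover have "6 * g 1 * g 2 \<le> (C 1 + C 2 - 4) * g 1 * g 2" "8 * g 2 * g 3 \<le> (C 2 + C 3 - 4) * g 2 * g 3" "6 * g 3 * g 4 \<le> (C 3 + C 4 - 4) * g 3 * g 4"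
    using C_first g0 by (auto intro!: coeff3)
  ultimately show ?thesis by linarith
qed

lemma T_next: "4 \<le> C (k - 1) \<Longrightarrow> 4 \<le> C k \<Longrightarrow> 4 * (g k)\<^sup>2 - 2 * f k * g k + 4 * g (k - 1) * g k \<le> T k"
  using coeff_sq[of 4 "C k" "g k"] coeff3[of 4 "C (k - 1) + C k - 4" "g (k - 1)" "g k"] g0 unfolding T_def by simp

lemma f_first:
  "2 * f 1 = f 2 + \<mu> * g 1" "2 * f 3 = f 2 + f 4 + \<mu> * g 3" "2 * f 4 = f 3 + f 5 + \<mu> * g 4"
  "f 1 = f 3 / 3 + \<mu> / 3 * (2 * g 1 + g 2)" "f 2 = 2 * f 3 / 3 + \<mu> / 3 * (g 1 + 2 * g 2)"
  "f 1 = f 4 / 4 + \<mu> / 4 * (3 * g 1 + 2 * g 2 + g 3)"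
  "f 2 = f 4 / 2 + \<mu> / 2 * (g 1 + 2 * g 2 + g 3)" "f 3 = 3 * f 4 / 4 + \<mu> / 4 * (g 1 + 2 * g 2 + 3 * g 3)"
  using m5 by (simp_all add: f_def psum_def w_def g_def numeral_eq_Suc field_simps)

text \<open>Valid for every size of cut 5. Position 5 can thus be a stopping point even when it is
  no 2-edge cut, which is the starting case when cuts 6, 7 and 8 are not 2-edge cuts either.\<close>

lemma P_5: "- (f 3)\<^sup>2 / 6 \<le> P 5"
proof -
  have "- (f 3)\<^sup>2 / 6 \<le> 4 * (g 1)\<^sup>2 + 6 * (g 2)\<^sup>2 + 6 * (g 3)\<^sup>2 + 4 * (g 4)\<^sup>2 + 6 * g 1 * g 2 + 8 * g 2 * g 3 + 6 * g 3 * g 4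
     + 4 * g 1 * g 3 + 2 * g 1 * g 4 + 4 * g 2 * g 4 - 2 * f 1 * g 1 - 2 * f 2 * g 2 - 2 * f 3 * g 3 - 2 * f 4 * g 4 + f 5 * g 4 - (g 4)\<^sup>2"
    by (rule start5[where \<mu> = \<mu>]) (use f_first mu1 g0 in auto)
  thus ?thesis using T_first ex_ge ex35 unfolding P_num by linarith
qed

lemma P_6: assumes "6 \<le> m" "4 \<le> C 5" shows "- (f 4)\<^sup>2 / 4 \<le> P 6"
proof -
  have "- (f 4)\<^sup>2 / 4 \<le> 4 * (g 1)\<^sup>2 + 6 * (g 2)\<^sup>2 + 6 * (g 3)\<^sup>2 + 4 * (g 4)\<^sup>2 + 4 * (g 5)\<^sup>2 + 6 * g 1 * g 2 + 8 * g 2 * g 3 + 6 * g 3 * g 4 + 4 * g 4 * g 5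
     + 4 * g 1 * g 3 + 2 * g 1 * g 4 + 4 * g 2 * g 4 + 2 * g 3 * g 5
     - 2 * f 1 * g 1 - 2 * f 2 * g 2 - 2 * f 3 * g 3 - 2 * f 4 * g 4 - 2 * f 5 * g 5 + f 6 * g 5 - (g 5)\<^sup>2"
    by (rule start6[where \<mu> = \<mu>]) (use f_first f_rel[of 5] assms mu34 g0 in auto)
  moreover have "(\<Sum>k<6. T k) = (\<Sum>k<5. T k) + T 5" by (simp add: numeral_eq_Suc)
  moreover have "4 * (g 5)\<^sup>2 - 2 * f 5 * g 5 + 4 * g 4 * g 5 \<le> T 5" using T_next[of 5] C_first assms by simp
  moreover have "2 * g 3 * g 5 \<le> 2 * c 3 5 * g 3 * g 5" by (rule coeff3) (use c35 assms g0 in \<open>auto simp: C_def\<close>)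
  ultimately show ?thesis using T_first ex_ge ex35 unfolding P_num by linarith
qed

text \<open>The 2-edge cut at 7 forces an edge over the gaps 4 and 6, and the product
  \<open>g 4 * g 6\<close> that it contributes is needed here.\<close>

lemma P_7: assumes "7 \<le> m" "4 \<le> C 5" "4 \<le> C 6" "C 7 = 2"
  shows "- (3/14 * (f 2)\<^sup>2 + 3/7 * (f 4)\<^sup>2 + 5/14 * (f 5)\<^sup>2 - 2/7 * f 2 * f 4 + 1/7 * f 2 * f 5 - 3/7 * f 4 * f 5) \<le> P 7"
proof -
  have "- (3/14 * (f 2)\<^sup>2 + 3/7 * (f 4)\<^sup>2 + 5/14 * (f 5)\<^sup>2 - 2/7 * f 2 * f 4 + 1/7 * f 2 * f 5 - 3/7 * f 4 * f 5) \<le>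
     4 * (g 1)\<^sup>2 + 6 * (g 2)\<^sup>2 + 6 * (g 3)\<^sup>2 + 4 * (g 4)\<^sup>2 + 4 * (g 5)\<^sup>2 + 4 * (g 6)\<^sup>2 + 6 * g 1 * g 2 + 8 * g 2 * g 3 + 6 * g 3 * g 4 + 4 * g 4 * g 5 + 4 * g 5 * g 6
     + 4 * g 1 * g 3 + 2 * g 1 * g 4 + 4 * g 2 * g 4 + 2 * g 3 * g 5 + 2 * g 4 * g 6
     - 2 * f 1 * g 1 - 2 * f 2 * g 2 - 2 * f 3 * g 3 - 2 * f 4 * g 4 - 2 * f 5 * g 5 - 2 * f 6 * g 6 + f 7 * g 6 - (g 6)\<^sup>2"
    by (rule start7[where \<mu> = \<mu>]) (use f_first f_rel[of 6] assms mu34 g0 in auto)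
  moreover have "(\<Sum>k<7. T k) = (\<Sum>k<5. T k) + T 5 + T 6" by (simp add: numeral_eq_Suc)
  moreover have "4 * (g 5)\<^sup>2 - 2 * f 5 * g 5 + 4 * g 4 * g 5 \<le> T 5" using T_next[of 5] C_first assms by simp
  moreover have "4 * (g 6)\<^sup>2 - 2 * f 6 * g 6 + 4 * g 5 * g 6 \<le> T 6" using T_next[of 6] C_first assms by simp
  moreover have "2 * g 3 * g 5 \<le> 2 * c 3 5 * g 3 * g 5" by (rule coeff3) (use c35 assms g0 in \<open>auto simp: C_def\<close>)
  moreover have "2 * g 4 * g 6 \<le> 2 * c 4 6 * g 4 * g 6" by (rule coeff3) (use c46 assms g0 in \<open>auto simp: C_def\<close>)
  ultimately show ?thesis using T_first ex_ge ex35 unfolding P_num by linarith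
qed

lemma P_8: assumes "8 \<le> m" "4 \<le> C 5" "4 \<le> C 6" "4 \<le> C 7"
  shows "- (f 4)\<^sup>2 / 4 - (f 6)\<^sup>2 / 4 \<le> P 8"
proof -
  have "- (f 4)\<^sup>2 / 4 - (f 6)\<^sup>2 / 4 \<le>
     4 * (g 1)\<^sup>2 + 6 * (g 2)\<^sup>2 + 6 * (g 3)\<^sup>2 + 4 * (g 4)\<^sup>2 + 4 * (g 5)\<^sup>2 + 4 * (g 6)\<^sup>2 + 4 * (g 7)\<^sup>2
     + 6 * g 1 * g 2 + 8 * g 2 * g 3 + 6 * g 3 * g 4 + 4 * g 4 * g 5 + 4 * g 5 * g 6 + 4 * g 6 * g 7
     + 4 * g 1 * g 3 + 2 * g 1 * g 4 + 4 * g 2 * g 4 + 2 * g 3 * g 5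
     - 2 * f 1 * g 1 - 2 * f 2 * g 2 - 2 * f 3 * g 3 - 2 * f 4 * g 4 - 2 * f 5 * g 5 - 2 * f 6 * g 6 - 2 * f 7 * g 7 + f 8 * g 7 - (g 7)\<^sup>2"
    by (rule start8[where \<mu> = \<mu>]) (use f_first f_rel[of 5] f_rel[of 7] assms mu35 g0 in auto)
  moreover have "(\<Sum>k<8. T k) = (\<Sum>k<5. T k) + T 5 + T 6 + T 7" by (simp add: numeral_eq_Suc)
  moreover have "4 * (g 5)\<^sup>2 - 2 * f 5 * g 5 + 4 * g 4 * g 5 \<le> T 5" using T_next[of 5] C_first assms by simp
  moreover have "4 * (g 6)\<^sup>2 - 2 * f 6 * g 6 + 4 * g 5 * g 6 \<le> T 6" using T_next[of 6] C_first assms by simp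
  moreover have "4 * (g 7)\<^sup>2 - 2 * f 7 * g 7 + 4 * g 6 * g 7 \<le> T 7" using T_next[of 7] C_first assms by simp
  moreover have "2 * g 3 * g 5 \<le> 2 * c 3 5 * g 3 * g 5" by (rule coeff3) (use c35 assms g0 in \<open>auto simp: C_def\<close>)
  ultimately show ?thesis using T_first ex_ge ex35 unfolding P_num by linarith
qed

section \<open>Chains of gadgets against the block\<close>

definition "weak z \<longleftrightarrow> (\<exists>v \<delta>. realises w z v \<delta> \<and> v \<le> P z)"
text \<open>The alternative \<open>\<delta> \<noteq> X 3 - X 4\<close> settles ties: equality in the
  replacement inequality makes the trial function agree with \<open>X\<close> up to a constant,
  hence also in this gap.\<close>

definition "strong z \<longleftrightarrow> (\<exists>v \<delta>. realises w z v \<delta> \<and> v \<le> P z \<and> (v < P z \<or> \<delta> \<noteq> X 3 - X 4))"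

text \<open>No 2-edge cut strictly between \<open>a\<close> and \<open>a + 4\<close>, so that a step of length four can be made from \<open>a\<close>, which need not be a
  2-edge cut itself.\<close>

definition "free a \<longleftrightarrow> 4 \<le> C (a - 1) \<and> (\<forall>k. a < k \<and> k < a + 4 \<and> k \<le> m \<longrightarrow> 4 \<le> C k)"

lemma strong_weak: "strong z \<Longrightarrow> weak z" unfolding weak_def strong_def by auto

text \<open>An attached \<open>K4\<close> costs exactly the lower bound for a step of length four,
  so such a step neither gains nor loses.\<close>

lemma step4:
  assumes "5 \<le> z" "z + 4 \<le> m" "free z"
  shows "weak z \<Longrightarrow> weak (z + 4)" "strong z \<Longrightarrow> strong (z + 4)"
proof -
  have P: "P (z + 4) \<ge> P z - (f z)\<^sup>2 / 2 - (f (z + 2))\<^sup>2 / 4"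
    by (rule P4) (use assms in \<open>auto simp: free_def\<close>)
  note R = realises_K4[of w z _ _, OF _ assms(1), folded f_def]
  show "weak z \<Longrightarrow> weak (z + 4)" unfolding weak_def using P by (elim exE conjE) (drule R, force)
  show "strong z \<Longrightarrow> strong (z + 4)" unfolding strong_def using P
    by (elim exE conjE) (drule R, (rule exI)+, rule conjI, assumption, auto)
qed

text \<open>\<open>(z + j) / (z + i)\<close> decreases in \<open>z\<close>, so that
  \<open>z = 5\<close> is the worst case.\<close>

lemma f_ratio: "5 \<le> z \<Longrightarrow> i \<le> j \<Longrightarrow> z + j \<le> m + 1 \<Longrightarrow> f (z + j) \<le> real (5 + j) / real (5 + i) * f (z + i)"
proof -
  assume a: "5 \<le> z" "i \<le> j" "z + j \<le> m + 1"
  have 1: "real (z + i) * f (z + j) \<le> real (z + j) * f (z + i)" using f_left[of "z + i" "z + j"] a by simp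
  have p: "0 \<le> f (z + i)" using f_pos[of "z + i"] f_m1 a by (cases "z + i = m + 1") auto
  have "f (z + j) \<le> real (z + j) / real (z + i) * f (z + i)" using 1 a by (simp add: field_simps)
  also have "\<dots> \<le> real (5 + j) / real (5 + i) * f (z + i)"
  proof (intro mult_right_mono p)
    have "real (z + j) * real (5 + i) \<le> real (5 + j) * real (z + i)"
    proof -
      have "(z + j) * (5 + i) \<le> (5 + j) * (z + i)"
      proof -
        have "(z - 5) * i \<le> (z - 5) * j" using a by simp
        moreover obtain y where "z = 5 + y" using a le_Suc_ex by blast
        ultimately show ?thesis by (simp add: algebra_simps)
      qed
      thus ?thesis by (metis of_nat_le_iff of_nat_mult)
    qed
    thus "real (z + j) / real (z + i) \<le> real (5 + j) / real (5 + i)" using a by (simp add: divide_simps)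
  qed
  finally show ?thesis .
qed

text \<open>The ratio is at most \<open>(m + 1 - i) / (m - i)\<close>, which is largest when few
  positions remain; \<open>N\<close> is a guaranteed number of them.\<close>

lemma f_right1:
  assumes "i + N \<le> m" "i < m"
  shows "real N * f i \<le> (real N + 1) * f (i + 1)"
proof -
  define q where "q = real (m - i)"
  have q: "real N \<le> q" "0 < q" "real (m + 1 - i) = q + 1" using assms by (auto simp: q_def)
  have a: "m + 1 - (i + 1) = m - i" by simp
  have 1: "q * f i \<le> (q + 1) * f (i + 1)" using f_right[of i "i + 1"] assms unfolding a q(3) q_def[symmetric] by simp
  have "real N * f (i + 1) \<le> q * f (i + 1)" using q f_pos[of "i + 1"] assms by (intro mult_right_mono) auto
  moreover have "real N * (q * f i) \<le> real N * ((q + 1) * f (i + 1))" using 1 by (intro mult_left_mono) auto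
  ultimately have "q * (real N * f i) \<le> q * ((real N + 1) * f (i + 1))" by (simp add: algebra_simps)
  thus ?thesis using q by simp
qed

text \<open>A longer step has room for a cut vertex, and inserting one gains strictly.\<close>

lemma step5:
  assumes z: "5 \<le> z" "z + 5 \<le> m" "free z" "4 \<le> C (z + 4)" and W: "weak z"
  shows "strong (z + 5)"
proof -
  have P: "P (z + 5) \<ge> P z - (f z)\<^sup>2 / 2 - ((f (z + 2))\<^sup>2 / 8 + (max (f (z + 2)) (f (z + 3)))\<^sup>2 / 8 + (f (z + 3))\<^sup>2 / 8)"
    by (rule P5) (use z in \<open>auto simp: free_def\<close>)
  have G: "(f (z + 2))\<^sup>2 / 8 + (max (f (z + 2)) (f (z + 3)))\<^sup>2 / 8 + (f (z + 3))\<^sup>2 / 8 < (f (z + 1))\<^sup>2 / 2 + (f (z + 3))\<^sup>2 / 4"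
    by (rule gain5) (use z f_pos[of "z + 1"] f_pos[of "z + 2"] f_pos[of "z + 3"] f_ratio[of z 1 2] in auto)
  obtain v \<delta> where "realises w z v \<delta>" "v \<le> P z" using W by (auto simp: weak_def)
  with realises_cutv_K4[of w z v \<delta>, OF _ z(1), folded f_def] P G show ?thesis unfolding strong_def by force
qed

lemma step6:
  assumes z: "5 \<le> z" "z + 6 \<le> m" "free z" "4 \<le> C (z + 4)" "4 \<le> C (z + 5)" and W: "weak z"
  shows "strong (z + 6)"
proof -
  have P: "P (z + 6) \<ge> P z - (f z)\<^sup>2 / 2 - ((f (z + 2))\<^sup>2 / 8 + (max (f (z + 2)) (f (z + 3)))\<^sup>2 / 8
     + (max (f (z + 3)) (f (z + 4)))\<^sup>2 / 8 + (f (z + 4))\<^sup>2 / 8)"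
    by (rule P6) (use z in \<open>auto simp: free_def\<close>)
  have G: "(f (z + 2))\<^sup>2 / 8 + (max (f (z + 2)) (f (z + 3)))\<^sup>2 / 8
     + (max (f (z + 3)) (f (z + 4)))\<^sup>2 / 8 + (f (z + 4))\<^sup>2 / 8 < (f (z + 1))\<^sup>2 / 2 + ((f (z + 3))\<^sup>2 / 3 + (f (z + 4))\<^sup>2 / 3 - f (z + 3) * f (z + 4) / 3)"
    using gain6[of "f (z + 1)" "f (z + 2)" "f (z + 3)" "f (z + 4)"]
      z f_pos[of "z + 1"] f_pos[of "z + 2"] f_pos[of "z + 3"] f_pos[of "z + 4"] f_ratio[of z 1 2] f_ratio[of z 1 3] f_ratio[of z 3 4] by auto
  obtain v \<delta> where "realises w z v \<delta>" "v \<le> P z" using W by (auto simp: weak_def)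
  with realises_cutv_G5[of w z v \<delta>, OF _ z(1), folded f_def] P G show ?thesis unfolding strong_def by force
qed

lemma step7:
  assumes z: "5 \<le> z" "z + 7 \<le> m" "free z" "4 \<le> C (z + 4)" "4 \<le> C (z + 5)" "4 \<le> C (z + 6)" and W: "weak z"
  shows "strong (z + 7)"
proof -
  have P: "P (z + 7) \<ge> P z - (f z)\<^sup>2 / 2 - ((f (z + 2))\<^sup>2 / 8 + (max (f (z + 2)) (f (z + 3)))\<^sup>2 / 8
     + (max (f (z + 3)) (f (z + 4)))\<^sup>2 / 8 + (max (f (z + 4)) (f (z + 5)))\<^sup>2 / 8 + (f (z + 5))\<^sup>2 / 8)"
    by (rule P7) (use z in \<open>auto simp: free_def\<close>)
  have r: "3/4 * f (z + 4) \<le> f (z + 5)" using f_right1[of "z + 4" 3] z by (simp add: add.commute)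
  have G: "(f (z + 2))\<^sup>2 / 8 + (max (f (z + 2)) (f (z + 3)))\<^sup>2 / 8
     + (max (f (z + 3)) (f (z + 4)))\<^sup>2 / 8 + (max (f (z + 4)) (f (z + 5)))\<^sup>2 / 8 + (f (z + 5))\<^sup>2 / 8 < (f (z + 1))\<^sup>2 / 2 + (f (z + 3))\<^sup>2 / 4 + (f (z + 5))\<^sup>2 / 4"
    by (rule gain7) (use r z f_pos[of "z + 1"] f_pos[of "z + 2"] f_pos[of "z + 3"] f_pos[of "z + 4"] f_pos[of "z + 5"]
        f_ratio[of z 1 2] f_ratio[of z 1 3] f_ratio[of z 1 4] f_ratio[of z 3 4] in auto)
  obtain v \<delta> where "realises w z v \<delta>" "v \<le> P z" using W by (auto simp: weak_def)
  with realises_cutv_G6[of w z v \<delta>, OF _ z(1), folded f_def] P G show ?thesis unfolding strong_def by force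
qed

text \<open>Either a 2-edge cut occurs among the positions \<open>a + 4\<close> to
  \<open>a + 7\<close>, and the spacing makes the first stop there free, or none occurs and
  \<open>a + 4\<close> is itself free. Since \<open>C m = 2\<close>, no step passes over
  \<open>m\<close>.\<close>

lemma next_zero:
  assumes a: "1 \<le> a" "a < m" "free a"
  shows "\<exists>L\<in>{4,5,6,7}. a + L \<le> m \<and> (\<forall>i. 1 \<le> i \<and> i < L \<longrightarrow> 4 \<le> C (a + i)) \<and> (a + L = m \<or> a + L < m \<and> free (a + L))"
proof -
  have am: "a + 4 \<le> m" using a c_m by (force simp: free_def C_def not_le dest!: spec[of _ m])
  have sp: "4 \<le> C l" if "C k = 2" "1 \<le> k" "k \<le> m" "1 \<le> l" "l \<le> m" "k \<noteq> l" "l < k + 4" "k < l + 4" for k l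
  proof (rule C4)
    show "C l \<noteq> 2" using c_space[of k l] c_space[of l k] that unfolding C_def by (metis linorder_neqE_nat not_le)
  qed (use that in auto)
  show ?thesis
  proof (cases "\<exists>b. a + 4 \<le> b \<and> b \<le> a + 7 \<and> b \<le> m \<and> C b = 2")
    case True
    then obtain b where b: "a + 4 \<le> b" "b \<le> a + 7" "b \<le> m" "C b = 2" by blast
    have "b - a \<in> {4,5,6,7}" using b by auto
    moreover have "\<forall>i. 1 \<le> i \<and> i < b - a \<longrightarrow> 4 \<le> C (a + i)"
    proof safe
      fix i :: nat assume i: "1 \<le> i" "i < b - a"
      show "4 \<le> C (a + i)"
      proof (cases "i < 4")
        case True thus ?thesis using a i b am by (auto simp: free_def)
      next
        case False thus ?thesis using sp[OF b(4), of "a + i"] b i a by auto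
      qed
    qed
    moreover have "a + (b - a) = m \<or> a + (b - a) < m \<and> free (a + (b - a))"
    proof (cases "b = m")
      case False
      have "free b" unfolding free_def using sp[OF b(4)] b a by auto
      thus ?thesis using False b by auto
    qed (use b in auto)
    ultimately show ?thesis using b by (intro bexI[of _ "b - a"]) auto
  next
    case False
    hence n: "4 \<le> C b" if "a + 4 \<le> b" "b \<le> a + 7" "b \<le> m" for b using that C4[of b] a by auto
    have "a + 7 < m"
    proof (rule ccontr)
      assume "\<not> a + 7 < m"
      hence "4 \<le> C m" using n[of m] am by simp
      thus False using c_m by (simp add: C_def)
    qed
    moreover have "\<forall>i. 1 \<le> i \<and> i < 4 \<longrightarrow> 4 \<le> C (a + i)" using a am by (auto simp: free_def)
    moreover have "free (a + 4)" unfolding free_def using n a am by (auto simp: free_def)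
    ultimately show ?thesis by (intro bexI[of _ 4]) auto
  qed
qed

text \<open>An advantage is never lost again, and every step of length other than four creates
  one.\<close>

lemma step_strong:
  assumes "5 \<le> a" "free a" "L \<in> {4,5,6,7}" "a + L \<le> m" "\<And>i. 1 \<le> i \<Longrightarrow> i < L \<Longrightarrow> 4 \<le> C (a + i)"
  shows "strong a \<or> L \<noteq> 4 \<and> weak a \<Longrightarrow> strong (a + L)"
  using assms step4[of a] step5[of a] step6[of a] step7[of a] strong_weak[of a] by auto

lemma propagate: "5 \<le> a \<Longrightarrow> a < m \<Longrightarrow> free a \<Longrightarrow> strong a \<Longrightarrow> strong m"
proof (induction "m - a" arbitrary: a rule: less_induct)
  case less
  obtain L where L: "L \<in> {4,5,6,7}" "a + L \<le> m" "\<forall>i. 1 \<le> i \<and> i < L \<longrightarrow> 4 \<le> C (a + i)" "a + L = m \<or> a + L < m \<and> free (a + L)"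
    using next_zero[of a, OF _ less.prems(2,3)] less.prems(1) by force
  have "strong (a + L)" using step_strong[of a L] less.prems L by auto
  thus ?case using L less.hyps[of "a + L"] less.prems by auto
qed

text \<open>The competitor is the chain 5-5: \<open>S5\<close>, a cut vertex, \<open>K4\<close>.
  After cancelling common terms \<open>f 4\<close> is compared with \<open>f 3\<close> from the left
  and with \<open>f 5\<close> from the right.\<close>

lemma strong_64:
  assumes z: "10 \<le> m" "free 6" shows "strong 10"
proof -
  have P: "P (6 + 4) \<ge> P 6 - (f 6)\<^sup>2 / 2 - (f (6 + 2))\<^sup>2 / 4"
    by (rule P4) (use z in \<open>auto simp: free_def\<close>)
  have "- (f 4)\<^sup>2 / 4 \<le> P 6" using P_6 z by (auto simp: free_def)
  moreover obtain \<delta> where R: "realises w 5 (- (f 3)\<^sup>2 / 6) \<delta>" using realises_start(1) unfolding f_def by blast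
  have "realises w 10 (- (f 3)\<^sup>2 / 6 - (f 5)\<^sup>2 / 2 - (f 6)\<^sup>2 / 2 - (f 8)\<^sup>2 / 4) \<delta>"
    using realises_cutv_K4[OF R] by (simp add: f_def)
  moreover have "(f 4)\<^sup>2 / 4 < (f 3)\<^sup>2 / 6 + (f 5)\<^sup>2 / 2"
  proof -
    have p: "0 < f 4" using f_pos[of 4] z by simp
    have "(f 4)\<^sup>2 \<le> (4/3)\<^sup>2 * (f 3)\<^sup>2" by (rule sq_bound) (use f_left[of 3 4] p z in auto)
    moreover have "(f 4)\<^sup>2 \<le> (7/6)\<^sup>2 * (f 5)\<^sup>2" by (rule sq_bound) (use f_right1[of 4 6] p z in auto)
    moreover have "0 < (f 4)\<^sup>2" using p by simp
    ultimately show ?thesis by (simp add: power2_eq_square)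
  qed
  ultimately show ?thesis unfolding strong_def using P by force
qed

text \<open>The competitor is the chain 6-5: \<open>S6\<close>, a cut vertex, \<open>K4\<close>. The
  mixed products in the three-level bound for 7 are compared by bounding \<open>f 2\<close> and
  \<open>f 5\<close> in terms of \<open>f 4\<close>.\<close>

lemma strong_74:
  assumes z: "11 \<le> m" "free 7" "4 \<le> C 5" "C 7 = 2" shows "strong 11"
proof -
  have P: "P (7 + 4) \<ge> P 7 - (f 7)\<^sup>2 / 2 - (f (7 + 2))\<^sup>2 / 4"
    by (rule P4) (use z in \<open>auto simp: free_def\<close>)
  have P7: "- (3/14 * (f 2)\<^sup>2 + 3/7 * (f 4)\<^sup>2 + 5/14 * (f 5)\<^sup>2 - 2/7 * f 2 * f 4 + 1/7 * f 2 * f 5 - 3/7 * f 4 * f 5) \<le> P 7"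
    using P_7 z by (auto simp: free_def)
  have R: "realises w 6 (- (f 4)\<^sup>2 / 4) (f 4 / 4)" using realises_start(2) unfolding f_def by blast
  have "realises w 11 (- (f 4)\<^sup>2 / 4 - (f 6)\<^sup>2 / 2 - (f 7)\<^sup>2 / 2 - (f 9)\<^sup>2 / 4) (f 4 / 4)"
    using realises_cutv_K4[OF R] by (simp add: f_def)
  moreover have "3/14 * (f 2)\<^sup>2 + 3/7 * (f 4)\<^sup>2 + 5/14 * (f 5)\<^sup>2 - 2/7 * f 2 * f 4 + 1/7 * f 2 * f 5 - 3/7 * f 4 * f 5 < (f 4)\<^sup>2 / 4 + (f 6)\<^sup>2 / 2"
  proof -
    have p: "0 < f 4" "0 < f 2" "0 < f 5" using f_pos z by auto
    \<comment> \<open>The factor is \<open>10/9 * 9/8\<close>, since at least nine positions follow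
      2 and eight follow 3.\<close>
    have 1: "f 2 \<le> 5/4 * f 4" using f_right1[of 2 9] f_right1[of 3 8] z by simp
    have 2: "7/8 * f 4 \<le> f 5" using f_right1[of 4 7] z by simp
    have "(f 5)\<^sup>2 \<le> (7/6)\<^sup>2 * (f 6)\<^sup>2" by (rule sq_bound) (use f_right1[of 5 6] p z in auto)
    hence 3: "36 * (f 5)\<^sup>2 \<le> 49 * (f 6)\<^sup>2" by (simp add: power2_eq_square)
    have 4: "(f 2)\<^sup>2 \<le> 5/4 * (f 2 * f 4)" using mult_left_mono[OF 1, of "f 2"] p by (simp add: power2_eq_square)
    have 5: "f 2 * f 5 \<le> 5/4 * (f 4 * f 5)" using mult_right_mono[OF 1, of "f 5"] p by simp
    have 6: "7/8 * (f 4)\<^sup>2 \<le> f 4 * f 5" using mult_left_mono[OF 2, of "f 4"] p by (simp add: power2_eq_square)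
    have 7: "0 < (f 4)\<^sup>2" "0 < f 2 * f 4" "0 < (f 5)\<^sup>2" using p by auto
    show ?thesis using 3 4 5 6 7 unfolding mult.assoc by linarith
  qed
  ultimately show ?thesis unfolding strong_def using P P7 by force
qed

text \<open>The competitor is the chain 7-5. The crude value of \<open>S7\<close> suffices because
  its term \<open>(f 4)^2 / 4\<close> occurs on both sides.\<close>

lemma strong_84:
  assumes z: "12 \<le> m" "free 8" "4 \<le> C 5" "4 \<le> C 6" shows "strong 12"
proof -
  have P: "P (8 + 4) \<ge> P 8 - (f 8)\<^sup>2 / 2 - (f (8 + 2))\<^sup>2 / 4"
    by (rule P4) (use z in \<open>auto simp: free_def\<close>)
  have "- (f 4)\<^sup>2 / 4 - (f 6)\<^sup>2 / 4 \<le> P 8" using P_8 z by (auto simp: free_def)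
  moreover obtain \<delta> where R: "realises w 7 (- (f 4)\<^sup>2 / 4) \<delta>" using realises_start(3) unfolding f_def by blast
  have "realises w 12 (- (f 4)\<^sup>2 / 4 - (f 7)\<^sup>2 / 2 - (f 8)\<^sup>2 / 2 - (f 10)\<^sup>2 / 4) \<delta>"
    using realises_cutv_K4[OF R] by (simp add: f_def)
  moreover have "(f 6)\<^sup>2 / 4 < (f 7)\<^sup>2 / 2"
  proof -
    have p: "0 < f 6" using f_pos[of 6] z by simp
    have "(f 6)\<^sup>2 \<le> (7/6)\<^sup>2 * (f 7)\<^sup>2" by (rule sq_bound) (use f_right1[of 6 6] p z in auto)
    moreover have "0 < (f 6)\<^sup>2" using p by simp
    ultimately show ?thesis by (simp add: power2_eq_square)
  qed
  ultimately show ?thesis unfolding strong_def using P by force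
qed

lemma P_9: assumes "9 \<le> m" "free 5" shows "- (f 3)\<^sup>2 / 6 - (f 5)\<^sup>2 / 2 - (f 7)\<^sup>2 / 4 \<le> P 9"
proof -
  have "P (5 + 4) \<ge> P 5 - (f 5)\<^sup>2 / 2 - (f (5 + 2))\<^sup>2 / 4" by (rule P4) (use assms in \<open>auto simp: free_def\<close>)
  thus ?thesis using P_5 by simp
qed

text \<open>The competitor is the chain 6-7: \<open>S6\<close>, a cut vertex, \<open>G6\<close>. For
  \<open>w 4 < w 3\<close> its value is strictly smaller. Otherwise \<open>X 3 = X 4\<close>,
  whereas the competitor has the positive gap \<open>f 4 / 4\<close> there.\<close>

lemma strong_544:
  assumes z: "13 \<le> m" "free 5" "free 9" shows "strong 13"
proof -
  have P: "P (9 + 4) \<ge> P 9 - (f 9)\<^sup>2 / 2 - (f (9 + 2))\<^sup>2 / 4"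
    by (rule P4) (use z in \<open>auto simp: free_def\<close>)
  have P': "- (f 3)\<^sup>2 / 6 - (f 5)\<^sup>2 / 2 - (f 7)\<^sup>2 / 4 \<le> P 9" using P_9 z by auto
  have R: "realises w 6 (- (f 4)\<^sup>2 / 4) (f 4 / 4)" using realises_start(2) unfolding f_def by blast
  have R': "realises w 13 (- (f 4)\<^sup>2 / 4 - (f 6)\<^sup>2 / 2 - (f 7)\<^sup>2 / 2 - (f 9)\<^sup>2 / 4 - (f 11)\<^sup>2 / 4) (f 4 / 4)"
    using realises_cutv_G6[OF R] by (simp add: f_def)
  define a where "a = f 3 / 3"
  define b where "b = (f 5 - f 3) / 2"
  define c where "c = (f 7 - f 5) / 2"
  define d where "d = (f 9 - f 7) / 2"
  have fs: "f 3 = w 0 + w 1 + w 2" "f 4 = f 3 + w 3" "f 5 = f 4 + w 4" "f 6 = f 5 + w 5" "f 7 = f 6 + w 6" "f 8 = f 7 + w 7" "f 9 = f 8 + w 8"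
    by (simp_all add: f_def psum_def numeral_eq_Suc)
  have ws: "w 2 \<le> w 1" "w 1 \<le> w 0" "w 3 \<le> w 2" "w 4 \<le> w 3" "w 5 \<le> w 4" "w 6 \<le> w 5" "w 7 \<le> w 6" "w 8 \<le> w 7"
    using z by (auto intro!: w_anti)
  \<comment> \<open>\<open>0 \<le> f 14 \<le> f 7 + 7 * w 7\<close> with \<open>w 7 \<le> c\<close>
    and \<open>f 7 = f 5 + 2 * c\<close>; the 9 is 2 + 7.\<close>
  have t: "0 \<le> f 5 + 9 * c"
  proof -
    have "0 \<le> f 14" using f_pos[of 14] f_m1 z by (cases "m = 13") auto
    moreover have "f 14 - f 7 \<le> 7 * w 7" using f_down[of 7 14] z by simp
    moreover have "2 * c = w 5 + w 6" "f 7 = f 5 + (w 5 + w 6)" using fs unfolding c_def by simp_all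
    ultimately show ?thesis using ws by linarith
  qed
  have G: "b \<le> a" "c \<le> b" "d \<le> c" "f 3 + b \<le> f 4" "f 5 + c \<le> f 6" "w 4 < w 3 \<Longrightarrow> b < a"
    using fs ws unfolding a_def b_def c_def d_def by (simp_all add: field_simps)
  have pos: "0 < f 3" "0 < f 5" "0 < f 7" "0 < f 9" "0 < f 4" using f_pos z by auto
  have f': "f 3 = 3 * a" "f 5 = f 3 + 2 * b" "f 7 = f 5 + 2 * c" "f 9 = f 7 + 2 * d" unfolding a_def b_def c_def d_def by (simp_all add: field_simps)
  note gg = gain544[OF f' G(4,5) pos(1-4) G(1-3) t]
  have "f 4 / 4 \<noteq> X 3 - X 4 \<or> (f 3)\<^sup>2 / 6 + (f 5)\<^sup>2 / 2 + (f 9)\<^sup>2 / 4 < (f 4)\<^sup>2 / 4 + (f 6)\<^sup>2 / 2 + (f 7)\<^sup>2 / 4"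
  proof (cases "w 4 < w 3")
    case False
    hence "X 3 - X 4 = 0" using ws(4) mu0 unfolding w_def by simp
    thus ?thesis using pos by simp
  qed (use gg(2) G(6) in auto)
  moreover define v where "v = - (f 4)\<^sup>2 / 4 - (f 6)\<^sup>2 / 2 - (f 7)\<^sup>2 / 2 - (f 9)\<^sup>2 / 4 - (f 11)\<^sup>2 / 4"
  moreover have P2: "P 9 - (f 9)\<^sup>2 / 2 - (f 11)\<^sup>2 / 4 \<le> P 13" using P by simp
  ultimately have "v < P 13 \<or> f 4 / 4 \<noteq> X 3 - X 4" using P' by linarith
  moreover have "v \<le> P 13" using P' P2 gg(1) unfolding v_def by linarith
  ultimately show ?thesis unfolding strong_def using R'[folded v_def] by blast
qed

text \<open>By the spacing at most one of the cuts 6, 7, 8 is a 2-edge cut, and then the chain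
  starts there; otherwise it starts at 5. The exceptions are the chains that end before any exchange
  is possible: a single initial stretch, and 5-4.\<close>

theorem chain_main:
  "strong m \<or> m = 5 \<or> m = 6 \<and> 4 \<le> C 5 \<or> m = 7 \<and> 4 \<le> C 5 \<and> 4 \<le> C 6 \<or> m = 8 \<and> 4 \<le> C 5 \<and> 4 \<le> C 6 \<and> 4 \<le> C 7 \<or> m = 9 \<and> free 5"
proof -
  have sp: "4 \<le> C l" if "C k = 2" "1 \<le> k" "k \<le> m" "1 \<le> l" "l \<le> m" "k \<noteq> l" "l < k + 4" "k < l + 4" for k l
  proof (rule C4)
    show "C l \<noteq> 2" using c_space[of k l] c_space[of l k] that unfolding C_def by (metis linorder_neqE_nat not_le)
  qed (use that in auto)
  have go: ?thesis if "5 \<le> z" "strong z" "z = m \<or> z < m \<and> free z" for z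
    using propagate[of z] that by auto
  have Cm: "C m = 2" using c_m by (simp add: C_def)
  consider (a) "6 \<le> m" "C 6 = 2" | (b) "7 \<le> m" "C 7 = 2" | (c) "8 \<le> m" "C 8 = 2"
    | (d) "6 \<le> m \<Longrightarrow> C 6 \<noteq> 2" "7 \<le> m \<Longrightarrow> C 7 \<noteq> 2" "8 \<le> m \<Longrightarrow> C 8 \<noteq> 2" by blast
  thus ?thesis
  proof cases
    case a
    have fr: "free 6" unfolding free_def using sp[OF a(2)] a(1) by auto
    have C5: "4 \<le> C 5" using sp[OF a(2), of 5] a(1) by auto
    show ?thesis
    proof (cases "m = 6")
      case False
      have lt: "6 < m" using False a by simp
      have "1 \<le> (6::nat)" by simp
      from next_zero[OF this lt fr]
      obtain L where L: "L \<in> {4,5,6,7}" "6 + L \<le> m" "\<forall>i. 1 \<le> i \<and> i < L \<longrightarrow> 4 \<le> C (6 + i)" "6 + L = m \<or> 6 + L < m \<and> free (6 + L)"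
        by blast
      have "weak 6" unfolding weak_def using realises_start(2)[of w] P_6 C5 a unfolding f_def by blast
      hence "strong (6 + L)" using step_strong[of 6 L] L fr strong_64 by (cases "L = 4") auto
      thus ?thesis using go[of "6 + L"] L by auto
    qed (use C5 in auto)
  next
    case b
    have fr: "free 7" unfolding free_def using sp[OF b(2)] b(1) by auto
    have C5: "4 \<le> C 5" "4 \<le> C 6" using sp[OF b(2), of 5] sp[OF b(2), of 6] b(1) by auto
    show ?thesis
    proof (cases "m = 7")
      case False
      have lt: "7 < m" using False b by simp
      have "1 \<le> (7::nat)" by simp
      from next_zero[OF this lt fr]
      obtain L where L: "L \<in> {4,5,6,7}" "7 + L \<le> m" "\<forall>i. 1 \<le> i \<and> i < L \<longrightarrow> 4 \<le> C (7 + i)" "7 + L = m \<or> 7 + L < m \<and> free (7 + L)"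
        by blast
      have "weak 7" unfolding weak_def using realises_start(4)[of w] P_7 C5 b unfolding f_def by blast
      hence "strong (7 + L)" using step_strong[of 7 L] L fr strong_74 C5 b by (cases "L = 4") auto
      thus ?thesis using go[of "7 + L"] L by auto
    qed (use C5 in auto)
  next
    case c
    have fr: "free 8" unfolding free_def using sp[OF c(2)] c(1) by auto
    have C5: "4 \<le> C 5" "4 \<le> C 6" "4 \<le> C 7" using sp[OF c(2), of 5] sp[OF c(2), of 6] sp[OF c(2), of 7] c(1) by auto
    show ?thesis
    proof (cases "m = 8")
      case False
      have lt: "8 < m" using False c by simp
      have "1 \<le> (8::nat)" by simp
      from next_zero[OF this lt fr]
      obtain L where L: "L \<in> {4,5,6,7}" "8 + L \<le> m" "\<forall>i. 1 \<le> i \<and> i < L \<longrightarrow> 4 \<le> C (8 + i)" "8 + L = m \<or> 8 + L < m \<and> free (8 + L)"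
        by blast
      have "weak 8" unfolding weak_def using realises_start(5)[of w] P_8 C5 c unfolding f_def by blast
      hence "strong (8 + L)" using step_strong[of 8 L] L fr strong_84 C5 by (cases "L = 4") auto
      thus ?thesis using go[of "8 + L"] L by auto
    qed (use C5 in auto)
  next
    case d
    show ?thesis
    proof (cases "m = 5")
      case False
      have "m \<noteq> 6" "m \<noteq> 7" "m \<noteq> 8" using d Cm by auto
      hence m9: "9 \<le> m" using m5 False by simp
      have fr: "free 5" unfolding free_def
      proof safe
        fix k :: nat assume "5 < k" "k < 5 + 4"
        hence "k = 6 \<or> k = 7 \<or> k = 8" by auto
        thus "4 \<le> C k" using d m9 C4[of k] by auto
      qed (use C_first in auto)
      have w5: "weak 5" unfolding weak_def using realises_start(1)[of w] P_5 unfolding f_def by blast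
      have lt: "5 < m" using False m5 by simp
      have "1 \<le> (5::nat)" by simp
      from next_zero[OF this lt fr]
      obtain L where L: "L \<in> {4,5,6,7}" "5 + L \<le> m" "\<forall>i. 1 \<le> i \<and> i < L \<longrightarrow> 4 \<le> C (5 + i)" "5 + L = m \<or> 5 + L < m \<and> free (5 + L)"
        by blast
      show ?thesis
      proof (cases "L = 4")
        case False
        hence "strong (5 + L)" using step_strong[of 5 L] L fr w5 by auto
        thus ?thesis using go[of "5 + L"] L by auto
      next
        case True
        show ?thesis
        proof (cases "m = 9")
          case False
          have fr9: "free 9" using L True False by auto
      have lt: "9 < m" using False m9 by simp
      have "1 \<le> (9::nat)" by simp
      from next_zero[OF this lt fr9]
          obtain K where K: "K \<in> {4,5,6,7}" "9 + K \<le> m" "\<forall>i. 1 \<le> i \<and> i < K \<longrightarrow> 4 \<le> C (9 + i)" "9 + K = m \<or> 9 + K < m \<and> free (9 + K)"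
        by blast
          have "weak 9" using step4(1)[of 5] w5 fr m9 by simp
          hence "strong (9 + K)" using step_strong[of 9 K] K fr9 strong_544 fr by (cases "K = 4") auto
          thus ?thesis using go[of "9 + K"] K by auto
        qed (use fr in auto)
      qed
    qed auto
  qed
qed

lemma C_last: "4 \<le> C (m - 1)"
proof (rule C4)
  show "C (m - 1) \<noteq> 2"
  proof
    assume "C (m - 1) = 2"
    hence "m - 1 + 4 \<le> m" using c_space[of "m - 1" m] c_m m5 unfolding C_def by linarith
    thus False using m5 by simp
  qed
qed (use m5 in auto)

lemmas J_P = P_final[OF C_last]

end

section \<open>Edge counts of a sorted block\<close>

text \<open>The edge counts now come from an adjacency relation on the sorted positions.
  \<open>noncut\<close> records 2-connectivity of the block: some edge jumps over every inner
  position.\<close>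

locale block_profile =
  fixes m :: nat and X :: "nat \<Rightarrow> real" and \<mu> :: real and a :: "nat \<Rightarrow> nat \<Rightarrow> bool"
  assumes m5: "5 \<le> m" and mu0: "0 < \<mu>" and mu34: "\<mu> \<le> 3/4" and mu35: "8 \<le> m \<Longrightarrow> \<mu> \<le> 3/5"
    and anti: "\<And>i j. i \<le> j \<Longrightarrow> j \<le> m \<Longrightarrow> X j \<le> X i"
    and total: "0 < (\<Sum>i<m. X i)" and tail: "0 \<le> (\<Sum>i\<le>m. X i)"
    and sym: "\<And>i j. a i j = a j i" and irrefl: "\<And>i. \<not> a i i"
    and deg: "\<And>i. i < m \<Longrightarrow> (\<Sum>j\<le>m. of_bool (a i j)) = (4::nat)" and deg_m: "(\<Sum>j\<le>m. of_bool (a m j)) = (2::nat)"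
    and noncut: "\<And>k. 1 \<le> k \<Longrightarrow> k < m \<Longrightarrow> \<exists>i<k. \<exists>j\<le>m. k < j \<and> a i j"
begin

section \<open>Edge counts forced by degree four\<close>

definition "\<alpha> i j = (of_bool (a i j) :: nat)"
definition "cn k l = (\<Sum>i<k. \<Sum>j=l..m. \<alpha> i j)"
definition "up k = (\<Sum>i<k. \<alpha> i k)"
definition "cc k l = real (cn (min k l) (max k l))"

lemma \<alpha>_le: "\<alpha> i j \<le> 1" and \<alpha>_sym: "\<alpha> i j = \<alpha> j i" and \<alpha>_irrefl [simp]: "\<alpha> i i = 0"
  using sym irrefl by (auto simp: \<alpha>_def)

lemma deg_\<alpha>: "i < m \<Longrightarrow> (\<Sum>j\<le>m. \<alpha> i j) = 4" unfolding \<alpha>_def using deg by simp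
lemma deg_\<alpha>m: "(\<Sum>j\<le>m. \<alpha> m j) = 2" unfolding \<alpha>_def using deg_m by simp

lemma row_split: "l \<le> m \<Longrightarrow> (\<Sum>j=l..m. \<alpha> i j) = \<alpha> i l + (\<Sum>j=Suc l..m. \<alpha> i j)"
  by (simp add: sum.atLeast_Suc_atMost)

lemma cn_split: "l \<le> m \<Longrightarrow> cn k l = (\<Sum>i<k. \<alpha> i l) + cn k (Suc l)"
  unfolding cn_def by (simp add: row_split sum.distrib)

lemma cn_Suc: "cn (Suc k) l = cn k l + (\<Sum>j=l..m. \<alpha> k j)" by (simp add: cn_def)

lemma row_full: "l \<le> m \<Longrightarrow> (\<Sum>j<l. \<alpha> i j) + (\<Sum>j=l..m. \<alpha> i j) = (\<Sum>j\<le>m. \<alpha> i j)"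
proof -
  assume "l \<le> m"
  hence "{..m} = {..<l} \<union> {l..m}" by auto
  thus ?thesis by (simp add: sum.union_disjoint[symmetric] ivl_disj_int)
qed

lemma up_row: "(\<Sum>j<k. \<alpha> k j) = up k" unfolding up_def using \<alpha>_sym by (metis (no_types, lifting) sum.cong)

text \<open>Passing position \<open>k\<close> exchanges its \<open>up k\<close> edges to earlier
  positions for \<open>4 - up k\<close> edges to later ones.\<close>

lemma cn_step: "k < m \<Longrightarrow> cn (Suc k) (Suc k) + 2 * up k = cn k k + 4"
proof -
  assume k: "k < m"
  have "cn (Suc k) (Suc k) = cn k (Suc k) + (\<Sum>j=Suc k..m. \<alpha> k j)" by (simp add: cn_Suc)
  moreover have "up k + (\<alpha> k k + (\<Sum>j=Suc k..m. \<alpha> k j)) = 4"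
    using row_full[of k k] row_split[of k k] deg_\<alpha>[OF k] k up_row[of k] by simp
  moreover have "cn k k = up k + cn k (Suc k)" using cn_split[of k k] k by (simp add: up_def)
  ultimately show ?thesis by simp
qed

lemma cn_adj: "k < m \<Longrightarrow> 2 * cn k (Suc k) + 4 = cn k k + cn (Suc k) (Suc k)"
  using cn_step[of k] cn_split[of k k] by (simp add: up_def)

lemma up_le: "up k \<le> k" unfolding up_def using sum_mono[of "{..<k}" "\<lambda>i. \<alpha> i k" "\<lambda>_. 1"] \<alpha>_le by simp

lemma cn_even: "k \<le> m \<Longrightarrow> even (cn k k)"
proof (induction k)
  case (Suc k)
  hence "cn (Suc k) (Suc k) + 2 * up k = cn k k + 4" using cn_step by simp
  moreover have "even (cn k k)" using Suc by simp
  ultimately show ?case by (metis even_add even_mult_iff even_numeral)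
qed (simp add: cn_def)

lemma cn_m: "cn m m = 2"
proof -
  have "cn m m = (\<Sum>i<m. \<alpha> i m)" by (simp add: cn_def)
  also have "\<dots> = (\<Sum>j<m. \<alpha> m j)" using \<alpha>_sym by (metis (no_types, lifting) sum.cong)
  also have "\<dots> = (\<Sum>j\<le>m. \<alpha> m j)" using row_full[of m m] by simp
  finally show ?thesis using deg_\<alpha>m by simp
qed

lemma cn_noncut: "1 \<le> k \<Longrightarrow> k < m \<Longrightarrow> 1 \<le> cn k (Suc k)"
proof -
  assume k: "1 \<le> k" "k < m"
  obtain i j where ij: "i < k" "j \<le> m" "k < j" "a i j" using noncut k by blast
  have "\<alpha> i j \<le> (\<Sum>j=Suc k..m. \<alpha> i j)" using ij by (intro member_le_sum) auto
  also have "\<dots> \<le> cn k (Suc k)" unfolding cn_def using ij by (intro member_le_sum[of i "{..<k}" "\<lambda>i. \<Sum>j=Suc k..m. \<alpha> i j"]) auto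
  finally show ?thesis using ij by (simp add: \<alpha>_def)
qed

lemma cn_pos: "1 \<le> k \<Longrightarrow> k \<le> m \<Longrightarrow> 2 \<le> cn k k"
proof -
  assume k: "1 \<le> k" "k \<le> m"
  show ?thesis
  proof (cases "k = m")
    case False
    hence "1 \<le> cn k k" using cn_noncut[of k] cn_split[of k k] k by simp
    thus ?thesis using cn_even[of k] k by (metis One_nat_def Suc_leI dvd_imp_le evenE less_eq_Suc_le nat_dvd_not_less not_less numeral_2_eq_2)
  qed (use cn_m in simp)
qed

lemma cn_ge: "1 \<le> k \<Longrightarrow> k \<le> m \<Longrightarrow> cn k k = 2 \<or> 4 \<le> cn k k"
proof -
  assume k: "1 \<le> k" "k \<le> m"
  obtain r where "cn k k = 2 * r" using cn_even[of k] k by (auto elim: evenE)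
  thus ?thesis using cn_pos[of k] k by (cases r rule: nat.exhaust; auto)
qed

text \<open>The \<open>l - k\<close> vertices between the cuts have degree sum
  \<open>4 * (l - k)\<close>, of which at most four belong to edges of the two cuts. Two vertices
  have only one edge among themselves and three have three, which is too few; a single vertex would
  have no edge jumping over it.\<close>

lemma cn_space:
  assumes "1 \<le> k" "k < l" "l \<le> m" "cn k k = 2" "cn l l = 2"
  shows "k + 4 \<le> l"
proof (rule ccontr)
  assume "\<not> k + 4 \<le> l"
  then consider "l = k + 1" | "l = k + 2" | "l = k + 3" using assms by linarith
  thus False
  proof cases
    case 1
    thus ?thesis using cn_adj[of k] cn_noncut[of k] assms by simp
  next
    case 2
    have "(\<Sum>i<k. \<alpha> i k) + ((\<Sum>i<k. \<alpha> i (Suc k)) + cn k (Suc (Suc k))) = 2"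
      using cn_split[of k k] cn_split[of "Suc k" k] 2 assms by simp
    moreover have "up (Suc k) = (\<Sum>i<k. \<alpha> i (Suc k)) + \<alpha> k (Suc k)" by (simp add: up_def)
    moreover have "cn l l + 2 * (up k + up (Suc k)) = cn k k + 8"
      using cn_step[of k] cn_step[of "Suc k"] 2 assms by simp
    moreover define A B where "A = (\<Sum>i<k. \<alpha> i k)" "B = (\<Sum>i<k. \<alpha> i (Suc k))"
    ultimately show ?thesis using \<alpha>_le[of k "Suc k"] assms unfolding up_def[of k] by simp
  next
    case 3
    have "(\<Sum>i<k. \<alpha> i k) + ((\<Sum>i<k. \<alpha> i (Suc k)) + ((\<Sum>i<k. \<alpha> i (Suc (Suc k))) + cn k (Suc (Suc (Suc k))))) = 2"
      using cn_split[of k k] cn_split[of "Suc k" k] cn_split[of "Suc (Suc k)" k] 3 assms by simp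
    moreover have "up (Suc k) = (\<Sum>i<k. \<alpha> i (Suc k)) + \<alpha> k (Suc k)"
       "up (Suc (Suc k)) = (\<Sum>i<k. \<alpha> i (Suc (Suc k))) + \<alpha> k (Suc (Suc k)) + \<alpha> (Suc k) (Suc (Suc k))" by (simp_all add: up_def)
    moreover have "cn l l + 2 * (up k + up (Suc k) + up (Suc (Suc k))) = cn k k + 12"
      using cn_step[of k] cn_step[of "Suc k"] cn_step[of "Suc (Suc k)"] 3 assms by (simp add: numeral_3_eq_3)
    ultimately show ?thesis using \<alpha>_le[of k "Suc k"] \<alpha>_le[of k "Suc (Suc k)"] \<alpha>_le[of "Suc k" "Suc (Suc k)"] assms unfolding up_def[of k] by simp
  qed
qed

lemma cn_0: "cn 0 l = 0" by (simp add: cn_def)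

lemma cn_first:
  "cn 1 1 = 4" "6 \<le> cn 2 2" "6 \<le> cn 3 3" "4 \<le> cn 4 4"
proof -
  show 1: "cn 1 1 = 4" using cn_step[of 0] m5 up_le[of 0] by (simp add: cn_0)
  have 2: "cn 2 2 + 2 * up 1 = cn 1 1 + 4" using cn_step[of 1] m5 by (simp add: numeral_2_eq_2)
  have 3: "cn 3 3 + 2 * up 2 = cn 2 2 + 4" using cn_step[of 2] m5 by (simp add: eval_nat_numeral)
  have 4: "cn 4 4 + 2 * up 3 = cn 3 3 + 4" using cn_step[of 3] m5 by (simp add: eval_nat_numeral)
  show "6 \<le> cn 2 2" "6 \<le> cn 3 3" "4 \<le> cn 4 4" using 1 2 3 4 up_le[of 1] up_le[of 2] up_le[of 3] by linarith+
qed

lemma cn13: "2 \<le> cn 1 3"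
proof -
  have "(\<Sum>j<3. \<alpha> 0 j) + (\<Sum>j=3..m. \<alpha> 0 j) = 4" using row_full[of 3 0] deg_\<alpha>[of 0] m5 by simp
  thus ?thesis using \<alpha>_le[of 0 1] \<alpha>_le[of 0 2] by (simp add: cn_def eval_nat_numeral)
qed

lemma row4: "i < 4 \<Longrightarrow> 1 \<le> (\<Sum>j=4..m. \<alpha> i j)"
proof -
  assume i: "i < 4"
  have "(\<Sum>j<4. \<alpha> i j) + (\<Sum>j=4..m. \<alpha> i j) = 4" using row_full[of 4 i] deg_\<alpha>[of i] m5 i by simp
  moreover have "(\<Sum>j<4. \<alpha> i j) \<le> 3"
  proof -
    have "(\<Sum>j<4. \<alpha> i j) = (\<Sum>j\<in>{..<4} - {i}. \<alpha> i j)" using i by (simp add: sum.remove[of _ i])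
    also have "\<dots> \<le> (\<Sum>j\<in>{..<4} - {i}. 1)" using \<alpha>_le by (intro sum_mono) auto
    finally show ?thesis using i by simp
  qed
  ultimately show ?thesis by simp
qed

lemma cn14: "1 \<le> cn 1 4" using row4[of 0] by (simp add: cn_def)
lemma cn24: "2 \<le> cn 2 4" using row4[of 0] row4[of 1] by (simp add: cn_def eval_nat_numeral)

text \<open>Otherwise the edges of cut 3, at least six, all end at positions 3 and 4, whose degree
  sum 8 leaves at most two edges for cut 5.\<close>

lemma cn35:
  assumes "4 \<le> cn 5 5" shows "1 \<le> cn 3 5"
proof -
  define q where "q = (\<Sum>i<3. \<alpha> i 4)"
  have 1: "cn 3 3 = up 3 + (q + cn 3 5)"
    using cn_split[of 3 3] cn_split[of 4 3] m5 by (simp add: up_def eval_nat_numeral q_def)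
  have 2: "up 4 = q + \<alpha> 3 4" by (simp add: up_def eval_nat_numeral q_def)
  have 3: "cn 5 5 + 2 * (up 3 + up 4) = cn 3 3 + 8" using cn_step[of 3] cn_step[of 4] m5 by (simp add: eval_nat_numeral)
  show ?thesis using 1 2 3 assms cn_first(3) by simp
qed

text \<open>Cut 6 has at least four edges and cut 7 has two, so position 6 has at least three
  earlier neighbours, of which at most two are 4 and 5.\<close>

lemma cn46:
  assumes "7 \<le> m" "cn 7 7 = 2" shows "1 \<le> cn 4 6"
proof -
  have "cn 6 6 \<noteq> 2" using cn_space[of 6 7] assms by auto
  hence "4 \<le> cn 6 6" using cn_ge[of 6] assms by auto
  moreover have "cn 7 7 + 2 * up 6 = cn 6 6 + 4" using cn_step[of 6] assms(1) by (simp add: eval_nat_numeral)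
  moreover have "up 6 = (\<Sum>i<4. \<alpha> i 6) + \<alpha> 4 6 + \<alpha> 5 6" by (simp add: up_def eval_nat_numeral)
  moreover have "cn 4 6 = (\<Sum>i<4. \<alpha> i 6) + cn 4 7" using cn_split[of 6 4] assms(1) by (simp add: eval_nat_numeral)
  ultimately show ?thesis using \<alpha>_le[of 4 6] \<alpha>_le[of 5 6] assms by linarith
qed

sublocale profile m X \<mu> cc
proof
  show "cc 1 3 \<ge> 2" "cc 1 4 \<ge> 1" "cc 2 4 \<ge> 2" using cn13 cn14 cn24 unfolding cc_def by simp_all
  show "4 \<le> cc 5 5 \<Longrightarrow> 1 \<le> cc 3 5" using cn35 unfolding cc_def by simp
  show "7 \<le> m \<Longrightarrow> cc 7 7 = 2 \<Longrightarrow> 1 \<le> cc 4 6" using cn46 unfolding cc_def by simp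
  show "4 \<le> cc 1 1" "6 \<le> cc 2 2" "6 \<le> cc 3 3" "4 \<le> cc 4 4" using cn_first unfolding cc_def by simp_all
  show "cc m m = 2" using cn_m by (simp add: cc_def)
  show "0 \<le> cc k l" "cc k l = cc l k" for k l by (simp_all add: cc_def min.commute max.commute)
  show "2 * cc k (Suc k) = cc k k + cc (Suc k) (Suc k) - 4" if "1 \<le> k" "k < m" for k
    using cn_adj[of k] that unfolding cc_def by simp
  show "cc k k = 2 \<or> 4 \<le> cc k k" if "1 \<le> k" "k \<le> m" for k using cn_ge[of k] that unfolding cc_def by simp
  show "k + 4 \<le> l" if "1 \<le> k" "k < l" "l \<le> m" "cc k k = 2" "cc l l = 2" for k l
    using cn_space[of k l] that unfolding cc_def by simp
qed (use m5 mu0 mu34 mu35 anti total tail in auto)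

section \<open>The energy as a form in the gaps\<close>

definition "energy = (\<Sum>i\<le>m. \<Sum>j\<le>m. of_bool (i < j \<and> a i j) * (X i - X j)\<^sup>2)"

lemma cc_alt: "1 \<le> k \<Longrightarrow> 1 \<le> l \<Longrightarrow> k \<le> m \<Longrightarrow> l \<le> m \<Longrightarrow> cc k l = (\<Sum>i\<le>m. \<Sum>j\<le>m. of_bool (i < k \<and> k \<le> j \<and> i < l \<and> l \<le> j \<and> a i j))"
proof -
  assume k: "1 \<le> k" "1 \<le> l" "k \<le> m" "l \<le> m"
  have "cc k l = (\<Sum>i<min k l. \<Sum>j=max k l..m. of_bool (a i j))" by (simp add: cc_def cn_def \<alpha>_def)
  also have "\<dots> = (\<Sum>i<min k l. \<Sum>j\<le>m. of_bool (max k l \<le> j \<and> a i j))"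
    by (intro sum.cong refl sum.mono_neutral_cong_left) auto
  also have "\<dots> = (\<Sum>i\<le>m. \<Sum>j\<le>m. of_bool (i < min k l \<and> max k l \<le> j \<and> a i j))"
    using k by (intro sum.mono_neutral_cong_left) auto
  also have "\<dots> = (\<Sum>i\<le>m. \<Sum>j\<le>m. of_bool (i < k \<and> k \<le> j \<and> i < l \<and> l \<le> j \<and> a i j))"
    by (intro sum.cong refl) auto
  finally show ?thesis .
qed

lemma X_diff: "i < j \<Longrightarrow> j \<le> m \<Longrightarrow> X i - X j = (\<Sum>k=1..m. of_bool (i < k \<and> k \<le> j) * g k)"
proof -
  have "X i - X j = (\<Sum>k=Suc i..j. X (k - 1) - X k)" if "i \<le> j" for j
    using that
  proof (induction j)
    case (Suc j)
    thus ?case by (cases "i = Suc j") auto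
  qed simp
  moreover assume "i < j" "j \<le> m"
  moreover have "(\<Sum>k=Suc i..j. X (k - 1) - X k) = (\<Sum>k=1..m. of_bool (i < k \<and> k \<le> j) * g k)"
    using \<open>j \<le> m\<close> by (intro sum.mono_neutral_cong_left) (auto simp: g_def)
  ultimately show ?thesis by simp
qed

text \<open>An edge contributes the square of the sum of the gaps below it. Expanding the squares
  and summing over the edges counts, for each pair of gaps, the edges over both.\<close>

lemma energy_cc: "energy = (\<Sum>k=1..m. \<Sum>l=1..m. cc k l * g k * g l)"
proof -
  have "of_bool (i < j \<and> a i j) * (X i - X j)\<^sup>2 =
      (\<Sum>k=1..m. \<Sum>l=1..m. of_bool (i < k \<and> k \<le> j \<and> i < l \<and> l \<le> j \<and> a i j) * g k * g l)" if "j \<le> m" for i j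
  proof (cases "i < j \<and> a i j")
    case True
    have "(X i - X j)\<^sup>2 = (\<Sum>k=1..m. of_bool (i < k \<and> k \<le> j) * g k) * (\<Sum>k=1..m. of_bool (i < k \<and> k \<le> j) * g k)"
      using X_diff[of i j] True that by (simp add: power2_eq_square)
    also have "\<dots> = (\<Sum>k=1..m. \<Sum>l=1..m. of_bool (i < k \<and> k \<le> j \<and> i < l \<and> l \<le> j \<and> a i j) * g k * g l)"
      unfolding sum_product using True by (intro sum.cong refl) auto
    finally show ?thesis using True by simp
  next
    case False
    have "(\<Sum>k=1..m. \<Sum>l=1..m. of_bool (i < k \<and> k \<le> j \<and> i < l \<and> l \<le> j \<and> a i j) * g k * g l) = 0"
      by (intro sum.neutral ballI) (use False in auto)
    thus ?thesis using False by simp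
  qed
  hence "energy = (\<Sum>i\<le>m. \<Sum>j\<le>m. \<Sum>k=1..m. \<Sum>l=1..m. of_bool (i < k \<and> k \<le> j \<and> i < l \<and> l \<le> j \<and> a i j) * g k * g l)"
    unfolding energy_def by (intro sum.cong refl) auto
  also have "\<dots> = (\<Sum>i\<le>m. \<Sum>k=1..m. \<Sum>j\<le>m. \<Sum>l=1..m. of_bool (i < k \<and> k \<le> j \<and> i < l \<and> l \<le> j \<and> a i j) * g k * g l)"
    by (intro sum.cong refl sum.swap)
  also have "\<dots> = (\<Sum>k=1..m. \<Sum>i\<le>m. \<Sum>j\<le>m. \<Sum>l=1..m. of_bool (i < k \<and> k \<le> j \<and> i < l \<and> l \<le> j \<and> a i j) * g k * g l)"
    by (rule sum.swap)
  also have "\<dots> = (\<Sum>k=1..m. \<Sum>i\<le>m. \<Sum>l=1..m. \<Sum>j\<le>m. of_bool (i < k \<and> k \<le> j \<and> i < l \<and> l \<le> j \<and> a i j) * g k * g l)"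
    by (intro sum.cong refl sum.swap)
  also have "\<dots> = (\<Sum>k=1..m. \<Sum>l=1..m. \<Sum>i\<le>m. \<Sum>j\<le>m. of_bool (i < k \<and> k \<le> j \<and> i < l \<and> l \<le> j \<and> a i j) * g k * g l)"
    by (intro sum.cong refl sum.swap)
  also have "\<dots> = (\<Sum>k=1..m. \<Sum>l=1..m. cc k l * g k * g l)"
    by (intro sum.cong refl, subst cc_alt) (simp_all only: sum_distrib_right atLeastAtMost_iff)
  finally show ?thesis .
qed

lemma parts: "(\<Sum>k=1..n. psum w k * (X (k - 1) - X k)) = (\<Sum>i<n. w i * X i) - psum w n * X n"
  by (induction n) (auto simp: psum_def algebra_simps)

lemma J_energy: "J = energy - 2 * (\<Sum>i<m. w i * (X i - X m))"
proof -
  have "(\<Sum>k=1..m. f k * g k) = (\<Sum>k=1..m. psum w k * (X (k - 1) - X k))"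
    by (intro sum.cong) (auto simp: f_def g_def)
  also have "\<dots> = (\<Sum>i<m. w i * (X i - X m))" unfolding parts
    by (simp add: psum_def algebra_simps sum_subtractf sum_distrib_left)
  finally show ?thesis unfolding J_def energy_cc by simp
qed

end

text \<open>\<open>core\<close> is the replacement inequality, with values measured from that of the
  cut vertex, and \<open>core_eq\<close> is its equality case.\<close>

locale optimal_profile = block_profile +
  assumes core: "\<And>H s t y. end_gadget m H s t \<Longrightarrow> s \<noteq> t \<Longrightarrow>
      energy - 2 * (\<Sum>i<m. w i * (X i - X m)) \<le> penergy H y + (y s)\<^sup>2 + (y t)\<^sup>2 - 2 * (\<Sum>i<m. w i * y i)"
    and core_eq: "\<And>H s t y i. end_gadget m H s t \<Longrightarrow> s \<noteq> t \<Longrightarrow>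
      energy - 2 * (\<Sum>i<m. w i * (X i - X m)) = penergy H y + (y s)\<^sup>2 + (y t)\<^sup>2 - 2 * (\<Sum>i<m. w i * y i)
      \<Longrightarrow> i < m \<Longrightarrow> y i = X i - X m"
begin

lemma core_gval:
  assumes H: "end_gadget m H s t" "s \<noteq> t" "y s = 0" "y t = 0"
  shows "J \<le> gval w m H y - (f m)\<^sup>2 / 2"
    and "J = gval w m H y - (f m)\<^sup>2 / 2 \<Longrightarrow> i < m \<Longrightarrow> X i - X m = y i + f m / 2"
    and "J = gval w m H y - (f m)\<^sup>2 / 2 \<Longrightarrow> energy = penergy H y + (f m)\<^sup>2 / 2"
proof -
  \<comment> \<open>This shift minimises \<open>2 * d^2 - 2 * d * f m\<close>, the contribution of
    the two edges at the cut vertex.\<close>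
  define d where "d = f m / 2"
  define y' where "y' = (\<lambda>i. y i + d)"
  have 1: "penergy H y' = penergy H y" by (rule penergy_cong) (simp add: y'_def)
  have 2: "penergy H y' + (y' s)\<^sup>2 + (y' t)\<^sup>2 - 2 * (\<Sum>i<m. w i * y' i) = gval w m H y - (f m)\<^sup>2 / 2"
  proof -
    have "(\<Sum>i<m. w i * y' i) = (\<Sum>i<m. w i * y i) + f m * d"
      unfolding y'_def f_def psum_def by (simp add: algebra_simps sum.distrib sum_distrib_left)
    thus ?thesis unfolding 1 gval_def by (simp add: y'_def H d_def power2_eq_square field_simps)
  qed
  show "J \<le> gval w m H y - (f m)\<^sup>2 / 2" using core[OF H(1,2), of y'] unfolding 2 J_energy .
  assume e: "J = gval w m H y - (f m)\<^sup>2 / 2"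
  have 3: "y' i = X i - X m" if "i < m" for i using core_eq[OF H(1,2), of y' i] that e unfolding 2 J_energy by simp
  show "energy = penergy H y + (f m)\<^sup>2 / 2"
  proof -
    have "(\<Sum>i<m. w i * y' i) = (\<Sum>i<m. w i * (X i - X m))" using 3 by (intro sum.cong) auto
    thus ?thesis using e 2 unfolding J_energy 1 by (simp add: y'_def H d_def power2_eq_square)
  qed
  show "X i - X m = y i + f m / 2" if "i < m" using 3[OF that] by (simp add: y'_def d_def)
qed

text \<open>\<open>J\<close> lies between the bound from \<open>P m\<close> and the value of the
  competitor, so both agree with it; the equality case then forces the recorded gap as well.\<close>

lemma not_strong: "\<not> strong m"
proof
  assume "strong m"
  then obtain H s t y where H: "end_gadget m H s t" "s \<noteq> t" "y s = 0" "y t = 0" "gval w m H y \<le> P m"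
     "gval w m H y < P m \<or> y 3 - y 4 \<noteq> X 3 - X 4" unfolding strong_def realises_def by auto
  have "J = gval w m H y - (f m)\<^sup>2 / 2" "gval w m H y = P m" using core_gval(1)[OF H(1-4)] J_P H(5) by linarith+
  thus False using core_gval(2)[OF H(1-4), of 3] core_gval(2)[OF H(1-4), of 4] H(6) m5 by auto
qed

end

section \<open>Equality cases\<close>

lemma sum_iv: "(\<Sum>k=1..(5::nat). F k) = F 1 + F 2 + F 3 + F 4 + (F 5 :: 'a :: comm_monoid_add)"
  "(\<Sum>k=1..(6::nat). F k) = F 1 + F 2 + F 3 + F 4 + F 5 + F 6"
  "(\<Sum>k=1..(7::nat). F k) = F 1 + F 2 + F 3 + F 4 + F 5 + F 6 + F 7"
  "(\<Sum>k=1..(8::nat). F k) = F 1 + F 2 + F 3 + F 4 + F 5 + F 6 + F 7 + F 8"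
  "(\<Sum>k=1..(9::nat). F k) = F 1 + F 2 + F 3 + F 4 + F 5 + F 6 + F 7 + F 8 + F 9"
  by (simp_all add: eval_nat_numeral)

lemma row_iv: "(\<Sum>k\<le>(5::nat). F k) = F 0 + F 1 + F 2 + F 3 + F 4 + (F 5 :: nat)"
  "(\<Sum>k\<le>(6::nat). F k) = F 0 + F 1 + F 2 + F 3 + F 4 + F 5 + F 6"
  "(\<Sum>k\<le>(7::nat). F k) = F 0 + F 1 + F 2 + F 3 + F 4 + F 5 + F 6 + F 7"
  "(\<Sum>k\<le>(8::nat). F k) = F 0 + F 1 + F 2 + F 3 + F 4 + F 5 + F 6 + F 7 + F 8"
  "(\<Sum>k\<le>(9::nat). F k) = F 0 + F 1 + F 2 + F 3 + F 4 + F 5 + F 6 + F 7 + F 8 + F 9"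
  by (simp_all add: eval_nat_numeral)

lemma clique_mem: "{x, y} \<in> clique S \<longleftrightarrow> x \<in> S \<and> y \<in> S \<and> x \<noteq> y"
  by (auto simp: clique_def doubleton_eq_iff)

lemma clique_single [simp]: "{x} \<notin> clique S" by (auto simp: clique_def)

lemma two_of_four:
  fixes p0 p1 p2 p3 :: nat
  assumes "p0 \<le> 1" "p1 \<le> 1" "p2 \<le> 1" "p3 \<le> 1" "p0 + p1 + p2 + p3 = 2"
  shows "p0 = 1 \<and> p1 = 1 \<and> p2 = 0 \<and> p3 = 0 \<or> p0 = 1 \<and> p2 = 1 \<and> p1 = 0 \<and> p3 = 0 \<or> p0 = 1 \<and> p3 = 1 \<and> p1 = 0 \<and> p2 = 0 \<or>
     p1 = 1 \<and> p2 = 1 \<and> p0 = 0 \<and> p3 = 0 \<or> p1 = 1 \<and> p3 = 1 \<and> p0 = 0 \<and> p2 = 0 \<or> p2 = 1 \<and> p3 = 1 \<and> p0 = 0 \<and> p1 = 0"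
proof -
  have "p = 0 \<or> p = 1" if "p \<le> 1" for p :: nat using that by linarith
  from this[OF assms(1)] this[OF assms(2)] this[OF assms(3)] this[OF assms(4)] show ?thesis
    by (elim disjE) (use assms(5) in simp_all)
qed

text \<open>The last clause allows sums over the four positions to be rewritten after the
  renaming.\<close>

lemma pick4:
  fixes F :: "nat \<Rightarrow> nat"
  assumes "\<And>i. F i \<le> 1" "F 0 + F (Suc 0) + F 2 + F 3 = 2"
  obtains i j k l where "i < 4" "j < 4" "k < 4" "l < 4" "distinct [i, j, k, l]" "F i = 1" "F j = 1" "F k = 0" "F l = 0"
    "\<forall>G :: nat \<Rightarrow> nat. G i + G j + G k + G l = G 0 + G (Suc 0) + G 2 + G 3"
proof -
  note pick = that[of 0 "Suc 0" 2 3] that[of 0 2 "Suc 0" 3] that[of 0 3 "Suc 0" 2] that[of "Suc 0" 2 0 3] that[of "Suc 0" 3 0 2] that[of 2 3 0 "Suc 0"]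
  from two_of_four[OF assms(1) assms(1) assms(1) assms(1) assms(2)] show ?thesis
    by (elim disjE conjE) (rule pick; simp; fail)+
qed

lemma less_4: "r < 4 \<Longrightarrow> r = 0 \<or> r = Suc 0 \<or> r = 2 \<or> r = (3::nat)" by linarith

lemma full2: "\<lbrakk>(p0::nat) \<le> 1; p1 \<le> 1; p0 + p1 = 2\<rbrakk> \<Longrightarrow> p0 = 1 \<and> p1 = 1" by linarith
lemma full4: "\<lbrakk>(p0::nat) \<le> 1; p1 \<le> 1; p2 \<le> 1; p3 \<le> 1; p0 + p1 + p2 + p3 = 4\<rbrakk> \<Longrightarrow> p0 = 1 \<and> p1 = 1 \<and> p2 = 1 \<and> p3 = 1" by linarith
lemma full6: "\<lbrakk>(p0::nat) \<le> 1; p1 \<le> 1; p2 \<le> 1; p3 \<le> 1; p4 \<le> 1; p5 \<le> 1; p0 + p1 + p2 + p3 + p4 + p5 = 6\<rbrakk> \<Longrightarrow>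
   p0 = 1 \<and> p1 = 1 \<and> p2 = 1 \<and> p3 = 1 \<and> p4 = 1 \<and> p5 = 1" by linarith

definition lab :: "nat \<Rightarrow> nat \<Rightarrow> nat \<Rightarrow> nat \<Rightarrow> nat \<Rightarrow> nat \<Rightarrow> nat \<Rightarrow> nat \<Rightarrow> nat \<Rightarrow> nat \<Rightarrow> lbl \<Rightarrow> nat" where
  "lab a b c d e f g h i w l = (case l of La \<Rightarrow> a | Lb \<Rightarrow> b | Lc \<Rightarrow> c | Ld \<Rightarrow> d | Le \<Rightarrow> e | Lf \<Rightarrow> f | Lg \<Rightarrow> g | Lh \<Rightarrow> h | Li \<Rightarrow> i | Lw \<Rightarrow> w)"

lemma lab_simps [simp]:
  "lab a b c d e f g h i w La = a" "lab a b c d e f g h i w Lb = b" "lab a b c d e f g h i w Lc = c" "lab a b c d e f g h i w Ld = d"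
  "lab a b c d e f g h i w Le = e" "lab a b c d e f g h i w Lf = f" "lab a b c d e f g h i w Lg = g" "lab a b c d e f g h i w Lh = h"
  "lab a b c d e f g h i w Li = i" "lab a b c d e f g h i w Lw = w"
  by (simp_all add: lab_def)

section \<open>The five graphs as edge lists\<close>

definition "D0_L = [(La, Lb), (La, Lc), (La, Ld), (La, Le), (Lb, Lc), (Lb, Ld), (Lb, Le), (Lc, Ld), (Lc, Le), (Ld, Lw), (Le, Lw)]"
definition "D0_vs = [La, Lb, Lc, Ld, Le, Lw]"
definition "D1_L = [(La, Lb), (La, Lc), (La, Ld), (Lb, Lc), (Lb, Ld), (Lc, Ld), (La, Le), (Lb, Le), (Lc, Lf), (Ld, Lf), (Le, Lf), (Le, Lw), (Lf, Lw)]"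
definition "D1_vs = [La, Lb, Lc, Ld, Le, Lf, Lw]"
definition "D2_L = [(La, Lb), (La, Lc), (La, Ld), (Lb, Lc), (Lb, Ld), (Lc, Ld), (La, Le), (Lb, Le), (Lc, Lf), (Ld, Lg), (Le, Lf), (Le, Lg), (Lf, Lg), (Lf, Lw), (Lg, Lw)]"
definition "D2_vs = [La, Lb, Lc, Ld, Le, Lf, Lg, Lw]"
definition "D3_L = [(La, Lb), (La, Lc), (La, Ld), (Lb, Lc), (Lb, Ld), (Lc, Ld), (La, Le), (Lb, Le), (Lc, Lf), (Ld, Lf), (Le, Lg), (Lf, Lg), (Le, Lh), (Lf, Lh), (Lg, Lh), (Lg, Lw), (Lh, Lw)]"
definition "D3_vs = [La, Lb, Lc, Ld, Le, Lf, Lg, Lh, Lw]"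
definition "D4_L = [(La, Lb), (La, Lc), (La, Ld), (La, Le), (Lb, Lc), (Lb, Ld), (Lb, Le), (Lc, Ld), (Lc, Le), (Ld, Lf), (Le, Lg), (Lf, Lg), (Lf, Lh), (Lf, Li), (Lg, Lh), (Lg, Li), (Lh, Li), (Lh, Lw), (Li, Lw)]"
definition "D4_vs = [La, Lb, Lc, Ld, Le, Lf, Lg, Lh, Li, Lw]"

lemma D0_set: "D0_V = set D0_vs" "{x, y} \<in> D0_E \<longleftrightarrow> (x, y) \<in> set D0_L \<or> (y, x) \<in> set D0_L"
  by (simp add: D0_V_def D0_vs_def) (cases x; cases y; simp add: D0_E_def D0_L_def clique_mem doubleton_eq_iff)
lemma D1_set: "D1_V = set D1_vs" "{x, y} \<in> D1_E \<longleftrightarrow> (x, y) \<in> set D1_L \<or> (y, x) \<in> set D1_L"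
  by (simp add: D1_V_def D1_vs_def) (cases x; cases y; simp add: D1_E_def D1_L_def clique_mem doubleton_eq_iff)
lemma D2_set: "D2_V = set D2_vs" "{x, y} \<in> D2_E \<longleftrightarrow> (x, y) \<in> set D2_L \<or> (y, x) \<in> set D2_L"
  by (simp add: D2_V_def D2_vs_def) (cases x; cases y; simp add: D2_E_def D2_L_def clique_mem doubleton_eq_iff)
lemma D3_set: "D3_V = set D3_vs" "{x, y} \<in> D3_E \<longleftrightarrow> (x, y) \<in> set D3_L \<or> (y, x) \<in> set D3_L"
  by (simp add: D3_V_def D3_vs_def) (cases x; cases y; simp add: D3_E_def D3_L_def clique_mem doubleton_eq_iff)
lemma D4_set: "D4_V = set D4_vs" "{x, y} \<in> D4_E \<longleftrightarrow> (x, y) \<in> set D4_L \<or> (y, x) \<in> set D4_L"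
  by (simp add: D4_V_def D4_vs_def) (cases x; cases y; simp add: D4_E_def D4_L_def clique_mem doubleton_eq_iff)

text \<open>D4 without the vertex \<open>w\<close>: \<open>S5\<close> with a \<open>K4\<close>
  attached, written out so that it can be evaluated.\<close>

definition S9 :: edges where "S9 = S5 @ [(3, 5), (4, 6)] @ [(5, 6), (5, 7), (5, 8), (6, 7), (6, 8), (7, 8)]"
definition lev9 :: "real \<Rightarrow> real \<Rightarrow> real \<Rightarrow> nat \<Rightarrow> real" where
  "lev9 a b c i = (if i < 3 then a + b + c else if i < 5 then b + c else if i < 7 then c else 0)"
definition "y9 w = lev9 (psum w 3 / 6) (psum w 5 / 2) (psum w 7 / 4)"

lemma end_S9: "end_gadget 9 S9 7 8"
proof -
  have "attach 5 S5 3 4 K4 0 1 = S9" by (simp add: attach_def S9_def K4_def shift_def)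
  thus ?thesis using attach_end_gadget[OF end_S5 link_K4] by simp
qed

lemma gval_lev9: "gval w 9 S9 (lev9 a b c) = 6 * a\<^sup>2 + 2 * b\<^sup>2 + 4 * c\<^sup>2 - 2 * (a * psum w 3 + b * psum w 5 + c * psum w 7)"
proof -
  have "penergy S9 (lev9 a b c) = 6 * a\<^sup>2 + 2 * b\<^sup>2 + 4 * c\<^sup>2"
    by (simp add: S9_def S5_def lev9_def)
  moreover have "(\<Sum>i<9. w i * lev9 a b c i) = a * psum w 3 + b * psum w 5 + c * psum w 7"
    by (simp add: lev9_def psum_def numeral_eq_Suc algebra_simps)
  ultimately show ?thesis by (simp add: gval_def)
qed

lemma gval_S9: "gval w 9 S9 (y9 w) = - (psum w 3)\<^sup>2 / 6 - (psum w 5)\<^sup>2 / 2 - (psum w 7)\<^sup>2 / 4"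
  unfolding y9_def gval_lev9 by (simp add: power2_eq_square field_simps)

section \<open>The five exceptional blocks\<close>

context optimal_profile
begin

text \<open>Only edges of the pattern have to be present; that there are no others follows later
  from equal degrees.\<close>

definition "layout DV DE = (\<exists>\<psi>. bij_betw \<psi> DV {..m} \<and> \<psi> Lw = m \<and> (\<forall>x y. {x, y} \<in> DE \<longrightarrow> a (\<psi> x) (\<psi> y)))"

lemma \<alpha>_swap: "j < i \<Longrightarrow> \<alpha> i j = \<alpha> j i" by (rule \<alpha>_sym)

lemma \<alpha>_1: "\<alpha> i j = 1 \<Longrightarrow> a i j" by (cases "a i j") (simp_all add: \<alpha>_def)

text \<open>These variants let the size \<open>m\<close> be replaced by a numeral without touching the constants of the locale.\<close>

lemma layoutI:
  assumes "n = m" "bij_betw \<psi> DV {..n}" "\<psi> Lw = n" "\<And>x y. {x, y} \<in> DE \<Longrightarrow> \<alpha> (\<psi> x) (\<psi> y) = 1"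
  shows "layout DV DE"
  unfolding layout_def using assms \<alpha>_1 by (intro exI[of _ \<psi>]) simp

lemma J_P_at: "n = m \<Longrightarrow> P n - (f n)\<^sup>2 / 2 \<le> J" using J_P by simp
lemma energy_at: "n = m \<Longrightarrow> energy = (\<Sum>k=1..n. \<Sum>l=1..n. cc k l * g k * g l)" using energy_cc by simp
lemma cn_at: "n = m \<Longrightarrow> cn k l = (\<Sum>i<k. \<Sum>j=l..n. \<alpha> i j)" by (simp add: cn_def)
lemma deg_at: "n = m \<Longrightarrow> i < n \<Longrightarrow> (\<Sum>j\<le>n. \<alpha> i j) = 4" "n = m \<Longrightarrow> (\<Sum>j\<le>n. \<alpha> n j) = 2"
  using deg_\<alpha> deg_\<alpha>m by simp_all
lemma g_at: "n = m \<Longrightarrow> 1 \<le> k \<Longrightarrow> k \<le> n \<Longrightarrow> g k = X (k - 1) - X k" by (simp add: g_def)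
lemma c_at: "n = m \<Longrightarrow> cc n n = 2" using c_m by simp
lemma f_pos_at: "n = m \<Longrightarrow> 1 \<le> k \<Longrightarrow> k \<le> n \<Longrightarrow> 0 < f k" using f_pos by simp

lemma layout_list:
  assumes n: "n = m" and V: "DV = set vs" "length vs = Suc n" "distinct (map \<psi> vs)" "list_all (\<lambda>x. \<psi> x \<le> n) vs" "\<psi> Lw = n"
    and E: "\<And>x y. {x, y} \<in> DE \<longleftrightarrow> (x, y) \<in> set L \<or> (y, x) \<in> set L" "list_all (\<lambda>(x, y). \<alpha> (\<psi> x) (\<psi> y) = 1) L"
  shows "layout DV DE"
proof (rule layoutI[OF n])
  have inj: "inj_on \<psi> DV" and d: "distinct vs" using V by (auto simp: distinct_map)
  have "\<psi> ` DV \<subseteq> {..n}" using V by (auto simp: list_all_iff)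
  moreover have "card (\<psi> ` DV) = card {..n}" using card_image[OF inj] distinct_card[OF d] V by simp
  ultimately have "\<psi> ` DV = {..n}" by (intro card_subset_eq) auto
  thus "bij_betw \<psi> DV {..n}" using inj by (simp add: bij_betw_def)
  show "\<alpha> (\<psi> x) (\<psi> y) = 1" if "{x, y} \<in> DE" for x y
  proof -
    have *: "\<alpha> (\<psi> x) (\<psi> y) = 1" if "(x, y) \<in> set L" for x y using E(2) that by (auto simp: list_all_iff)
    from that E(1) have "(x, y) \<in> set L \<or> (y, x) \<in> set L" by simp
    thus ?thesis using *[of x y] *[of y x] \<alpha>_sym[of "\<psi> x" "\<psi> y"] by argo
  qed
qed (rule V)

lemma core_at:
  assumes "n = m" "end_gadget n H s t" "s \<noteq> t" "y s = 0" "y t = 0"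
  shows "J \<le> gval w n H y - (f n)\<^sup>2 / 2"
    and "J = gval w n H y - (f n)\<^sup>2 / 2 \<Longrightarrow> i < n \<Longrightarrow> X i - X n = y i + f n / 2"
    and "J = gval w n H y - (f n)\<^sup>2 / 2 \<Longrightarrow> energy = penergy H y + (f n)\<^sup>2 / 2"
  using core_gval(1)[of H s t y] core_gval(2)[of H s t y i] core_gval(3)[of H s t y] assms by simp_all

text \<open>Equality makes \<open>X\<close> the trial function of \<open>S5\<close>, so that only
  the gaps 3 and 5 are nonzero. The block then has the energy of \<open>S5\<close> with its two exit
  edges, while its coefficients are at least as large; hence they agree. The resulting counts and
  the degrees leave no choice for the edges. The other sizes follow the same pattern.\<close>

lemma layout_5:
  assumes m: "m = 5"
  shows "layout D0_V D0_E"
proof -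
  have m': "5 = m" using m by simp
  have ne: "3 \<noteq> (4::nat)" by simp
  have y: "y5 w 3 = 0" "y5 w 4 = 0" by (simp_all add: y5_def)
  note H = core_at[OF m' end_S5 ne y]
  have e: "J = gval w 5 S5 (y5 w) - (f 5)\<^sup>2 / 2"
    using H(1) J_P_at[OF m'] P_5 unfolding gval_S5 f_def[symmetric] by linarith
  have X: "X i - X 5 = y5 w i + f 5 / 2" if "i < 5" for i by (rule H(2)[OF e that])
  have pen: "penergy S5 (y5 w) = penergy S5 X"
  proof (rule penergy_cong)
    fix i j assume "(i, j) \<in> set S5"
    hence "i < 5" "j < 5" using end_S5 by (auto simp: end_gadget_def)
    thus "y5 w i - y5 w j = X i - X j" using X[of i] X[of j] by linarith
  qed
  have en: "energy = penergy S5 X + (f 5)\<^sup>2 / 2" using H(3)[OF e] pen by simp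
  have f: "0 < f 1" "0 < f 2" "0 < f 3" "0 < f 4" "0 < f 5" by (simp_all add: f_pos_at[OF m'])
  have g: "g 1 = 0" "g 2 = 0" "g 4 = 0" "g 5 = f 5 / 2"
    using X[of 0] X[of 1] X[of 2] X[of 3] X[of 4] by (simp_all add: g_at[OF m'] y5_def)
  have p: "0 < g 3" "0 < g 5" using X[of 2] X[of 3] f by (simp_all add: g_at[OF m'] g y5_def f_def)
  have cmin: "6 \<le> cc 3 3" using c3 by simp
  have XX: "X 0 = X 1" "X 1 = X 2" "X 3 = X 4"
    using g by (simp_all add: g_at[OF m'])
  have gX: "X 2 - X 3 = g 3" "X 4 - X 5 = g 5"
    by (simp_all add: g_at[OF m'])
  have "penergy S5 X = 6 * g 3 * g 3"
    unfolding gX[symmetric] by (simp add: S5_def XX[unfolded One_nat_def] power2_eq_square algebra_simps)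
  moreover have "(f 5)\<^sup>2 / 2 = 2 * g 5 * g 5" by (simp add: g power2_eq_square)
  moreover have "energy = cc 3 3 * g 3 * g 3 + 2 * cc 3 5 * g 3 * g 5 + cc 5 5 * g 5 * g 5"
    unfolding energy_at[OF m'] sum_iv using g by (simp add: c_sym[of 5 3])
  moreover have "cc 5 5 = 2" by (rule c_at[OF m'])
  ultimately have s: "(cc 3 3 - 6) * (g 3 * g 3) + 2 * (cc 3 5 * (g 3 * g 5)) = 0"
    using en by (simp add: algebra_simps)
  have n: "0 \<le> (cc 3 3 - 6) * (g 3 * g 3)" "0 \<le> cc 3 5 * (g 3 * g 5)"
    using g0 c0 cmin by (auto intro!: mult_nonneg_nonneg)
  have "(cc 3 3 - 6) * (g 3 * g 3) = 0" "cc 3 5 * (g 3 * g 5) = 0" using s n by linarith+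
  hence K: "cn 3 3 = 6" "cn 3 5 = 0"
    using p by (simp_all add: cc_def)
  have k3_3: "cn 3 3 = \<alpha> 0 3 + \<alpha> 0 4 + \<alpha> 0 5 + \<alpha> (Suc 0) 3 + \<alpha> (Suc 0) 4 + \<alpha> (Suc 0) 5 + \<alpha> 2 3 + \<alpha> 2 4 + \<alpha> 2 5"
    unfolding cn_at[OF m'] by (simp add: eval_nat_numeral)
  have k3_5: "cn 3 5 = \<alpha> 0 5 + \<alpha> (Suc 0) 5 + \<alpha> 2 5"
    unfolding cn_at[OF m'] by (simp add: eval_nat_numeral)
  have d0: "\<alpha> 0 (Suc 0) + \<alpha> 0 2 + \<alpha> 0 3 + \<alpha> 0 4 + \<alpha> 0 5 = 4"
    using deg_at(1)[OF m', of 0] unfolding row_iv by (simp add: \<alpha>_swap \<alpha>_sym[of 6 5])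
  have d1: "\<alpha> 0 (Suc 0) + \<alpha> (Suc 0) 2 + \<alpha> (Suc 0) 3 + \<alpha> (Suc 0) 4 + \<alpha> (Suc 0) 5 = 4"
    using deg_at(1)[OF m', of 1] unfolding row_iv by (simp add: \<alpha>_swap \<alpha>_sym[of 6 5])
  have d2: "\<alpha> 0 2 + \<alpha> (Suc 0) 2 + \<alpha> 2 3 + \<alpha> 2 4 + \<alpha> 2 5 = 4"
    using deg_at(1)[OF m', of 2] unfolding row_iv by (simp add: \<alpha>_swap \<alpha>_sym[of 6 5])
  have d3: "\<alpha> 0 3 + \<alpha> (Suc 0) 3 + \<alpha> 2 3 + \<alpha> 3 4 + \<alpha> 3 5 = 4"
    using deg_at(1)[OF m', of 3] unfolding row_iv by (simp add: \<alpha>_swap \<alpha>_sym[of 6 5])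
  have d4: "\<alpha> 0 4 + \<alpha> (Suc 0) 4 + \<alpha> 2 4 + \<alpha> 3 4 + \<alpha> 4 5 = 4"
    using deg_at(1)[OF m', of 4] unfolding row_iv by (simp add: \<alpha>_swap \<alpha>_sym[of 6 5])
  have d5: "\<alpha> 0 5 + \<alpha> (Suc 0) 5 + \<alpha> 2 5 + \<alpha> 3 5 + \<alpha> 4 5 = 2"
    using deg_at(2)[OF m'] unfolding row_iv by (simp add: \<alpha>_swap \<alpha>_sym[of 6 5])
  note D = d0 d1 d2 d3 d4 d5
  note kk = K(1)[unfolded k3_3] K(2)[unfolded k3_5]
  have z: "\<alpha> 0 5 = 0" "\<alpha> (Suc 0) 5 = 0" "\<alpha> 2 5 = 0" using kk by simp_all
  have o1: "\<alpha> 0 (Suc 0) = 1 \<and> \<alpha> 0 2 = 1 \<and> \<alpha> 0 3 = 1 \<and> \<alpha> 0 4 = 1"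
    by (rule full4[OF \<alpha>_le \<alpha>_le \<alpha>_le \<alpha>_le]) (use D(1) z in simp)
  have o2: "\<alpha> 0 (Suc 0) = 1 \<and> \<alpha> (Suc 0) 2 = 1 \<and> \<alpha> (Suc 0) 3 = 1 \<and> \<alpha> (Suc 0) 4 = 1"
    by (rule full4[OF \<alpha>_le \<alpha>_le \<alpha>_le \<alpha>_le]) (use D(2) z in simp)
  have o3: "\<alpha> 0 2 = 1 \<and> \<alpha> (Suc 0) 2 = 1 \<and> \<alpha> 2 3 = 1 \<and> \<alpha> 2 4 = 1"
    by (rule full4[OF \<alpha>_le \<alpha>_le \<alpha>_le \<alpha>_le]) (use D(3) z in simp)
  have o4: "\<alpha> 3 5 = 1 \<and> \<alpha> 4 5 = 1"
    by (rule full2[OF \<alpha>_le \<alpha>_le]) (use D(6) z in simp)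
  show ?thesis
    by (rule layout_list[OF m' D0_set(1) _ _ _ _ D0_set(2), of "lab 0 1 2 3 4 0 0 0 0 5"]) (simp_all add: D0_vs_def D0_L_def o1 o2 o3 o4 \<alpha>_swap \<alpha>_sym[of 6 5])
qed

lemma layout_6:
  assumes m: "m = 6" and C5: "4 \<le> C 5"
  shows "layout D1_V D1_E"
proof -
  have m': "6 = m" using m by simp
  have ne: "4 \<noteq> (5::nat)" by simp
  have y: "y6 w 4 = 0" "y6 w 5 = 0" by (simp_all add: y6_def)
  note H = core_at[OF m' end_S6 ne y]
  have e: "J = gval w 6 S6 (y6 w) - (f 6)\<^sup>2 / 2"
    using H(1) J_P_at[OF m'] P_6[OF eq_refl[OF m'] C5] unfolding gval_S6 f_def[symmetric] by linarith
  have X: "X i - X 6 = y6 w i + f 6 / 2" if "i < 6" for i by (rule H(2)[OF e that])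
  have pen: "penergy S6 (y6 w) = penergy S6 X"
  proof (rule penergy_cong)
    fix i j assume "(i, j) \<in> set S6"
    hence "i < 6" "j < 6" using end_S6 by (auto simp: end_gadget_def)
    thus "y6 w i - y6 w j = X i - X j" using X[of i] X[of j] by linarith
  qed
  have en: "energy = penergy S6 X + (f 6)\<^sup>2 / 2" using H(3)[OF e] pen by simp
  have f: "0 < f 1" "0 < f 2" "0 < f 3" "0 < f 4" "0 < f 5" "0 < f 6" by (simp_all add: f_pos_at[OF m'])
  have g: "g 1 = 0" "g 2 = 0" "g 3 = 0" "g 5 = 0" "g 6 = f 6 / 2"
    using X[of 0] X[of 1] X[of 2] X[of 3] X[of 4] X[of 5] by (simp_all add: g_at[OF m'] y6_def)
  have p: "0 < g 4" "0 < g 6" using X[of 3] X[of 4] f by (simp_all add: g_at[OF m'] g y6_def f_def)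
  have cmin: "4 \<le> cc 4 4" using c4 by simp
  have XX: "X 0 = X 1" "X 1 = X 2" "X 2 = X 3" "X 4 = X 5"
    using g by (simp_all add: g_at[OF m'])
  have gX: "X 3 - X 4 = g 4" "X 5 - X 6 = g 6"
    by (simp_all add: g_at[OF m'])
  have "penergy S6 X = 4 * g 4 * g 4"
    unfolding gX[symmetric] by (simp add: S6_def K4_def XX[unfolded One_nat_def] power2_eq_square algebra_simps)
  moreover have "(f 6)\<^sup>2 / 2 = 2 * g 6 * g 6" by (simp add: g power2_eq_square)
  moreover have "energy = cc 4 4 * g 4 * g 4 + 2 * cc 4 6 * g 4 * g 6 + cc 6 6 * g 6 * g 6"
    unfolding energy_at[OF m'] sum_iv using g by (simp add: c_sym[of 6 4])
  moreover have "cc 6 6 = 2" by (rule c_at[OF m'])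
  ultimately have s: "(cc 4 4 - 4) * (g 4 * g 4) + 2 * (cc 4 6 * (g 4 * g 6)) = 0"
    using en by (simp add: algebra_simps)
  have n: "0 \<le> (cc 4 4 - 4) * (g 4 * g 4)" "0 \<le> cc 4 6 * (g 4 * g 6)"
    using g0 c0 cmin by (auto intro!: mult_nonneg_nonneg)
  have "(cc 4 4 - 4) * (g 4 * g 4) = 0" "cc 4 6 * (g 4 * g 6) = 0" using s n by linarith+
  hence K: "cn 4 4 = 4" "cn 4 6 = 0"
    using p by (simp_all add: cc_def)
  have k4_4: "cn 4 4 = \<alpha> 0 4 + \<alpha> 0 5 + \<alpha> 0 6 + \<alpha> (Suc 0) 4 + \<alpha> (Suc 0) 5 + \<alpha> (Suc 0) 6 + \<alpha> 2 4 + \<alpha> 2 5 + \<alpha> 2 6 + \<alpha> 3 4 + \<alpha> 3 5 + \<alpha> 3 6"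
    unfolding cn_at[OF m'] by (simp add: eval_nat_numeral)
  have k4_6: "cn 4 6 = \<alpha> 0 6 + \<alpha> (Suc 0) 6 + \<alpha> 2 6 + \<alpha> 3 6"
    unfolding cn_at[OF m'] by (simp add: eval_nat_numeral)
  have d0: "\<alpha> 0 (Suc 0) + \<alpha> 0 2 + \<alpha> 0 3 + \<alpha> 0 4 + \<alpha> 0 5 + \<alpha> 0 6 = 4"
    using deg_at(1)[OF m', of 0] unfolding row_iv by (simp add: \<alpha>_swap \<alpha>_sym[of 6 5])
  have d1: "\<alpha> 0 (Suc 0) + \<alpha> (Suc 0) 2 + \<alpha> (Suc 0) 3 + \<alpha> (Suc 0) 4 + \<alpha> (Suc 0) 5 + \<alpha> (Suc 0) 6 = 4"
    using deg_at(1)[OF m', of 1] unfolding row_iv by (simp add: \<alpha>_swap \<alpha>_sym[of 6 5])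
  have d2: "\<alpha> 0 2 + \<alpha> (Suc 0) 2 + \<alpha> 2 3 + \<alpha> 2 4 + \<alpha> 2 5 + \<alpha> 2 6 = 4"
    using deg_at(1)[OF m', of 2] unfolding row_iv by (simp add: \<alpha>_swap \<alpha>_sym[of 6 5])
  have d3: "\<alpha> 0 3 + \<alpha> (Suc 0) 3 + \<alpha> 2 3 + \<alpha> 3 4 + \<alpha> 3 5 + \<alpha> 3 6 = 4"
    using deg_at(1)[OF m', of 3] unfolding row_iv by (simp add: \<alpha>_swap \<alpha>_sym[of 6 5])
  have d4: "\<alpha> 0 4 + \<alpha> (Suc 0) 4 + \<alpha> 2 4 + \<alpha> 3 4 + \<alpha> 4 5 + \<alpha> 4 6 = 4"
    using deg_at(1)[OF m', of 4] unfolding row_iv by (simp add: \<alpha>_swap \<alpha>_sym[of 6 5])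
  have d5: "\<alpha> 0 5 + \<alpha> (Suc 0) 5 + \<alpha> 2 5 + \<alpha> 3 5 + \<alpha> 4 5 + \<alpha> 5 6 = 4"
    using deg_at(1)[OF m', of 5] unfolding row_iv by (simp add: \<alpha>_swap \<alpha>_sym[of 6 5])
  have d6: "\<alpha> 0 6 + \<alpha> (Suc 0) 6 + \<alpha> 2 6 + \<alpha> 3 6 + \<alpha> 4 6 + \<alpha> 5 6 = 2"
    using deg_at(2)[OF m'] unfolding row_iv by (simp add: \<alpha>_swap \<alpha>_sym[of 6 5])
  note D = d0 d1 d2 d3 d4 d5 d6
  note kk = K(1)[unfolded k4_4] K(2)[unfolded k4_6]
  have z: "\<alpha> 0 6 = 0" "\<alpha> (Suc 0) 6 = 0" "\<alpha> 2 6 = 0" "\<alpha> 3 6 = 0" using kk by simp_all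
  \<comment> \<open>Sixteen edge ends less the four edges of cut 4 leave room for exactly all six
    edges among the first four positions.\<close>
  have k4: "\<alpha> 0 (Suc 0) = 1 \<and> \<alpha> 0 2 = 1 \<and> \<alpha> 0 3 = 1 \<and> \<alpha> (Suc 0) 2 = 1 \<and> \<alpha> (Suc 0) 3 = 1 \<and> \<alpha> 2 3 = 1"
    by (rule full6[OF \<alpha>_le \<alpha>_le \<alpha>_le \<alpha>_le \<alpha>_le \<alpha>_le]) (use D(1-4) kk(1) z in linarith)
  have o1: "\<alpha> 4 6 = 1 \<and> \<alpha> 5 6 = 1"
    by (rule full2[OF \<alpha>_le \<alpha>_le]) (use D(7) z in simp)
  \<comment> \<open>The degrees of 4 and 5 are added: together these positions receive all four
    edges of cut 4.\<close>
  have o: "\<alpha> 4 5 = 1" using D(5,6) kk(1) z o1 by linarith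
  have o2: "\<alpha> 0 4 + \<alpha> (Suc 0) 4 + \<alpha> 2 4 + \<alpha> 3 4 = 2" using D(5) o o1 by simp
  have o3: "\<alpha> 0 4 + \<alpha> 0 5 = 1" "\<alpha> (Suc 0) 4 + \<alpha> (Suc 0) 5 = 1" "\<alpha> 2 4 + \<alpha> 2 5 = 1" "\<alpha> 3 4 + \<alpha> 3 5 = 1" using D(1-4) k4 z by simp_all
  have K: "\<alpha> r s = 1" if "r < 4" "s < 4" "r \<noteq> s" for r s
    using less_4[OF that(1)] less_4[OF that(2)] that(3) k4 by (elim disjE) (simp_all add: \<alpha>_swap)
  have O: "\<alpha> r 4 + \<alpha> r 5 = 1" if "r < 4" for r
    using less_4[OF that] o3 by (elim disjE) simp_all
  \<comment> \<open>Which two vertices of the clique are joined to 4 is not determined; they are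
    called \<open>i\<close> and \<open>j\<close> and become \<open>La\<close> and
    \<open>Lb\<close>.\<close>
  obtain i j k l where q: "i < 4" "j < 4" "k < 4" "l < 4" "distinct [i, j, k, l]"
      "\<alpha> i 4 = 1" "\<alpha> j 4 = 1" "\<alpha> k 4 = 0" "\<alpha> l 4 = 0"
    by (rule pick4[of "\<lambda>r. \<alpha> r 4", OF \<alpha>_le o2])
  have q2: "\<alpha> k 5 = 1" "\<alpha> l 5 = 1" using O[of k] O[of l] q by simp_all
  show ?thesis
    by (rule layout_list[OF m' D1_set(1) _ _ _ _ D1_set(2), of "lab i j k l 4 5 0 0 0 6"]) (use q in \<open>simp_all add: D1_vs_def D1_L_def K o o1 q2 \<alpha>_swap\<close>)
qed

lemma layout_7:
  assumes m: "m = 7" and C5: "4 \<le> C 5" and C6: "4 \<le> C 6"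
  shows "layout D2_V D2_E"
proof -
  have m': "7 = m" using m by simp
  have ne: "5 \<noteq> (6::nat)" by simp
  have y: "y7o w 5 = 0" "y7o w 6 = 0" by (simp_all add: y7o_def lev7_def)
  note H = core_at[OF m' end_S7 ne y]
  have m4: "4 < m" using m by simp
  have C7: "C 7 = 2" unfolding C_def by (rule c_at[OF m'])
  have e: "J = gval w 7 S7 (y7o w) - (f 7)\<^sup>2 / 2"
    using H(1) J_P_at[OF m'] P_7[OF eq_refl[OF m'] C5 C6 C7] unfolding gval_S7o f_def[symmetric] by linarith
  have X: "X i - X 7 = y7o w i + f 7 / 2" if "i < 7" for i by (rule H(2)[OF e that])
  have pen: "penergy S7 (y7o w) = penergy S7 X"
  proof (rule penergy_cong)
    fix i j assume "(i, j) \<in> set S7"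
    hence "i < 7" "j < 7" using end_S7 by (auto simp: end_gadget_def)
    thus "y7o w i - y7o w j = X i - X j" using X[of i] X[of j] by linarith
  qed
  have en: "energy = penergy S7 X + (f 7)\<^sup>2 / 2" using H(3)[OF e] pen by simp
  have f: "0 < f 1" "0 < f 2" "0 < f 3" "0 < f 4" "0 < f 5" "0 < f 6" "0 < f 7" by (simp_all add: f_pos_at[OF m'])
  have g: "g 1 = 0" "g 3 = 0" "g 6 = 0" "g 7 = f 7 / 2"
    using X[of 0] X[of 1] X[of 2] X[of 3] X[of 4] X[of 5] X[of 6] by (simp_all add: g_at[OF m'] y7o_def lev7_def)
  have p: "0 < g 4" "0 < g 5" "0 < g 7"
  proof -
    \<comment> \<open>\<open>g 4\<close> and \<open>g 5\<close> are the optimal gaps of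
      \<open>S7\<close>. Their positivity is where concavity at 4 and the three positions after 4
      enter.\<close>
    have "3 * f 4 \<ge> f 2 + 2 * f 5" using f_conc[of 2 4 5] m by simp
    moreover have "4 * f 5 \<ge> 3 * f 4" using f_right1[of 4 3] m by simp
    ultimately have "0 < 6 * f 4 - 2 * f 2 - 3 * f 5" "0 < 10 * f 5 - 6 * f 4 + 2 * f 2" using f by linarith+
    moreover have "g 4 = (6 * f 4 - 2 * f 2 - 3 * f 5) / 14" "g 5 = (10 * f 5 - 6 * f 4 + 2 * f 2) / 28"
    proof -
      have "g 4 = y7o w 3 - y7o w 4" "g 5 = y7o w 4 - y7o w 5" using X[of 3] X[of 4] X[of 5] by (simp_all add: g_at[OF m'])
      thus "g 4 = (6 * f 4 - 2 * f 2 - 3 * f 5) / 14" "g 5 = (10 * f 5 - 6 * f 4 + 2 * f 2) / 28" by (simp_all add: y7o_def lev7_def f_def)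
    qed
    ultimately show "0 < g 4" "0 < g 5" by simp_all
    show "0 < g 7" using f g by simp
  qed
  have cmin: "6 \<le> cc 2 2" "2 \<le> cc 2 4" "4 \<le> cc 4 4" "2 \<le> cc 4 5" "4 \<le> cc 5 5" using c2 c24 c4 c_adj[OF _ m4] C5 by (simp_all add: C_def)
  have XX: "X 0 = X 1" "X 2 = X 3" "X 5 = X 6"
    using g by (simp_all add: g_at[OF m'])
  have gX: "X 1 - X 2 = g 2" "X 3 - X 4 = g 4" "X 4 - X 5 = g 5" "X 6 - X 7 = g 7"
    by (simp_all add: g_at[OF m'])
  have "penergy S7 X = 6 * g 2 * g 2 + 4 * g 2 * g 4 + 4 * g 4 * g 4 + 4 * g 4 * g 5 + 4 * g 5 * g 5"
    unfolding gX[symmetric] by (simp add: S7_def K4_def XX[unfolded One_nat_def] power2_eq_square algebra_simps)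
  moreover have "(f 7)\<^sup>2 / 2 = 2 * g 7 * g 7" by (simp add: g power2_eq_square)
  moreover have "energy = cc 2 2 * g 2 * g 2 + 2 * cc 2 4 * g 2 * g 4 + 2 * cc 2 5 * g 2 * g 5 + 2 * cc 2 7 * g 2 * g 7 + cc 4 4 * g 4 * g 4 + 2 * cc 4 5 * g 4 * g 5 + 2 * cc 4 7 * g 4 * g 7 + cc 5 5 * g 5 * g 5 + 2 * cc 5 7 * g 5 * g 7 + cc 7 7 * g 7 * g 7"
    unfolding energy_at[OF m'] sum_iv using g by (simp add: c_sym[of 4 2] c_sym[of 5 2] c_sym[of 7 2] c_sym[of 5 4] c_sym[of 7 4] c_sym[of 7 5])
  moreover have "cc 7 7 = 2" by (rule c_at[OF m'])
  ultimately have s: "(cc 2 2 - 6) * (g 2 * g 2) + 2 * ((cc 2 4 - 2) * (g 2 * g 4)) + 2 * (cc 2 5 * (g 2 * g 5)) + 2 * (cc 2 7 * (g 2 * g 7)) + (cc 4 4 - 4) * (g 4 * g 4) + 2 * ((cc 4 5 - 2) * (g 4 * g 5)) + 2 * (cc 4 7 * (g 4 * g 7)) + (cc 5 5 - 4) * (g 5 * g 5) + 2 * (cc 5 7 * (g 5 * g 7)) = 0"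
    using en by (simp add: algebra_simps)
  have n: "0 \<le> (cc 2 2 - 6) * (g 2 * g 2)" "0 \<le> (cc 2 4 - 2) * (g 2 * g 4)" "0 \<le> cc 2 5 * (g 2 * g 5)" "0 \<le> cc 2 7 * (g 2 * g 7)" "0 \<le> (cc 4 4 - 4) * (g 4 * g 4)" "0 \<le> (cc 4 5 - 2) * (g 4 * g 5)" "0 \<le> cc 4 7 * (g 4 * g 7)" "0 \<le> (cc 5 5 - 4) * (g 5 * g 5)" "0 \<le> cc 5 7 * (g 5 * g 7)"
    using g0 c0 cmin by (auto intro!: mult_nonneg_nonneg)
  \<comment> \<open>Products with \<open>g 2\<close> are left out: positivity was shown only for the
    gaps 4, 5 and 7.\<close>
  have "(cc 4 4 - 4) * (g 4 * g 4) = 0" "(cc 4 5 - 2) * (g 4 * g 5) = 0" "cc 4 7 * (g 4 * g 7) = 0" "(cc 5 5 - 4) * (g 5 * g 5) = 0" "cc 5 7 * (g 5 * g 7) = 0" using s n by linarith+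
  hence K: "cn 4 4 = 4" "cn 4 5 = 2" "cn 4 7 = 0" "cn 5 5 = 4" "cn 5 7 = 0"
    using p by (simp_all add: cc_def)
  have k4_4: "cn 4 4 = \<alpha> 0 4 + \<alpha> 0 5 + \<alpha> 0 6 + \<alpha> 0 7 + \<alpha> (Suc 0) 4 + \<alpha> (Suc 0) 5 + \<alpha> (Suc 0) 6 + \<alpha> (Suc 0) 7 + \<alpha> 2 4 + \<alpha> 2 5 + \<alpha> 2 6 + \<alpha> 2 7 + \<alpha> 3 4 + \<alpha> 3 5 + \<alpha> 3 6 + \<alpha> 3 7"
    unfolding cn_at[OF m'] by (simp add: eval_nat_numeral)
  have k4_5: "cn 4 5 = \<alpha> 0 5 + \<alpha> 0 6 + \<alpha> 0 7 + \<alpha> (Suc 0) 5 + \<alpha> (Suc 0) 6 + \<alpha> (Suc 0) 7 + \<alpha> 2 5 + \<alpha> 2 6 + \<alpha> 2 7 + \<alpha> 3 5 + \<alpha> 3 6 + \<alpha> 3 7"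
    unfolding cn_at[OF m'] by (simp add: eval_nat_numeral)
  have k4_7: "cn 4 7 = \<alpha> 0 7 + \<alpha> (Suc 0) 7 + \<alpha> 2 7 + \<alpha> 3 7"
    unfolding cn_at[OF m'] by (simp add: eval_nat_numeral)
  have k5_5: "cn 5 5 = \<alpha> 0 5 + \<alpha> 0 6 + \<alpha> 0 7 + \<alpha> (Suc 0) 5 + \<alpha> (Suc 0) 6 + \<alpha> (Suc 0) 7 + \<alpha> 2 5 + \<alpha> 2 6 + \<alpha> 2 7 + \<alpha> 3 5 + \<alpha> 3 6 + \<alpha> 3 7 + \<alpha> 4 5 + \<alpha> 4 6 + \<alpha> 4 7"
    unfolding cn_at[OF m'] by (simp add: eval_nat_numeral)
  have k5_7: "cn 5 7 = \<alpha> 0 7 + \<alpha> (Suc 0) 7 + \<alpha> 2 7 + \<alpha> 3 7 + \<alpha> 4 7"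
    unfolding cn_at[OF m'] by (simp add: eval_nat_numeral)
  have d0: "\<alpha> 0 (Suc 0) + \<alpha> 0 2 + \<alpha> 0 3 + \<alpha> 0 4 + \<alpha> 0 5 + \<alpha> 0 6 + \<alpha> 0 7 = 4"
    using deg_at(1)[OF m', of 0] unfolding row_iv by (simp add: \<alpha>_swap \<alpha>_sym[of 6 5])
  have d1: "\<alpha> 0 (Suc 0) + \<alpha> (Suc 0) 2 + \<alpha> (Suc 0) 3 + \<alpha> (Suc 0) 4 + \<alpha> (Suc 0) 5 + \<alpha> (Suc 0) 6 + \<alpha> (Suc 0) 7 = 4"
    using deg_at(1)[OF m', of 1] unfolding row_iv by (simp add: \<alpha>_swap \<alpha>_sym[of 6 5])
  have d2: "\<alpha> 0 2 + \<alpha> (Suc 0) 2 + \<alpha> 2 3 + \<alpha> 2 4 + \<alpha> 2 5 + \<alpha> 2 6 + \<alpha> 2 7 = 4"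
    using deg_at(1)[OF m', of 2] unfolding row_iv by (simp add: \<alpha>_swap \<alpha>_sym[of 6 5])
  have d3: "\<alpha> 0 3 + \<alpha> (Suc 0) 3 + \<alpha> 2 3 + \<alpha> 3 4 + \<alpha> 3 5 + \<alpha> 3 6 + \<alpha> 3 7 = 4"
    using deg_at(1)[OF m', of 3] unfolding row_iv by (simp add: \<alpha>_swap \<alpha>_sym[of 6 5])
  have d4: "\<alpha> 0 4 + \<alpha> (Suc 0) 4 + \<alpha> 2 4 + \<alpha> 3 4 + \<alpha> 4 5 + \<alpha> 4 6 + \<alpha> 4 7 = 4"
    using deg_at(1)[OF m', of 4] unfolding row_iv by (simp add: \<alpha>_swap \<alpha>_sym[of 6 5])
  have d5: "\<alpha> 0 5 + \<alpha> (Suc 0) 5 + \<alpha> 2 5 + \<alpha> 3 5 + \<alpha> 4 5 + \<alpha> 5 6 + \<alpha> 5 7 = 4"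
    using deg_at(1)[OF m', of 5] unfolding row_iv by (simp add: \<alpha>_swap \<alpha>_sym[of 6 5])
  have d6: "\<alpha> 0 6 + \<alpha> (Suc 0) 6 + \<alpha> 2 6 + \<alpha> 3 6 + \<alpha> 4 6 + \<alpha> 5 6 + \<alpha> 6 7 = 4"
    using deg_at(1)[OF m', of 6] unfolding row_iv by (simp add: \<alpha>_swap \<alpha>_sym[of 6 5])
  have d7: "\<alpha> 0 7 + \<alpha> (Suc 0) 7 + \<alpha> 2 7 + \<alpha> 3 7 + \<alpha> 4 7 + \<alpha> 5 7 + \<alpha> 6 7 = 2"
    using deg_at(2)[OF m'] unfolding row_iv by (simp add: \<alpha>_swap \<alpha>_sym[of 6 5])
  note D = d0 d1 d2 d3 d4 d5 d6 d7
  note kk = K(1)[unfolded k4_4] K(2)[unfolded k4_5] K(3)[unfolded k4_7] K(4)[unfolded k5_5] K(5)[unfolded k5_7]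
  have z: "\<alpha> 0 7 = 0" "\<alpha> (Suc 0) 7 = 0" "\<alpha> 2 7 = 0" "\<alpha> 3 7 = 0" "\<alpha> 4 7 = 0" using kk by simp_all
  have k4: "\<alpha> 0 (Suc 0) = 1 \<and> \<alpha> 0 2 = 1 \<and> \<alpha> 0 3 = 1 \<and> \<alpha> (Suc 0) 2 = 1 \<and> \<alpha> (Suc 0) 3 = 1 \<and> \<alpha> 2 3 = 1"
    by (rule full6[OF \<alpha>_le \<alpha>_le \<alpha>_le \<alpha>_le \<alpha>_le \<alpha>_le]) (use D(1-4) kk(1) z in linarith)
  have o1: "\<alpha> 5 7 = 1 \<and> \<alpha> 6 7 = 1"
    by (rule full2[OF \<alpha>_le \<alpha>_le]) (use D(8) z in simp)
  have s4: "\<alpha> 0 4 + \<alpha> (Suc 0) 4 + \<alpha> 2 4 + \<alpha> 3 4 = 2" using kk(1,2) by linarith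
  have o4: "\<alpha> 4 5 = 1 \<and> \<alpha> 4 6 = 1"
    by (rule full2[OF \<alpha>_le \<alpha>_le]) (use D(5) s4 z in linarith)
  have o: "\<alpha> 5 6 = 1" using D(6,7) kk(2) z o1 o4 by linarith
  have o2: "\<alpha> 0 5 + \<alpha> (Suc 0) 5 + \<alpha> 2 5 + \<alpha> 3 5 = 1" using D(6) o o1 o4 by simp
  have o3: "\<alpha> 0 4 + \<alpha> 0 5 + \<alpha> 0 6 = 1" "\<alpha> (Suc 0) 4 + \<alpha> (Suc 0) 5 + \<alpha> (Suc 0) 6 = 1" "\<alpha> 2 4 + \<alpha> 2 5 + \<alpha> 2 6 = 1" "\<alpha> 3 4 + \<alpha> 3 5 + \<alpha> 3 6 = 1" using D(1-4) k4 z by simp_all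
  have K: "\<alpha> r s = 1" if "r < 4" "s < 4" "r \<noteq> s" for r s
    using less_4[OF that(1)] less_4[OF that(2)] that(3) k4 by (elim disjE) (simp_all add: \<alpha>_swap)
  have O: "\<alpha> r 4 + \<alpha> r 5 + \<alpha> r 6 = 1" if "r < 4" for r
    using less_4[OF that] o3 by (elim disjE) simp_all
  obtain i j k l where q: "i < 4" "j < 4" "k < 4" "l < 4" "distinct [i, j, k, l]"
      "\<alpha> i 4 = 1" "\<alpha> j 4 = 1" "\<alpha> k 4 = 0" "\<alpha> l 4 = 0"
    and G: "\<forall>G :: nat \<Rightarrow> nat. G i + G j + G k + G l = G 0 + G (Suc 0) + G 2 + G 3"
    by (rule pick4[of "\<lambda>r. \<alpha> r 4", OF \<alpha>_le s4])
  have "\<alpha> i 5 = 0" "\<alpha> j 5 = 0" using O[of i] O[of j] q by simp_all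
  hence "\<alpha> k 5 + \<alpha> l 5 = 1" using G[rule_format, of "\<lambda>r. \<alpha> r 5"] o2 by simp
  \<comment> \<open>Exactly one of the two remaining clique vertices is joined to 5; it receives the
    label \<open>Lc\<close>.\<close>
  then consider "\<alpha> k 5 = 1" "\<alpha> l 5 = 0" | "\<alpha> k 5 = 0" "\<alpha> l 5 = 1" by linarith
  thus ?thesis
  proof cases
    case 1
    hence q2: "\<alpha> l 6 = 1" using O[of l] q by simp
    show ?thesis
      by (rule layout_list[OF m' D2_set(1) _ _ _ _ D2_set(2), of "lab i j k l 4 5 6 0 0 7"]) (use q in \<open>simp_all add: D2_vs_def D2_L_def K o o1 o4 q2 1 \<alpha>_swap\<close>)
  next
    case 2
    hence q2: "\<alpha> k 6 = 1" using O[of k] q by simp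
    show ?thesis
      by (rule layout_list[OF m' D2_set(1) _ _ _ _ D2_set(2), of "lab i j l k 4 5 6 0 0 7"]) (use q in \<open>simp_all add: D2_vs_def D2_L_def K o o1 o4 q2 2 \<alpha>_swap\<close>)
  qed
qed

lemma layout_8:
  assumes m: "m = 8" and C5: "4 \<le> C 5" and C6: "4 \<le> C 6" and C7: "4 \<le> C 7"
  shows "layout D3_V D3_E"
proof -
  have m': "8 = m" using m by simp
  have ne: "6 \<noteq> (7::nat)" by simp
  have y: "y8 w 6 = 0" "y8 w 7 = 0" by (simp_all add: y8_def)
  note H = core_at[OF m' end_S8 ne y]
  have e: "J = gval w 8 S8 (y8 w) - (f 8)\<^sup>2 / 2"
    using H(1) J_P_at[OF m'] P_8[OF eq_refl[OF m'] C5 C6 C7] unfolding gval_S8 f_def[symmetric] by linarith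
  have X: "X i - X 8 = y8 w i + f 8 / 2" if "i < 8" for i by (rule H(2)[OF e that])
  have pen: "penergy S8 (y8 w) = penergy S8 X"
  proof (rule penergy_cong)
    fix i j assume "(i, j) \<in> set S8"
    hence "i < 8" "j < 8" using end_S8 by (auto simp: end_gadget_def)
    thus "y8 w i - y8 w j = X i - X j" using X[of i] X[of j] by linarith
  qed
  have en: "energy = penergy S8 X + (f 8)\<^sup>2 / 2" using H(3)[OF e] pen by simp
  have f: "0 < f 1" "0 < f 2" "0 < f 3" "0 < f 4" "0 < f 5" "0 < f 6" "0 < f 7" "0 < f 8" by (simp_all add: f_pos_at[OF m'])
  have g: "g 1 = 0" "g 2 = 0" "g 3 = 0" "g 5 = 0" "g 7 = 0" "g 8 = f 8 / 2"
    using X[of 0] X[of 1] X[of 2] X[of 3] X[of 4] X[of 5] X[of 6] X[of 7] by (simp_all add: g_at[OF m'] y8_def)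
  have p: "0 < g 4" "0 < g 6" "0 < g 8" using X[of 3] X[of 4] X[of 5] X[of 6] f by (simp_all add: g_at[OF m'] g y8_def f_def)
  have cmin: "4 \<le> cc 4 4" "4 \<le> cc 6 6" using c4 C6 by (simp_all add: C_def)
  have XX: "X 0 = X 1" "X 1 = X 2" "X 2 = X 3" "X 4 = X 5" "X 6 = X 7"
    using g by (simp_all add: g_at[OF m'])
  have gX: "X 3 - X 4 = g 4" "X 5 - X 6 = g 6" "X 7 - X 8 = g 8"
    by (simp_all add: g_at[OF m'])
  have "penergy S8 X = 4 * g 4 * g 4 + 4 * g 6 * g 6"
    unfolding gX[symmetric] by (simp add: S8_def K4_def XX[unfolded One_nat_def] power2_eq_square algebra_simps)
  moreover have "(f 8)\<^sup>2 / 2 = 2 * g 8 * g 8" by (simp add: g power2_eq_square)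
  moreover have "energy = cc 4 4 * g 4 * g 4 + 2 * cc 4 6 * g 4 * g 6 + 2 * cc 4 8 * g 4 * g 8 + cc 6 6 * g 6 * g 6 + 2 * cc 6 8 * g 6 * g 8 + cc 8 8 * g 8 * g 8"
    unfolding energy_at[OF m'] sum_iv using g by (simp add: c_sym[of 6 4] c_sym[of 8 4] c_sym[of 8 6])
  moreover have "cc 8 8 = 2" by (rule c_at[OF m'])
  ultimately have s: "(cc 4 4 - 4) * (g 4 * g 4) + 2 * (cc 4 6 * (g 4 * g 6)) + 2 * (cc 4 8 * (g 4 * g 8)) + (cc 6 6 - 4) * (g 6 * g 6) + 2 * (cc 6 8 * (g 6 * g 8)) = 0"
    using en by (simp add: algebra_simps)
  have n: "0 \<le> (cc 4 4 - 4) * (g 4 * g 4)" "0 \<le> cc 4 6 * (g 4 * g 6)" "0 \<le> cc 4 8 * (g 4 * g 8)" "0 \<le> (cc 6 6 - 4) * (g 6 * g 6)" "0 \<le> cc 6 8 * (g 6 * g 8)"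
    using g0 c0 cmin by (auto intro!: mult_nonneg_nonneg)
  have "(cc 4 4 - 4) * (g 4 * g 4) = 0" "cc 4 6 * (g 4 * g 6) = 0" "cc 4 8 * (g 4 * g 8) = 0" "(cc 6 6 - 4) * (g 6 * g 6) = 0" "cc 6 8 * (g 6 * g 8) = 0" using s n by linarith+
  hence K: "cn 4 4 = 4" "cn 4 6 = 0" "cn 4 8 = 0" "cn 6 6 = 4" "cn 6 8 = 0"
    using p by (simp_all add: cc_def)
  have k4_4: "cn 4 4 = \<alpha> 0 4 + \<alpha> 0 5 + \<alpha> 0 6 + \<alpha> 0 7 + \<alpha> 0 8 + \<alpha> (Suc 0) 4 + \<alpha> (Suc 0) 5 + \<alpha> (Suc 0) 6 + \<alpha> (Suc 0) 7 + \<alpha> (Suc 0) 8 + \<alpha> 2 4 + \<alpha> 2 5 + \<alpha> 2 6 + \<alpha> 2 7 + \<alpha> 2 8 + \<alpha> 3 4 + \<alpha> 3 5 + \<alpha> 3 6 + \<alpha> 3 7 + \<alpha> 3 8"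
    unfolding cn_at[OF m'] by (simp add: eval_nat_numeral)
  have k4_6: "cn 4 6 = \<alpha> 0 6 + \<alpha> 0 7 + \<alpha> 0 8 + \<alpha> (Suc 0) 6 + \<alpha> (Suc 0) 7 + \<alpha> (Suc 0) 8 + \<alpha> 2 6 + \<alpha> 2 7 + \<alpha> 2 8 + \<alpha> 3 6 + \<alpha> 3 7 + \<alpha> 3 8"
    unfolding cn_at[OF m'] by (simp add: eval_nat_numeral)
  have k4_8: "cn 4 8 = \<alpha> 0 8 + \<alpha> (Suc 0) 8 + \<alpha> 2 8 + \<alpha> 3 8"
    unfolding cn_at[OF m'] by (simp add: eval_nat_numeral)
  have k6_6: "cn 6 6 = \<alpha> 0 6 + \<alpha> 0 7 + \<alpha> 0 8 + \<alpha> (Suc 0) 6 + \<alpha> (Suc 0) 7 + \<alpha> (Suc 0) 8 + \<alpha> 2 6 + \<alpha> 2 7 + \<alpha> 2 8 + \<alpha> 3 6 + \<alpha> 3 7 + \<alpha> 3 8 + \<alpha> 4 6 + \<alpha> 4 7 + \<alpha> 4 8 + \<alpha> 5 6 + \<alpha> 5 7 + \<alpha> 5 8"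
    unfolding cn_at[OF m'] by (simp add: eval_nat_numeral)
  have k6_8: "cn 6 8 = \<alpha> 0 8 + \<alpha> (Suc 0) 8 + \<alpha> 2 8 + \<alpha> 3 8 + \<alpha> 4 8 + \<alpha> 5 8"
    unfolding cn_at[OF m'] by (simp add: eval_nat_numeral)
  have d0: "\<alpha> 0 (Suc 0) + \<alpha> 0 2 + \<alpha> 0 3 + \<alpha> 0 4 + \<alpha> 0 5 + \<alpha> 0 6 + \<alpha> 0 7 + \<alpha> 0 8 = 4"
    using deg_at(1)[OF m', of 0] unfolding row_iv by (simp add: \<alpha>_swap \<alpha>_sym[of 6 5])
  have d1: "\<alpha> 0 (Suc 0) + \<alpha> (Suc 0) 2 + \<alpha> (Suc 0) 3 + \<alpha> (Suc 0) 4 + \<alpha> (Suc 0) 5 + \<alpha> (Suc 0) 6 + \<alpha> (Suc 0) 7 + \<alpha> (Suc 0) 8 = 4"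
    using deg_at(1)[OF m', of 1] unfolding row_iv by (simp add: \<alpha>_swap \<alpha>_sym[of 6 5])
  have d2: "\<alpha> 0 2 + \<alpha> (Suc 0) 2 + \<alpha> 2 3 + \<alpha> 2 4 + \<alpha> 2 5 + \<alpha> 2 6 + \<alpha> 2 7 + \<alpha> 2 8 = 4"
    using deg_at(1)[OF m', of 2] unfolding row_iv by (simp add: \<alpha>_swap \<alpha>_sym[of 6 5])
  have d3: "\<alpha> 0 3 + \<alpha> (Suc 0) 3 + \<alpha> 2 3 + \<alpha> 3 4 + \<alpha> 3 5 + \<alpha> 3 6 + \<alpha> 3 7 + \<alpha> 3 8 = 4"
    using deg_at(1)[OF m', of 3] unfolding row_iv by (simp add: \<alpha>_swap \<alpha>_sym[of 6 5])
  have d4: "\<alpha> 0 4 + \<alpha> (Suc 0) 4 + \<alpha> 2 4 + \<alpha> 3 4 + \<alpha> 4 5 + \<alpha> 4 6 + \<alpha> 4 7 + \<alpha> 4 8 = 4"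
    using deg_at(1)[OF m', of 4] unfolding row_iv by (simp add: \<alpha>_swap \<alpha>_sym[of 6 5])
  have d5: "\<alpha> 0 5 + \<alpha> (Suc 0) 5 + \<alpha> 2 5 + \<alpha> 3 5 + \<alpha> 4 5 + \<alpha> 5 6 + \<alpha> 5 7 + \<alpha> 5 8 = 4"
    using deg_at(1)[OF m', of 5] unfolding row_iv by (simp add: \<alpha>_swap \<alpha>_sym[of 6 5])
  have d6: "\<alpha> 0 6 + \<alpha> (Suc 0) 6 + \<alpha> 2 6 + \<alpha> 3 6 + \<alpha> 4 6 + \<alpha> 5 6 + \<alpha> 6 7 + \<alpha> 6 8 = 4"
    using deg_at(1)[OF m', of 6] unfolding row_iv by (simp add: \<alpha>_swap \<alpha>_sym[of 6 5])
  have d7: "\<alpha> 0 7 + \<alpha> (Suc 0) 7 + \<alpha> 2 7 + \<alpha> 3 7 + \<alpha> 4 7 + \<alpha> 5 7 + \<alpha> 6 7 + \<alpha> 7 8 = 4"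
    using deg_at(1)[OF m', of 7] unfolding row_iv by (simp add: \<alpha>_swap \<alpha>_sym[of 6 5])
  have d8: "\<alpha> 0 8 + \<alpha> (Suc 0) 8 + \<alpha> 2 8 + \<alpha> 3 8 + \<alpha> 4 8 + \<alpha> 5 8 + \<alpha> 6 8 + \<alpha> 7 8 = 2"
    using deg_at(2)[OF m'] unfolding row_iv by (simp add: \<alpha>_swap \<alpha>_sym[of 6 5])
  note D = d0 d1 d2 d3 d4 d5 d6 d7 d8
  note kk = K(1)[unfolded k4_4] K(2)[unfolded k4_6] K(3)[unfolded k4_8] K(4)[unfolded k6_6] K(5)[unfolded k6_8]
  have z: "\<alpha> 0 6 = 0" "\<alpha> 0 7 = 0" "\<alpha> 0 8 = 0" "\<alpha> (Suc 0) 6 = 0" "\<alpha> (Suc 0) 7 = 0" "\<alpha> (Suc 0) 8 = 0" "\<alpha> 2 6 = 0" "\<alpha> 2 7 = 0" "\<alpha> 2 8 = 0" "\<alpha> 3 6 = 0" "\<alpha> 3 7 = 0" "\<alpha> 3 8 = 0" "\<alpha> 4 8 = 0" "\<alpha> 5 8 = 0" using kk(2,5) by (simp_all only: add_is_0)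
  have k4: "\<alpha> 0 (Suc 0) = 1 \<and> \<alpha> 0 2 = 1 \<and> \<alpha> 0 3 = 1 \<and> \<alpha> (Suc 0) 2 = 1 \<and> \<alpha> (Suc 0) 3 = 1 \<and> \<alpha> 2 3 = 1"
    by (rule full6[OF \<alpha>_le \<alpha>_le \<alpha>_le \<alpha>_le \<alpha>_le \<alpha>_le]) (use D(1-4) kk(1) z in linarith)
  have o1: "\<alpha> 6 8 = 1 \<and> \<alpha> 7 8 = 1"
    by (rule full2[OF \<alpha>_le \<alpha>_le]) (use D(9) z in simp)
  have o4: "\<alpha> 4 6 = 1 \<and> \<alpha> 4 7 = 1 \<and> \<alpha> 5 6 = 1 \<and> \<alpha> 5 7 = 1"
    by (rule full4[OF \<alpha>_le \<alpha>_le \<alpha>_le \<alpha>_le]) (use kk(4) z in simp)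
  have o: "\<alpha> 6 7 = 1" using D(7) z o1 o4 by simp
  have o5: "\<alpha> 4 5 = 0" using D(5,6) kk(1) z o4 by linarith
  have o2: "\<alpha> 0 4 + \<alpha> (Suc 0) 4 + \<alpha> 2 4 + \<alpha> 3 4 = 2" using D(5) o5 o4 z by simp
  have o3: "\<alpha> 0 4 + \<alpha> 0 5 = 1" "\<alpha> (Suc 0) 4 + \<alpha> (Suc 0) 5 = 1" "\<alpha> 2 4 + \<alpha> 2 5 = 1" "\<alpha> 3 4 + \<alpha> 3 5 = 1" using D(1-4) k4 z by simp_all
  have K: "\<alpha> r s = 1" if "r < 4" "s < 4" "r \<noteq> s" for r s
    using less_4[OF that(1)] less_4[OF that(2)] that(3) k4 by (elim disjE) (simp_all add: \<alpha>_swap)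
  have O: "\<alpha> r 4 + \<alpha> r 5 = 1" if "r < 4" for r
    using less_4[OF that] o3 by (elim disjE) simp_all
  obtain i j k l where q: "i < 4" "j < 4" "k < 4" "l < 4" "distinct [i, j, k, l]"
      "\<alpha> i 4 = 1" "\<alpha> j 4 = 1" "\<alpha> k 4 = 0" "\<alpha> l 4 = 0"
    by (rule pick4[of "\<lambda>r. \<alpha> r 4", OF \<alpha>_le o2])
  have q2: "\<alpha> k 5 = 1" "\<alpha> l 5 = 1" using O[of k] O[of l] q by simp_all
  show ?thesis
    by (rule layout_list[OF m' D3_set(1) _ _ _ _ D3_set(2), of "lab i j k l 4 5 6 7 0 8"]) (use q in \<open>simp_all add: D3_vs_def D3_L_def K o o1 o4 q2 \<alpha>_swap\<close>)
qed

lemma layout_9: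
  assumes m: "m = 9" and fr: "free 5"
  shows "layout D4_V D4_E"
proof -
  have m': "9 = m" using m by simp
  have ne: "7 \<noteq> (8::nat)" by simp
  have y: "y9 w 7 = 0" "y9 w 8 = 0" by (simp_all add: y9_def lev9_def)
  note H = core_at[OF m' end_S9 ne y]
  have C7: "4 \<le> C 7" using fr eq_refl[OF m'] unfolding free_def by simp
  have e: "J = gval w 9 S9 (y9 w) - (f 9)\<^sup>2 / 2"
    using H(1) J_P_at[OF m'] P_9[OF eq_refl[OF m'] fr] unfolding gval_S9 f_def[symmetric] by linarith
  have X: "X i - X 9 = y9 w i + f 9 / 2" if "i < 9" for i by (rule H(2)[OF e that])
  have pen: "penergy S9 (y9 w) = penergy S9 X"
  proof (rule penergy_cong)
    fix i j assume "(i, j) \<in> set S9"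
    hence "i < 9" "j < 9" using end_S9 by (auto simp: end_gadget_def)
    thus "y9 w i - y9 w j = X i - X j" using X[of i] X[of j] by linarith
  qed
  have en: "energy = penergy S9 X + (f 9)\<^sup>2 / 2" using H(3)[OF e] pen by simp
  have f: "0 < f 1" "0 < f 2" "0 < f 3" "0 < f 4" "0 < f 5" "0 < f 6" "0 < f 7" "0 < f 8" "0 < f 9" by (simp_all add: f_pos_at[OF m'])
  have g: "g 1 = 0" "g 2 = 0" "g 4 = 0" "g 6 = 0" "g 8 = 0" "g 9 = f 9 / 2"
    using X[of 0] X[of 1] X[of 2] X[of 3] X[of 4] X[of 5] X[of 6] X[of 7] X[of 8] by (simp_all add: g_at[OF m'] y9_def lev9_def)
  have p: "0 < g 3" "0 < g 5" "0 < g 7" "0 < g 9" using X[of 2] X[of 3] X[of 4] X[of 5] X[of 6] X[of 7] f by (simp_all add: g_at[OF m'] g y9_def lev9_def f_def)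
  \<comment> \<open>Cut 5 enters with the general bound 2 only; equality will show that it is a
    2-edge cut.\<close>
  have cmin: "6 \<le> cc 3 3" "2 \<le> cc 5 5" "4 \<le> cc 7 7" using c3 c_ge[of 5] m5 C7 by (auto simp: C_def)
  have XX: "X 0 = X 1" "X 1 = X 2" "X 3 = X 4" "X 5 = X 6" "X 7 = X 8"
    using g by (simp_all add: g_at[OF m'])
  have gX: "X 2 - X 3 = g 3" "X 4 - X 5 = g 5" "X 6 - X 7 = g 7" "X 8 - X 9 = g 9"
    by (simp_all add: g_at[OF m'])
  have "penergy S9 X = 6 * g 3 * g 3 + 2 * g 5 * g 5 + 4 * g 7 * g 7"
    unfolding gX[symmetric] by (simp add: S9_def S5_def XX[unfolded One_nat_def] power2_eq_square algebra_simps)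
  moreover have "(f 9)\<^sup>2 / 2 = 2 * g 9 * g 9" by (simp add: g power2_eq_square)
  moreover have "energy = cc 3 3 * g 3 * g 3 + 2 * cc 3 5 * g 3 * g 5 + 2 * cc 3 7 * g 3 * g 7 + 2 * cc 3 9 * g 3 * g 9 + cc 5 5 * g 5 * g 5 + 2 * cc 5 7 * g 5 * g 7 + 2 * cc 5 9 * g 5 * g 9 + cc 7 7 * g 7 * g 7 + 2 * cc 7 9 * g 7 * g 9 + cc 9 9 * g 9 * g 9"
    unfolding energy_at[OF m'] sum_iv using g by (simp add: c_sym[of 5 3] c_sym[of 7 3] c_sym[of 9 3] c_sym[of 7 5] c_sym[of 9 5] c_sym[of 9 7])
  moreover have "cc 9 9 = 2" by (rule c_at[OF m'])
  ultimately have s: "(cc 3 3 - 6) * (g 3 * g 3) + 2 * (cc 3 5 * (g 3 * g 5)) + 2 * (cc 3 7 * (g 3 * g 7)) + 2 * (cc 3 9 * (g 3 * g 9)) + (cc 5 5 - 2) * (g 5 * g 5) + 2 * (cc 5 7 * (g 5 * g 7)) + 2 * (cc 5 9 * (g 5 * g 9)) + (cc 7 7 - 4) * (g 7 * g 7) + 2 * (cc 7 9 * (g 7 * g 9)) = 0"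
    using en by (simp add: algebra_simps)
  have n: "0 \<le> (cc 3 3 - 6) * (g 3 * g 3)" "0 \<le> cc 3 5 * (g 3 * g 5)" "0 \<le> cc 3 7 * (g 3 * g 7)" "0 \<le> cc 3 9 * (g 3 * g 9)" "0 \<le> (cc 5 5 - 2) * (g 5 * g 5)" "0 \<le> cc 5 7 * (g 5 * g 7)" "0 \<le> cc 5 9 * (g 5 * g 9)" "0 \<le> (cc 7 7 - 4) * (g 7 * g 7)" "0 \<le> cc 7 9 * (g 7 * g 9)"
    using g0 c0 cmin by (auto intro!: mult_nonneg_nonneg)
  have "(cc 3 3 - 6) * (g 3 * g 3) = 0" "cc 3 5 * (g 3 * g 5) = 0" "cc 3 7 * (g 3 * g 7) = 0" "cc 3 9 * (g 3 * g 9) = 0" "(cc 5 5 - 2) * (g 5 * g 5) = 0" "cc 5 7 * (g 5 * g 7) = 0" "cc 5 9 * (g 5 * g 9) = 0" "(cc 7 7 - 4) * (g 7 * g 7) = 0" "cc 7 9 * (g 7 * g 9) = 0" using s n by linarith+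
  hence K: "cn 3 3 = 6" "cn 3 5 = 0" "cn 3 7 = 0" "cn 3 9 = 0" "cn 5 5 = 2" "cn 5 7 = 0" "cn 5 9 = 0" "cn 7 7 = 4" "cn 7 9 = 0"
    using p by (simp_all add: cc_def)
  have k3_3: "cn 3 3 = \<alpha> 0 3 + \<alpha> 0 4 + \<alpha> 0 5 + \<alpha> 0 6 + \<alpha> 0 7 + \<alpha> 0 8 + \<alpha> 0 9 + \<alpha> (Suc 0) 3 + \<alpha> (Suc 0) 4 + \<alpha> (Suc 0) 5 + \<alpha> (Suc 0) 6 + \<alpha> (Suc 0) 7 + \<alpha> (Suc 0) 8 + \<alpha> (Suc 0) 9 + \<alpha> 2 3 + \<alpha> 2 4 + \<alpha> 2 5 + \<alpha> 2 6 + \<alpha> 2 7 + \<alpha> 2 8 + \<alpha> 2 9"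
    unfolding cn_at[OF m'] by (simp add: eval_nat_numeral)
  have k3_5: "cn 3 5 = \<alpha> 0 5 + \<alpha> 0 6 + \<alpha> 0 7 + \<alpha> 0 8 + \<alpha> 0 9 + \<alpha> (Suc 0) 5 + \<alpha> (Suc 0) 6 + \<alpha> (Suc 0) 7 + \<alpha> (Suc 0) 8 + \<alpha> (Suc 0) 9 + \<alpha> 2 5 + \<alpha> 2 6 + \<alpha> 2 7 + \<alpha> 2 8 + \<alpha> 2 9"
    unfolding cn_at[OF m'] by (simp add: eval_nat_numeral)
  have k3_7: "cn 3 7 = \<alpha> 0 7 + \<alpha> 0 8 + \<alpha> 0 9 + \<alpha> (Suc 0) 7 + \<alpha> (Suc 0) 8 + \<alpha> (Suc 0) 9 + \<alpha> 2 7 + \<alpha> 2 8 + \<alpha> 2 9"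
    unfolding cn_at[OF m'] by (simp add: eval_nat_numeral)
  have k3_9: "cn 3 9 = \<alpha> 0 9 + \<alpha> (Suc 0) 9 + \<alpha> 2 9"
    unfolding cn_at[OF m'] by (simp add: eval_nat_numeral)
  have k5_5: "cn 5 5 = \<alpha> 0 5 + \<alpha> 0 6 + \<alpha> 0 7 + \<alpha> 0 8 + \<alpha> 0 9 + \<alpha> (Suc 0) 5 + \<alpha> (Suc 0) 6 + \<alpha> (Suc 0) 7 + \<alpha> (Suc 0) 8 + \<alpha> (Suc 0) 9 + \<alpha> 2 5 + \<alpha> 2 6 + \<alpha> 2 7 + \<alpha> 2 8 + \<alpha> 2 9 + \<alpha> 3 5 + \<alpha> 3 6 + \<alpha> 3 7 + \<alpha> 3 8 + \<alpha> 3 9 + \<alpha> 4 5 + \<alpha> 4 6 + \<alpha> 4 7 + \<alpha> 4 8 + \<alpha> 4 9"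
    unfolding cn_at[OF m'] by (simp add: eval_nat_numeral)
  have k5_7: "cn 5 7 = \<alpha> 0 7 + \<alpha> 0 8 + \<alpha> 0 9 + \<alpha> (Suc 0) 7 + \<alpha> (Suc 0) 8 + \<alpha> (Suc 0) 9 + \<alpha> 2 7 + \<alpha> 2 8 + \<alpha> 2 9 + \<alpha> 3 7 + \<alpha> 3 8 + \<alpha> 3 9 + \<alpha> 4 7 + \<alpha> 4 8 + \<alpha> 4 9"
    unfolding cn_at[OF m'] by (simp add: eval_nat_numeral)
  have k5_9: "cn 5 9 = \<alpha> 0 9 + \<alpha> (Suc 0) 9 + \<alpha> 2 9 + \<alpha> 3 9 + \<alpha> 4 9"
    unfolding cn_at[OF m'] by (simp add: eval_nat_numeral)
  have k7_7: "cn 7 7 = \<alpha> 0 7 + \<alpha> 0 8 + \<alpha> 0 9 + \<alpha> (Suc 0) 7 + \<alpha> (Suc 0) 8 + \<alpha> (Suc 0) 9 + \<alpha> 2 7 + \<alpha> 2 8 + \<alpha> 2 9 + \<alpha> 3 7 + \<alpha> 3 8 + \<alpha> 3 9 + \<alpha> 4 7 + \<alpha> 4 8 + \<alpha> 4 9 + \<alpha> 5 7 + \<alpha> 5 8 + \<alpha> 5 9 + \<alpha> 6 7 + \<alpha> 6 8 + \<alpha> 6 9"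
    unfolding cn_at[OF m'] by (simp add: eval_nat_numeral)
  have k7_9: "cn 7 9 = \<alpha> 0 9 + \<alpha> (Suc 0) 9 + \<alpha> 2 9 + \<alpha> 3 9 + \<alpha> 4 9 + \<alpha> 5 9 + \<alpha> 6 9"
    unfolding cn_at[OF m'] by (simp add: eval_nat_numeral)
  have d0: "\<alpha> 0 (Suc 0) + \<alpha> 0 2 + \<alpha> 0 3 + \<alpha> 0 4 + \<alpha> 0 5 + \<alpha> 0 6 + \<alpha> 0 7 + \<alpha> 0 8 + \<alpha> 0 9 = 4"
    using deg_at(1)[OF m', of 0] unfolding row_iv by (simp add: \<alpha>_swap \<alpha>_sym[of 6 5])
  have d1: "\<alpha> 0 (Suc 0) + \<alpha> (Suc 0) 2 + \<alpha> (Suc 0) 3 + \<alpha> (Suc 0) 4 + \<alpha> (Suc 0) 5 + \<alpha> (Suc 0) 6 + \<alpha> (Suc 0) 7 + \<alpha> (Suc 0) 8 + \<alpha> (Suc 0) 9 = 4"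
    using deg_at(1)[OF m', of 1] unfolding row_iv by (simp add: \<alpha>_swap \<alpha>_sym[of 6 5])
  have d2: "\<alpha> 0 2 + \<alpha> (Suc 0) 2 + \<alpha> 2 3 + \<alpha> 2 4 + \<alpha> 2 5 + \<alpha> 2 6 + \<alpha> 2 7 + \<alpha> 2 8 + \<alpha> 2 9 = 4"
    using deg_at(1)[OF m', of 2] unfolding row_iv by (simp add: \<alpha>_swap \<alpha>_sym[of 6 5])
  have d3: "\<alpha> 0 3 + \<alpha> (Suc 0) 3 + \<alpha> 2 3 + \<alpha> 3 4 + \<alpha> 3 5 + \<alpha> 3 6 + \<alpha> 3 7 + \<alpha> 3 8 + \<alpha> 3 9 = 4"
    using deg_at(1)[OF m', of 3] unfolding row_iv by (simp add: \<alpha>_swap \<alpha>_sym[of 6 5])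
  have d4: "\<alpha> 0 4 + \<alpha> (Suc 0) 4 + \<alpha> 2 4 + \<alpha> 3 4 + \<alpha> 4 5 + \<alpha> 4 6 + \<alpha> 4 7 + \<alpha> 4 8 + \<alpha> 4 9 = 4"
    using deg_at(1)[OF m', of 4] unfolding row_iv by (simp add: \<alpha>_swap \<alpha>_sym[of 6 5])
  have d5: "\<alpha> 0 5 + \<alpha> (Suc 0) 5 + \<alpha> 2 5 + \<alpha> 3 5 + \<alpha> 4 5 + \<alpha> 5 6 + \<alpha> 5 7 + \<alpha> 5 8 + \<alpha> 5 9 = 4"
    using deg_at(1)[OF m', of 5] unfolding row_iv by (simp add: \<alpha>_swap \<alpha>_sym[of 6 5])
  have d6: "\<alpha> 0 6 + \<alpha> (Suc 0) 6 + \<alpha> 2 6 + \<alpha> 3 6 + \<alpha> 4 6 + \<alpha> 5 6 + \<alpha> 6 7 + \<alpha> 6 8 + \<alpha> 6 9 = 4"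
    using deg_at(1)[OF m', of 6] unfolding row_iv by (simp add: \<alpha>_swap \<alpha>_sym[of 6 5])
  have d7: "\<alpha> 0 7 + \<alpha> (Suc 0) 7 + \<alpha> 2 7 + \<alpha> 3 7 + \<alpha> 4 7 + \<alpha> 5 7 + \<alpha> 6 7 + \<alpha> 7 8 + \<alpha> 7 9 = 4"
    using deg_at(1)[OF m', of 7] unfolding row_iv by (simp add: \<alpha>_swap \<alpha>_sym[of 6 5])
  have d8: "\<alpha> 0 8 + \<alpha> (Suc 0) 8 + \<alpha> 2 8 + \<alpha> 3 8 + \<alpha> 4 8 + \<alpha> 5 8 + \<alpha> 6 8 + \<alpha> 7 8 + \<alpha> 8 9 = 4"
    using deg_at(1)[OF m', of 8] unfolding row_iv by (simp add: \<alpha>_swap \<alpha>_sym[of 6 5])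
  have d9: "\<alpha> 0 9 + \<alpha> (Suc 0) 9 + \<alpha> 2 9 + \<alpha> 3 9 + \<alpha> 4 9 + \<alpha> 5 9 + \<alpha> 6 9 + \<alpha> 7 9 + \<alpha> 8 9 = 2"
    using deg_at(2)[OF m'] unfolding row_iv by (simp add: \<alpha>_swap \<alpha>_sym[of 6 5])
  note D = d0 d1 d2 d3 d4 d5 d6 d7 d8 d9
  note kk = K(1)[unfolded k3_3] K(2)[unfolded k3_5] K(3)[unfolded k3_7] K(4)[unfolded k3_9] K(5)[unfolded k5_5] K(6)[unfolded k5_7] K(7)[unfolded k5_9] K(8)[unfolded k7_7] K(9)[unfolded k7_9]
  have z: "\<alpha> 0 5 = 0" "\<alpha> 0 6 = 0" "\<alpha> 0 7 = 0" "\<alpha> 0 8 = 0" "\<alpha> 0 9 = 0" "\<alpha> (Suc 0) 5 = 0" "\<alpha> (Suc 0) 6 = 0" "\<alpha> (Suc 0) 7 = 0" "\<alpha> (Suc 0) 8 = 0" "\<alpha> (Suc 0) 9 = 0" "\<alpha> 2 5 = 0" "\<alpha> 2 6 = 0" "\<alpha> 2 7 = 0" "\<alpha> 2 8 = 0" "\<alpha> 2 9 = 0" "\<alpha> 3 7 = 0" "\<alpha> 3 8 = 0" "\<alpha> 3 9 = 0" "\<alpha> 4 7 = 0" "\<alpha> 4 8 = 0" "\<alpha> 4 9 = 0" "\<alpha> 5 9 = 0" "\<alpha> 6 9 = 0" using kk(2,6,9) by (simp_all only: add_is_0)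
  have o1: "\<alpha> 0 3 = 1 \<and> \<alpha> 0 4 = 1 \<and> \<alpha> (Suc 0) 3 = 1 \<and> \<alpha> (Suc 0) 4 = 1 \<and> \<alpha> 2 3 = 1 \<and> \<alpha> 2 4 = 1"
    by (rule full6[OF \<alpha>_le \<alpha>_le \<alpha>_le \<alpha>_le \<alpha>_le \<alpha>_le]) (use kk(1) z in simp)
  have o2: "\<alpha> 0 (Suc 0) = 1 \<and> \<alpha> 0 2 = 1"
    by (rule full2[OF \<alpha>_le \<alpha>_le]) (use D(1) o1 z in simp)
  have o3: "\<alpha> 0 (Suc 0) = 1 \<and> \<alpha> (Suc 0) 2 = 1"
    by (rule full2[OF \<alpha>_le \<alpha>_le]) (use D(2) o1 z in simp)
  have o4: "\<alpha> 5 7 = 1 \<and> \<alpha> 5 8 = 1 \<and> \<alpha> 6 7 = 1 \<and> \<alpha> 6 8 = 1"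
    by (rule full4[OF \<alpha>_le \<alpha>_le \<alpha>_le \<alpha>_le]) (use kk(8) z in simp)
  have o5: "\<alpha> 7 9 = 1 \<and> \<alpha> 8 9 = 1"
    by (rule full2[OF \<alpha>_le \<alpha>_le]) (use D(10) z in simp)
  have o6: "\<alpha> 7 8 = 1" using D(8) z o4 o5 by simp
  have o7: "\<alpha> 3 4 = 0" using D(4,5) kk(5) z o1 by linarith
  have o8: "\<alpha> 3 5 + \<alpha> 3 6 = 1" "\<alpha> 4 5 + \<alpha> 4 6 = 1" using D(4,5) o1 o7 z by simp_all
  have o9: "\<alpha> 5 6 = 1" using D(6,7) o8 o4 z by linarith
  have o10: "\<alpha> 3 5 + \<alpha> 4 5 = 1" using D(6) o9 o4 z by simp
  \<comment> \<open>The edges of cut 5 match 3, 4 with 5, 6. The second matching is the first one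
    with \<open>Lf\<close> and \<open>Lg\<close> exchanged.\<close>
  from o8 o10 consider "\<alpha> 3 5 = 1" "\<alpha> 4 6 = 1" | "\<alpha> 3 6 = 1" "\<alpha> 4 5 = 1" by linarith
  thus ?thesis
  proof cases
    case 1
    show ?thesis
      by (rule layout_list[OF m' D4_set(1) _ _ _ _ D4_set(2), of "lab 0 1 2 3 4 5 6 7 8 9"]) (simp_all add: D4_vs_def D4_L_def o1 o2 o3 o4 o5 o6 o9 1 \<alpha>_swap \<alpha>_sym[of 6 5])
  next
    case 2
    show ?thesis
      by (rule layout_list[OF m' D4_set(1) _ _ _ _ D4_set(2), of "lab 0 1 2 3 4 6 5 7 8 9"]) (simp_all add: D4_vs_def D4_L_def o1 o2 o3 o4 o5 o6 o9 2 \<alpha>_swap \<alpha>_sym[of 6 5])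
  qed
qed

theorem layouts: "layout D0_V D0_E \<or> layout D1_V D1_E \<or> layout D2_V D2_E \<or> layout D3_V D3_E \<or> layout D4_V D4_E"
  using chain_main not_strong layout_5 layout_6 layout_7 layout_8 layout_9 by blast

end

section \<open>The Laplacian form and algebraic connectivity\<close>

definition adj :: "nat set set \<Rightarrow> nat \<Rightarrow> nat \<Rightarrow> real" where
  "adj E i j = of_bool ({i, j} \<in> E)"

definition lap :: "nat \<Rightarrow> nat set set \<Rightarrow> (nat \<Rightarrow> real) \<Rightarrow> nat \<Rightarrow> real" where
  "lap n E z i = (\<Sum>j<n. adj E i j * (z i - z j))"

definition qform :: "nat \<Rightarrow> nat set set \<Rightarrow> (nat \<Rightarrow> real) \<Rightarrow> real" where
  "qform n E z = (\<Sum>i<n. \<Sum>j<n. adj E i j * (z i - z j)\<^sup>2) / 2"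

definition ip :: "nat \<Rightarrow> (nat \<Rightarrow> real) \<Rightarrow> (nat \<Rightarrow> real) \<Rightarrow> real" where
  "ip n y z = (\<Sum>i<n. y i * z i)"

lemma adj_sym: "adj E i j = adj E j i" by (simp add: adj_def insert_commute)

lemma ip_nonneg: "0 \<le> ip n z z" by (auto simp: ip_def intro: sum_nonneg)
lemma ip_zero: "ip n z z = 0 \<Longrightarrow> i < n \<Longrightarrow> z i = 0"
  unfolding ip_def by (subst (asm) sum_nonneg_eq_0_iff) auto

lemma qform_nonneg: "0 \<le> qform n E z"
  unfolding qform_def adj_def by (auto intro!: sum_nonneg divide_nonneg_nonneg)

lemma ip_lap: "ip n y (lap n E z) = (\<Sum>i<n. \<Sum>j<n. adj E i j * (y i - y j) * (z i - z j)) / 2"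
proof -
  have 1: "ip n y (lap n E z) = (\<Sum>i<n. \<Sum>j<n. adj E i j * y i * (z i - z j))"
    unfolding ip_def lap_def by (simp add: sum_distrib_left algebra_simps)
  also have "\<dots> = (\<Sum>j<n. \<Sum>i<n. adj E i j * y i * (z i - z j))" by (rule sum.swap)
  also have "\<dots> = (\<Sum>i<n. \<Sum>j<n. - (adj E i j * y j * (z i - z j)))"
    by (intro sum.cong refl) (simp add: adj_sym algebra_simps)
  finally have 2: "ip n y (lap n E z) = (\<Sum>i<n. \<Sum>j<n. - (adj E i j * y j * (z i - z j)))" .
  have "2 * ip n y (lap n E z) = (\<Sum>i<n. \<Sum>j<n. adj E i j * (y i - y j) * (z i - z j))"
    unfolding mult_2 by (subst (1) 1, subst 2) (simp add: sum.distrib[symmetric] algebra_simps)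
  thus ?thesis by simp
qed

lemma qform_ip: "qform n E z = ip n z (lap n E z)"
  unfolding ip_lap qform_def by (simp add: power2_eq_square mult.assoc)

lemma ip_lap_sym: "ip n y (lap n E z) = ip n z (lap n E y)"
  unfolding ip_lap by (simp add: mult.assoc mult.commute mult.left_commute)

lemma lap_add: "lap n E (\<lambda>i. y i + z i) i = lap n E y i + lap n E z i"
  unfolding lap_def by (simp add: algebra_simps sum.distrib sum_subtractf)
lemma lap_scale: "lap n E (\<lambda>i. t * z i) i = t * lap n E z i"
  unfolding lap_def by (simp add: algebra_simps sum_distrib_left)

lemma lap_sum: "(\<Sum>i<n. lap n E z i) = 0"
proof -
  have "ip n (\<lambda>_. 1) (lap n E z) = 0" unfolding ip_lap by simp
  thus ?thesis by (simp add: ip_def)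
qed

lemma qform_shift: "qform n E (\<lambda>i. z i + c) = qform n E z" by (simp add: qform_def)

lemma qform_cong: "(\<And>i. i < n \<Longrightarrow> y i = z i) \<Longrightarrow> qform n E y = qform n E z"
  unfolding qform_def by (auto intro!: arg_cong[where f = "\<lambda>x. x / 2"] sum.cong)

lemma qform_add: "qform n E (\<lambda>i. y i + t * d i) = qform n E y + 2 * t * ip n d (lap n E y) + t\<^sup>2 * qform n E d"
proof -
  have "ip n (\<lambda>i. y i + t * d i) (lap n E (\<lambda>i. y i + t * d i)) =
     ip n y (lap n E y) + t * ip n d (lap n E y) + t * (ip n y (lap n E d)) + t * t * ip n d (lap n E d)"
    unfolding ip_def lap_add lap_scale by (simp add: algebra_simps sum.distrib sum_distrib_left)
  thus ?thesis unfolding qform_ip ip_lap_sym[of n y E d] by (simp add: power2_eq_square)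
qed

lemma ip_quad: "ip n (\<lambda>i. y i + t * d i) (\<lambda>i. y i + t * d i) = ip n y y + 2 * t * ip n d y + t\<^sup>2 * ip n d d"
  unfolding ip_def by (simp add: algebra_simps sum.distrib sum_distrib_left power2_eq_square)

section \<open>Minimisers of the Rayleigh quotient\<close>

lemma linear_zero:
  fixes a b :: real
  assumes "\<And>t. 0 \<le> 2 * t * a + t\<^sup>2 * b" shows "a = 0"
proof (rule ccontr)
  assume a: "a \<noteq> 0"
  \<comment> \<open>A small step against the sign of \<open>a\<close>; the added 1 keeps the
    denominator positive.\<close>
  define t where "t = - a / (\<bar>b\<bar> + 1)"
  have "0 \<le> 2 * t * a + t\<^sup>2 * b" by (rule assms)
  also have "\<dots> \<le> 2 * t * a + t\<^sup>2 * (\<bar>b\<bar> + 1)" by (intro add_left_mono mult_left_mono) auto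
  also have "\<dots> = - a\<^sup>2 / (\<bar>b\<bar> + 1)" unfolding t_def by (simp add: power2_eq_square divide_simps)
  also have "\<dots> < 0" using a by (simp add: divide_neg_pos add_nonneg_pos)
  finally show False by simp
qed

text \<open>The first-order condition makes the residual \<open>r\<close> orthogonal to all vectors
  of sum zero. It has sum zero itself, so it vanishes.\<close>

lemma minimiser_eigen:
  assumes min: "\<And>z. (\<Sum>i<n. z i) = 0 \<Longrightarrow> \<nu> * ip n z z \<le> qform n E z"
    and y: "(\<Sum>i<n. y i) = 0" "qform n E y = \<nu> * ip n y y" and i: "i < n"
  shows "lap n E y i = \<nu> * y i"
proof -
  define r where "r i = lap n E y i - \<nu> * y i" for i
  have ort: "ip n d r = 0" if d: "(\<Sum>i<n. d i) = 0" for d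
  proof (rule linear_zero)
    fix t :: real
    have "\<nu> * ip n (\<lambda>i. y i + t * d i) (\<lambda>i. y i + t * d i) \<le> qform n E (\<lambda>i. y i + t * d i)"
      by (rule min) (use y d in \<open>simp add: sum.distrib sum_distrib_left[symmetric]\<close>)
    moreover have r: "ip n d r = ip n d (lap n E y) - \<nu> * ip n d y"
      unfolding ip_def r_def by (simp add: algebra_simps sum_subtractf sum_distrib_left)
    ultimately show "0 \<le> 2 * t * ip n d r + t\<^sup>2 * (qform n E d - \<nu> * ip n d d)"
      unfolding qform_add ip_quad y(2) r by (simp add: algebra_simps)
  qed
  have sr: "(\<Sum>i<n. r i) = 0" unfolding r_def using y(1) by (simp add: sum_subtractf lap_sum sum_distrib_left[symmetric])
  have "ip n r r = 0" by (rule ort[OF sr])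
  hence "r i = 0" using ip_zero i by blast
  thus ?thesis by (simp add: r_def)
qed

lemma qform_zero_adj:
  assumes "qform n E z = 0" "i < n" "j < n" "{i, j} \<in> E" shows "z i = z j"
proof -
  have "(\<Sum>i<n. \<Sum>j<n. adj E i j * (z i - z j)\<^sup>2) = 0" using assms(1) by (simp add: qform_def)
  moreover have "\<And>i. i < n \<Longrightarrow> 0 \<le> (\<Sum>j<n. adj E i j * (z i - z j)\<^sup>2)" by (auto intro!: sum_nonneg simp: adj_def)
  ultimately have "(\<Sum>j<n. adj E i j * (z i - z j)\<^sup>2) = 0" using assms(2) by (subst (asm) sum_nonneg_eq_0_iff) auto
  hence "adj E i j * (z i - z j)\<^sup>2 = 0" using assms(3) by (subst (asm) sum_nonneg_eq_0_iff) (auto simp: adj_def)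
  thus ?thesis using assms(4) by (simp add: adj_def)
qed

lemma qform_zero_const:
  assumes "qform n E z = 0" "connected_graph n E" "i < n" "j < n" shows "z i = z j"
proof -
  have "reach_in E {0..<n} i j" using assms unfolding connected_graph_def connected_on_def by auto
  thus ?thesis unfolding reach_in_def
    by (induction rule: rtranclp_induct) (auto dest: qform_zero_adj[OF assms(1)])
qed

text \<open>Vectors are functions on all natural numbers; pinning the coordinates from
  \<open>n\<close> on to 0 makes the box a product of compact sets.\<close>

lemma compact_box: "compact {z :: nat \<Rightarrow> real. \<forall>i. z i \<in> (if i < n then {-1..1} else {0})}"
proof -
  have "compactin (product_topology (\<lambda>i. euclidean) UNIV) (PiE UNIV (\<lambda>i::nat. if i < n then {-1..1::real} else {0}))"
    unfolding compactin_PiE by auto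
  hence "compactin (euclidean :: (nat \<Rightarrow> real) topology) (PiE UNIV (\<lambda>i::nat. if i < n then {-1..1::real} else {0}))"
    unfolding euclidean_product_topology[symmetric] by simp
  moreover have "PiE UNIV (\<lambda>i::nat. if i < n then {-1..1::real} else {0}) = {z. \<forall>i. z i \<in> (if i < n then {-1..1} else {0})}"
    by (auto simp: PiE_def Pi_def extensional_def)
  ultimately show ?thesis unfolding compactin_euclidean_iff by (simp only:)
qed

lemma rayleigh_attained:
  assumes n: "2 \<le> n"
  shows "\<exists>y. (\<Sum>i<n. y i) = 0 \<and> ip n y y = 1 \<and> (\<forall>z. (\<Sum>i<n. z i) = 0 \<longrightarrow> qform n E y * ip n z z \<le> qform n E z)"
proof -
  define S where "S = {z :: nat \<Rightarrow> real. \<forall>i. z i \<in> (if i < n then {-1..1} else {0})} \<inter> {z. (\<Sum>i<n. z i) = 0 \<and> ip n z z = 1}"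
  have co: "continuous_on UNIV (\<lambda>z :: nat \<Rightarrow> real. z i)" for i by (rule continuous_on_product_coordinates)
  have c1: "continuous_on UNIV (\<lambda>z :: nat \<Rightarrow> real. \<Sum>i<n. z i)" by (intro continuous_on_sum co)
  have c2: "continuous_on UNIV (\<lambda>z :: nat \<Rightarrow> real. ip n z z)" unfolding ip_def by (intro continuous_intros co)
  have c3: "continuous_on S (qform n E)"
    unfolding qform_def by (intro continuous_intros continuous_on_subset[OF co]) auto
  have "closed {z :: nat \<Rightarrow> real. (\<Sum>i<n. z i) = 0}" "closed {z :: nat \<Rightarrow> real. ip n z z = 1}"
    by (rule closed_Collect_eq[OF c1]; simp) (rule closed_Collect_eq[OF c2]; simp)
  hence "compact S" unfolding S_def Collect_conj_eq by (intro compact_Int_closed compact_box closed_Int)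
  moreover have "S \<noteq> {}"
  proof -
    define z where "z i = (if i = 0 then 1 / sqrt 2 else if i = 1 then - (1 / sqrt 2) else 0)" for i :: nat
    have s: "1 / sqrt 2 \<le> (1::real)" "0 \<le> 1 / sqrt (2::real)" "-1 \<le> 1 / sqrt (2::real)" by (auto intro: order_trans[of _ 0])
    obtain k where k: "n = Suc (Suc k)" using n by (metis Suc_le_D numeral_2_eq_2 Suc_le_mono)
    have "(\<Sum>i<n. F i) = F 0 + F 1" if "\<And>i. 2 \<le> i \<Longrightarrow> F i = 0" for F :: "nat \<Rightarrow> real"
    proof -
      have "(\<Sum>i<n. F i) = (\<Sum>i\<in>{0,1}. F i)" using n that by (intro sum.mono_neutral_right) (auto simp: not_le less_2_cases_iff)
      thus ?thesis by simp
    qed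
    hence "(\<Sum>i<n. z i) = 0" "ip n z z = 1" unfolding ip_def by (simp_all add: z_def)
    moreover have "z i \<in> (if i < n then {-1..1} else {0})" for i using s n by (auto simp: z_def)
    ultimately show ?thesis unfolding S_def by blast
  qed
  ultimately obtain y where y: "y \<in> S" "\<And>z. z \<in> S \<Longrightarrow> qform n E y \<le> qform n E z"
    using continuous_attains_inf[OF _ _ c3] by blast
  have "qform n E y * ip n z z \<le> qform n E z" if z: "(\<Sum>i<n. z i) = 0" for z
  proof (cases "ip n z z = 0")
    case True
    thus ?thesis using qform_nonneg by simp
  next
    case False
    define N where "N = sqrt (ip n z z)"
    have N: "0 < N" "N * N = ip n z z" using False ip_nonneg[of n z] by (auto simp: N_def)
    define v where "v i = (if i < n then (1 / N) * z i else 0)" for i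
    have iv: "ip n v v = (1 / N) * (1 / N) * ip n z z" unfolding ip_def v_def by (simp add: sum_distrib_left algebra_simps sum_divide_distrib)
    have v1: "ip n v v = 1" unfolding iv N(2)[symmetric] using N(1) by (simp add: field_simps)
    have "v \<in> S"
    proof -
      have "(\<Sum>i<n. v i) = 0" using z by (simp add: v_def sum_divide_distrib[symmetric])
      moreover have "v i \<in> (if i < n then {-1..1} else {0})" for i
      proof (cases "i < n")
        case True
        have "v i * v i \<le> ip n v v" unfolding ip_def using True by (intro member_le_sum) auto
        hence "(v i)\<^sup>2 \<le> 1" using v1 by (simp add: power2_eq_square)
        thus ?thesis using True by (simp add: abs_square_le_1 abs_le_iff)
      qed (simp add: v_def)
      ultimately show ?thesis using v1 unfolding S_def by blast
    qed
    hence "qform n E y \<le> qform n E v" by (rule y(2))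
    also have "\<dots> = qform n E (\<lambda>i. (1 / N) * z i)" by (rule qform_cong) (simp add: v_def)
    also have "\<dots> = qform n E z / (N * N)"
      unfolding qform_ip ip_def lap_scale by (simp add: sum_divide_distrib)
    finally have le: "qform n E y \<le> qform n E z / ip n z z" unfolding N(2) .
    have "0 < ip n z z" using N(1) unfolding N(2)[symmetric] by simp
    thus ?thesis using le by (simp add: pos_le_divide_eq)
  qed
  thus ?thesis using y(1) unfolding S_def by blast
qed

section \<open>The Laplacian matrix and its characteristic polynomial\<close>

lemma simple_adj: "simple_graph n E \<Longrightarrow> {i, j} \<in> E \<Longrightarrow> i < n \<and> j < n \<and> i \<noteq> j"
  unfolding simple_graph_def by (metis doubleton_eq_iff)

lemma degree_sum: "simple_graph n E \<Longrightarrow> real (degree E i) = (\<Sum>j<n. adj E i j)"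
proof -
  assume s: "simple_graph n E"
  have "(\<Sum>j<n. adj E i j) = real (card ({..<n} \<inter> {j. {i, j} \<in> E}))" unfolding adj_def by simp
  also have "{..<n} \<inter> {j. {i, j} \<in> E} = {u. {u, i} \<in> E}" using simple_adj[OF s] by (auto simp: insert_commute)
  finally show ?thesis by (simp add: degree_def)
qed

lemma laplacian_entry:
  assumes "simple_graph n E" "i < n" "j < n"
  shows "laplacian n E $$ (i, j) = (if i = j then \<Sum>k<n. adj E i k else - adj E i j)"
  using assms by (simp add: laplacian_def degree_sum adj_def)

lemma laplacian_row:
  assumes s: "simple_graph n E" and i: "i < n"
  shows "(\<Sum>j<n. laplacian n E $$ (i, j) * z j) = lap n E z i"
proof -
  have "adj E i i = 0" using simple_adj[OF s, of i i] by (auto simp: adj_def)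
  hence "laplacian n E $$ (i, j) * z j = of_bool (i = j) * ((\<Sum>k<n. adj E i k) * z i) - adj E i j * z j" if "j < n" for j
    using laplacian_entry[OF s i that] by auto
  hence "(\<Sum>j<n. laplacian n E $$ (i, j) * z j) = (\<Sum>j<n. of_bool (i = j) * ((\<Sum>k<n. adj E i k) * z i) - adj E i j * z j)"
    by (intro sum.cong) auto
  also have "\<dots> = (\<Sum>k<n. adj E i k) * z i - (\<Sum>j<n. adj E i j * z j)"
    using i by (simp add: sum_subtractf of_bool_def if_distrib[of "\<lambda>x. x * _"] cong: if_cong)
  finally show ?thesis unfolding lap_def by (simp add: algebra_simps sum_subtractf sum_distrib_left sum_distrib_right)
qed

lemma laplacian_carrier: "laplacian n E \<in> carrier_mat n n" by (simp add: laplacian_def)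

lemma laplacian_mult:
  assumes s: "simple_graph n E"
  shows "laplacian n E *\<^sub>v vec n z = vec n (lap n E z)"
proof (rule eq_vecI)
  fix i assume "i < dim_vec (vec n (lap n E z))"
  hence i: "i < n" by simp
  have "(laplacian n E *\<^sub>v vec n z) $ i = (\<Sum>j<n. laplacian n E $$ (i, j) * z j)"
    using i laplacian_carrier[of n E] by (simp add: scalar_prod_def lessThan_atLeast0)
  thus "(laplacian n E *\<^sub>v vec n z) $ i = vec n (lap n E z) $ i" using laplacian_row[OF s i] i by simp
qed (use laplacian_carrier[of n E] in auto)

lemma eigen_iff:
  assumes s: "simple_graph n E"
  shows "poly (char_poly (laplacian n E)) k = 0 \<longleftrightarrow> (\<exists>z. (\<exists>i<n. z i \<noteq> 0) \<and> (\<forall>i<n. lap n E z i = k * z i))"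
proof -
  have "poly (char_poly (laplacian n E)) k = 0 \<longleftrightarrow> eigenvalue (laplacian n E) k"
    using eigenvalue_root_char_poly[OF laplacian_carrier] by simp
  also have "\<dots> \<longleftrightarrow> (\<exists>z. (\<exists>i<n. z i \<noteq> 0) \<and> (\<forall>i<n. lap n E z i = k * z i))"
  proof
    assume "eigenvalue (laplacian n E) k"
    then obtain v where v: "v \<in> carrier_vec n" "v \<noteq> 0\<^sub>v n" "laplacian n E *\<^sub>v v = k \<cdot>\<^sub>v v"
      unfolding eigenvalue_def eigenvector_def using laplacian_carrier[of n E] by auto
    define z where "z i = v $ i" for i
    have vz: "v = vec n z" using v(1) by (auto simp: z_def)
    have "\<exists>i<n. z i \<noteq> 0" using v(1,2) by (auto simp: z_def intro!: eq_vecI)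
    moreover have "lap n E z i = k * z i" if "i < n" for i
      using arg_cong[OF v(3), of "\<lambda>v. v $ i"] that unfolding vz laplacian_mult[OF s] by simp
    ultimately show "\<exists>z. (\<exists>i<n. z i \<noteq> 0) \<and> (\<forall>i<n. lap n E z i = k * z i)" by blast
  next
    assume "\<exists>z. (\<exists>i<n. z i \<noteq> 0) \<and> (\<forall>i<n. lap n E z i = k * z i)"
    then obtain z i where z: "i < n" "z i \<noteq> 0" "\<And>i. i < n \<Longrightarrow> lap n E z i = k * z i" by blast
    have "vec n z \<noteq> 0\<^sub>v n" using z(1,2) by (metis index_vec index_zero_vec(1))
    moreover have "laplacian n E *\<^sub>v vec n z = k \<cdot>\<^sub>v vec n z" unfolding laplacian_mult[OF s] using z(3) by (intro eq_vecI) auto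
    ultimately show "eigenvalue (laplacian n E) k" unfolding eigenvalue_def eigenvector_def
      using laplacian_carrier[of n E] by (intro exI[of _ "vec n z"]) auto
  qed
  finally show ?thesis .
qed

lemma zero_smult_vec: "v \<in> carrier_vec k \<Longrightarrow> (0::real) \<cdot>\<^sub>v v = 0\<^sub>v k" by (intro eq_vecI) auto

text \<open>Conjugation by a matrix with first column \<open>1\<close> splits off the root \<open>0\<close> of the characteristic polynomial.\<close>

lemma zero_eigenvalue_simple:
  assumes s: "simple_graph n E" and con: "connected_graph n E" and n: "2 \<le> n"
  shows "order 0 (char_poly (laplacian n E)) \<le> 1"
proof (rule ccontr)
  assume neg: "\<not> ?thesis"
  obtain k where k: "n = Suc k" using n by (cases n) auto
  define L where "L = laplacian n E"
  define P where "P = mat n n (\<lambda>(i, j). if j = 0 then 1 else of_bool (i = j) :: real)"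
  define Q where "Q = mat n n (\<lambda>(i, j). if j = 0 then (if i = 0 then 1 else -1) else of_bool (i = j) :: real)"
  have L: "L \<in> carrier_mat n n" and P: "P \<in> carrier_mat n n" and Q: "Q \<in> carrier_mat n n"
    by (auto simp: L_def P_def Q_def laplacian_carrier)
  have two: "(\<Sum>j = 0..<n. F j) = F 0 + (if i = 0 then 0 else F i)"
    if "i < n" "\<And>j. j < n \<Longrightarrow> j \<noteq> 0 \<Longrightarrow> j \<noteq> i \<Longrightarrow> F j = 0" for F :: "nat \<Rightarrow> real" and i
  proof -
    have "(\<Sum>j = 0..<n. F j) = (\<Sum>j\<in>{0, i}. F j)" using that by (intro sum.mono_neutral_right) auto
    thus ?thesis by simp
  qed
  have PQ: "P * Q = 1\<^sub>m n"
  proof (rule eq_matI)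
    fix i j assume "i < dim_row (1\<^sub>m n)" "j < dim_col (1\<^sub>m n)"
    hence ij: "i < n" "j < n" by auto
    have "(P * Q) $$ (i, j) = (\<Sum>l = 0..<n. P $$ (i, l) * Q $$ (l, j))"
      using ij P Q by (simp add: scalar_prod_def)
    also have "\<dots> = 1\<^sub>m n $$ (i, j)"
      using ij n by (subst two[OF ij(1)]) (auto simp: P_def Q_def)
    finally show "(P * Q) $$ (i, j) = 1\<^sub>m n $$ (i, j)" .
  qed (use P Q in auto)
  have QP: "Q * P = 1\<^sub>m n" by (rule mat_mult_left_right_inverse[OF P Q PQ])
  define M where "M = Q * L * P"
  have M: "M \<in> carrier_mat n n" using L P Q by (auto simp: M_def)
  have PM: "P * M = L * P"
  proof -
    have "P * M = (P * Q) * L * P" unfolding M_def using L P Q by (simp add: assoc_mult_mat[of _ n n _ n _ n])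
    thus ?thesis unfolding PQ using L by simp
  qed
  have cp: "char_poly M = char_poly L"
    by (rule char_poly_similar[OF similar_matI[of _ _ Q P n]]) (use M L P Q PQ QP M_def in auto)
  have col0: "M $$ (i, 0) = 0" if i: "i < n" for i
  proof -
    have "(L * P) $$ (l, 0) = 0" if l: "l < n" for l
    proof -
      have "(L * P) $$ (l, 0) = (\<Sum>j<n. laplacian n E $$ (l, j) * 1)"
        using l L P n by (simp add: scalar_prod_def L_def P_def lessThan_atLeast0)
      thus ?thesis unfolding laplacian_row[OF s l] lap_def by simp
    qed
    moreover have "M = Q * (L * P)" unfolding M_def by (rule assoc_mult_mat[OF Q L P])
    ultimately show ?thesis using i Q L P n by (simp add: scalar_prod_def)
  qed
  define A2 where "A2 = mat 1 k (\<lambda>(i, j). M $$ (0, Suc j))"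
  define A3 where "A3 = mat k k (\<lambda>(i, j). M $$ (Suc i, Suc j))"
  have Mb: "M = four_block_mat (0\<^sub>m 1 1) A2 (0\<^sub>m k 1) A3"
    by (rule eq_matI) (use M k col0 in \<open>auto simp: A2_def A3_def four_block_mat_def Let_def\<close>)
  have A3: "A3 \<in> carrier_mat k k" and A2: "A2 \<in> carrier_mat 1 k" by (auto simp: A2_def A3_def)
  have c1: "char_poly (0\<^sub>m 1 1 :: real mat) = [:0, 1:]" by (simp add: char_poly_defs det_def sign_def)
  have fac: "char_poly L = [:0, 1:] * char_poly A3"
    unfolding cp[symmetric] by (subst Mb) (simp only: char_poly_four_block_zeros_col[OF zero_carrier_mat A2 A3] c1)
  have "[:- 0, 1:] ^ 2 dvd char_poly L"
    unfolding order_divides using neg by (auto simp: L_def)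
  hence "[:0, 1:] dvd char_poly A3" unfolding fac power2_eq_square by (simp only: minus_zero dvd_mult_cancel_left) simp
  hence "poly (char_poly A3) 0 = 0" by (metis dvd_iff_poly_eq_0 minus_zero)
  hence "eigenvalue A3 0" using eigenvalue_root_char_poly[OF A3] by simp
  then obtain w where w: "w \<in> carrier_vec k" "w \<noteq> 0\<^sub>v k" "A3 *\<^sub>v w = 0\<^sub>v k"
    unfolding eigenvalue_def eigenvector_def using A3 by (metis carrier_matD(1) zero_smult_vec)
  define z where "z i = (if i = 0 then 0 else w $ (i - 1))" for i
  have Pz: "P *\<^sub>v vec n z = vec n z"
  proof (rule eq_vecI)
    fix i assume "i < dim_vec (vec n z)"
    hence i: "i < n" by simp
    have "(P *\<^sub>v vec n z) $ i = (\<Sum>j = 0..<n. P $$ (i, j) * z j)" using i P by (simp add: scalar_prod_def)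
    thus "(P *\<^sub>v vec n z) $ i = vec n z $ i" using i n by (subst (asm) two[OF i]) (auto simp: P_def z_def)
  qed (use P in auto)
  have Mz: "(M *\<^sub>v vec n z) $ Suc i = 0" if i: "i < k" for i
  proof -
    have "(M *\<^sub>v vec n z) $ Suc i = (\<Sum>j = 0..<Suc k. M $$ (Suc i, j) * z j)" using i M k by (simp add: scalar_prod_def)
    also have "\<dots> = (\<Sum>j = 0..<k. M $$ (Suc i, Suc j) * w $ j)"
      by (subst sum.atLeast0_lessThan_Suc_shift) (simp add: z_def)
    also have "\<dots> = (A3 *\<^sub>v w) $ i" using i A3 w(1) by (simp add: scalar_prod_def A3_def)
    finally show ?thesis using w(3) i by simp
  qed
  \<comment> \<open>A null vector of the lower block determines \<open>L\<close> applied to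
    \<open>z\<close> up to a multiple of the constant vector; as its entries sum to 0, that multiple
    is 0.\<close>
  have "lap n E z i = (M *\<^sub>v vec n z) $ 0" if i: "i < n" for i
  proof -
    have "vec n (lap n E z) = L *\<^sub>v (P *\<^sub>v vec n z)" unfolding Pz L_def laplacian_mult[OF s] ..
    also have "\<dots> = P *\<^sub>v (M *\<^sub>v vec n z)"
      unfolding assoc_mult_mat_vec[OF L P vec_carrier, symmetric] assoc_mult_mat_vec[OF P M vec_carrier, symmetric] PM ..
    finally have "lap n E z i = (P *\<^sub>v (M *\<^sub>v vec n z)) $ i" using i by (metis index_vec)
    also have "\<dots> = (\<Sum>j = 0..<n. P $$ (i, j) * (M *\<^sub>v vec n z) $ j)" using i P M by (simp add: scalar_prod_def)
    also have "\<dots> = (M *\<^sub>v vec n z) $ 0"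
    proof -
      have "(M *\<^sub>v vec n z) $ j = 0" if "j < n" "j \<noteq> 0" for j using that Mz[of "j - 1"] k by (cases j) auto
      thus ?thesis using i n by (subst two[OF i]) (auto simp: P_def)
    qed
    finally show ?thesis .
  qed
  hence "real n * (M *\<^sub>v vec n z) $ 0 = 0" using lap_sum[of n E z] by simp
  hence "(M *\<^sub>v vec n z) $ 0 = 0" using n by simp
  hence "lap n E z i = 0" if "i < n" for i using that \<open>\<And>i. i < n \<Longrightarrow> lap n E z i = (M *\<^sub>v vec n z) $ 0\<close> by simp
  hence "qform n E z = 0" unfolding qform_ip ip_def by simp
  hence "z i = z 0" if "i < n" for i using qform_zero_const[OF _ con] that n by blast
  note zc = this
  have "w $ i = 0" if "i < k" for i using zc[of "Suc i"] that k by (simp add: z_def)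
  thus False using w(1,2) by (auto intro!: eq_vecI)
qed

text \<open>The Rayleigh minimum over vectors of sum zero is a positive eigenvalue. As 0 is an
  eigenvalue too, this minimum is not the first entry of the sorted list, so entry 1 is at most the
  minimum. Entry 1 is positive because 0 is a simple root, and an eigenvector of a nonzero
  eigenvalue has sum zero.\<close>

theorem algebraic_connectivity_props:
  assumes s: "simple_graph n E" and con: "connected_graph n E" and n: "2 \<le> n"
  defines "\<nu> \<equiv> algebraic_connectivity n E"
  shows "0 < \<nu>"
    and "\<exists>z. (\<exists>i<n. z i \<noteq> 0) \<and> (\<Sum>i<n. z i) = 0 \<and> (\<forall>i<n. lap n E z i = \<nu> * z i)"
    and "\<And>z. (\<Sum>i<n. z i) = 0 \<Longrightarrow> \<nu> * ip n z z \<le> qform n E z"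
proof -
  define p where "p = char_poly (laplacian n E)"
  define l where "l = sorted_list_of_multiset (proots p)"
  have lam: "\<nu> = l ! 1" unfolding \<nu>_def algebraic_connectivity_def l_def p_def ..
  have "coeff p n = 1" unfolding p_def using degree_monic_char_poly[OF laplacian_carrier] by blast
  hence p0: "p \<noteq> 0" by auto
  have srt: "sorted l" and ml: "mset l = proots p" unfolding l_def by auto
  have sl: "k \<in> set l \<longleftrightarrow> poly p k = 0" for k
    using p0 by (simp add: set_mset_mset[symmetric] ml del: set_mset_mset)
  obtain y where y: "(\<Sum>i<n. y i) = 0" "ip n y y = 1" "\<And>z. (\<Sum>i<n. z i) = 0 \<Longrightarrow> qform n E y * ip n z z \<le> qform n E z"
    using rayleigh_attained[OF n] by metis
  have yn: "\<exists>i<n. y i \<noteq> 0" using y(2) by (auto simp: ip_def intro: ccontr)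
  have "\<And>i. i < n \<Longrightarrow> lap n E y i = qform n E y * y i" by (rule minimiser_eigen) (use y in auto)
  hence "qform n E y \<in> set l" unfolding sl p_def eigen_iff[OF s] using yn by blast
  moreover have nu: "0 < qform n E y"
  proof (rule ccontr)
    assume "\<not> 0 < qform n E y"
    hence q0: "qform n E y = 0" using qform_nonneg[of n E y] by simp
    hence c: "\<And>i. i < n \<Longrightarrow> y i = y 0" using n by (intro qform_zero_const[OF q0 con]) auto
    have "(\<Sum>i<n. y i) = (\<Sum>i<n. y 0)" by (intro sum.cong refl c) simp
    hence "y 0 = 0" using y(1) n by simp
    thus False using yn c by auto
  qed
  moreover have z0: "0 \<in> set l" unfolding sl p_def eigen_iff[OF s] using n by (intro exI[of _ "\<lambda>_. 1"] conjI exI[of _ "0::nat"]) (auto simp: lap_def)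
  ultimately obtain i j where ij: "i < length l" "l ! i = 0" "j < length l" "l ! j = qform n E y" by (metis in_set_conv_nth)
  have nn: "0 \<le> k" if k: "k \<in> set l" for k
  proof -
    obtain z where z: "\<exists>i<n. z i \<noteq> 0" "\<And>i. i < n \<Longrightarrow> lap n E z i = k * z i" using k unfolding sl p_def eigen_iff[OF s] by blast
    have "qform n E z = k * ip n z z" unfolding qform_ip ip_def using z(2) by (simp add: sum_distrib_left algebra_simps)
    moreover have "0 < ip n z z" using z(1) ip_zero[of n z] ip_nonneg[of n z] by (metis less_eq_real_def)
    ultimately show ?thesis using qform_nonneg[of n E z] by (simp add: zero_le_mult_iff)
  qed
  have j0: "j \<noteq> 0"
  proof
    assume "j = 0"
    hence "l ! j \<le> l ! i" using srt ij by (intro sorted_nth_mono) auto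
    thus False using ij nu by simp
  qed
  hence len: "1 < length l" using ij(3) by simp
  have up: "\<nu> \<le> qform n E y" unfolding lam ij(4)[symmetric] using j0 ij(3) by (intro sorted_nth_mono[OF srt]) auto
  have lin: "\<nu> \<in> set l" unfolding lam using len by simp
  show pos: "0 < \<nu>"
  proof (rule ccontr)
    assume "\<not> 0 < \<nu>"
    hence l1: "l ! 1 = 0" using nn[OF lin] lam by simp
    have "l ! 0 \<le> l ! 1" using sorted_nth_mono[OF srt, of 0 1] len by simp
    moreover have "0 \<le> l ! 0" by (rule nn, rule nth_mem) (use len in auto)
    ultimately have l0: "l ! 0 = 0" using l1 by simp
    obtain a b l' where l': "l = a # b # l'" using len by (cases l; cases "tl l") auto
    have "count (mset l) 0 \<ge> 2" using l0 l1 unfolding l' by simp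
    thus False using zero_eigenvalue_simple[OF s con n] unfolding ml count_proots[OF p0] by (simp add: p_def)
  qed
  obtain z where z: "\<exists>i<n. z i \<noteq> 0" "\<And>i. i < n \<Longrightarrow> lap n E z i = \<nu> * z i" using lin unfolding sl p_def eigen_iff[OF s] by blast
  have "\<nu> * (\<Sum>i<n. z i) = 0" using lap_sum[of n E z] z(2) by (simp add: sum_distrib_left)
  thus "\<exists>z. (\<exists>i<n. z i \<noteq> 0) \<and> (\<Sum>i<n. z i) = 0 \<and> (\<forall>i<n. lap n E z i = \<nu> * z i)" using z pos by auto
  fix z :: "nat \<Rightarrow> real" assume "(\<Sum>i<n. z i) = 0"
  hence "qform n E y * ip n z z \<le> qform n E z" by (rule y(3))
  moreover have "\<nu> * ip n z z \<le> qform n E y * ip n z z" by (rule mult_right_mono[OF up ip_nonneg])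
  ultimately show "\<nu> * ip n z z \<le> qform n E z" by simp
qed

section \<open>Edge sums and edge switching\<close>

text \<open>\<open>Max\<close> and \<open>Min\<close> select the two ends, so that sums can run over
  edges as sets.\<close>

definition edge_form :: "(nat \<Rightarrow> real) \<Rightarrow> nat set \<Rightarrow> real" where
  "edge_form z e = (z (Max e) - z (Min e))\<^sup>2"

lemma edge_form_pair [simp]: "edge_form z {i, j} = (z i - z j)\<^sup>2"
  by (cases i j rule: le_cases) (auto simp: edge_form_def max_def min_def power2_commute)

lemma simple_finite: "simple_graph n E \<Longrightarrow> finite E"
  by (rule finite_subset[of _ "Pow {..<n}"]) (auto simp: simple_graph_def)

lemma simple_subset: "simple_graph n E \<Longrightarrow> F \<subseteq> E \<Longrightarrow> simple_graph n F"
  by (auto simp: simple_graph_def)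

lemma simple_Un: "simple_graph n E \<Longrightarrow> simple_graph n F \<Longrightarrow> simple_graph n (E \<union> F)"
  by (auto simp: simple_graph_def)

lemma simple_edgeE:
  assumes "simple_graph n E" "e \<in> E" obtains i j where "i < j" "j < n" "e = {i, j}"
  using assms unfolding simple_graph_def by (metis insert_commute linorder_neqE_nat)

lemma simple_edge_minmax:
  assumes "simple_graph n E" "e \<in> E"
  shows "Min e < Max e" "Max e < n" "{Min e, Max e} = e" "{Max e, Min e} = e"
proof -
  obtain i j where "i < j" "j < n" "e = {i, j}" using simple_edgeE[OF assms] by blast
  thus "Min e < Max e" "Max e < n" "{Min e, Max e} = e" "{Max e, Min e} = e" by (auto simp: insert_commute)
qed

lemma qform_edges:
  assumes s: "simple_graph n E" shows "qform n E z = (\<Sum>e\<in>E. edge_form z e)"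
proof -
  have half: "(\<Sum>(i, j)\<in>{(i, j). {i, j} \<in> E \<and> i < j}. (z i - z j)\<^sup>2) = (\<Sum>e\<in>E. edge_form z e)"
    by (rule sum.reindex_bij_witness[where j = "\<lambda>(i, j). {i, j}" and i = "\<lambda>e. (Min e, Max e)"])
       (auto simp: simple_edge_minmax[OF s])
  have half': "(\<Sum>(i, j)\<in>{(i, j). {i, j} \<in> E \<and> j < i}. (z i - z j)\<^sup>2) = (\<Sum>e\<in>E. edge_form z e)"
    by (rule sum.reindex_bij_witness[where j = "\<lambda>(i, j). {i, j}" and i = "\<lambda>e. (Max e, Min e)"])
       (auto simp: simple_edge_minmax[OF s])
  have fin: "finite {(i, j). {i, j} \<in> E \<and> P i j}" for P
    by (rule finite_subset[of _ "{..<n} \<times> {..<n}"]) (auto dest: simple_adj[OF s])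
  have "(\<Sum>i<n. \<Sum>j<n. adj E i j * (z i - z j)\<^sup>2) = (\<Sum>(i, j)\<in>{..<n} \<times> {..<n}. adj E i j * (z i - z j)\<^sup>2)"
    by (rule sum.cartesian_product)
  also have "\<dots> = (\<Sum>(i, j)\<in>{(i, j). {i, j} \<in> E \<and> i < j} \<union> {(i, j). {i, j} \<in> E \<and> j < i}. (z i - z j)\<^sup>2)"
  proof (rule sum.mono_neutral_cong_right)
    have "adj E i j = 0" if "\<not> ({i, j} \<in> E \<and> i < j)" "\<not> ({i, j} \<in> E \<and> j < i)" for i j
      using that simple_adj[OF s, of i j] by (cases "{i, j} \<in> E") (auto simp: adj_def)
    thus "\<forall>p\<in>{..<n} \<times> {..<n} - ({(i, j). {i, j} \<in> E \<and> i < j} \<union> {(i, j). {i, j} \<in> E \<and> j < i}).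
      (case p of (i, j) \<Rightarrow> adj E i j * (z i - z j)\<^sup>2) = 0" by (simp add: split_beta)
  qed (auto simp: adj_def dest: simple_adj[OF s])
  also have "\<dots> = 2 * (\<Sum>e\<in>E. edge_form z e)"
    by (subst sum.union_disjoint) (use fin half half' in auto)
  finally show ?thesis by (simp add: qform_def)
qed

definition edge_deg :: "nat set set \<Rightarrow> nat \<Rightarrow> nat" where
  "edge_deg F v = (\<Sum>e\<in>F. of_bool (v \<in> e))"

lemma degree_edges:
  assumes s: "simple_graph n E" shows "degree E v = edge_deg E v"
proof -
  have "{e \<in> E. v \<in> e} = (\<lambda>u. {u, v}) ` {u. {u, v} \<in> E}"
  proof (rule Set.set_eqI)
    fix e
    have "e \<in> (\<lambda>u. {u, v}) ` {u. {u, v} \<in> E}" if e: "e \<in> E" "v \<in> e"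
    proof -
      obtain i j where ij: "e = {i, j}" using simple_edgeE[OF s e(1)] by blast
      hence "e = {i, v} \<or> e = {j, v}" using e(2) by auto
      thus ?thesis using e(1) by auto
    qed
    thus "e \<in> {e \<in> E. v \<in> e} \<longleftrightarrow> e \<in> (\<lambda>u. {u, v}) ` {u. {u, v} \<in> E}" by auto
  qed
  moreover have "inj_on (\<lambda>u. {u, v}) {u. {u, v} \<in> E}" by (auto simp: inj_on_def doubleton_eq_iff)
  ultimately have "card {u. {u, v} \<in> E} = card {e \<in> E. v \<in> e}" by (simp add: card_image)
  thus ?thesis using simple_finite[OF s] by (simp add: degree_def edge_deg_def Int_def)
qed

lemma edge_deg_Un: "finite E \<Longrightarrow> finite F \<Longrightarrow> E \<inter> F = {} \<Longrightarrow> edge_deg (E \<union> F) v = edge_deg E v + edge_deg F v"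
  unfolding edge_deg_def by (rule sum.union_disjoint)

section \<open>Reachability along edges\<close>

abbreviation edge_reach :: "nat set set \<Rightarrow> nat \<Rightarrow> nat \<Rightarrow> bool" where
  "edge_reach E \<equiv> (\<lambda>x y. {x, y} \<in> E)\<^sup>*\<^sup>*"

lemma edge_reach_sym: "edge_reach E x y \<Longrightarrow> edge_reach E y x"
  by (rule sympD[OF symp_rtranclp]) (auto simp: symp_def insert_commute)

lemma edge_reach_mono: "edge_reach E x y \<Longrightarrow> E \<subseteq> F \<Longrightarrow> edge_reach F x y"
  by (induction rule: rtranclp_induct) (auto intro: rtranclp.rtrancl_into_rtrancl)

lemma edge_reach_replace:
  assumes "edge_reach E x y" "\<And>u v. {u, v} \<in> E \<Longrightarrow> edge_reach F u v" shows "edge_reach F x y"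
  using assms(1) by (induction rule: rtranclp_induct) (auto dest: assms(2))

lemma reach_in_edge_reach: "simple_graph n E \<Longrightarrow> reach_in E {0..<n} x y = edge_reach E x y"
  unfolding reach_in_def by (rule arg_cong[where f = "\<lambda>r. r\<^sup>*\<^sup>* x y"]) (auto dest: simple_adj intro!: ext)

lemma connected_graph_reach:
  "simple_graph n E \<Longrightarrow> connected_graph n E \<longleftrightarrow> (\<forall>u<n. \<forall>v<n. edge_reach E u v)"
  by (auto simp: connected_graph_def connected_on_def reach_in_edge_reach)

text \<open>If removing \<open>uv\<close> disconnected \<open>u\<close> from \<open>v\<close>, the component of \<open>u\<close> would have odd degree sum.\<close>
lemma even_no_bridge:
  assumes s: "simple_graph n F" and ev: "\<And>w. w < n \<Longrightarrow> even (edge_deg F w)" and e: "{u, v} \<in> F"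
  shows "edge_reach (F - {{u, v}}) u v"
proof (rule ccontr)
  let ?F = "F - {{u, v}}"
  assume no: "\<not> edge_reach ?F u v"
  define K where "K = {w. w < n \<and> edge_reach ?F u w}"
  have uv: "u < n" "v < n" "u \<noteq> v" using simple_adj[OF s e] by auto
  have fin: "finite F" "finite K" using simple_finite[OF s] by (auto simp: K_def)
  have uK: "u \<in> K" "v \<notin> K" using uv no by (auto simp: K_def)
  have "(\<Sum>w\<in>K. edge_deg ?F w) = (\<Sum>e\<in>?F. \<Sum>w\<in>K. of_bool (w \<in> e))" unfolding edge_deg_def by (rule sum.swap)
  moreover have "even (\<Sum>w\<in>K. of_bool (w \<in> e) :: nat)" if e: "e \<in> ?F" for e
  proof -
    obtain i j where ij: "i < j" "j < n" "e = {i, j}" using simple_edgeE[OF s] e by blast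
    have "i \<in> K \<longleftrightarrow> j \<in> K" using ij e unfolding K_def
      by (auto intro: rtranclp.rtrancl_into_rtrancl simp: insert_commute)
    moreover have "(\<Sum>w\<in>K. of_bool (w \<in> e) :: nat) = (\<Sum>w\<in>{i, j}. 1)" if "i \<in> K" "j \<in> K"
      unfolding ij(3) using that fin(2) by (intro sum.mono_neutral_cong_right) auto
    moreover have "(\<Sum>w\<in>K. of_bool (w \<in> e) :: nat) = 0" if "i \<notin> K" "j \<notin> K"
      unfolding ij(3) using that by (intro sum.neutral) auto
    ultimately show ?thesis using ij(1) by (cases "i \<in> K") auto
  qed
  ultimately have "even (\<Sum>w\<in>K. edge_deg ?F w)" by (auto intro: dvd_sum)
  moreover have "edge_deg F w = edge_deg ?F w + of_bool (w \<in> {u, v})" for w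
    unfolding edge_deg_def using fin e by (subst sum.remove[of F "{u, v}"]) auto
  moreover have "(\<Sum>w\<in>K. of_bool (w \<in> {u, v}) :: nat) = (\<Sum>w\<in>{u}. 1)"
    using uK fin by (intro sum.mono_neutral_cong_right) auto
  ultimately have "odd (\<Sum>w\<in>K. edge_deg F w)" by (simp add: sum.distrib)
  moreover have "even (\<Sum>w\<in>K. edge_deg F w)" using ev by (intro dvd_sum) (auto simp: K_def)
  ultimately show False by simp
qed

locale extremal =
  fixes n :: nat and E :: "nat set set" and x :: "nat \<Rightarrow> real" and \<mu> :: real
  assumes n11: "11 \<le> n" and simple: "simple_graph n E" and quart: "quartic n E" and con: "connected_graph n E"
    and minimal: "\<And>E'. simple_graph n E' \<Longrightarrow> quartic n E' \<Longrightarrow> connected_graph n E' \<Longrightarrow> \<mu> \<le> algebraic_connectivity n E'"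
    and mu: "\<mu> = algebraic_connectivity n E"
    and nonzero: "\<exists>i<n. x i \<noteq> 0" and orth: "(\<Sum>i<n. x i) = 0" and eigen: "\<And>i. i < n \<Longrightarrow> lap n E x i = \<mu> * x i"
begin

lemma mu_pos: "0 < \<mu>" unfolding mu using algebraic_connectivity_props(1)[OF simple con] n11 by simp

lemma deg4: "v < n \<Longrightarrow> edge_deg E v = 4" using quart degree_edges[OF simple] by (simp add: quartic_def)

lemma rayleigh:
  assumes "simple_graph n E'" "quartic n E'" "connected_graph n E'" "(\<Sum>i<n. z i) = 0"
  shows "\<mu> * ip n z z \<le> qform n E' z"
proof -
  have "\<mu> * ip n z z \<le> algebraic_connectivity n E' * ip n z z"
    by (intro mult_right_mono minimal assms ip_nonneg)
  also have "\<dots> \<le> qform n E' z" by (rule algebraic_connectivity_props(3)) (use assms n11 in auto)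
  finally show ?thesis .
qed

lemma qform_x: "qform n E x = \<mu> * ip n x x"
  unfolding qform_ip ip_def using eigen by (simp add: sum_distrib_left algebra_simps)

text \<open>For \<open>z\<close> reduced to mean zero, \<open>q(E', z) \<ge> \<mu> |z|^2 = \<mu> |z
  - x|^2 + 2 \<mu> <x, z> - \<mu> |x|^2\<close>, and \<open>q(E, x) = \<mu> |x|^2\<close>. Dropping
  the first square gives the inequality; equality makes it vanish.\<close>

lemma opt:
  assumes E': "simple_graph n E'" "quartic n E'" "connected_graph n E'"
  shows "qform n E x + 2 * \<mu> * (ip n x z - ip n x x) \<le> qform n E' z"
    and "qform n E' z \<le> qform n E x + 2 * \<mu> * (ip n x z - ip n x x) \<Longrightarrow> i < n \<Longrightarrow> j < n \<Longrightarrow> z i - x i = z j - x j"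
proof -
  define c where "c = (\<Sum>i<n. z i) / n"
  define y where "y i = z i + (- c)" for i
  have n0: "n \<noteq> 0" using n11 by simp
  have sy: "(\<Sum>i<n. y i) = 0" unfolding y_def c_def using n0 by (simp add: sum_subtractf)
  have qy: "qform n E' y = qform n E' z" unfolding y_def by (rule qform_shift)
  have iy: "ip n x y = ip n x z"
    unfolding ip_def y_def using orth by (simp add: algebra_simps sum_subtractf sum_distrib_left[symmetric])
  have r: "\<mu> * ip n y y \<le> qform n E' z" using rayleigh[OF E' sy] unfolding qy .
  have dd: "ip n (\<lambda>i. y i - x i) (\<lambda>i. y i - x i) = ip n y y - 2 * ip n x y + ip n x x"
    unfolding ip_def by (simp add: algebra_simps sum_subtractf sum.distrib sum_distrib_left)
  have eq: "\<mu> * ip n y y = \<mu> * ip n (\<lambda>i. y i - x i) (\<lambda>i. y i - x i) + (qform n E x + 2 * \<mu> * (ip n x z - ip n x x))"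
    unfolding dd iy qform_x by (simp add: algebra_simps)
  have nn: "0 \<le> \<mu> * ip n (\<lambda>i. y i - x i) (\<lambda>i. y i - x i)" using mu_pos ip_nonneg by (simp add: mult_nonneg_nonneg)
  show "qform n E x + 2 * \<mu> * (ip n x z - ip n x x) \<le> qform n E' z" using r eq nn by linarith
  assume "qform n E' z \<le> qform n E x + 2 * \<mu> * (ip n x z - ip n x x)" and ij: "i < n" "j < n"
  hence "\<mu> * ip n (\<lambda>i. y i - x i) (\<lambda>i. y i - x i) = 0" using r eq nn by linarith
  hence "ip n (\<lambda>i. y i - x i) (\<lambda>i. y i - x i) = 0" using mu_pos by simp
  from ip_zero[OF this ij(1)] ip_zero[OF this ij(2)] show "z i - x i = z j - x j" by (simp add: y_def)
qed

text \<open>The switch changes the form by \<open>2 * (x a - x d) * (x b - x c)\<close>. Equality in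
  the principle says nothing at \<open>z = x\<close>, so \<open>x\<close> is perturbed at the single
  vertices \<open>a\<close> and \<open>b\<close>; the first-order terms are the two factors.\<close>

lemma switch:
  assumes ab: "{a, b} \<in> E" and cd: "{c, d} \<in> E" and ac: "{a, c} \<notin> E" and bd: "{b, d} \<notin> E"
    and dist: "a \<noteq> c" "a \<noteq> d" "b \<noteq> c" "b \<noteq> d"
    and conn: "connected_graph n (E - {{a, b}, {c, d}} \<union> {{a, c}, {b, d}})"
    and le: "(x a - x d) * (x b - x c) \<le> 0"
  shows "x a = x d" "x b = x c"
proof -
  let ?E = "E - {{a, b}, {c, d}} \<union> {{a, c}, {b, d}}"
  have lt: "a < n" "b < n" "c < n" "d < n" "a \<noteq> b" "c \<noteq> d" using simple_adj[OF simple ab] simple_adj[OF simple cd] by auto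
  have s': "simple_graph n ?E" using simple lt dist unfolding simple_graph_def by (auto simp: doubleton_eq_iff)
  have fin: "finite E" by (rule simple_finite[OF simple])
  have ne: "{a, b} \<noteq> {c, d}" "{a, c} \<noteq> {b, d}" using dist lt by (auto simp: doubleton_eq_iff)
  have sums: "(\<Sum>e\<in>?E. f e) + f {a, b} + f {c, d} = (\<Sum>e\<in>E. f e) + f {a, c} + f {b, d}" for f :: "nat set \<Rightarrow> 'b::comm_monoid_add"
  proof -
    have "(\<Sum>e\<in>?E. f e) = (\<Sum>e\<in>E - {{a, b}, {c, d}}. f e) + (f {a, c} + f {b, d})"
      using fin ac bd ne by (subst sum.union_disjoint) auto
    moreover have "(\<Sum>e\<in>E. f e) = (\<Sum>e\<in>E - {{a, b}, {c, d}}. f e) + (f {a, b} + f {c, d})"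
      using fin ab cd ne by (subst sum.subset_diff[of "{{a, b}, {c, d}}"]) auto
    ultimately show ?thesis by (simp add: ac_simps)
  qed
  have "edge_deg ?E v = edge_deg E v" for v
    using sums[of "\<lambda>e. of_bool (v \<in> e) :: nat"] dist lt unfolding edge_deg_def by (auto split: if_splits simp: of_bool_def)
  hence q': "quartic n ?E" using quart unfolding quartic_def degree_edges[OF simple] degree_edges[OF s'] by simp
  have diff: "qform n ?E z = qform n E z + 2 * ((z a - z d) * (z b - z c))" for z
    using sums[of "edge_form z"] unfolding qform_edges[OF simple] qform_edges[OF s']
    by (simp add: power2_eq_square algebra_simps)
  define D where "D u i = (of_bool (i = u) :: real)" for u i :: nat
  have pert: "0 \<le> 2 * ((x a + t * D u a - x d - t * D u d) * (x b + t * D u b - x c - t * D u c)) + t\<^sup>2 * qform n E (D u)" for u t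
  proof -
    have "ip n x (\<lambda>i. x i + t * D u i) - ip n x x = t * ip n (D u) x"
      unfolding ip_def by (simp add: algebra_simps sum.distrib sum_distrib_left)
    moreover have "ip n (D u) (lap n E x) = \<mu> * ip n (D u) x" unfolding ip_def using eigen by (simp add: sum_distrib_left algebra_simps)
    ultimately show ?thesis using opt(1)[OF s' q' conn, of "\<lambda>i. x i + t * D u i"] unfolding diff[of "\<lambda>i. x i + t * D u i"] qform_add[of n E x t "D u"] by (simp add: algebra_simps)
  qed
  \<comment> \<open>Without perturbation the product is nonnegative, so hypothesis \<open>le\<close>
    makes it zero.\<close>
  have p0: "(x a - x d) * (x b - x c) = 0" using pert[of 0 0] le by simp
  have "0 \<le> 2 * t * (x b - x c) + t\<^sup>2 * qform n E (D a)" for t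
    using pert[of t a] p0 dist lt by (simp add: D_def algebra_simps)
  from linear_zero[OF this] show "x b = x c" by simp
  have "0 \<le> 2 * t * (x a - x d) + t\<^sup>2 * qform n E (D b)" for t
    using pert[of t b] p0 dist lt by (simp add: D_def algebra_simps)
  from linear_zero[OF this] show "x a = x d" by simp
qed

end

section \<open>Structure of end blocks\<close>

lemma reach_in_sym: "reach_in E S x y \<Longrightarrow> reach_in E S y x"
  unfolding reach_in_def by (rule sympD[OF symp_rtranclp]) (auto simp: symp_def insert_commute)

lemma reach_in_trans: "reach_in E S x y \<Longrightarrow> reach_in E S y z \<Longrightarrow> reach_in E S x z"
  unfolding reach_in_def by (rule rtranclp_trans)

lemma reach_in_mono: "reach_in E S x y \<Longrightarrow> S \<subseteq> T \<Longrightarrow> reach_in E T x y"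
  unfolding reach_in_def by (induction rule: rtranclp_induct) (auto intro: rtranclp.rtrancl_into_rtrancl)

lemma reach_in_refl: "reach_in E S x x" unfolding reach_in_def by simp

lemma reach_in_edge: "{x, y} \<in> E \<Longrightarrow> x \<in> S \<Longrightarrow> y \<in> S \<Longrightarrow> reach_in E S x y"
  unfolding reach_in_def by (rule r_into_rtranclp) simp

lemma connected_on_root:
  assumes "\<And>u. u \<in> S \<Longrightarrow> reach_in E S r u" shows "connected_on E S"
  unfolding connected_on_def using assms reach_in_sym reach_in_trans by metis

lemma connected_on_Un:
  assumes "connected_on E S" "connected_on E T" "S \<inter> T \<noteq> {}" shows "connected_on E (S \<union> T)"
proof -
  obtain r where "r \<in> S" "r \<in> T" using assms(3) by blast
  hence "reach_in E S r u" if "u \<in> S" for u using that assms(1) by (simp add: connected_on_def)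
  moreover have "reach_in E T r u" if "u \<in> T" for u using that assms(2) \<open>r \<in> T\<close> by (simp add: connected_on_def)
  ultimately have "reach_in E (S \<union> T) r u" if "u \<in> S \<union> T" for u
    using that by (auto intro: reach_in_mono)
  thus ?thesis by (rule connected_on_root)
qed

lemma connected_on_path: "successively (\<lambda>x y. {x, y} \<in> E) ws \<Longrightarrow> connected_on E (set ws)"
proof (induction ws)
  case Nil
  thus ?case by (simp add: connected_on_def)
next
  case (Cons w ws)
  show ?case
  proof (cases ws)
    case Nil
    thus ?thesis by (simp add: connected_on_def reach_in_refl)
  next
    case (Cons v vs)
    hence e: "{w, v} \<in> E" "connected_on E (set ws)" using Cons.IH Cons.prems by auto
    have "connected_on E {w, v}"
      by (rule connected_on_root[of _ _ w]) (auto intro: reach_in_refl reach_in_edge e)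
    hence "connected_on E ({w, v} \<union> set ws)" using e(2) by (rule connected_on_Un) (simp add: Cons)
    thus ?thesis using Cons by (simp add: insert_absorb insert_commute)
  qed
qed

lemma reach_in_path:
  assumes "reach_in E S u v" "v \<in> S"
  shows "\<exists>ws. ws \<noteq> [] \<and> hd ws = u \<and> last ws = v \<and> set ws \<subseteq> S \<and> distinct ws \<and> successively (\<lambda>x y. {x, y} \<in> E) ws"
  using assms(1) unfolding reach_in_def
proof (induction rule: converse_rtranclp_induct)
  case base
  show ?case using assms(2) by (intro exI[of _ "[v]"]) auto
next
  case (step u u')
  then obtain ws where ws: "ws \<noteq> []" "hd ws = u'" "last ws = v" "set ws \<subseteq> S" "distinct ws" "successively (\<lambda>x y. {x, y} \<in> E) ws" by blast
  show ?case
  proof (cases "u \<in> set ws")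
    case True
    then obtain as bs where "ws = as @ u # bs" by (meson split_list)
    thus ?thesis using ws by (intro exI[of _ "u # bs"]) (auto simp: successively_append_iff split: if_splits)
  next
    case False
    thus ?thesis using ws step by (intro exI[of _ "u # ws"]) (auto simp: successively_Cons)
  qed
qed

lemma nonsep_minus: "nonsep E B \<Longrightarrow> connected_on E (B - {v})"
  unfolding nonsep_def cut_vertex_def connected_on_def by (cases "v \<in> B") auto

lemma nonsepI:
  assumes "B \<noteq> {}" "connected_on E B" "\<And>v. v \<in> B \<Longrightarrow> connected_on E (B - {v})" shows "nonsep E B"
  using assms unfolding nonsep_def cut_vertex_def connected_on_def by blast

text \<open>After removal of a vertex of \<open>B\<close> the whole ear still hangs on
  \<open>b\<close> or on \<open>z\<close>; after removal of a vertex of the ear its two pieces hang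
  on \<open>b\<close> and on \<open>z\<close>.\<close>

lemma nonsep_ear:
  assumes B: "nonsep E B" and b: "b \<in> B" "z \<in> B" "b \<noteq> z"
    and ws: "ws \<noteq> []" "distinct ws" "set ws \<inter> B = {}" "successively (\<lambda>x y. {x, y} \<in> E) ws"
    and e: "{b, hd ws} \<in> E" "{last ws, z} \<in> E"
  shows "nonsep E (B \<union> set ws)"
proof (rule nonsepI)
  show "B \<union> set ws \<noteq> {}" using b by auto
  have p: "successively (\<lambda>x y. {x, y} \<in> E) (b # ws @ [z])"
    using ws e by (auto simp: successively_append_iff successively_Cons)
  have pp: "successively (\<lambda>x y. {x, y} \<in> E) ((b # us) @ (vs @ [z]))" if "ws = us @ vs" for us vs
    using p that by simp
  have pb: "connected_on E (set (b # us))" and pz: "connected_on E (set (vs @ [z]))" if "ws = us @ vs" for us vs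
    using successively_append_iff[THEN iffD1, OF pp[OF that]] connected_on_path by (metis, metis)
  have cB: "connected_on E B" using B by (simp add: nonsep_def)
  have "connected_on E (B \<union> set (b # ws))" by (rule connected_on_Un[OF cB pb]) (use b in auto)
  thus "connected_on E (B \<union> set ws)" using b by (simp add: insert_absorb)
  fix v assume v: "v \<in> B \<union> set ws"
  show "connected_on E (B \<union> set ws - {v})"
  proof (cases "v \<in> B")
    case True
    hence vw: "v \<notin> set ws" using ws by auto
    show ?thesis
    proof (cases "v = b")
      case True
      have "connected_on E ((B - {v}) \<union> set (ws @ [z]))" by (rule connected_on_Un[OF nonsep_minus[OF B] pz]) (use b True in auto)
      moreover have "(B - {v}) \<union> set (ws @ [z]) = B \<union> set ws - {v}" using True b vw by auto
      ultimately show ?thesis by simp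
    next
      case False
      have "connected_on E ((B - {v}) \<union> set (b # ws))" by (rule connected_on_Un[OF nonsep_minus[OF B] pb]) (use b False in auto)
      moreover have "(B - {v}) \<union> set (b # ws) = B \<union> set ws - {v}" using False b vw by auto
      ultimately show ?thesis by simp
    qed
  next
    case False
    then obtain us vs where uv: "ws = us @ v # vs" using v by (meson UnE split_list)
    have "connected_on E (B \<union> set (b # us) \<union> set (vs @ [z]))"
      by (rule connected_on_Un[OF connected_on_Un[OF cB pb] pz]) (use b uv in auto)
    moreover have "B \<union> set (b # us) \<union> set (vs @ [z]) = B \<union> set ws - {v}" using False b ws(2) uv by auto
    ultimately show ?thesis by simp
  qed
qed

lemma edge_deg_sum:
  assumes s: "simple_graph n F" shows "(\<Sum>v<n. edge_deg F v) = 2 * card F"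
proof -
  have "(\<Sum>v<n. edge_deg F v) = (\<Sum>e\<in>F. \<Sum>v<n. of_bool (v \<in> e))" unfolding edge_deg_def by (rule sum.swap)
  also have "\<dots> = (\<Sum>e\<in>F. 2)"
  proof (rule sum.cong[OF refl])
    fix e assume "e \<in> F"
    then obtain i j where ij: "i < j" "j < n" "e = {i, j}" using simple_edgeE[OF s] by blast
    have "(\<Sum>v<n. of_bool (v \<in> e) :: nat) = (\<Sum>v\<in>{i, j}. 1)"
      unfolding ij(3) using ij by (intro sum.mono_neutral_cong_right) auto
    thus "(\<Sum>v<n. of_bool (v \<in> e) :: nat) = 2" using ij(1) by simp
  qed
  finally show ?thesis by simp
qed

locale extremal_block = extremal +
  fixes B :: "nat set" and c :: nat
  assumes eb: "end_block n E B" and cB: "c \<in> B" and cv: "cut_vertex E {0..<n} c"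
begin

definition "S = B - {c}"
definition "R = {0..<n} - B"
definition "E_B = {e \<in> E. e \<subseteq> B}"
definition "E_R = {e \<in> E. \<not> e \<subseteq> B}"

lemma sub: "B \<subseteq> {0..<n}" and ns: "nonsep E B" and maxB: "B \<subset> B' \<Longrightarrow> B' \<subseteq> {0..<n} \<Longrightarrow> \<not> nonsep E B'"
  using eb unfolding end_block_def is_block_def by auto

lemma c_lt: "c < n" using sub cB by auto

lemma only_c: "b \<in> B \<Longrightarrow> cut_vertex E {0..<n} b \<Longrightarrow> b = c"
proof -
  assume b: "b \<in> B" "cut_vertex E {0..<n} b"
  have "card {v \<in> B. cut_vertex E {0..<n} v} = 1" using eb by (simp add: end_block_def)
  then obtain w where w: "{v \<in> B. cut_vertex E {0..<n} v} = {w}" by (auto simp: card_1_singleton_iff)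
  have "b \<in> {w}" "c \<in> {w}" unfolding w[symmetric] using b cB cv by auto
  thus "b = c" by simp
qed

lemma conV: "connected_on E {0..<n}" using con by (simp add: connected_graph_def)

lemma edge_lt: "{u, v} \<in> E \<Longrightarrow> u < n \<and> v < n \<and> u \<noteq> v" using simple_adj[OF simple] .

lemma no_loop [simp]: "{u} \<notin> E" using edge_lt[of u u] by auto

lemma nbrs4: "v < n \<Longrightarrow> card {u. {u, v} \<in> E} = 4" using quart by (simp add: quartic_def degree_def)

lemma ex_nbr: "v < n \<Longrightarrow> \<exists>u. {u, v} \<in> E" using nbrs4[of v] by (metis card.empty Collect_empty_eq zero_neq_numeral)

lemma S_ne: "S \<noteq> {}"
proof
  assume "S = {}"
  hence B: "B = {c}" using cB by (auto simp: S_def)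
  obtain y where y: "{y, c} \<in> E" using ex_nbr[OF c_lt] by blast
  have "nonsep E {y, c}"
  proof (rule nonsepI)
    show "connected_on E {y, c}" by (rule connected_on_root[of _ _ y]) (auto intro: reach_in_refl reach_in_edge y)
    fix v assume "v \<in> {y, c}"
    hence "{y, c} - {v} = {if v = y then c else y}" using edge_lt[OF y] by auto
    thus "connected_on E ({y, c} - {v})" by (simp add: connected_on_def reach_in_refl)
  qed simp
  thus False using maxB[of "{y, c}"] edge_lt[OF y] B c_lt by auto
qed

text \<open>Otherwise a path from \<open>y\<close> back to the block, avoiding \<open>b\<close>, would be an ear extending the block.\<close>

lemma no_cross:
  assumes b: "b \<in> S" and y: "y \<in> R" shows "{b, y} \<notin> E"
proof
  assume e: "{b, y} \<in> E"
  have bB: "b \<in> B" "b \<noteq> c" and yn: "y < n" "y \<notin> B" using b y by (auto simp: S_def R_def)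
  have "\<not> cut_vertex E {0..<n} b" using only_c bB by blast
  moreover have "reach_in E {0..<n} y c" using conV yn c_lt by (simp add: connected_on_def)
  ultimately have "reach_in E ({0..<n} - {b}) y c" using bB yn c_lt sub unfolding cut_vertex_def by fastforce
  from reach_in_path[OF this] obtain ws where
    ws: "ws \<noteq> []" "hd ws = y" "last ws = c" "set ws \<subseteq> {0..<n} - {b}" "distinct ws" "successively (\<lambda>x y. {x, y} \<in> E) ws"
    using c_lt bB by auto
  have "c \<in> set ws" using ws(1,3) last_in_set by blast
  then obtain us z vs where z: "ws = us @ z # vs" "z \<in> B" "\<forall>u\<in>set us. u \<notin> B"
    using split_list_first_prop[of ws "\<lambda>v. v \<in> B"] cB by blast
  have us: "us \<noteq> []" using z ws(2) yn by (cases us) auto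
  have "nonsep E (B \<union> set us)"
    by (rule nonsep_ear[OF ns bB(1) z(2)]) (use z ws us e in \<open>auto simp: successively_append_iff\<close>)
  moreover have "set us \<subseteq> {0..<n}" "y \<in> set us" using ws z us by auto
  ultimately show False using maxB[of "B \<union> set us"] sub yn by auto
qed

lemma B_minus: "connected_on E (B - {v})" by (rule nonsep_minus[OF ns])

lemma S_nbr: "v \<in> S \<Longrightarrow> {u, v} \<in> E \<Longrightarrow> u \<in> B"
  using no_cross[of v u] edge_lt[of u v] by (auto simp: R_def insert_commute)
lemma R_nbr: "v \<in> R \<Longrightarrow> {u, v} \<in> E \<Longrightarrow> u \<in> insert c R"
  using no_cross[of u v] edge_lt[of u v] by (auto simp: R_def S_def)

lemma parts: "{..<n} = S \<union> insert c R" "S \<inter> insert c R = {}" "c \<notin> R" "c \<notin> S" "B = insert c S"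
  using sub cB c_lt by (auto simp: S_def R_def)
lemma fin: "finite S" "finite R" "finite B" using finite_subset[OF sub] by (auto simp: S_def R_def)

lemma sum_split: "(\<Sum>i<n. F i) = (\<Sum>i\<in>S. F i) + (F c + (\<Sum>i\<in>R. F i))" for F :: "nat \<Rightarrow> 'b::comm_monoid_add"
  unfolding parts(1) using parts(2,3) fin by (subst sum.union_disjoint) auto

lemma step_out:
  assumes "reach_in E T u v" "u \<in> A" "v \<notin> A" shows "\<exists>a\<in>A. \<exists>b. b \<notin> A \<and> {a, b} \<in> E \<and> a \<in> T \<and> b \<in> T"
  using assms unfolding reach_in_def by (induction rule: rtranclp_induct) auto

lemma S_c: "\<exists>p\<in>S. {p, c} \<in> E"
proof -
  obtain s where s: "s \<in> S" using S_ne by blast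
  have "connected_on E B" using ns by (simp add: nonsep_def)
  hence "reach_in E B s c" using s cB by (auto simp: connected_on_def S_def)
  from step_out[OF this, of S] show ?thesis using s parts by auto
qed

lemma R_c: "\<exists>r\<in>R. {r, c} \<in> E"
proof -
  have "R \<noteq> {}"
  proof
    assume "R = {}"
    hence "B = {0..<n}" using sub by (auto simp: R_def)
    thus False using ns cv by (simp add: nonsep_def)
  qed
  then obtain r where r: "r \<in> R" by blast
  have "reach_in E {0..<n} r c" using conV r c_lt by (auto simp: connected_on_def R_def)
  from step_out[OF this, of R] obtain a b where ab: "a \<in> R" "b \<notin> R" "{a, b} \<in> E" using r parts by auto
  hence "b = c" using R_nbr[of a b] by (auto simp: insert_commute)
  thus ?thesis using ab by blast
qed

section \<open>The two sides of the cut vertex\<close>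

lemma simple_B: "simple_graph n E_B" and simple_R: "simple_graph n E_R"
  by (auto intro: simple_subset[OF simple] simp: E_B_def E_R_def)
lemma E_split: "E = E_B \<union> E_R" "E_B \<inter> E_R = {}" by (auto simp: E_B_def E_R_def)
lemma finite_E: "finite E_B" "finite E_R" using simple_finite simple_B simple_R by auto
lemma deg_split: "edge_deg E v = edge_deg E_B v + edge_deg E_R v"
  by (subst E_split) (rule edge_deg_Un[OF finite_E E_split(2)])

lemma E_B_iff: "{u, v} \<in> E_B \<longleftrightarrow> {u, v} \<in> E \<and> u \<in> B \<and> v \<in> B" by (auto simp: E_B_def)
lemma E_R_iff: "{u, v} \<in> E_R \<longleftrightarrow> {u, v} \<in> E \<and> u \<in> insert c R \<and> v \<in> insert c R"
proof (cases "{u, v} \<in> E")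
  case True
  hence "v \<in> S \<Longrightarrow> u \<in> B" "u \<in> S \<Longrightarrow> v \<in> B" using S_nbr[of v u] S_nbr[of u v] by (simp_all add: insert_commute)
  thus ?thesis using True edge_lt[OF True] by (auto simp: E_R_def R_def S_def)
qed (simp add: E_R_def)

lemma S_mem: "v \<in> S \<Longrightarrow> v < n \<and> v \<in> B \<and> v \<notin> R \<and> v \<noteq> c" and R_mem: "v \<in> R \<Longrightarrow> v < n \<and> v \<notin> B \<and> v \<notin> S \<and> v \<noteq> c"
  using sub cB by (auto simp: S_def R_def)

lemma deg_R_S: "v \<in> S \<Longrightarrow> edge_deg E_R v = 0"
  unfolding degree_edges[OF simple_R, symmetric] degree_def E_R_iff using S_mem[of v] by simp
lemma deg_B_R: "v \<in> R \<Longrightarrow> edge_deg E_B v = 0"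
  unfolding degree_edges[OF simple_B, symmetric] degree_def E_B_iff using R_mem[of v] by simp
lemma deg_B_S: "v \<in> S \<Longrightarrow> edge_deg E_B v = 4" using deg_split[of v] deg_R_S[of v] deg4[of v] S_mem[of v] by simp
lemma deg_R_R: "v \<in> R \<Longrightarrow> edge_deg E_R v = 4" using deg_split[of v] deg_B_R[of v] deg4[of v] R_mem[of v] by simp

lemma nbrs_S: "edge_deg E_B c = card {p \<in> S. {p, c} \<in> E}"
  unfolding degree_edges[OF simple_B, symmetric] degree_def E_B_iff using cB
  by (intro arg_cong[where f = card]) (auto simp: S_def)
lemma nbrs_R: "edge_deg E_R c = card {r \<in> R. {r, c} \<in> E}"
  unfolding degree_edges[OF simple_R, symmetric] degree_def E_R_iff using R_mem no_loop
  by (intro arg_cong[where f = card]) auto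

text \<open>The degree sum inside the block is even, and all its vertices except \<open>c\<close>
  have degree four there, so \<open>c\<close> has an even number of neighbours in \<open>S\<close>.
  Each side gets at least one of the four edges at \<open>c\<close>.\<close>

lemma two_S: "edge_deg E_B c = 2" and two_R: "edge_deg E_R c = 2"
proof -
  have "edge_deg E_B c \<noteq> 0" unfolding nbrs_S using S_c fin by auto
  moreover have "edge_deg E_R c \<noteq> 0" unfolding nbrs_R using R_c fin by auto
  moreover have "edge_deg E_B c + edge_deg E_R c = 4" using deg_split[of c] deg4[OF c_lt] by simp
  moreover have "(\<Sum>v\<in>S. edge_deg E_B v) + (edge_deg E_B c + (\<Sum>v\<in>R. edge_deg E_B v)) = 2 * card E_B"
    using edge_deg_sum[OF simple_B] unfolding sum_split .
  hence "4 * card S + edge_deg E_B c = 2 * card E_B" using deg_B_S deg_B_R by simp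
  hence "even (edge_deg E_B c)" by presburger
  ultimately show "edge_deg E_B c = 2" "edge_deg E_R c = 2" by presburger+
qed

lemma even_B: "even (edge_deg E_B v)" if "v < n" for v
  using that deg_B_S deg_B_R two_S parts(1) by (metis UnE even_numeral even_zero insertE lessThan_iff)
lemma even_R: "even (edge_deg E_R v)" if "v < n" for v
  using that deg_R_S deg_R_R two_R parts(1) by (metis UnE even_numeral even_zero insertE lessThan_iff)

lemma connected_replace:
  assumes "simple_graph n E'" and "\<And>u v. {u, v} \<in> E \<Longrightarrow> edge_reach E' u v" shows "connected_graph n E'"
  using con assms(2) unfolding connected_graph_reach[OF simple] connected_graph_reach[OF assms(1)]
  by (metis edge_reach_replace)

text \<open>Both sides have only even degrees and hence no bridge, so one edge of each may be
  removed.\<close>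

lemma connected_minus:
  assumes s: "simple_graph n E'" and e: "f \<in> E_B" "g \<in> E_R" and sup: "E - {f, g} \<subseteq> E'"
  shows "connected_graph n E'"
proof (rule connected_replace[OF s])
  fix u v assume uv: "{u, v} \<in> E"
  consider "{u, v} = f" | "{u, v} = g" | "{u, v} \<in> E'" using uv sup by blast
  thus "edge_reach E' u v"
  proof cases
    case 1
    have "edge_reach (E_B - {{u, v}}) u v" by (rule even_no_bridge[OF simple_B even_B]) (use 1 e in auto)
    thus ?thesis by (rule edge_reach_mono) (use sup e 1 E_split in auto)
  next
    case 2
    have "edge_reach (E_R - {{u, v}}) u v" by (rule even_no_bridge[OF simple_R even_R]) (use 2 e in auto)
    thus ?thesis by (rule edge_reach_mono) (use sup e 2 E_split in auto)
  qed auto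
qed

text \<open>The neighbours of one vertex already give four vertices in \<open>T\<close>, so some
  vertex of \<open>T\<close> is not adjacent to \<open>c\<close>; it and its four neighbours lie in
  \<open>T\<close>.\<close>

lemma side_card:
  assumes T: "finite T" "c \<notin> T" "T \<subseteq> {..<n}" "\<And>u v. v \<in> T \<Longrightarrow> {u, v} \<in> E \<Longrightarrow> u \<in> insert c T"
    and two: "card {p \<in> T. {p, c} \<in> E} = 2"
  shows "5 \<le> card T"
proof -
  have 4: "4 \<le> card T"
  proof -
    obtain p where p: "p \<in> T" "{p, c} \<in> E" using two by (metis (mono_tags, lifting) card.empty Collect_empty_eq zero_neq_numeral)
    have "{u. {u, p} \<in> E} \<subseteq> insert c (T - {p})" using T(4)[OF p(1)] by auto
    hence "4 \<le> card (insert c (T - {p}))" using T nbrs4[of p] p by (metis card_mono finite.insertI finite_Diff lessThan_iff subsetD)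
    also have "\<dots> \<le> Suc (card (T - {p}))" by (rule card_insert_le_m1) auto
    also have "\<dots> = card T" using T p by (simp add: card_Suc_Diff1 del: card_Diff_insert)
    finally show ?thesis .
  qed
  have "{p \<in> T. {p, c} \<in> E} \<noteq> T" using two 4 by auto
  then obtain v where v: "v \<in> T" "{v, c} \<notin> E" by blast
  have "{u. {u, v} \<in> E} \<subseteq> T - {v}" using T(4)[OF v(1)] v by (auto simp: insert_commute)
  hence "4 \<le> card (T - {v})" using T nbrs4[of v] v by (metis card_mono finite_Diff lessThan_iff subsetD)
  thus ?thesis using T v by simp
qed

lemma card_S: "5 \<le> card S"
  by (rule side_card) (use fin parts S_nbr two_S nbrs_S in auto)
lemma card_R: "5 \<le> card R"
  by (rule side_card) (use fin parts R_nbr two_R nbrs_R in auto)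

lemma card_n: "n = card S + 1 + card R"
  using sum_split[of "\<lambda>_. 1::nat"] by simp

end

section \<open>Values of the eigenvector on an end block\<close>

lemma extremal_block_neg: "extremal_block n E x \<mu> B c \<Longrightarrow> extremal_block n E (\<lambda>i. - x i) \<mu> B c"
proof -
  assume a: "extremal_block n E x \<mu> B c"
  interpret extremal_block n E x \<mu> B c by fact
  show ?thesis
  proof unfold_locales
    show "lap n E (\<lambda>i. - x i) i = \<mu> * - x i" if "i < n" for i
      using lap_scale[of n E "-1" x i] eigen[OF that] by simp
  qed (use n11 simple quart con minimal mu nonzero orth eb cB cv in \<open>auto simp: sum_negf\<close>)
qed

context extremal_block begin

text \<open>An edge inside \<open>S\<close> is switched with an edge on the other side. Connectivity
  is then automatic, and \<open>{r, t}\<close> is never an edge.\<close>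

lemma swap:
  assumes r: "r \<in> R" "w \<in> insert c R" "{r, w} \<in> E" and t: "t \<in> S" "t' \<in> S" "{t, t'} \<in> E" and wt: "{w, t'} \<notin> E"
    and le: "(x r - x t') * (x w - x t) \<le> 0"
  shows "x r = x t'" "x w = x t"
proof -
  have ne: "r \<noteq> t" "r \<noteq> t'" "w \<noteq> t" "w \<noteq> t'" using r t S_mem[of t] S_mem[of t'] by auto
  have lt: "r < n" "w < n" "t < n" "t' < n" using r t S_mem R_mem c_lt by auto
  have rt: "{r, t} \<notin> E" using no_cross[OF t(1) r(1)] by (simp add: insert_commute)
  have s: "simple_graph n (E - {{r, w}, {t, t'}} \<union> {{r, t}, {w, t'}})"
    using simple lt ne unfolding simple_graph_def by auto
  have c: "connected_graph n (E - {{r, w}, {t, t'}} \<union> {{r, t}, {w, t'}})"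
    by (rule connected_minus[OF s, of "{t, t'}" "{r, w}"])
       (use r t S_mem R_mem in \<open>auto simp: E_B_iff E_R_iff insert_commute\<close>)
  show "x r = x t'" "x w = x t" using switch[OF r(3) t(3) rt wt ne c le] by auto
qed

text \<open>An edge of \<open>S\<close> from a value at most \<open>x c\<close> to a value above it can be switched with the edge \<open>rc\<close> unless both its ends are
  neighbours of \<open>c\<close>; but then it is the only such edge, which contradicts 2-connectivity.\<close>

lemma above:
  assumes r: "r \<in> R" "{r, c} \<in> E" "x r \<le> x c" and u0: "u0 \<in> S" "x c < x u0" and t0: "t0 \<in> S"
  shows "x c < x t0"
proof (rule ccontr)
  assume t0c: "\<not> x c < x t0"
  define T where "T = {t \<in> S. x t \<le> x c}"
  define U where "U = {t \<in> S. x c < x t}"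
  define N where "N = {p \<in> S. {p, c} \<in> E}"
  have N2: "card N = 2" "finite N" using two_S nbrs_S fin by (auto simp: N_def)
  have e1: "{y, c} \<in> E" if ty: "t \<in> T" "y \<in> U" "{t, y} \<in> E" for t y
  proof (rule ccontr)
    assume "{y, c} \<notin> E"
    hence "{c, y} \<notin> E" by (simp add: insert_commute)
    moreover have "(x r - x y) * (x c - x t) \<le> 0"
      using ty r by (intro mult_nonpos_nonneg) (auto simp: T_def U_def)
    ultimately have "x r = x y" using ty by (intro swap(1)[OF r(1) _ r(2)]) (auto simp: T_def U_def)
    thus False using r ty by (simp add: U_def)
  qed
  have e2: "{t, c} \<in> E" if ty: "t \<in> T" "y \<in> U" "{t, y} \<in> E" for t y
  proof (rule ccontr)
    assume tc: "{t, c} \<notin> E"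
    hence ct: "{c, t} \<notin> E" by (simp add: insert_commute)
    have tS: "t \<in> S" "y \<in> S" "x t \<le> x c" "x c < x y" using ty by (auto simp: T_def U_def)
    have yt: "{y, t} \<in> E" using ty by (simp add: insert_commute)
    have lt: "x r < x t"
    proof (rule ccontr)
      assume "\<not> x r < x t"
      hence "(x r - x t) * (x c - x y) \<le> 0" using tS by (intro mult_nonneg_nonpos) auto
      hence "x c = x y" using tS yt ct by (intro swap(2)[OF r(1) _ r(2)]) auto
      thus False using tS by simp
    qed
    have "{u. {u, t} \<in> E} \<subseteq> N"
    proof
      fix u assume "u \<in> {u. {u, t} \<in> E}"
      hence u: "{u, t} \<in> E" by simp
      hence uS: "u \<in> S" using S_nbr[OF tS(1) u] ct by (auto simp: S_def)
      have "\<not> x u \<le> x c"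
      proof
        assume "x u \<le> x c"
        hence "(x r - x t) * (x c - x u) \<le> 0" using lt by (intro mult_nonpos_nonneg) auto
        hence "x r = x t" using tS uS u ct by (intro swap(1)[OF r(1) _ r(2)]) auto
        thus False using lt by simp
      qed
      hence "u \<in> U" using uS by (simp add: U_def)
      moreover have "{t, u} \<in> E" using u by (simp add: insert_commute)
      ultimately have "{u, c} \<in> E" using e1[OF ty(1)] by blast
      thus "u \<in> N" using uS by (simp add: N_def)
    qed
    hence "4 \<le> (2::nat)" using card_mono[OF N2(2)] nbrs4[of t] S_mem[OF tS(1)] N2(1) by metis
    thus False by simp
  qed
  have "reach_in E S t0 u0" using B_minus[of c] t0 u0 by (simp add: connected_on_def S_def)
  from step_out[OF this, of T] obtain t y where ty: "t \<in> T" "y \<notin> T" "{t, y} \<in> E" "y \<in> S" using t0 u0 t0c by (auto simp: T_def)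
  hence yU: "y \<in> U" by (simp add: T_def U_def)
  have "t \<noteq> y" "{t, y} \<subseteq> N" using ty yU e1[OF ty(1) yU ty(3)] e2[OF ty(1) yU ty(3)] by (auto simp: N_def T_def)
  hence N: "N = {t, y}" using N2 by (metis card_2_iff card_seteq card_subset_eq)
  have uniq: "t' = t" "y' = y" if "t' \<in> T" "y' \<in> U" "{t', y'} \<in> E" for t' y'
  proof -
    have "t' \<in> N" "y' \<in> N" using that e1[OF that] e2[OF that] by (auto simp: N_def T_def U_def)
    thus "t' = t" "y' = y" using that ty yU unfolding N by (auto simp: T_def U_def)
  qed
  \<comment> \<open>Another vertex of \<open>U\<close> would reach \<open>c\<close> while avoiding
    \<open>y\<close>, either through a third neighbour of \<open>c\<close> or through a second edge
    between \<open>U\<close> and \<open>T\<close>.\<close>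
  have U: "U = {y}"
  proof (rule ccontr)
    assume "U \<noteq> {y}"
    then obtain u where u: "u \<in> U" "u \<noteq> y" using yU by blast
    have "reach_in E (B - {y}) u c" using B_minus[of y] u cB ty S_mem by (auto simp: connected_on_def U_def)
    from step_out[OF this, of "U - {y}"] obtain a b where ab: "a \<in> U" "a \<noteq> y" "b \<notin> U - {y}" "{a, b} \<in> E" "b \<in> B" "b \<noteq> y"
      using u by (auto simp: U_def S_def)
    show False
    proof (cases "b = c")
      case True
      hence "a \<in> N" using ab by (simp add: N_def U_def)
      thus False using ab ty unfolding N by (auto simp: T_def U_def)
    next
      case False
      hence "b \<in> T" using ab by (auto simp: T_def U_def S_def)
      thus False using uniq(2)[of b a] ab by (simp add: insert_commute)
    qed
  qed
  \<comment> \<open>Now \<open>y\<close> is left with at most two neighbours, against degree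
    four.\<close>
  have "{u. {u, y} \<in> E} \<subseteq> {c, t}"
  proof
    fix u assume "u \<in> {u. {u, y} \<in> E}"
    hence u: "{u, y} \<in> E" "u \<noteq> y" using edge_lt by auto
    hence "u \<in> B" using S_nbr[OF ty(4)] by simp
    moreover have "u \<notin> U" using u U by simp
    ultimately have "u = c \<or> u \<in> T" by (auto simp: T_def U_def S_def)
    thus "u \<in> {c, t}" using uniq(1)[OF _ yU] u by auto
  qed
  hence "4 \<le> card {c, t}" using card_mono[of "{c, t}"] nbrs4[of y] S_mem[OF ty(4)] by (metis finite.emptyI finite.insertI)
  moreover have "card {c, t} \<le> 2" by (cases "c = t") auto
  ultimately show False by simp
qed

section \<open>Totals and flows on the two sides\<close>

abbreviation "A \<equiv> \<Sum>i\<in>S. x i"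
abbreviation "C \<equiv> \<Sum>i\<in>R. x i"

lemma AC: "A + (x c + C) = 0" using orth unfolding sum_split .

lemma adj_S: "i \<in> S \<Longrightarrow> j \<in> R \<Longrightarrow> adj E i j = 0" using no_cross by (simp add: adj_def)
lemma adj_R: "i \<in> R \<Longrightarrow> j \<in> S \<Longrightarrow> adj E i j = 0" unfolding adj_sym[of E i] by (rule adj_S)

lemma lap_S: "i \<in> S \<Longrightarrow> lap n E z i = (\<Sum>j\<in>S. adj E i j * (z i - z j)) + adj E i c * (z i - z c)"
  unfolding lap_def sum_split using adj_S by simp
lemma lap_R: "i \<in> R \<Longrightarrow> lap n E z i = (\<Sum>j\<in>R. adj E i j * (z i - z j)) + adj E i c * (z i - z c)"
  unfolding lap_def sum_split using adj_R by simp

lemma antisym_sum: "(\<Sum>i\<in>T. \<Sum>j\<in>T. adj E i j * (z i - z j)) = (0::real)"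
proof -
  have "(\<Sum>i\<in>T. \<Sum>j\<in>T. adj E i j * (z i - z j)) = (\<Sum>j\<in>T. \<Sum>i\<in>T. adj E i j * (z i - z j))" by (rule sum.swap)
  also have "\<dots> = (\<Sum>j\<in>T. \<Sum>i\<in>T. - (adj E j i * (z j - z i)))"
    by (intro sum.cong refl) (simp add: adj_sym algebra_simps)
  also have "\<dots> = - (\<Sum>i\<in>T. \<Sum>j\<in>T. adj E i j * (z i - z j))" by (simp add: sum_negf)
  finally show ?thesis by simp
qed

lemma flux_S: "(\<Sum>i\<in>S. lap n E z i) = (\<Sum>i\<in>S. adj E i c * (z i - z c))"
  using antisym_sum[where T = S and z = z] by (simp add: lap_S sum.distrib)
lemma flux_R: "(\<Sum>i\<in>R. lap n E z i) = (\<Sum>i\<in>R. adj E i c * (z i - z c))"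
  using antisym_sum[where T = R and z = z] by (simp add: lap_R sum.distrib)

text \<open>The function \<open>x - x c\<close> is multiplied by \<open>s2\<close> on
  \<open>S\<close> and by \<open>- s1\<close> on \<open>R\<close>. The result vanishes at
  \<open>c\<close>, has sum zero, and its Rayleigh quotient would be below
  \<open>\<mu>\<close>.\<close>

lemma not_both_pos:
  assumes "0 \<le> A" "0 \<le> C" "x c < 0" shows False
proof -
  define s1 where "s1 = (\<Sum>i\<in>S. x i - x c)"
  define s2 where "s2 = (\<Sum>i\<in>R. x i - x c)"
  have mc: "real (card S) * x c < 0" "real (card R) * x c < 0" using card_S card_R assms(3) by (auto simp: mult_pos_neg)
  have s: "0 < s1" "0 < s2" using assms mc by (auto simp: s1_def s2_def sum_subtractf)
  define z where "z i = (if i \<in> S then s2 * (x i - x c) else if i \<in> R then - s1 * (x i - x c) else 0)" for i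
  have zS: "z i = s2 * (x i - x c)" if "i \<in> S" for i using that by (simp add: z_def)
  have zR: "z i = - s1 * (x i - x c)" if "i \<in> R" for i using that R_mem by (simp add: z_def)
  have zc: "z c = 0" using parts by (simp add: z_def)
  have "(\<Sum>i\<in>S. z i) = s2 * s1" unfolding s1_def by (simp add: zS sum_distrib_left)
  moreover have "(\<Sum>i\<in>R. z i) = - s1 * s2" unfolding s2_def by (simp add: zR sum_distrib_left sum_negf)
  ultimately have z0: "(\<Sum>i<n. z i) = 0" unfolding sum_split zc by simp
  have lS: "lap n E z i = s2 * (\<mu> * x i)" if "i \<in> S" for i
  proof -
    have "lap n E z i = s2 * lap n E x i" unfolding lap_S[OF that]
      using that by (simp add: zS zc algebra_simps sum_distrib_left)
    thus ?thesis using eigen S_mem[OF that] by simp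
  qed
  have lR: "lap n E z i = - s1 * (\<mu> * x i)" if "i \<in> R" for i
  proof -
    have "lap n E z i = - s1 * lap n E x i" unfolding lap_R[OF that]
      using that by (simp add: zR zc algebra_simps sum_distrib_left sum_negf)
    thus ?thesis using eigen R_mem[OF that] by simp
  qed
  have "qform n E z - \<mu> * ip n z z = (\<Sum>i<n. z i * (lap n E z i - \<mu> * z i))"
    unfolding qform_ip ip_def by (simp add: algebra_simps sum_subtractf sum_distrib_left)
  also have "\<dots> = (\<Sum>i\<in>S. \<mu> * x c * s2 * s2 * (x i - x c)) + (\<Sum>i\<in>R. \<mu> * x c * s1 * s1 * (x i - x c))"
    unfolding sum_split zc by (simp add: zS zR lS lR) (intro arg_cong2[where f = "(+)"] sum.cong refl; simp add: algebra_simps)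
  also have "\<dots> = \<mu> * x c * s2 * s2 * s1 + \<mu> * x c * s1 * s1 * s2"
    unfolding s1_def[symmetric] s2_def[symmetric] sum_distrib_left[symmetric] ..
  also have "\<dots> = \<mu> * x c * (s1 * s2 * (s1 + s2))" by (simp add: algebra_simps)
  also have "\<dots> < 0" using s mu_pos assms(3) by (intro mult_neg_pos mult_pos_neg mult_pos_pos add_pos_pos)
  finally show False using rayleigh[OF simple quart con z0] by simp
qed

lemma ex_non_nbr: "\<exists>y\<in>S. {y, c} \<notin> E"
proof (rule ccontr)
  assume "\<not> ?thesis"
  hence "{p \<in> S. {p, c} \<in> E} = S" by auto
  thus False using two_S card_S unfolding nbrs_S by simp
qed

text \<open>Some edge on the other side has \<open>x\<close> zero at exactly one end. Switching it
  with an edge of \<open>S\<close>, where \<open>x\<close> vanishes, leaves the form unchanged,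
  which forces the other end to be zero too.\<close>

lemma zero_on_S:
  assumes c0: "x c = 0" and z: "\<And>s. s \<in> S \<Longrightarrow> x s = 0" shows False
proof -
  obtain v where v: "v < n" "x v \<noteq> 0" using nonzero by blast
  have "reach_in E {0..<n} c v" using conV c_lt v by (simp add: connected_on_def)
  from step_out[OF this, of "{v. x v = 0}"] obtain a b where ab: "x a = 0" "x b \<noteq> 0" "{a, b} \<in> E" using c0 v by auto
  have "b < n" using edge_lt[OF ab(3)] by simp
  hence "b \<in> S \<union> insert c R" using parts(1) by blast
  hence bR: "b \<in> R" using ab z c0 by auto
  have aR: "a \<in> insert c R" using R_nbr[OF bR ab(3)] .
  obtain y where y: "y \<in> S" "{y, c} \<notin> E" using ex_non_nbr by blast
  obtain u where u: "{u, y} \<in> E" using ex_nbr S_mem[OF y(1)] by blast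
  have uS: "u \<in> S" using S_nbr[OF y(1) u] y(2) u by (auto simp: S_def insert_commute)
  have ba: "{b, a} \<in> E" using ab by (simp add: insert_commute)
  have ay: "{a, y} \<notin> E" using aR y no_cross[OF y(1)] by (auto simp: insert_commute)
  have "x b = x y" by (rule swap(1)[OF bR aR ba uS y(1) u ay]) (use ab z uS in simp)
  thus False using ab z y by simp
qed

text \<open>If \<open>x\<close> is not zero on \<open>S\<close>, it takes both signs there. This
  contradicts \<open>above\<close>, for \<open>x\<close> or for its negative according to the value
  at a neighbour of \<open>c\<close> in \<open>R\<close>.\<close>

lemma not_both_zero: assumes A0: "A = 0" and c0: "x c = 0" shows False
proof (cases "\<exists>s\<in>S. x s \<noteq> 0")
  case True
  then obtain s where s: "s \<in> S" "x s \<noteq> 0" by blast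
  have "\<exists>u\<in>S. 0 < x u"
  proof (rule ccontr)
    assume "\<not> ?thesis"
    hence "\<And>i. i \<in> S \<Longrightarrow> x i \<le> 0" by force
    thus False using A0 s sum_nonneg_eq_0_iff[OF fin(1), of "\<lambda>i. - x i"] by (auto simp: sum_negf)
  qed
  moreover have "\<exists>t\<in>S. x t < 0"
  proof (rule ccontr)
    assume "\<not> ?thesis"
    hence "\<And>i. i \<in> S \<Longrightarrow> 0 \<le> x i" by force
    thus False using A0 s sum_nonneg_eq_0_iff[OF fin(1), of x] by auto
  qed
  ultimately obtain u t where ut: "u \<in> S" "0 < x u" "t \<in> S" "x t < 0" by blast
  obtain r where r: "r \<in> R" "{r, c} \<in> E" using R_c by blast
  show False
  proof (cases "x r \<le> x c")
    case True
    thus False using above[OF r True, of u t] ut c0 by simp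
  next
    case False
    interpret neg: extremal_block n E "\<lambda>i. - x i" \<mu> B c by (rule extremal_block_neg) unfold_locales
    show False using neg.above[OF r, of t u] False ut c0 by simp
  qed
next
  case False
  thus False using zero_on_S[OF c0] by blast
qed

text \<open>Summing the eigenvalue equation over \<open>R\<close> and over \<open>S\<close>
  expresses \<open>\<mu> * C\<close> and \<open>\<mu> * A\<close> as flows through the edges at
  \<open>c\<close>. Their signs supply the neighbour in \<open>R\<close> and the vertex above
  \<open>x c\<close> that \<open>above\<close> asks for.\<close>

lemma mono_pos:
  assumes A: "0 < A" and C: "C < 0" and s: "s \<in> S" shows "x c < x s"
proof -
  have "\<exists>r\<in>R. {r, c} \<in> E \<and> x r \<le> x c"
  proof (rule ccontr)
    assume "\<not> ?thesis"
    hence "0 \<le> (\<Sum>i\<in>R. adj E i c * (x i - x c))" by (intro sum_nonneg) (auto simp: adj_def)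
    moreover have "(\<Sum>i\<in>R. lap n E x i) = \<mu> * C" using eigen R_mem by (simp add: sum_distrib_left)
    moreover have "\<mu> * C < 0" using mu_pos C by (simp add: mult_pos_neg)
    ultimately show False unfolding flux_R by simp
  qed
  then obtain r where r: "r \<in> R" "{r, c} \<in> E" "x r \<le> x c" by blast
  have "\<exists>p\<in>S. x c < x p"
  proof (rule ccontr)
    assume "\<not> ?thesis"
    hence "(\<Sum>i\<in>S. adj E i c * (x i - x c)) \<le> 0" by (intro sum_nonpos) (auto simp: adj_def)
    moreover have "(\<Sum>i\<in>S. lap n E x i) = \<mu> * A" using eigen S_mem by (simp add: sum_distrib_left)
    moreover have "0 < \<mu> * A" using mu_pos A by simp
    ultimately show False unfolding flux_S by simp
  qed
  then obtain p where "p \<in> S" "x c < x p" by blast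
  thus ?thesis using above[OF r] s by blast
qed

lemma sign_cases: "(0 < A \<and> C < 0) \<or> (A < 0 \<and> 0 < C)"
proof -
  interpret neg: extremal_block n E "\<lambda>i. - x i" \<mu> B c by (rule extremal_block_neg) unfold_locales
  have 1: "\<not> (0 \<le> A \<and> 0 \<le> C \<and> x c < 0)" using not_both_pos by blast
  have 2: "\<not> (A \<le> 0 \<and> C \<le> 0 \<and> 0 < x c)" using neg.not_both_pos by (auto simp: sum_negf)
  have 3: "\<not> (A = 0 \<and> x c = 0)" using not_both_zero by blast
  show ?thesis using AC 1 2 3 by linarith
qed

text \<open>The test vector is the centred indicator of \<open>S\<close>, whose boundary consists of
  two edges.\<close>

lemma mu_bound: "\<mu> * (real (card S) * (real n - real (card S))) \<le> 2 * real n"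
proof -
  define m where "m = real (card S)"
  define y where "y i = of_bool (i \<in> S) + (- (m / real n))" for i
  have n0: "0 < real n" using n11 by simp
  have s: "(\<Sum>i<n. of_bool (i \<in> S)) = m" unfolding sum_split m_def using parts R_mem by simp
  have y0: "(\<Sum>i<n. y i) = 0" unfolding y_def sum.distrib s using n0 by simp
  have "qform n E y = qform n E (\<lambda>i. of_bool (i \<in> S))" unfolding y_def by (rule qform_shift)
  also have "\<dots> = (\<Sum>i\<in>S. lap n E (\<lambda>i. of_bool (i \<in> S)) i)"
    unfolding qform_ip ip_def sum_split using parts R_mem by simp
  also have "\<dots> = (\<Sum>i\<in>S. adj E i c)" unfolding flux_S using parts by simp
  also have "\<dots> = real (card {p \<in> S. {p, c} \<in> E})" unfolding adj_def using fin by (simp add: Int_def)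
  finally have q: "qform n E y = 2" using two_S nbrs_S by simp
  have "ip n y y = (\<Sum>i<n. of_bool (i \<in> S) * (1 - 2 * (m / n)) + (m / n) * (m / n))"
    unfolding ip_def y_def by (intro sum.cong refl) (auto simp: algebra_simps)
  also have "\<dots> = m * (1 - 2 * (m / n)) + n * ((m / n) * (m / n))"
    unfolding sum.distrib sum_distrib_right[symmetric] s by simp
  also have "\<dots> = m * (n - m) / n" using n0 by (simp add: field_simps)
  finally have "\<mu> * (m * (n - m) / n) \<le> 2" using rayleigh[OF simple quart con y0] q by simp
  thus ?thesis using n0 unfolding m_def by (simp add: field_simps)
qed

text \<open>The bound is \<open>2 / m + 2 / q\<close>, decreasing in both sizes:
  \<open>m = 5\<close>, \<open>q = 6\<close> give 11/15, and \<open>m = 8\<close>,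
  \<open>q = 6\<close> give 7/12.\<close>

lemma mu34: "\<mu> \<le> 3/4" and mu35: "8 \<le> card S \<Longrightarrow> \<mu> \<le> 3/5"
proof -
  define m where "m = real (card S)"
  define q where "q = real n - m"
  have b: "\<mu> * (m * q) \<le> 2 * (m + q)" using mu_bound by (simp add: m_def q_def)
  have m5: "5 \<le> m" and q6: "6 \<le> q" using card_S card_R card_n by (auto simp: m_def q_def)
  have bound: "\<mu> \<le> k" if "2 * (m + q) \<le> k * (m * q)" for k
  proof (rule ccontr)
    assume "\<not> \<mu> \<le> k"
    hence "k * (m * q) < \<mu> * (m * q)" using m5 q6 by (intro mult_strict_right_mono) auto
    thus False using b that by simp
  qed
  show "\<mu> \<le> 3/4"
  proof (rule bound)
    have "0 \<le> (m - 5) * (q - 6)" using m5 q6 by simp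
    thus "2 * (m + q) \<le> 3/4 * (m * q)" using m5 q6 by (simp add: algebra_simps)
  qed
  assume "8 \<le> card S"
  hence m8: "8 \<le> m" by (simp add: m_def)
  show "\<mu> \<le> 3/5"
  proof (rule bound)
    have "0 \<le> (m - 8) * (q - 6)" using m8 q6 by simp
    thus "2 * (m + q) \<le> 3/5 * (m * q)" using m8 q6 by (simp add: algebra_simps)
  qed
qed

end

text \<open>As the total is zero, \<open>A + x c = - C\<close>; so the sign that makes
  \<open>A\<close> positive and \<open>C\<close> negative also gives the tail condition.\<close>

lemma extremal_block_oriented:
  assumes "extremal_block n E x \<mu> B c"
  shows "\<exists>x'. extremal_block n E x' \<mu> B c \<and> 0 < (\<Sum>i\<in>B - {c}. x' i) \<and> 0 < (\<Sum>i\<in>B - {c}. x' i) + x' c \<and>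
    (\<forall>s\<in>B - {c}. x' c < x' s)"
proof -
  interpret extremal_block n E x \<mu> B c by fact
  interpret neg: extremal_block n E "\<lambda>i. - x i" \<mu> B c by (rule extremal_block_neg) fact
  show ?thesis
  proof (cases "0 < A \<and> C < 0")
    case True
    thus ?thesis using mono_pos AC assms unfolding S_def by (intro exI[of _ x]) auto
  next
    case False
    hence "A < 0 \<and> 0 < C" using sign_cases by blast
    thus ?thesis using neg.mono_pos neg.AC neg.extremal_block_axioms
      unfolding S_def by (intro exI[of _ "\<lambda>i. - x i"]) (auto simp: sum_negf)
  qed
qed

section \<open>Replacing an end block\<close>

lemma end_gadgetD:
  assumes "end_gadget k H s t"
  shows "distinct H" "(a, b) \<in> set H \<Longrightarrow> a < b \<and> b < k" "s < k" "t < k"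
    "i < k \<Longrightarrow> pdeg H i + of_bool (i = s) + of_bool (i = t) = 4" "i < k \<Longrightarrow> (padj H)\<^sup>*\<^sup>* i s"
  using assms unfolding end_gadget_def by auto

locale oriented_block = extremal_block +
  fixes v :: "nat \<Rightarrow> nat" and m :: nat
  assumes m: "m = card S" and bij: "bij_betw v {..<m} S" and vm: "v m = c"
    and anti: "\<And>i j. i \<le> j \<Longrightarrow> j \<le> m \<Longrightarrow> x (v j) \<le> x (v i)"
    and total: "0 < (\<Sum>i\<in>S. x i)" and tail: "0 \<le> (\<Sum>i\<in>S. x i) + x c"
begin

definition "X i = x (v i)"
definition "a i j \<longleftrightarrow> {v i, v j} \<in> E"
definition "pr = (\<lambda>(i, j). {v i, v j})"

lemma v_S: "i < m \<Longrightarrow> v i \<in> S" using bij by (auto simp: bij_betw_def)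
lemma v_B: "i \<le> m \<Longrightarrow> v i \<in> B" using v_S S_mem vm cB by (cases "i = m") auto
lemma v_ex: "u \<in> S \<Longrightarrow> \<exists>i<m. u = v i" using bij by (auto simp: bij_betw_def)

lemma bijB: "bij_betw v {..m} B"
proof -
  have "bij_betw v ({..<m} \<union> {m}) (S \<union> {c})"
    by (rule bij_betw_combine[OF bij]) (use vm parts in auto)
  moreover have "{..<m} \<union> {m} = {..m}" "S \<union> {c} = B" using parts(5) by auto
  ultimately show ?thesis by simp
qed

lemma v_inj: "i \<le> m \<Longrightarrow> j \<le> m \<Longrightarrow> v i = v j \<longleftrightarrow> i = j"
  using bijB by (auto simp: bij_betw_def inj_on_def)
lemma v_exB: "u \<in> B \<Longrightarrow> \<exists>i\<le>m. u = v i" using bijB by (auto simp: bij_betw_def)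

lemma sum_v: "(\<Sum>i<m. F (v i)) = (\<Sum>u\<in>S. F u)" by (rule sum.reindex_bij_betw[OF bij])
lemma sum_vB: "(\<Sum>i\<le>m. F (v i)) = (\<Sum>u\<in>B. F u)" by (rule sum.reindex_bij_betw[OF bijB])

lemma pr_inj: "inj_on pr {(i, j). i < j \<and> j \<le> m}"
  by (auto simp: inj_on_def pr_def doubleton_eq_iff v_inj)

lemma pr_sum:
  assumes "P \<subseteq> {(i, j). i < j \<and> j \<le> m}"
  shows "(\<Sum>e\<in>pr ` P. F e) = (\<Sum>(i, j)\<in>P. F {v i, v j})"
  by (subst sum.reindex[OF inj_on_subset[OF pr_inj assms]]) (simp add: pr_def comp_def split_beta)

lemma E_B_pr: "E_B = pr ` {(i, j). i < j \<and> j \<le> m \<and> a i j}"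
proof
  show "E_B \<subseteq> pr ` {(i, j). i < j \<and> j \<le> m \<and> a i j}"
  proof
    fix e assume e: "e \<in> E_B"
    then obtain u w where uw: "e = {u, w}" "u \<noteq> w" using simple_edgeE[OF simple_B] by blast
    then obtain i j where ij: "u = v i" "w = v j" "i \<le> m" "j \<le> m" using e v_exB by (metis E_B_iff)
    have "{v i, v j} \<in> E" using e uw ij by (simp add: E_B_iff)
    hence "a i j" "a j i" by (auto simp: a_def insert_commute)
    moreover have "i < j \<or> j < i" using uw ij by (metis linorder_neqE_nat)
    ultimately have "(i, j) \<in> {(i, j). i < j \<and> j \<le> m \<and> a i j} \<or> (j, i) \<in> {(i, j). i < j \<and> j \<le> m \<and> a i j}" using ij by auto
    moreover have "e = pr (i, j)" "e = pr (j, i)" using uw ij by (auto simp: pr_def)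
    ultimately show "e \<in> pr ` {(i, j). i < j \<and> j \<le> m \<and> a i j}" by blast
  qed
  show "pr ` {(i, j). i < j \<and> j \<le> m \<and> a i j} \<subseteq> E_B"
    using v_B by (auto simp: pr_def a_def E_B_iff)
qed

lemma row_sum: "(\<Sum>j\<le>m. of_bool (a i j)) = card {u \<in> B. {u, v i} \<in> E}"
proof -
  have "(\<Sum>j\<le>m. of_bool (a i j)) = (\<Sum>u\<in>B. of_bool ({v i, u} \<in> E))" unfolding a_def by (rule sum_vB)
  also have "\<dots> = card {u \<in> B. {u, v i} \<in> E}" using fin by (simp add: insert_commute Int_def)
  finally show ?thesis .
qed

sublocale prof: block_profile m X \<mu> a
proof unfold_locales
  show "5 \<le> m" using card_S m by simp
  show "0 < \<mu>" by (rule mu_pos)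
  show "\<mu> \<le> 3/4" by (rule mu34)
  show "8 \<le> m \<Longrightarrow> \<mu> \<le> 3/5" using mu35 m by simp
  show "X j \<le> X i" if "i \<le> j" "j \<le> m" for i j using anti[OF that] by (simp add: X_def)
  show "0 < (\<Sum>i<m. X i)" unfolding X_def sum_v using total .
  have "(\<Sum>i\<le>m. X i) = (\<Sum>i<m. X i) + X m" by (simp add: lessThan_Suc_atMost[symmetric])
  thus "0 \<le> (\<Sum>i\<le>m. X i)" using tail vm unfolding X_def sum_v by simp
  show "a i j = a j i" for i j by (simp add: a_def insert_commute)
  show "\<not> a i i" for i by (simp add: a_def)
  show "(\<Sum>j\<le>m. of_bool (a i j)) = (4::nat)" if "i < m" for i
  proof -
    have "{u \<in> B. {u, v i} \<in> E} = {u. {u, v i} \<in> E}" using S_nbr[OF v_S[OF that]] by auto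
    thus ?thesis unfolding row_sum using nbrs4 S_mem[OF v_S[OF that]] by simp
  qed
  show "(\<Sum>j\<le>m. of_bool (a m j)) = (2::nat)"
  proof -
    have "{u \<in> B. {u, v m} \<in> E} = {p \<in> S. {p, c} \<in> E}" using S_mem cB by (auto simp: vm S_def)
    thus ?thesis unfolding row_sum using two_S nbrs_S by simp
  qed
  \<comment> \<open>The block stays connected without \<open>v k\<close>, so a path from
    \<open>v 0\<close> to \<open>c\<close> avoids it and leaves the first \<open>k\<close> positions
    by an edge over \<open>k\<close>.\<close>
  show "\<exists>i<k. \<exists>j\<le>m. k < j \<and> a i j" if k: "1 \<le> k" "k < m" for k
  proof -
    have "v 0 \<in> B - {v k}" using k v_B[of 0] v_inj[of 0 k] by simp
    moreover have "v m \<in> B - {v k}" using k v_B[of m] v_inj[of m k] by simp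
    ultimately have "reach_in E (B - {v k}) (v 0) c" using B_minus[of "v k"] unfolding connected_on_def vm by blast
    moreover have "v 0 \<in> v ` {..<k}" "v m \<notin> v ` {..<k}" using k by (auto simp: v_inj)
    ultimately obtain u w where uw: "u \<in> v ` {..<k}" "w \<notin> v ` {..<k}" "{u, w} \<in> E" "w \<in> B" "w \<noteq> v k"
      using step_out[of "B - {v k}" "v 0" "v m" "v ` {..<k}"] vm by auto
    obtain j where j: "j \<le> m" "w = v j" using v_exB uw by blast
    have "k < j" using uw j by (metis imageI lessThan_iff linorder_neqE_nat)
    thus ?thesis using uw j by (auto simp: a_def)
  qed
qed

lemma energy_eq: "prof.energy = (\<Sum>e\<in>E_B. edge_form x e)"
proof -
  have "prof.energy = (\<Sum>(i, j)\<in>{..m} \<times> {..m}. of_bool (i < j \<and> a i j) * (X i - X j)\<^sup>2)"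
    unfolding prof.energy_def by (rule sum.cartesian_product)
  also have "\<dots> = (\<Sum>(i, j)\<in>{(i, j). i < j \<and> j \<le> m \<and> a i j}. (X i - X j)\<^sup>2)"
    by (rule sum.mono_neutral_cong_right) auto
  also have "\<dots> = (\<Sum>e\<in>E_B. edge_form x e)" unfolding E_B_pr by (subst pr_sum) (auto simp: X_def)
  finally show ?thesis .
qed

section \<open>The graph with the block replaced by a gadget\<close>

context
  fixes H :: edges and s t :: nat
  assumes H: "end_gadget m H s t" "s \<noteq> t"
begin

definition "PH = set H \<union> {(s, m), (t, m)}"
definition "EH = E_R \<union> pr ` PH"

lemma PH: "PH \<subseteq> {(i, j). i < j \<and> j \<le> m}" "set H \<inter> {(s, m), (t, m)} = {}"
  using end_gadgetD[OF H(1)] by (auto simp: PH_def dest: less_imp_le)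

lemma PH_sum: "(\<Sum>(i, j)\<in>PH. F i j) = (\<Sum>(i, j)\<leftarrow>H. F i j) + (F s m + F t m)" for F :: "nat \<Rightarrow> nat \<Rightarrow> 'b::comm_monoid_add"
  unfolding PH_def using PH(2) H(2) end_gadgetD(1)[OF H(1)]
  by (subst sum.union_disjoint) (auto simp: sum_list_distinct_conv_sum_set)

lemma EH_disj: "E_R \<inter> pr ` PH = {}" "finite (pr ` PH)"
  using PH(1) v_B by (fastforce simp: E_R_def pr_def) (simp add: PH_def)

lemma EH_simple: "simple_graph n EH"
proof -
  have "simple_graph n (pr ` PH)" unfolding simple_graph_def
  proof
    fix e assume "e \<in> pr ` PH"
    then obtain i j where ij: "i < j" "j \<le> m" "e = {v i, v j}" using PH(1) by (auto simp: pr_def)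
    hence "v i \<in> B" "v j \<in> B" "v i \<noteq> v j" using v_B v_inj[of i j] by auto
    thus "\<exists>u w. u \<noteq> w \<and> u < n \<and> w < n \<and> e = {u, w}" using sub ij(3) by (intro exI[of _ "v i"] exI[of _ "v j"]) auto
  qed
  thus ?thesis unfolding EH_def by (rule simple_Un[OF simple_R])
qed

lemma EH_sum: "(\<Sum>e\<in>EH. F e) = (\<Sum>e\<in>E_R. F e) + ((\<Sum>(i, j)\<leftarrow>H. F {v i, v j}) + (F {v s, c} + F {v t, c}))"
  for F :: "nat set \<Rightarrow> 'b::comm_monoid_add"
  unfolding EH_def sum.union_disjoint[OF finite_E(2) EH_disj(2,1)] pr_sum[OF PH(1)] PH_sum vm ..

lemma EH_quartic: "quartic n EH" unfolding quartic_def degree_edges[OF EH_simple]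
proof (intro allI impI)
  fix u assume u: "u < n"
  have st: "s < m" "t < m" by (rule end_gadgetD[OF H(1)])+
  have d: "edge_deg EH u = edge_deg E_R u + ((\<Sum>(i, j)\<leftarrow>H. of_bool (u = v i \<or> u = v j)) + (of_bool (u = v s \<or> u = c) + of_bool (u = v t \<or> u = c)))"
    unfolding edge_deg_def EH_sum by simp
  have hv: "v i \<noteq> w \<and> v j \<noteq> w" if "(i, j) \<in> set H" "w \<notin> S" for i j w
    using end_gadgetD(2)[OF H(1) that(1)] v_S that(2) by auto
  have h0: "(\<Sum>(i, j)\<leftarrow>H. of_bool (u = v i \<or> u = v j)) = (0::nat)" if "u \<notin> S"
  proof -
    have "(\<Sum>(i, j)\<leftarrow>H. of_bool (u = v i \<or> u = v j)) = (\<Sum>_\<leftarrow>H. (0::nat))"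
      by (intro arg_cong[where f = sum_list] map_cong refl) (use hv[OF _ that] in fastforce)
    thus ?thesis by simp
  qed
  consider "u \<in> S" | "u = c" | "u \<in> R" using u parts(1) by blast
  thus "edge_deg EH u = 4"
  proof cases
    case 1
    then obtain i where i: "i < m" "u = v i" using v_ex by blast
    have "(\<Sum>(k, l)\<leftarrow>H. of_bool (u = v k \<or> u = v l)) = pdeg H i"
      unfolding pdeg_def
    proof (intro arg_cong[where f = sum_list] map_cong refl)
      fix p assume "p \<in> set H"
      obtain k l where p: "p = (k, l)" by (cases p)
      hence kl: "p = (k, l)" "k < l" "l < m" using end_gadgetD(2)[OF H(1), of k l] \<open>p \<in> set H\<close> by auto
      thus "(case p of (k, l) \<Rightarrow> (of_bool (u = v k \<or> u = v l) :: nat)) = (case p of (k, l) \<Rightarrow> of_bool (k = i) + of_bool (l = i))"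
        using i v_inj[of i k] v_inj[of i l] by auto
    qed
    moreover have "u = v s \<longleftrightarrow> i = s" "u = v t \<longleftrightarrow> i = t" "u \<noteq> c" using i st v_inj S_mem[OF 1] by auto
    ultimately show ?thesis unfolding d using deg_R_S[OF 1] end_gadgetD(5)[OF H(1) i(1)] by simp
  next
    case 2
    thus ?thesis unfolding d using h0 parts two_R by simp
  next
    case 3
    hence "u \<notin> S" "u \<noteq> c" "u \<noteq> v s" "u \<noteq> v t" using R_mem[OF 3] v_S st by auto
    thus ?thesis unfolding d using h0 deg_R_R[OF 3] by simp
  qed
qed

text \<open>Edges outside the block survive. An edge of the block is replaced by a walk through
  \<open>c\<close>, which every vertex of the gadget reaches by way of the exit
  \<open>s\<close>.\<close>

lemma EH_connected: "connected_graph n EH"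
proof (rule connected_replace[OF EH_simple])
  have sc: "edge_reach EH (v s) c" by (rule r_into_rtranclp) (auto simp: EH_def PH_def pr_def vm)
  have step: "edge_reach EH (v i) (v j)" if "padj H i j" for i j
  proof (rule r_into_rtranclp)
    show "{v i, v j} \<in> EH" using that by (force simp: padj_def EH_def PH_def pr_def image_def insert_commute)
  qed
  have "edge_reach EH (v i) (v s)" if "(padj H)\<^sup>*\<^sup>* i s" for i
    using that by (induction rule: converse_rtranclp_induct) (auto intro: rtranclp_trans step)
  hence toc: "edge_reach EH (v i) c" if "i < m" for i using end_gadgetD(6)[OF H(1) that] sc by (meson rtranclp_trans)
  have all: "edge_reach EH u c" if "u \<in> B" for u using v_exB[OF that] toc vm by (metis le_neq_implies_less rtranclp.rtrancl_refl)
  fix u w assume uw: "{u, w} \<in> E"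
  show "edge_reach EH u w"
  proof (cases "{u, w} \<in> E_R")
    case True
    thus ?thesis by (intro r_into_rtranclp) (simp add: EH_def)
  next
    case False
    hence "u \<in> B" "w \<in> B" using uw by (auto simp: E_R_def)
    thus ?thesis using all edge_reach_sym by (meson rtranclp_trans)
  qed
qed

text \<open>The principle is applied to the vector that equals \<open>y + x c\<close> on the gadget
  and \<open>x\<close> elsewhere. It keeps the value at \<open>c\<close>, so all terms outside the
  block cancel, and equality up to a constant becomes equality.\<close>

lemma core_both:
  fixes y :: "nat \<Rightarrow> real"
  shows "prof.energy - 2 * (\<Sum>i<m. prof.w i * (X i - X m)) \<le> penergy H y + (y s)\<^sup>2 + (y t)\<^sup>2 - 2 * (\<Sum>i<m. prof.w i * y i)"
    and "prof.energy - 2 * (\<Sum>i<m. prof.w i * (X i - X m)) = penergy H y + (y s)\<^sup>2 + (y t)\<^sup>2 - 2 * (\<Sum>i<m. prof.w i * y i) \<Longrightarrow>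
      i < m \<Longrightarrow> y i = X i - X m"
proof -
  have st: "s < m" "t < m" by (rule end_gadgetD[OF H(1)])+
  define z where "z u = (if u \<in> S then y (the_inv_into {..<m} v u) + x c else x u)" for u
  have zv: "z (v i) = y i + x c" if "i < m" for i
    using that v_S bij by (simp add: z_def bij_betw_def the_inv_into_f_f)
  have zc: "z c = x c" and zR: "u \<in> R \<Longrightarrow> z u = x u" for u using parts R_mem by (auto simp: z_def)
  have "(\<Sum>e\<in>E_R. edge_form z e) = (\<Sum>e\<in>E_R. edge_form x e)"
  proof (rule sum.cong[OF refl])
    fix e assume e: "e \<in> E_R"
    then obtain u w where uw: "e = {u, w}" using simple_edgeE[OF simple_R] by blast
    hence "u \<in> insert c R" "w \<in> insert c R" using e by (auto simp: E_R_iff)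
    thus "edge_form z e = edge_form x e" using zc zR by (auto simp: uw)
  qed
  moreover have "(\<Sum>(i, j)\<leftarrow>H. edge_form z {v i, v j}) = penergy H y"
    unfolding penergy_def
    by (intro arg_cong[where f = sum_list] map_cong refl) (use end_gadgetD(2)[OF H(1)] zv in \<open>fastforce simp: split_beta\<close>)
  ultimately have q': "qform n EH z = (\<Sum>e\<in>E_R. edge_form x e) + (penergy H y + ((y s)\<^sup>2 + (y t)\<^sup>2))"
    unfolding qform_edges[OF EH_simple] EH_sum using zv st zc by simp
  have "(\<Sum>e\<in>E. edge_form x e) = (\<Sum>e\<in>E_B. edge_form x e) + (\<Sum>e\<in>E_R. edge_form x e)"
    by (subst E_split(1)) (rule sum.union_disjoint[OF finite_E E_split(2)])
  hence q: "qform n E x = prof.energy + (\<Sum>e\<in>E_R. edge_form x e)"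
    unfolding qform_edges[OF simple] energy_eq .
  have "ip n x z - ip n x x = (\<Sum>u<n. x u * (z u - x u))" unfolding ip_def by (simp add: algebra_simps sum_subtractf)
  also have "\<dots> = (\<Sum>u\<in>S. x u * (z u - x u))" unfolding sum_split using zc zR by simp
  also have "\<dots> = (\<Sum>i<m. x (v i) * (z (v i) - x (v i)))" by (rule sum_v[symmetric])
  also have "\<dots> = (\<Sum>i<m. X i * (y i - (X i - X m)))" using zv by (intro sum.cong refl) (simp add: X_def vm)
  finally have "2 * \<mu> * (ip n x z - ip n x x) = 2 * (\<Sum>i<m. prof.w i * y i) - 2 * (\<Sum>i<m. prof.w i * (X i - X m))"
    unfolding prof.w_def by (simp add: sum_distrib_left sum_subtractf[symmetric] algebra_simps)
  note eqs = this q q'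
  show "prof.energy - 2 * (\<Sum>i<m. prof.w i * (X i - X m)) \<le> penergy H y + (y s)\<^sup>2 + (y t)\<^sup>2 - 2 * (\<Sum>i<m. prof.w i * y i)"
    using opt(1)[OF EH_simple EH_quartic EH_connected, of z] eqs by linarith
  assume "prof.energy - 2 * (\<Sum>i<m. prof.w i * (X i - X m)) = penergy H y + (y s)\<^sup>2 + (y t)\<^sup>2 - 2 * (\<Sum>i<m. prof.w i * y i)" and i: "i < m"
  hence "qform n EH z \<le> qform n E x + 2 * \<mu> * (ip n x z - ip n x x)" using eqs by linarith
  hence "z (v i) - x (v i) = z c - x c"
    by (rule opt(2)[OF EH_simple EH_quartic EH_connected]) (use S_mem v_S i c_lt in auto)
  thus "y i = X i - X m" using zv[OF i] zc by (simp add: X_def vm)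
qed

end

sublocale prof: optimal_profile m X \<mu> a
  by unfold_locales (rule core_both, assumption+)+

text \<open>Block and pattern have the same degree at corresponding vertices, so an edge-preserving
  bijection maps neighbourhoods onto neighbourhoods and reflects edges too.\<close>

lemma pointed_iso_of_layout:
  assumes lay: "prof.layout DV DE" and D: "finite DV" "Lw \<in> DV"
    "\<And>p. p \<in> DV \<Longrightarrow> card {q \<in> DV. {p, q} \<in> DE} = (if p = Lw then 2 else 4)"
  shows "pointed_iso E B c DV DE"
proof -
  obtain \<psi> where \<psi>: "bij_betw \<psi> DV {..m}" "\<psi> Lw = m" "\<And>p q. {p, q} \<in> DE \<Longrightarrow> a (\<psi> p) (\<psi> q)"
    using lay unfolding prof.layout_def by blast
  define \<theta> where "\<theta> = v \<circ> \<psi>"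
  have \<theta>: "bij_betw \<theta> DV B" unfolding \<theta>_def by (rule bij_betw_trans[OF \<psi>(1) bijB])
  have \<psi>_lt: "\<psi> p < m" if "p \<in> DV" "p \<noteq> Lw" for p
  proof -
    have "\<psi> p \<le> m" "\<psi> p \<noteq> \<psi> Lw" using \<psi>(1) that D(2) by (auto simp: bij_betw_def inj_on_def)
    thus ?thesis using \<psi>(2) by simp
  qed
  have iff: "{\<theta> p, \<theta> q} \<in> E \<longleftrightarrow> {p, q} \<in> DE" if pq: "p \<in> DV" "q \<in> DV" for p q
  proof
    show "{\<theta> p, \<theta> q} \<in> E" if "{p, q} \<in> DE" using \<psi>(3)[OF that] by (simp add: a_def \<theta>_def)
    let ?N = "{u \<in> B. {u, \<theta> p} \<in> E}" and ?M = "{q \<in> DV. {p, q} \<in> DE}"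
    have "card ?N = (\<Sum>j\<le>m. of_bool (a (\<psi> p) j))" unfolding row_sum \<theta>_def by simp
    also have "\<dots> = (if p = Lw then 2 else 4)" using prof.deg[OF \<psi>_lt[OF pq(1)]] prof.deg_m \<psi>(2) by simp
    finally have "card ?N = card ?M" using D(3)[OF pq(1)] by simp
    moreover have "card (\<theta> ` ?M) = card ?M"
      by (rule card_image) (rule inj_on_subset[OF bij_betw_imp_inj_on[OF \<theta>]], auto)
    moreover have "\<theta> ` ?M \<subseteq> ?N"
    proof
      fix u assume "u \<in> \<theta> ` ?M"
      then obtain r where r: "u = \<theta> r" "r \<in> DV" "{p, r} \<in> DE" by blast
      have "{\<theta> r, \<theta> p} \<in> E" using \<psi>(3)[OF r(3)] by (simp add: a_def \<theta>_def insert_commute)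
      thus "u \<in> ?N" using r bij_betw_apply[OF \<theta>] by simp
    qed
    ultimately have N: "\<theta> ` ?M = ?N" using fin by (intro card_subset_eq) auto
    assume "{\<theta> p, \<theta> q} \<in> E"
    hence "\<theta> q \<in> \<theta> ` ?M" unfolding N using bij_betw_apply[OF \<theta> pq(2)] by (simp add: insert_commute)
    then obtain r where "\<theta> q = \<theta> r" "r \<in> DV" "{p, r} \<in> DE" by blast
    thus "{p, q} \<in> DE" using inj_onD[OF bij_betw_imp_inj_on[OF \<theta>] _ pq(2)] by metis
  qed
  define \<phi> where "\<phi> = the_inv_into DV \<theta>"
  have \<phi>: "bij_betw \<phi> B DV" unfolding \<phi>_def by (rule bij_betw_the_inv_into[OF \<theta>])
  have \<theta>\<phi>: "\<theta> (\<phi> u) = u" if "u \<in> B" for u unfolding \<phi>_def by (rule f_the_inv_into_f_bij_betw[OF \<theta>]) (use that in simp)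
  have "\<theta> Lw = c" using \<psi>(2) vm by (simp add: \<theta>_def)
  hence "\<phi> c = Lw" unfolding \<phi>_def using the_inv_into_f_f[OF bij_betw_imp_inj_on[OF \<theta>] D(2)] by simp
  moreover have "{u, w} \<in> E \<longleftrightarrow> {\<phi> u, \<phi> w} \<in> DE" if "u \<in> B" "w \<in> B" for u w
    using iff[of "\<phi> u" "\<phi> w"] bij_betw_apply[OF \<phi>] that \<theta>\<phi> by simp
  ultimately show ?thesis unfolding pointed_iso_def using \<phi> by blast
qed

end

lemma card_nbrs_of_list:
  assumes V: "V = set vs" "distinct vs" and D: "\<And>x y. {x, y} \<in> D \<longleftrightarrow> (x, y) \<in> set L \<or> (y, x) \<in> set L"
    and deg: "\<forall>p\<in>set vs. length (filter (\<lambda>q. (p, q) \<in> set L \<or> (q, p) \<in> set L) vs) = (if p = Lw then 2 else 4)"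
    and p: "p \<in> V"
  shows "card {q \<in> V. {p, q} \<in> D} = (if p = Lw then 2 else 4)"
proof -
  have "{q \<in> V. {p, q} \<in> D} = set (filter (\<lambda>q. (p, q) \<in> set L \<or> (q, p) \<in> set L) vs)" using V D by auto
  thus ?thesis using deg p V by (simp add: distinct_card del: set_filter)
qed

lemma D_degrees:
  "p \<in> D0_V \<Longrightarrow> card {q \<in> D0_V. {p, q} \<in> D0_E} = (if p = Lw then 2 else 4)"
  "p \<in> D1_V \<Longrightarrow> card {q \<in> D1_V. {p, q} \<in> D1_E} = (if p = Lw then 2 else 4)"
  "p \<in> D2_V \<Longrightarrow> card {q \<in> D2_V. {p, q} \<in> D2_E} = (if p = Lw then 2 else 4)"
  "p \<in> D3_V \<Longrightarrow> card {q \<in> D3_V. {p, q} \<in> D3_E} = (if p = Lw then 2 else 4)"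
  "p \<in> D4_V \<Longrightarrow> card {q \<in> D4_V. {p, q} \<in> D4_E} = (if p = Lw then 2 else 4)"
  by (rule card_nbrs_of_list[OF D0_set(1) _ D0_set(2)] card_nbrs_of_list[OF D1_set(1) _ D1_set(2)] card_nbrs_of_list[OF D2_set(1) _ D2_set(2)]
        card_nbrs_of_list[OF D3_set(1) _ D3_set(2)] card_nbrs_of_list[OF D4_set(1) _ D4_set(2)]; assumption?;
      simp add: D0_vs_def D0_L_def D1_vs_def D1_L_def D2_vs_def D2_L_def D3_vs_def D3_L_def D4_vs_def D4_L_def)+

context oriented_block
begin

lemma block_iso:
  "pointed_iso E B c D0_V D0_E \<or> pointed_iso E B c D1_V D1_E \<or> pointed_iso E B c D2_V D2_E \<or>
   pointed_iso E B c D3_V D3_E \<or> pointed_iso E B c D4_V D4_E"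
proof -
  note iso = pointed_iso_of_layout[OF _ _ _ D_degrees(1)] pointed_iso_of_layout[OF _ _ _ D_degrees(2)] pointed_iso_of_layout[OF _ _ _ D_degrees(3)]
    pointed_iso_of_layout[OF _ _ _ D_degrees(4)] pointed_iso_of_layout[OF _ _ _ D_degrees(5)]
  have "finite D0_V" "finite D1_V" "finite D2_V" "finite D3_V" "finite D4_V"
    "Lw \<in> D0_V" "Lw \<in> D1_V" "Lw \<in> D2_V" "Lw \<in> D3_V" "Lw \<in> D4_V"
    by (auto simp: D0_V_def D1_V_def D2_V_def D3_V_def D4_V_def)
  thus ?thesis using prof.layouts iso by blast
qed

end

lemma extremal_block_sort:
  assumes "extremal_block n E x \<mu> B c" and pos: "0 < (\<Sum>i\<in>B - {c}. x i)" "0 < (\<Sum>i\<in>B - {c}. x i) + x c"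
    and above: "\<forall>s\<in>B - {c}. x c < x s"
  shows "\<exists>v m. oriented_block n E x \<mu> B c v m"
proof -
  interpret extremal_block n E x \<mu> B c by fact
  define vs where "vs = sort_key (\<lambda>i. - x i) (sorted_list_of_set S)"
  define m where "m = card S"
  define v where "v i = (if i < m then vs ! i else c)" for i
  have vs: "set vs = S" "distinct vs" "length vs = m" "sorted (map (\<lambda>i. - x i) vs)"
    using fin by (simp_all add: vs_def m_def)
  have "oriented_block n E x \<mu> B c v m"
  proof unfold_locales
    show "m = card S" by (rule m_def)
    show "v m = c" by (simp add: v_def)
    have "bij_betw (\<lambda>i. vs ! i) {..<m} S" using vs by (intro bij_betw_nth) auto
    thus "bij_betw v {..<m} S" by (rule bij_betw_cong[THEN iffD1, rotated]) (simp add: v_def)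
    show "x (v j) \<le> x (v i)" if ij: "i \<le> j" "j \<le> m" for i j
    proof (cases "j < m")
      case True
      thus ?thesis using sorted_nth_mono[OF vs(4) ij(1)] ij vs(3) by (simp add: v_def)
    next
      case False
      hence "j = m" using ij by simp
      moreover have "x c \<le> x (vs ! i)" if "i < m"
        using nth_mem[of i vs] that vs(1,3) assms(4) unfolding S_def by (metis less_imp_le)
      ultimately show ?thesis using ij by (simp add: v_def)
    qed
  qed (use pos in \<open>auto simp: S_def\<close>)
  thus ?thesis by blast
qed

theorem theorem5:
  fixes n :: nat and E :: "nat set set"
  assumes "n \<ge> 11"
    and "simple_graph n E" and "quartic n E" and "connected_graph n E"
    and "\<forall>E'. simple_graph n E' \<and> quartic n E' \<and> connected_graph n E' \<longrightarrow>
            algebraic_connectivity n E \<le> algebraic_connectivity n E'"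
  shows "\<forall>B c. end_block n E B \<and> c \<in> B \<and> cut_vertex E {0..<n} c \<longrightarrow>
           pointed_iso E B c D0_V D0_E \<or> pointed_iso E B c D1_V D1_E \<or>
           pointed_iso E B c D2_V D2_E \<or> pointed_iso E B c D3_V D3_E \<or>
           pointed_iso E B c D4_V D4_E"
proof (intro allI impI)
  fix B c assume Bc: "end_block n E B \<and> c \<in> B \<and> cut_vertex E {0..<n} c"
  define \<mu> where "\<mu> = algebraic_connectivity n E"
  obtain z where z: "\<exists>i<n. z i \<noteq> 0" "(\<Sum>i<n. z i) = 0" "\<forall>i<n. lap n E z i = \<mu> * z i"
    using algebraic_connectivity_props(2)[OF assms(2,4)] assms(1) unfolding \<mu>_def by auto
  have "extremal_block n E z \<mu> B c"
    by unfold_locales (use assms Bc z \<mu>_def in auto)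
  then obtain x where x: "extremal_block n E x \<mu> B c" "0 < (\<Sum>i\<in>B - {c}. x i)" "0 < (\<Sum>i\<in>B - {c}. x i) + x c"
      "\<forall>s\<in>B - {c}. x c < x s"
    using extremal_block_oriented by blast
  obtain v m where "oriented_block n E x \<mu> B c v m" using extremal_block_sort[OF x] by blast
  thus "pointed_iso E B c D0_V D0_E \<or> pointed_iso E B c D1_V D1_E \<or>
           pointed_iso E B c D2_V D2_E \<or> pointed_iso E B c D3_V D3_E \<or>
           pointed_iso E B c D4_V D4_E" by (rule oriented_block.block_iso)
qed

end
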